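(* Let $\mathfrak{B}$ be a $C^*$-algebra, let $(\mathcal{H},\pi)$ and $(\mathcal{H},\tilde\pi)$ be two irreducible representations of $\mathfrak{B}$, and let $O$ be the open and non-empty set $$O=\{(\alpha,\Omega,\Psi)\in\mathrm{Aut}(\mathfrak{B})_{\mathrm{n}}\times\mathbb{S}\mathcal{H}\times\mathbb{S}\mathcal{H} : \alpha_*r(\mathbb{C}\Omega)\in\mathbb{B}_2(\tilde r(\mathbb{C}\Psi))\}$$ (non-emptiness of $O$ being understood as given). Then the following hold: (i) The map $\Phi:O\to\mathbb{S}\mathcal{H}$, $(\alpha,\Omega,\Psi)\mapsto\tilde s_\Psi(\alpha_*r(\mathbb{C}\Omega))$, is smooth. (ii) The unique map $U:O\to\mathsf{U}(\mathcal{H})$ such that $$U(\alpha,\Omega,\Psi)\,\pi(B)\Omega=\tilde\pi(\alpha(B))\,\Phi(\alpha,\Omega,\Psi)\quad\text{for all }B\in\mathfrak{B},\ (\alpha,\Omega,\Psi)\in O$$ is smooth.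
   Context: Inner products are linear in the second variable; representations are nonzero. $\mathbb{S}\mathcal{H}$ is the unit sphere of $\mathcal{H}$ with its usual structure of a (real analytic, hence smooth) submanifold of $\mathcal{H}$. $\mathrm{Aut}(\mathfrak{B})_{\mathrm{n}}$ is the $*$-automorphism group with the norm topology; it is a real Banach-Lie group modeled on the space of symmetric bounded derivations (derivations $\delta\in\mathfrak{B}(\mathfrak{B})$, the bounded linear operators on $\mathfrak{B}$, with $\delta(A)^*=\delta(A^* )$), with charts given near each automorphism by the exponential series composed with translation. $\mathsf{U}(\mathcal{H})$ is the unitary group with the norm topology and its Banach-Lie group structure. $\mathscr{P}(\mathfrak{B})$ is the set of pure states with the norm metric of $\mathfrak{B}^*$, and $\mathbb{B}_2(\omega)=\{\psi\in\mathscr{P}(\mathfrak{B}):\|\psi-\omega\|<2\}$. For $\Omega\in\mathbb{S}\mathcal{H}$, $r(\mathbb{C}\Omega)$ is the vector state $B\mapsto\langle\Omega,\pi(B)\Omega\rangle$ and $\tilde r(\mathbb{C}\Omega)$ the vector state $B\mapsto\langle\Omega,\tilde\pi(B)\Omega\rangle$. For $\Psi\in\mathbb{S}\mathcal{H}$, $\tilde s_\Psi:\mathbb{B}_2(\tilde r(\mathbb{C}\Psi))\to\mathbb{S}\mathcal{H}$ sends $\omega$ to the unique unit vector $\tilde s_\Psi(\omega)$ with $\tilde r(\mathbb{C}\tilde s_\Psi(\omega))=\omega$ and $\langle\Psi,\tilde s_\Psi(\omega)\rangle>0$. For $\alpha\in\mathrm{Aut}(\mathfrak{B})$ and a state $\omega$,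 $\alpha_*\omega=\omega\circ\alpha^{-1}$. *)

theory Defs
  imports "HOL-Analysis.Analysis"
begin

section \<open>Complex Banach spaces, Hilbert spaces, C*-algebras\<close>

class complex_banach = banach +
  fixes scaleC :: "complex \<Rightarrow> 'a \<Rightarrow> 'a"  (infixr "*\<^sub>C" 75)
  assumes scaleC_add_right: "c *\<^sub>C (x + y) = c *\<^sub>C x + c *\<^sub>C y"
    and scaleC_add_left: "(c + d) *\<^sub>C x = c *\<^sub>C x + d *\<^sub>C x"
    and scaleC_scaleC: "c *\<^sub>C (d *\<^sub>C x) = (c * d) *\<^sub>C x"
    and scaleC_of_real: "complex_of_real r *\<^sub>C x = r *\<^sub>R x"
    and norm_scaleC: "norm (c *\<^sub>C x) = cmod c * norm x"

text \<open>The inner product is linear in the second variable.  Positivity and definiteness are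
  contained in the last axiom.\<close>

class complex_hilbert = complex_banach +
  fixes cinner :: "'a \<Rightarrow> 'a \<Rightarrow> complex"
  assumes cinner_add_right: "cinner x (y + z) = cinner x y + cinner x z"
    and cinner_scaleC_right: "cinner x (c *\<^sub>C y) = c * cinner x y"
    and cinner_commute: "cinner x y = cnj (cinner y x)"
    and cinner_self: "cinner x x = complex_of_real ((norm x)\<^sup>2)"

text \<open>No unit is required.\<close>

class cstar_algebra = complex_banach + real_normed_algebra +
  fixes star :: "'a \<Rightarrow> 'a"
  assumes scaleC_mult_left: "(c *\<^sub>C x) * y = c *\<^sub>C (x * y)"
    and scaleC_mult_right: "x * (c *\<^sub>C y) = c *\<^sub>C (x * y)"
    and star_star: "star (star x) = x"
    and star_add: "star (x + y) = star x + star y"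
    and star_scaleC: "star (c *\<^sub>C x) = cnj c *\<^sub>C star x"
    and star_mult: "star (x * y) = star y * star x"
    and cstar_identity: "norm (star x * x) = (norm x)\<^sup>2"

text \<open>Bounded operators on a complex Banach space are the elements of
  \<open>'a \<Rightarrow>\<^sub>L 'a\<close> (bounded real-linear maps with operator norm) that are complex linear;
  their norm does not depend on the field of scalars.  The same applies to functionals.\<close>

definition complex_linear :: "('a::complex_banach \<Rightarrow>\<^sub>L 'b::complex_banach) \<Rightarrow> bool" where
  "complex_linear T \<longleftrightarrow> (\<forall>c x. T (c *\<^sub>C x) = c *\<^sub>C T x)"

section \<open>States and representations\<close>

definition states :: "('b::cstar_algebra \<Rightarrow>\<^sub>L complex) set" where
  "states = {\<omega>. (\<forall>c A. blinfun_apply \<omega> (c *\<^sub>C A) = c * blinfun_apply \<omega> A)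
      \<and> (\<forall>A. Im (blinfun_apply \<omega> (star A * A)) = 0 \<and> 0 \<le> Re (blinfun_apply \<omega> (star A * A)))
      \<and> norm \<omega> = 1}"

definition pure_states :: "('b::cstar_algebra \<Rightarrow>\<^sub>L complex) set" where
  "pure_states = {\<omega>. \<omega> extreme_point_of states}"

definition ball2 :: "('b::cstar_algebra \<Rightarrow>\<^sub>L complex) \<Rightarrow> ('b \<Rightarrow>\<^sub>L complex) set" where
  "ball2 \<omega> = {\<psi> \<in> pure_states. norm (\<psi> - \<omega>) < 2}"

text \<open>Boundedness of \<open>\<pi>\<close> itself is automatic, and not required.\<close>

definition representation :: "('b::cstar_algebra \<Rightarrow> ('h::complex_hilbert \<Rightarrow>\<^sub>L 'h)) \<Rightarrow> bool" where
  "representation \<pi> \<longleftrightarrow>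
      (\<forall>A. complex_linear (\<pi> A))
    \<and> (\<forall>A B. \<pi> (A + B) = \<pi> A + \<pi> B)
    \<and> (\<forall>c A x. \<pi> (c *\<^sub>C A) x = c *\<^sub>C \<pi> A x)
    \<and> (\<forall>A B. \<pi> (A * B) = \<pi> A o\<^sub>L \<pi> B)
    \<and> (\<forall>A x y. cinner (\<pi> (star A) x) y = cinner x (\<pi> A y))
    \<and> (\<exists>A. \<pi> A \<noteq> 0)"

definition closed_complex_subspace :: "'h::complex_banach set \<Rightarrow> bool" where
  "closed_complex_subspace S \<longleftrightarrow>
      closed S \<and> 0 \<in> S \<and> (\<forall>x\<in>S. \<forall>y\<in>S. x + y \<in> S) \<and> (\<forall>c. \<forall>x\<in>S. c *\<^sub>C x \<in> S)"

definition irreducible_representation ::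
    "('b::cstar_algebra \<Rightarrow> ('h::complex_hilbert \<Rightarrow>\<^sub>L 'h)) \<Rightarrow> bool" where
  "irreducible_representation \<pi> \<longleftrightarrow> representation \<pi> \<and>
      (\<forall>S. closed_complex_subspace S \<and> (\<forall>A. \<forall>x\<in>S. \<pi> A x \<in> S) \<longrightarrow> S = {0} \<or> S = UNIV)"

definition vector_state ::
    "('b::cstar_algebra \<Rightarrow> ('h::complex_hilbert \<Rightarrow>\<^sub>L 'h)) \<Rightarrow> 'h \<Rightarrow> ('b \<Rightarrow>\<^sub>L complex)" where
  "vector_state \<pi> \<Omega> = Blinfun (\<lambda>B. cinner \<Omega> (\<pi> B \<Omega>))"

text \<open>The section \<open>\<omega> \<mapsto> s\<^bsub>\<Psi>\<^esub>(\<omega>)\<close> of the map sending a unit vector to its vector state; it is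
  meaningful for \<open>\<omega> \<in> ball2 (vector_state \<pi> \<Psi>)\<close>, where the described vector exists uniquely.\<close>

definition state_section ::
    "('b::cstar_algebra \<Rightarrow> ('h::complex_hilbert \<Rightarrow>\<^sub>L 'h)) \<Rightarrow> 'h \<Rightarrow> ('b \<Rightarrow>\<^sub>L complex) \<Rightarrow> 'h" where
  "state_section \<pi> \<Psi> \<omega> = (THE \<Theta>. norm \<Theta> = 1 \<and> vector_state \<pi> \<Theta> = \<omega>
      \<and> Im (cinner \<Psi> \<Theta>) = 0 \<and> 0 < Re (cinner \<Psi> \<Theta>))"

section \<open>The groups and their Lie algebras\<close>

text \<open>Automorphisms are automatically bounded, so the automorphism group with its norm topology
  is a subset of \<open>'b \<Rightarrow>\<^sub>L 'b\<close>.\<close>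

definition automorphisms :: "('b::cstar_algebra \<Rightarrow>\<^sub>L 'b) set" where
  "automorphisms = {\<alpha>. complex_linear \<alpha> \<and> bij (blinfun_apply \<alpha>)
      \<and> (\<forall>A B. blinfun_apply \<alpha> (A * B) = blinfun_apply \<alpha> A * blinfun_apply \<alpha> B)
      \<and> (\<forall>A. blinfun_apply \<alpha> (star A) = star (blinfun_apply \<alpha> A))}"

definition symmetric_derivations :: "('b::cstar_algebra \<Rightarrow>\<^sub>L 'b) set" where
  "symmetric_derivations = {\<delta>. complex_linear \<delta>
      \<and> (\<forall>A B. blinfun_apply \<delta> (A * B) = blinfun_apply \<delta> A * B + A * blinfun_apply \<delta> B)
      \<and> (\<forall>A. blinfun_apply \<delta> (star A) = star (blinfun_apply \<delta> A))}"

definition push_state ::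
    "('b::cstar_algebra \<Rightarrow>\<^sub>L 'b) \<Rightarrow> ('b \<Rightarrow>\<^sub>L complex) \<Rightarrow> ('b \<Rightarrow>\<^sub>L complex)" where
  "push_state \<alpha> \<omega> = Blinfun (\<lambda>B. \<omega> (inv (blinfun_apply \<alpha>) B))"

definition unitaries :: "('h::complex_hilbert \<Rightarrow>\<^sub>L 'h) set" where
  "unitaries = {U. complex_linear U \<and> surj (blinfun_apply U)
      \<and> (\<forall>x y. cinner (blinfun_apply U x) (blinfun_apply U y) = cinner x y)}"

definition skew_adjoints :: "('h::complex_hilbert \<Rightarrow>\<^sub>L 'h) set" where
  "skew_adjoints = {X. complex_linear X
      \<and> (\<forall>x y. cinner (blinfun_apply X x) y = - cinner x (blinfun_apply X y))}"

definition unit_sphere :: "'h::complex_hilbert set" where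
  "unit_sphere = {x. norm x = 1}"

section \<open>Smooth maps in Banach spaces\<close>

text \<open>\<open>M vs\<close>, for \<open>vs\<close> a list of \<open>n\<close> vectors of the subspace \<open>E\<close>, is a bounded \<open>n\<close>-linear map.\<close>

definition bounded_multilinear_on ::
    "'a::real_normed_vector set \<Rightarrow> nat \<Rightarrow> ('a list \<Rightarrow> 'b::real_normed_vector) \<Rightarrow> bool" where
  "bounded_multilinear_on E n M \<longleftrightarrow>
      (\<forall>us vs. \<forall>v\<in>E. \<forall>w\<in>E. \<forall>c::real.
         length us + length vs + 1 = n \<and> set us \<subseteq> E \<and> set vs \<subseteq> E \<longrightarrow>
           M (us @ (v + w) # vs) = M (us @ v # vs) + M (us @ w # vs)
         \<and> M (us @ (c *\<^sub>R v) # vs) = c *\<^sub>R M (us @ v # vs))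
    \<and> (\<exists>K. \<forall>vs. length vs = n \<and> set vs \<subseteq> E \<longrightarrow> norm (M vs) \<le> K * prod_list (map norm vs))"

text \<open>\<open>f\<close> is \<open>C\<^sup>\<infinity>\<close> (in the Frechet sense) on the open subset \<open>W\<close> of the closed real subspace \<open>E\<close>.
  The witness \<open>D x vs\<close> is the derivative of order \<open>length vs\<close> at \<open>x\<close> applied to \<open>vs\<close>.  The last
  clause says that the \<open>n\<close>-th derivative, as a map from \<open>W\<close> to the bounded \<open>n\<close>-linear maps on \<open>E\<close>
  with the operator norm, is Frechet differentiable at \<open>x\<close> with derivative
  \<open>h \<mapsto> D x (h # _)\<close>.  An explicit subspace \<open>E\<close> is used because the model spaces below (such as
  the symmetric derivations) are subspaces and not types.\<close>

definition smooth_on ::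
    "'a::real_normed_vector set \<Rightarrow> 'a set \<Rightarrow> ('a \<Rightarrow> 'b::real_normed_vector) \<Rightarrow> bool" where
  "smooth_on E W f \<longleftrightarrow> openin (top_of_set E) W \<and>
     (\<exists>D :: 'a \<Rightarrow> 'a list \<Rightarrow> 'b.
        (\<forall>x\<in>W. D x [] = f x)
      \<and> (\<forall>x\<in>W. \<forall>n. bounded_multilinear_on E n (D x))
      \<and> (\<forall>n. \<forall>x\<in>W. \<forall>e>0. \<exists>d>0. \<forall>y\<in>W. norm (y - x) < d \<longrightarrow>
           (\<forall>vs. length vs = n \<and> set vs \<subseteq> E \<longrightarrow>
              norm (D y vs - D x vs - D x ((y - x) # vs))
                \<le> e * norm (y - x) * prod_list (map norm vs))))"

section \<open>Banach manifolds\<close>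

text \<open>A chart \<open>(E, U, \<phi>)\<close> is a homeomorphism \<open>\<phi>\<close> from an open subset \<open>U\<close> of the manifold to an open
  subset of the closed real subspace \<open>E\<close>.  The manifolds below carry the subspace topology of the
  surrounding normed space, and their underlying set is the union of the domains of their charts.\<close>

type_synonym ('m, 'e) chart = "'e set \<times> 'm set \<times> ('m \<Rightarrow> 'e)"

definition atlas_carrier :: "('m, 'e) chart set \<Rightarrow> 'm set" where
  "atlas_carrier \<A> = (\<Union>(E, U, \<phi>)\<in>\<A>. U)"

definition smooth_map ::
    "('m::topological_space, 'e::real_normed_vector) chart set \<Rightarrow>
     ('n::topological_space, 'f::real_normed_vector) chart set \<Rightarrow> 'm set \<Rightarrow> ('m \<Rightarrow> 'n) \<Rightarrow> bool" where
  "smooth_map \<A> \<B> W f \<longleftrightarrow>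
      openin (top_of_set (atlas_carrier \<A>)) W
    \<and> f ` W \<subseteq> atlas_carrier \<B>
    \<and> continuous_on W f
    \<and> (\<forall>(E, U, \<phi>)\<in>\<A>. \<forall>(F, V, \<psi>)\<in>\<B>.
         smooth_on E (\<phi> ` (W \<inter> U \<inter> f -` V)) (\<lambda>e. \<psi> (f (inv_into U \<phi> e))))"

definition product_atlas ::
    "('m, 'e) chart set \<Rightarrow> ('n, 'f) chart set \<Rightarrow> ('m \<times> 'n, 'e \<times> 'f) chart set" where
  "product_atlas \<A> \<B> =
     {(E \<times> F, U \<times> V, map_prod \<phi> \<psi>) | E U \<phi> F V \<psi>. (E, U, \<phi>) \<in> \<A> \<and> (F, V, \<psi>) \<in> \<B>}"

text \<open>The submanifold structure of \<open>S\<close>: its charts are the restrictions to \<open>S\<close> of all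
  diffeomorphisms \<open>\<theta>\<close> between open sets of the Hilbert space that map \<open>S\<close> to a closed real
  subspace \<open>E\<close>.  (Closed subspaces of a Hilbert space are complemented.)\<close>

definition submanifold_atlas :: "'h::complex_hilbert set \<Rightarrow> ('h, 'h) chart set" where
  "submanifold_atlas S = {(E, W \<inter> S, \<theta>) | E W \<theta>.
      closed E \<and> subspace E
    \<and> inj_on \<theta> W \<and> smooth_on UNIV W \<theta> \<and> smooth_on UNIV (\<theta> ` W) (inv_into W \<theta>)
    \<and> \<theta> ` (W \<inter> S) = \<theta> ` W \<inter> E}"

definition blinfun_exp :: "('a::banach \<Rightarrow>\<^sub>L 'a) \<Rightarrow> ('a \<Rightarrow>\<^sub>L 'a)" where
  "blinfun_exp X = (\<Sum>n. (1 / fact n) *\<^sub>R ((\<lambda>Y. X o\<^sub>L Y) ^^ n) id_blinfun)"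

text \<open>The Banach-Lie group structure of a group \<open>G\<close> of operators with Lie algebra \<open>L\<close>: near
  \<open>g \<in> G\<close> the inverse of \<open>X \<mapsto> exp X \<circ> g\<close> is a chart.  On the ball of radius \<open>ln 2\<close> we have
  \<open>norm (exp X - 1) < 1\<close>, so that the logarithm series inverts \<open>exp\<close> there; for
  the two groups below, the logarithm of an element of \<open>G\<close> in the image of the ball of all operators
  lies in \<open>L\<close>, so that the domain of the chart is open in \<open>G\<close>.\<close>

definition exp_atlas :: "('a::banach \<Rightarrow>\<^sub>L 'a) set \<Rightarrow> ('a \<Rightarrow>\<^sub>L 'a) set \<Rightarrow> ('a \<Rightarrow>\<^sub>L 'a, 'a \<Rightarrow>\<^sub>L 'a) chart set"
  where
  "exp_atlas L G = {(L, (\<lambda>X. blinfun_exp X o\<^sub>L g) ` {X \<in> L. norm X < ln 2},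
      inv_into {X \<in> L. norm X < ln 2} (\<lambda>X. blinfun_exp X o\<^sub>L g)) | g. g \<in> G}"

definition aut_atlas :: "('b::cstar_algebra \<Rightarrow>\<^sub>L 'b, 'b \<Rightarrow>\<^sub>L 'b) chart set" where
  "aut_atlas = exp_atlas symmetric_derivations automorphisms"

definition unitary_atlas :: "('h::complex_hilbert \<Rightarrow>\<^sub>L 'h, 'h \<Rightarrow>\<^sub>L 'h) chart set" where
  "unitary_atlas = exp_atlas skew_adjoints unitaries"

definition sphere_atlas :: "('h::complex_hilbert, 'h) chart set" where
  "sphere_atlas = submanifold_atlas unit_sphere"

section \<open>The domain and the maps\<close>

definition triple_domain ::
    "('b::cstar_algebra \<Rightarrow> ('h::complex_hilbert \<Rightarrow>\<^sub>L 'h)) \<Rightarrow> ('b \<Rightarrow> ('h \<Rightarrow>\<^sub>L 'h)) \<Rightarrow>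
     (('b \<Rightarrow>\<^sub>L 'b) \<times> 'h \<times> 'h) set" where
  "triple_domain \<pi> \<pi>' = {(\<alpha>, \<Omega>, \<Psi>) \<in> automorphisms \<times> unit_sphere \<times> unit_sphere.
      push_state \<alpha> (vector_state \<pi> \<Omega>) \<in> ball2 (vector_state \<pi>' \<Psi>)}"

definition section_map ::
    "('b::cstar_algebra \<Rightarrow> ('h::complex_hilbert \<Rightarrow>\<^sub>L 'h)) \<Rightarrow> ('b \<Rightarrow> ('h \<Rightarrow>\<^sub>L 'h)) \<Rightarrow>
     ('b \<Rightarrow>\<^sub>L 'b) \<times> 'h \<times> 'h \<Rightarrow> 'h" where
  "section_map \<pi> \<pi>' = (\<lambda>(\<alpha>, \<Omega>, \<Psi>). state_section \<pi>' \<Psi> (push_state \<alpha> (vector_state \<pi> \<Omega>)))"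

definition intertwining_unitary_map ::
    "('b::cstar_algebra \<Rightarrow> ('h::complex_hilbert \<Rightarrow>\<^sub>L 'h)) \<Rightarrow> ('b \<Rightarrow> ('h \<Rightarrow>\<^sub>L 'h)) \<Rightarrow>
     (('b \<Rightarrow>\<^sub>L 'b) \<times> 'h \<times> 'h \<Rightarrow> ('h \<Rightarrow>\<^sub>L 'h)) \<Rightarrow> bool" where
  "intertwining_unitary_map \<pi> \<pi>' U \<longleftrightarrow>
      U \<in> triple_domain \<pi> \<pi>' \<rightarrow>\<^sub>E unitaries
    \<and> (\<forall>(\<alpha>, \<Omega>, \<Psi>)\<in>triple_domain \<pi> \<pi>'. \<forall>B.
         U (\<alpha>, \<Omega>, \<Psi>) (\<pi> B \<Omega>) = \<pi>' (\<alpha> B) (section_map \<pi> \<pi>' (\<alpha>, \<Omega>, \<Psi>)))"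

end

theory Submission
  imports Defs
begin

text \<open>If \<open>\<alpha>\<^sub>* r(\<complex> \<Omega>)\<close> and \<open>r'(\<complex> \<Psi>)\<close> are at distance less than \<open>2\<close>, then \<open>\<pi> \<circ> \<alpha>\<^sup>-\<^sup>1\<close> and \<open>\<pi>'\<close> are
  equivalent: otherwise a positive contraction of the algebra would almost separate the two states.
  So there is a unitary \<open>V\<close> with \<open>V \<pi>(B) = \<pi>'(\<alpha>(B)) V\<close>, and \<open>\<Phi>(\<alpha>, \<Omega>, \<Psi>) = c V \<Omega>\<close> and
  \<open>U(\<alpha>, \<Omega>, \<Psi>) = c V\<close> with the phase \<open>c\<close> that makes \<open>\<langle>\<Psi>, c V \<Omega>\<rangle>\<close> positive; both are independent of
  the choice of \<open>V\<close>, which is unique up to a phase.  It remains to choose \<open>V\<close> smoothly in \<open>\<alpha>\<close> near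
  a given automorphism \<open>\<gamma>\<close>.  Automorphisms close to the identity are implemented by unitaries close
  to the identity; if \<open>exp(K)\<close> is such a unitary for \<open>exp(\<delta>)\<close>, with \<open>K\<close> and \<open>\<delta>\<close> small,
  then \<open>\<pi>'(\<delta>(B)) = [K, \<pi>'(B)]\<close>.  Hence every symmetric derivation \<open>\<delta>\<close> is the commutator with a
  skew-adjoint operator \<open>K(\<delta>)\<close>, and \<open>K\<close> can be chosen linear and bounded.  In the
  chart \<open>\<delta> \<mapsto> exp(\<delta>) \<gamma>\<close> one then takes \<open>V = exp(K(\<delta>)) V\<^sub>\<gamma>\<close>.\<close>

section \<open>Complex vector spaces and semidefinite forms\<close>

text \<open>The phase of an implementing unitary chosen for each \<open>\<alpha>\<close> need not
  depend continuously on \<open>\<alpha>\<close>. Therefore \<open>\<Phi>\<close> and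
  \<open>U\<close> are treated as fixed expressions in \<open>(V, \<Omega>, \<Psi>)\<close>, smooth
  on the open set of operators and vectors with
  \<open>\<langle>\<Psi>, V \<Omega>\<rangle> \<noteq> 0\<close>, into which any local family of
  implementers may be inserted. The algebra may lack a unit and no spectral theory is used: the
  analytic input is a square root of \<open>1 - h\<close> by iteration and the inverse of
  \<open>1 + h * h\<close> for self-adjoint \<open>h\<close>, both written without the unit. They
  give contractivity of representations, approximate units, and cutoffs that act as
  near-projections. The separating contraction is \<open>(2 A - 1) E\<close> with a cutoff
  \<open>A\<close> and an approximate unit \<open>E\<close>. Linearity of \<open>K(\<delta>)\<close>
  rests on Schur's lemma: two choices differ by an imaginary scalar, requiring
  \<open>\<langle>x, K x\<rangle> = 0\<close> at a fixed unit vector removes it, and uniqueness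
  forces linearity. The logarithm only provides existence for small \<open>\<delta>\<close>.\<close>

lemma scaleC_zero_left [simp]: "0 *\<^sub>C (x::'a::complex_banach) = 0"
  using scaleC_of_real[of 0 x] by simp

lemma scaleC_one [simp]: "1 *\<^sub>C (x::'a::complex_banach) = x"
  using scaleC_of_real[of 1 x] by simp

lemma scaleC_zero_right [simp]: "c *\<^sub>C (0::'a::complex_banach) = 0"
  using norm_scaleC[of c "0::'a"] by simp

lemma scaleC_minus_left: "(- c) *\<^sub>C (x::'a::complex_banach) = - (c *\<^sub>C x)"
  using scaleC_add_left[of c "- c" x] by (simp add: eq_neg_iff_add_eq_0 add.commute)

lemma scaleC_minus_right: "c *\<^sub>C (- (x::'a::complex_banach)) = - (c *\<^sub>C x)"
  using scaleC_add_right[of c x "- x"] by (simp add: eq_neg_iff_add_eq_0 add.commute)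

lemma scaleC_diff_right: "c *\<^sub>C ((x::'a::complex_banach) - y) = c *\<^sub>C x - c *\<^sub>C y"
  using scaleC_add_right[of c x "- y"] by (simp add: scaleC_minus_right)

lemma scaleC_scaleR: "c *\<^sub>C (r *\<^sub>R (x::'a::complex_banach)) = r *\<^sub>R (c *\<^sub>C x)"
  by (simp add: scaleC_of_real[symmetric] scaleC_scaleC mult.commute)

lemma scaleR_scaleC: "r *\<^sub>R (c *\<^sub>C (x::'a::complex_banach)) = (complex_of_real r * c) *\<^sub>C x"
  by (simp add: scaleC_of_real[symmetric] scaleC_scaleC)

lemma bounded_bilinear_scaleC: "bounded_bilinear (scaleC :: complex \<Rightarrow> 'a::complex_banach \<Rightarrow> 'a)"
proof
  show "(r *\<^sub>R a) *\<^sub>C b = r *\<^sub>R (a *\<^sub>C b)" for r a and b :: 'a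
    by (simp add: scaleC_of_real[symmetric] scaleC_scaleC scaleR_conv_of_real)
  show "\<exists>K. \<forall>a (b::'a). norm (a *\<^sub>C b) \<le> norm a * norm b * K"
    by (rule exI[of _ 1]) (simp add: norm_scaleC)
qed (simp_all add: scaleC_add_left scaleC_add_right scaleC_scaleR)

locale semidefinite_form =
  fixes q :: "'v::complex_banach \<Rightarrow> 'v \<Rightarrow> complex"
  assumes add_right: "q x (y + z) = q x y + q x z"
    and scaleC_right: "q x (c *\<^sub>C y) = c * q x y"
    and hermitian: "q x y = cnj (q y x)"
    and nonneg: "0 \<le> Re (q x x)"
begin

lemma add_left: "q (x + y) z = q x z + q y z"
  by (metis add_right hermitian complex_cnj_add)

lemma scaleC_left: "q (c *\<^sub>C x) y = cnj c * q x y"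
  by (metis scaleC_right hermitian complex_cnj_mult)

lemma zero_right [simp]: "q x 0 = 0"
  using scaleC_right[of x 0 0] by simp

lemma zero_left [simp]: "q 0 x = 0"
  by (subst hermitian) simp

lemma minus_right: "q x (- y) = - q x y"
  using scaleC_right[of x "-1" y] by (simp add: scaleC_minus_left)

lemma minus_left: "q (- x) y = - q x y"
  using scaleC_left[of "-1" x y] by (simp add: scaleC_minus_left)

lemma diff_right: "q x (y - z) = q x y - q x z"
  using add_right[of x y "- z"] by (simp add: minus_right)

lemma diff_left: "q (x - y) z = q x z - q y z"
  using add_left[of x "- y" z] by (simp add: minus_left)

lemma self_real: "Im (q x x) = 0"
  using arg_cong[OF hermitian[of x x], of Im] by simp

lemma self_eq: "q x x = complex_of_real (Re (q x x))"
  by (simp add: complex_eq_iff self_real)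

lemma cauchy_schwarz: "(cmod (q x y))\<^sup>2 \<le> Re (q x x) * Re (q y y)"
proof -
  define a b c where "a = Re (q x x)" and "b = Re (q y y)" and "c = q x y"
  have expand: "Re (q (x + t *\<^sub>C y) (x + t *\<^sub>C y)) = a + 2 * Re (t * c) + (cmod t)\<^sup>2 * b" for t
  proof -
    have "q (x + t *\<^sub>C y) (x + t *\<^sub>C y) = q x x + t * c + cnj (t * c) + (t * cnj t) * q y y"
      by (simp add: add_right add_left scaleC_left scaleC_right c_def hermitian[of y x] algebra_simps)
    moreover have "t * cnj t = complex_of_real ((cmod t)\<^sup>2)"
      by (rule complex_norm_square[symmetric])
    ultimately show ?thesis
      using self_eq[of y] by (simp add: a_def b_def)
  qed
  have pos: "0 \<le> a + 2 * Re (t * c) + (cmod t)\<^sup>2 * b" for t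
    using nonneg[of "x + t *\<^sub>C y"] unfolding expand .
  \<comment> \<open>Taking \<open>t\<close> as a real multiple of \<open>cnj c\<close> makes
    \<open>t * c\<close> real, so the sharp inequality follows from a real quadratic in
    \<open>s\<close>.\<close>
  have key: "0 \<le> a + 2 * s * (cmod c)\<^sup>2 + s\<^sup>2 * (cmod c)\<^sup>2 * b" for s :: real
  proof -
    have "Re ((complex_of_real s * cnj c) * c) = s * (cmod c)\<^sup>2"
      by (simp add: cmod_def power2_eq_square algebra_simps)
    with pos[of "complex_of_real s * cnj c"] show ?thesis
      by (simp add: norm_mult power_mult_distrib algebra_simps)
  qed
  have b0: "0 \<le> b" using nonneg by (simp add: b_def)
  show ?thesis
  proof (cases "b = 0")
    \<comment> \<open>For a null vector \<open>y\<close> the quadratic is affine in \<open>s\<close>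
      and stays nonnegative only if \<open>c\<close> vanishes.\<close>
    case True
    have "c = 0"
    proof (rule ccontr)
      assume "c \<noteq> 0"
      then have "(cmod c)\<^sup>2 > 0" by simp
      with key[of "- (a + 1) / (2 * (cmod c)\<^sup>2)"] True show False
        by (simp add: field_simps)
    qed
    then show ?thesis using True by (simp add: a_def b_def c_def)
  next
    case False
    with b0 have "b > 0" by simp
    with key[of "- 1 / b"] have "(cmod c)\<^sup>2 \<le> a * b"
      by (simp add: field_simps power2_eq_square)
    then show ?thesis by (simp add: a_def b_def c_def)
  qed
qed

end

text \<open>Polarisation: a sesquilinear form with real diagonal is hermitian. The values
  \<open>t = 1\<close> and \<open>t = \<i>\<close> compare the imaginary and the real parts of the
  two off-diagonal values.\<close>

lemma semidefinite_formI:
  assumes add_right: "\<And>x y z. q x (y + z) = q x y + q x (z::'v::complex_banach)"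
    and add_left: "\<And>x y z. q (x + y) z = q x z + q y z"
    and scaleC_right: "\<And>c x y. q x (c *\<^sub>C y) = c * q x y"
    and scaleC_left: "\<And>c x y. q (c *\<^sub>C x) y = cnj c * q x y"
    and nonneg: "\<And>x. Im (q x x) = 0 \<and> 0 \<le> Re (q x x)"
  shows "semidefinite_form q"
proof
  fix x y
  have e: "q (x + t *\<^sub>C y) (x + t *\<^sub>C y) = q x x + t * q x y + cnj t * q y x + t * cnj t * q y y" for t
    by (simp add: add_right add_left scaleC_right scaleC_left algebra_simps)
  have 1: "Im (q x y) + Im (q y x) = 0"
    using e[of 1] nonneg[of "x + 1 *\<^sub>C y"] nonneg[of x] nonneg[of y]
    by (simp add: complex_eq_iff)
  have 2: "Re (q x y) - Re (q y x) = 0"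
    using e[of \<i>] nonneg[of "x + \<i> *\<^sub>C y"] nonneg[of x] nonneg[of y]
    by (simp add: complex_eq_iff)
  show "q x y = cnj (q y x)"
    using 1 2 by (simp add: complex_eq_iff)
qed (use assms in auto)

section \<open>Hilbert spaces\<close>

global_interpretation cinner: semidefinite_form "cinner :: 'h::complex_hilbert \<Rightarrow> 'h \<Rightarrow> complex"
  by standard (simp_all add: cinner_add_right cinner_scaleC_right cinner_self cinner_commute[symmetric])

lemma cinner_scaleR_right: "cinner x (r *\<^sub>R y) = complex_of_real r * cinner x (y::'h::complex_hilbert)"
  by (simp add: scaleC_of_real[symmetric] cinner_scaleC_right)

lemma cinner_scaleR_left: "cinner (r *\<^sub>R x) y = complex_of_real r * cinner x (y::'h::complex_hilbert)"
  by (simp add: scaleC_of_real[symmetric] cinner.scaleC_left)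

lemmas cinner_simps = cinner.add_left cinner.add_right cinner.diff_left cinner.diff_right
  cinner.minus_left cinner.minus_right cinner.scaleC_left cinner.scaleC_right
  cinner_scaleR_right cinner_scaleR_left

lemma norm_sq_cinner: "(norm (x::'h::complex_hilbert))\<^sup>2 = Re (cinner x x)"
  by (simp add: cinner_self)

lemma norm_cinner: "cmod (cinner x y) \<le> norm x * norm (y::'h::complex_hilbert)"
proof -
  have "(cmod (cinner x y))\<^sup>2 \<le> (norm x * norm y)\<^sup>2"
    using cinner.cauchy_schwarz[of x y] by (simp add: cinner_self power_mult_distrib)
  then show ?thesis by (simp add: abs_le_square_iff[symmetric])
qed

lemma bounded_bilinear_cinner: "bounded_bilinear (cinner :: 'h::complex_hilbert \<Rightarrow> 'h \<Rightarrow> complex)"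
proof
  show "\<exists>K. \<forall>a (b::'h). norm (cinner a b) \<le> norm a * norm b * K"
    by (rule exI[of _ 1]) (simp add: norm_cinner)
qed (simp_all add: cinner_simps scaleR_conv_of_real)

lemma norm_add_sq: "(norm (x + y))\<^sup>2 = (norm x)\<^sup>2 + 2 * Re (cinner x y) + (norm (y::'h::complex_hilbert))\<^sup>2"
  using cinner_commute[of y x] by (simp add: norm_sq_cinner cinner_simps)

lemma norm_diff_sq: "(norm (x - y))\<^sup>2 = (norm x)\<^sup>2 - 2 * Re (cinner x y) + (norm (y::'h::complex_hilbert))\<^sup>2"
  using cinner_commute[of y x] by (simp add: norm_sq_cinner cinner_simps)

lemma cinner_eq_zero_iff [simp]: "cinner x x = 0 \<longleftrightarrow> x = (0::'h::complex_hilbert)"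
  by (simp add: cinner_self)

lemma cinner_zero_dense:
  fixes x :: "'h::complex_hilbert"
  assumes "closure S = UNIV" "\<And>z. z \<in> S \<Longrightarrow> cinner z x = 0"
  shows "x = 0"
proof -
  have "x \<in> closure S" using assms(1) by simp
  then obtain f where f: "\<And>n. f n \<in> S" "f \<longlonglongrightarrow> x"
    unfolding closure_sequential by blast
  have "(\<lambda>n. cinner (f n) x) \<longlonglongrightarrow> cinner x x"
    by (rule bounded_bilinear.tendsto[OF bounded_bilinear_cinner f(2) tendsto_const])
  moreover have "(\<lambda>n. cinner (f n) x) = (\<lambda>n. 0)" using f(1) assms(2) by auto
  ultimately have "cinner x x = 0" using LIMSEQ_unique tendsto_const by metis
  then show ?thesis by simp
qed

section \<open>Nearest points, orthogonal projections and representation of functionals\<close>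

text \<open>A minimising sequence is Cauchy because midpoints stay in \<open>S\<close>
  (parallelogram law). The inequality is the first-order condition for the minimum along segments
  from \<open>s\<close>.\<close>

lemma nearest_point_exists:
  fixes S :: "'h::complex_hilbert set"
  assumes "closed S" "convex S" "S \<noteq> {}"
  obtains s where "s \<in> S" "\<And>t. t \<in> S \<Longrightarrow> Re (cinner (x - s) (t - s)) \<le> 0"
proof -
  define d where "d = (INF t\<in>S. norm (x - t))"
  have bdd: "bdd_below ((\<lambda>t. norm (x - t)) ` S)" by (rule bdd_belowI2[of _ 0]) simp
  have d_le: "d \<le> norm (x - t)" if "t \<in> S" for t
    unfolding d_def by (rule cINF_lower[OF bdd that])
  have d0: "0 \<le> d" unfolding d_def using assms(3) by (intro cINF_greatest) auto
  have "\<exists>t\<in>S. norm (x - t) < d + 1 / real (Suc n)" for n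
    using cINF_less_iff[OF assms(3) bdd, of "d + 1 / real (Suc n)"] by (auto simp: d_def)
  then obtain f where fS: "\<And>n. f n \<in> S" and fn: "\<And>n. norm (x - f n) < d + 1 / real (Suc n)"
    by metis
  have mid: "(norm (a - b))\<^sup>2 \<le> 2 * (norm (x - a))\<^sup>2 + 2 * (norm (x - b))\<^sup>2 - 4 * d\<^sup>2"
    if "a \<in> S" "b \<in> S" for a b
  proof -
    have "(1/2) *\<^sub>R a + (1/2) *\<^sub>R b \<in> S" using assms(2) that by (auto intro: convexD)
    then have "d \<le> norm (x - ((1/2) *\<^sub>R a + (1/2) *\<^sub>R b))" by (rule d_le)
    also have "x - ((1/2) *\<^sub>R a + (1/2) *\<^sub>R b) = (1/2) *\<^sub>R ((x - a) + (x - b))"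
    proof -
      have "x = (1/2) *\<^sub>R x + (1/2) *\<^sub>R x" by (simp flip: scaleR_add_left)
      then show ?thesis by (simp add: scaleR_add_right scaleR_diff_right)
    qed
    finally have "2 * d \<le> norm ((x - a) + (x - b))" by simp
    then have "4 * d\<^sup>2 \<le> (norm ((x - a) + (x - b)))\<^sup>2"
      using d0 power_mono[of "2 * d" _ 2] by (simp add: power_mult_distrib)
    moreover have "a - b = (x - b) - (x - a)" by simp
    then have "(norm (a - b))\<^sup>2 + (norm ((x - a) + (x - b)))\<^sup>2 = 2 * (norm (x - a))\<^sup>2 + 2 * (norm (x - b))\<^sup>2"
      using norm_add_sq[of "x - a" "x - b"] norm_diff_sq[of "x - b" "x - a"] cinner_commute[of "x-a" "x-b"]
      by simp
    ultimately show ?thesis by simp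
  qed
  have lim: "(\<lambda>n. norm (x - f n)) \<longlonglongrightarrow> d"
  proof (rule tendsto_sandwich[of "\<lambda>_. d" _ _ "\<lambda>n. d + 1 / real (Suc n)"])
    have "(\<lambda>n. d + 1 / real (Suc n)) \<longlonglongrightarrow> d + 0"
      by (intro tendsto_add tendsto_const LIMSEQ_Suc[OF lim_1_over_n])
    then show "(\<lambda>n. d + 1 / real (Suc n)) \<longlonglongrightarrow> d" by simp
  qed (use d_le[OF fS] less_imp_le[OF fn] in \<open>auto intro!: always_eventually simp del: of_nat_Suc\<close>)
  have "Cauchy f"
  proof (rule CauchyI)
    fix e :: real assume e: "0 < e"
    have "(\<lambda>n. (norm (x - f n))\<^sup>2) \<longlonglongrightarrow> d\<^sup>2" by (intro tendsto_intros lim)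
    then have "\<forall>\<^sub>F n in sequentially. (norm (x - f n))\<^sup>2 < d\<^sup>2 + e\<^sup>2 / 4"
      using e by (intro order_tendstoD) auto
    then obtain N where N: "\<And>n. n \<ge> N \<Longrightarrow> (norm (x - f n))\<^sup>2 < d\<^sup>2 + e\<^sup>2 / 4"
      by (auto simp: eventually_sequentially)
    show "\<exists>M. \<forall>m\<ge>M. \<forall>n\<ge>M. norm (f m - f n) < e"
    proof (intro exI allI impI)
      fix m n assume "N \<le> m" "N \<le> n"
      then have "(norm (f m - f n))\<^sup>2 < e\<^sup>2"
        using mid[OF fS fS, of m n] N[of m] N[of n] by simp
      then show "norm (f m - f n) < e" using e by (simp add: power_less_imp_less_base)
    qed
  qed
  then obtain s where s: "f \<longlonglongrightarrow> s" using Cauchy_convergent convergent_def by blast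
  have sS: "s \<in> S" using closed_sequentially[OF assms(1)] fS s by blast
  have "(\<lambda>n. norm (x - f n)) \<longlonglongrightarrow> norm (x - s)" by (intro tendsto_intros s)
  then have ns: "norm (x - s) = d" using lim LIMSEQ_unique by blast
  have "Re (cinner (x - s) (t - s)) \<le> 0" if t: "t \<in> S" for t
  proof (rule ccontr)
    assume "\<not> ?thesis"
    then have c: "Re (cinner (x - s) (t - s)) > 0" (is "?c > 0") by simp
    \<comment> \<open>A step so short that the gain linear in \<open>r\<close> exceeds the quadratic
      loss; capping it by \<open>1\<close> keeps the new point on the segment.\<close>
    define r where "r = min 1 (?c / ((norm (t - s))\<^sup>2 + 1))"
    have r: "0 < r" "r \<le> 1" using c by (auto simp: r_def add_nonneg_pos)
    have "r * (norm (t - s))\<^sup>2 \<le> ?c / ((norm (t - s))\<^sup>2 + 1) * (norm (t - s))\<^sup>2"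
      by (rule mult_right_mono) (auto simp: r_def)
    also have "\<dots> < 2 * ?c"
    proof -
      have "?c * (norm (t - s))\<^sup>2 < 2 * ?c * ((norm (t - s))\<^sup>2 + 1)"
        unfolding distrib_left
        using c mult_nonneg_nonneg[OF less_imp_le[OF c] zero_le_power2[of "norm (t - s)"]] by linarith
      then show ?thesis by (simp add: divide_less_eq add_nonneg_pos)
    qed
    finally have lt: "r * (norm (t - s))\<^sup>2 < 2 * ?c" .
    have "(1 - r) *\<^sub>R s + r *\<^sub>R t \<in> S" using assms(2) sS t r by (auto intro: convexD)
    then have "d \<le> norm (x - ((1 - r) *\<^sub>R s + r *\<^sub>R t))" by (rule d_le)
    also have "x - ((1 - r) *\<^sub>R s + r *\<^sub>R t) = (x - s) - r *\<^sub>R (t - s)"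
      by (simp add: algebra_simps)
    finally have "d\<^sup>2 \<le> (norm ((x - s) - r *\<^sub>R (t - s)))\<^sup>2"
      using d0 by (simp add: power_mono)
    also have "\<dots> = d\<^sup>2 - 2 * r * ?c + r\<^sup>2 * (norm (t - s))\<^sup>2"
      by (simp add: norm_diff_sq ns cinner_simps power_mult_distrib)
    finally have "r * (2 * ?c) \<le> r * (r * (norm (t - s))\<^sup>2)"
      by (simp add: power2_eq_square algebra_simps)
    then have "2 * ?c \<le> r * (norm (t - s))\<^sup>2" using r by simp
    with lt show False by simp
  qed
  with sS show thesis by (rule that)
qed

text \<open>The normal vector is \<open>x - s\<close> with \<open>s\<close> the nearest point of
  \<open>S\<close>; the gap is its squared length.\<close>

lemma separate_point_closed_convex:
  fixes S :: "'h::complex_hilbert set"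
  assumes "closed S" "convex S" "S \<noteq> {}" "x \<notin> S"
  obtains v c where "\<And>t. t \<in> S \<Longrightarrow> Re (cinner v t) \<le> c" "c < Re (cinner v x)"
proof -
  obtain s where s: "s \<in> S" "\<And>t. t \<in> S \<Longrightarrow> Re (cinner (x - s) (t - s)) \<le> 0"
    using nearest_point_exists[OF assms(1-3), of x] by blast
  have "x \<noteq> s" using s(1) assms(4) by auto
  then have "0 < (norm (x - s))\<^sup>2" by simp
  then have "0 < Re (cinner (x - s) (x - s))" by (simp add: norm_sq_cinner)
  with s(2) that[of "x - s" "Re (cinner (x - s) s)"] show thesis
    by (auto simp: cinner_simps)
qed

lemma orthogonal_projection_exists:
  fixes S :: "'h::complex_hilbert set"
  assumes "closed_complex_subspace S"
  obtains s where "s \<in> S" "\<And>t. t \<in> S \<Longrightarrow> cinner (x - s) t = 0"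
proof -
  have S: "closed S" "0 \<in> S" "\<And>x y. x \<in> S \<Longrightarrow> y \<in> S \<Longrightarrow> x + y \<in> S" "\<And>c x. x \<in> S \<Longrightarrow> c *\<^sub>C x \<in> S"
    using assms by (auto simp: closed_complex_subspace_def)
  have "convex S" by (auto simp: convex_def S simp flip: scaleC_of_real)
  then obtain s where s: "s \<in> S" "\<And>t. t \<in> S \<Longrightarrow> Re (cinner (x - s) (t - s)) \<le> 0"
    using nearest_point_exists[OF S(1), of x] S(2) by blast
  have le: "Re (cinner (x - s) t) \<le> 0" if "t \<in> S" for t
    using s(2)[of "t + s"] S(3)[OF that s(1)] by simp
  have "cinner (x - s) t = 0" if t: "t \<in> S" for t
  proof -
    \<comment> \<open>Since \<open>S\<close> is a complex subspace, the one-sided bound holds for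
      every multiple; the four units \<open>1\<close>, \<open>-1\<close>, \<open>\<i>\<close>,
      \<open>-\<i>\<close> turn it into an equality.\<close>
    have "Re (c * cinner (x - s) t) \<le> 0" for c
      using le[OF S(4)[OF t, of c]] by (simp add: cinner_simps)
    from this[of 1] this[of "-1"] this[of \<i>] this[of "-\<i>"] show ?thesis
      by (simp add: complex_eq_iff)
  qed
  with s(1) show thesis by (rule that)
qed

lemma riesz_representation:
  fixes f :: "'h::complex_hilbert \<Rightarrow> complex"
  assumes "bounded_linear f" "\<And>c x. f (c *\<^sub>C x) = c * f x"
  obtains y where "\<And>x. f x = cinner y x"
proof (cases "\<forall>x. f x = 0")
  case True
  then show ?thesis using that[of 0] by simp
next
  case False
  then obtain x0 where x0: "f x0 \<noteq> 0" by blast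
  interpret bounded_linear f by fact
  define S where "S = {x. f x = 0}"
  have "closed S" unfolding S_def
    using continuous_on_closed_vimage by (intro closed_Collect_eq continuous_intros) (auto intro: continuous_on)
  then have S: "closed_complex_subspace S"
    by (auto simp: closed_complex_subspace_def S_def add assms(2))
  obtain s where s: "s \<in> S" "\<And>t. t \<in> S \<Longrightarrow> cinner (x0 - s) t = 0"
    using orthogonal_projection_exists[OF S, of x0] by blast
  define u where "u = x0 - s"
  have fu: "f u \<noteq> 0" using s(1) x0 by (simp add: u_def diff S_def)
  then have u0: "u \<noteq> 0" by auto
  show ?thesis
  proof (rule that)
    fix x
    \<comment> \<open>Any \<open>x\<close> is a multiple of \<open>u\<close> modulo the kernel of
      \<open>f\<close>, and \<open>u\<close> is orthogonal to that kernel.\<close>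
    have "f (f u *\<^sub>C x - f x *\<^sub>C u) = 0" by (simp add: diff assms(2))
    then have "cinner u (f u *\<^sub>C x - f x *\<^sub>C u) = 0" using s(2) by (simp add: u_def S_def)
    then have "f u * cinner u x = f x * cinner u u" by (simp add: cinner_simps)
    then show "f x = cinner (cnj (f u / cinner u u) *\<^sub>C u) x"
      using u0 by (simp add: cinner_simps field_simps)
  qed
qed

section \<open>Extension by density and square roots by iteration\<close>

text \<open>The domination hypothesis gives both well-definedness and continuity on the range of
  \<open>f\<close>. In the applications \<open>v\<close> is an algebra element and
  \<open>f v\<close> its action on a cyclic vector, so an operator is prescribed on the orbit of
  that vector.\<close>

lemma bounded_linear_extension:
  fixes f :: "'v::real_vector \<Rightarrow> 'a::real_normed_vector" and g :: "'v \<Rightarrow> 'b::banach"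
  assumes "linear f" "linear g" "closure (range f) = UNIV" "\<And>v. norm (g v) \<le> M * norm (f v)"
  obtains T :: "'a \<Rightarrow>\<^sub>L 'b" where "\<And>v. T (f v) = g v"
proof -
  interpret f: linear f by fact
  interpret g: linear g by fact
  have gf: "g v = g w" if "f v = f w" for v w
    using assms(4)[of "v - w"] that by (simp add: f.diff g.diff)
  define h where "h y = g (SOME v. f v = y)" for y
  have hf: "h (f v) = g v" for v
    unfolding h_def by (rule gf) (rule someI[of _ v], simp)
  have lip: "dist (h y) (h z) \<le> M * dist y z" if "y \<in> range f" "z \<in> range f" for y z
    using that assms(4) by (auto simp: hf dist_norm simp flip: f.diff g.diff)
  have uc: "uniformly_continuous_on (range f) h"
    unfolding uniformly_continuous_on_def
  proof (intro allI impI)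
    fix e :: real assume e: "0 < e"
    show "\<exists>d>0. \<forall>x\<in>range f. \<forall>x'\<in>range f. dist x' x < d \<longrightarrow> dist (h x') (h x) < e"
    proof (intro exI[of _ "e / (\<bar>M\<bar> + 1)"] conjI ballI impI)
      fix x x' assume x: "x \<in> range f" "x' \<in> range f" and d: "dist x' x < e / (\<bar>M\<bar> + 1)"
      have "dist (h x') (h x) \<le> M * dist x' x" using lip x by blast
      also have "\<dots> \<le> (\<bar>M\<bar> + 1) * dist x' x" by (intro mult_right_mono) auto
      also have "\<dots> < e" using d by (simp add: field_simps)
      finally show "dist (h x') (h x) < e" .
    qed (use e in auto)
  qed
  obtain k where k: "uniformly_continuous_on (closure (range f)) k" "\<And>x. x \<in> range f \<Longrightarrow> h x = k x"
    using uniformly_continuous_on_extension_on_closure[OF uc] by metis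
  have kf: "k (f v) = g v" for v using k(2)[of "f v"] hf by simp
  have cont: "isCont k x" for x
    using uniformly_continuous_imp_continuous[OF k(1)] continuous_on_eq_continuous_at[OF open_UNIV, of k]
    by (simp add: assms(3))
  have seq: "\<exists>v. (\<lambda>n. f (v n)) \<longlonglongrightarrow> x" for x
  proof -
    have "x \<in> closure (range f)" using assms(3) by simp
    then obtain z where z: "\<And>n. z n \<in> range f" "z \<longlonglongrightarrow> x" unfolding closure_sequential by blast
    have "\<forall>n. \<exists>v. z n = f v" using z(1) by (auto simp: image_iff)
    then obtain v where "\<forall>n. z n = f (v n)" by (rule choice[THEN exE])
    then have "z = (\<lambda>n. f (v n))" by auto
    then show ?thesis using z(2) by auto
  qed
  have klim: "(\<lambda>n. g (v n)) \<longlonglongrightarrow> k x" if "(\<lambda>n. f (v n)) \<longlonglongrightarrow> x" for v x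
    using isCont_tendsto_compose[OF cont that] by (simp add: kf)
  have "bounded_linear k"
  proof (rule bounded_linear_intro)
    fix x y
    obtain v w where v: "(\<lambda>n. f (v n)) \<longlonglongrightarrow> x" and w: "(\<lambda>n. f (w n)) \<longlonglongrightarrow> y" using seq by metis
    have "(\<lambda>n. f (v n + w n)) \<longlonglongrightarrow> x + y" using tendsto_add[OF v w] by (simp add: f.add)
    from klim[OF this] have "(\<lambda>n. g (v n) + g (w n)) \<longlonglongrightarrow> k (x + y)" by (simp add: g.add)
    then show "k (x + y) = k x + k y"
      using LIMSEQ_unique tendsto_add[OF klim[OF v] klim[OF w]] by blast
    fix r :: real
    have "(\<lambda>n. f (r *\<^sub>R v n)) \<longlonglongrightarrow> r *\<^sub>R x" using tendsto_scaleR[OF tendsto_const v] by (simp add: f.scale)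
    from klim[OF this] have "(\<lambda>n. r *\<^sub>R g (v n)) \<longlonglongrightarrow> k (r *\<^sub>R x)" by (simp add: g.scale)
    then show "k (r *\<^sub>R x) = r *\<^sub>R k x"
      using LIMSEQ_unique tendsto_scaleR[OF tendsto_const klim[OF v]] by blast
    have "(\<lambda>n. norm (g (v n))) \<longlonglongrightarrow> norm (k x)" by (intro tendsto_norm klim v)
    moreover have "(\<lambda>n. M * norm (f (v n))) \<longlonglongrightarrow> M * norm x" by (intro tendsto_intros v)
    ultimately show "norm (k x) \<le> norm x * M"
      unfolding mult.commute[of "norm x"] by (rule LIMSEQ_le) (use assms(4) in auto)
  qed
  then have "blinfun_apply (Blinfun k) = k" by (rule bounded_linear_Blinfun_apply)
  then show thesis using that[of "Blinfun k"] kf by simp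
qed

text \<open>The iteration \<open>k \<mapsto> (h + k\<^sup>2) / 2\<close> is dominated by its scalar counterpart started at \<open>h = 1\<close>,
  so that it converges even when \<open>norm h = 1\<close>; \<open>1 - k\<close> is then a square root of \<open>1 - h\<close>.\<close>

lemma square_root_series:
  fixes h :: "'a::banach"
  assumes "bounded_bilinear m" and contr: "\<And>a b. norm (m a b) \<le> norm a * norm b"
    and h: "norm h \<le> 1"
    and S: "closed S" "0 \<in> S" "\<And>k. k \<in> S \<Longrightarrow> (1/2) *\<^sub>R (h + m k k) \<in> S"
  obtains k where "k \<in> S" "norm k \<le> 1" "h + m k k = 2 *\<^sub>R k"
proof -
  interpret m: bounded_bilinear m by fact
  define F where "F k = (1/2) *\<^sub>R (h + m k k)" for k
  define k where "k n = (F ^^ n) 0" for n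
  define t where "t n = ((\<lambda>s. (1 + s\<^sup>2) / 2) ^^ n) (0::real)" for n
  have kS: "k (Suc n) = F (k n)" and k0: "k 0 = 0" for n by (simp_all add: k_def)
  have tS: "t (Suc n) = (1 + (t n)\<^sup>2) / 2" and t0: "t 0 = 0" for n by (simp_all add: t_def)
  have t: "0 \<le> t n \<and> t n \<le> 1" for n
    by (induction n) (auto simp: t0 tS power_le_one add_nonneg_nonneg)
  have kt: "norm (k n) \<le> t n" for n
  proof (induction n)
    case (Suc n)
    have "norm (h + m (k n) (k n)) \<le> norm h + norm (k n) * norm (k n)"
      using norm_triangle_ineq[of h] contr order_trans by (meson add_left_mono)
    also have "\<dots> \<le> 1 + t n * t n" using h Suc t by (intro add_mono mult_mono) auto
    finally show ?case by (simp add: kS F_def tS power2_eq_square)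
  qed (simp add: k0 t0)
  \<comment> \<open>The increments are bounded by those of \<open>t\<close>, which telescope to a
    convergent series because \<open>t\<close> is monotone and bounded by \<open>1\<close>.\<close>
  have kd: "norm (k (Suc n) - k n) \<le> t (Suc n) - t n" for n
  proof (induction n)
    case 0
    then show ?case using h by (simp add: kS k0 t0 tS F_def m.zero_left)
  next
    case (Suc n)
    have "k (Suc (Suc n)) - k (Suc n) = (1/2) *\<^sub>R (m (k (Suc n)) (k (Suc n)) - m (k n) (k n))"
      by (simp add: kS F_def scaleR_diff_right[symmetric])
    also have "m (k (Suc n)) (k (Suc n)) - m (k n) (k n)
        = m (k (Suc n)) (k (Suc n) - k n) + m (k (Suc n) - k n) (k n)"
      by (simp add: m.diff_left m.diff_right)
    finally have "norm (k (Suc (Suc n)) - k (Suc n))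
        \<le> (1/2) * (norm (m (k (Suc n)) (k (Suc n) - k n)) + norm (m (k (Suc n) - k n) (k n)))"
      using norm_triangle_ineq by simp
    also have "\<dots> \<le> (1/2) * (t (Suc n) * (t (Suc n) - t n) + (t (Suc n) - t n) * t n)"
      using Suc kt t norm_ge_zero order_trans[OF norm_ge_zero Suc]
      by (intro mult_left_mono add_mono order_trans[OF contr] mult_mono) auto
    also have "\<dots> = t (Suc (Suc n)) - t (Suc n)"
      by (simp add: tS[of "Suc n"] tS[of n] power2_eq_square field_simps)
    finally show ?case .
  qed
  have tmono: "t n \<le> t (Suc n)" for n
    using order_trans[OF norm_ge_zero kd[of n]] by simp
  have "summable (\<lambda>n. t (Suc n) - t n)"
  proof -
    have "convergent t"
    proof (rule Bseq_mono_convergent)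
      show "Bseq t" by (rule BseqI'[of _ 1]) (simp add: t)
      show "\<forall>m n. m \<le> n \<longrightarrow> t m \<le> t n" using lift_Suc_mono_le[of t, OF tmono] by blast
    qed
    then show ?thesis
      unfolding convergent_def using telescope_summable by blast
  qed
  then have "summable (\<lambda>n. k (Suc n) - k n)" by (rule summable_comparison_test') (use kd in auto)
  then obtain s where "(\<lambda>n. k (Suc n) - k n) sums s" by auto
  then have "(\<lambda>n. \<Sum>i<n. k (Suc i) - k i) \<longlonglongrightarrow> s" by (simp add: sums_def)
  then have lim: "k \<longlonglongrightarrow> s" by (simp add: sum_lessThan_telescope k0)
  have "k n \<in> S" for n by (induction n) (auto simp: k0 kS F_def S)
  then have "s \<in> S" using closed_sequentially[OF S(1) _ lim] by blast
  moreover have "norm s \<le> 1"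
  proof (rule Lim_norm_ubound[OF _ lim])
    show "\<forall>\<^sub>F n in sequentially. norm (k n) \<le> 1"
      using kt t by (intro always_eventually allI) (meson order_trans)
  qed simp
  moreover have "(\<lambda>n. F (k n)) \<longlonglongrightarrow> F s"
    unfolding F_def by (intro tendsto_intros m.tendsto lim)
  then have "F s = s" using LIMSEQ_Suc[OF lim] LIMSEQ_unique by (simp add: kS)
  then have "2 *\<^sub>R F s = 2 *\<^sub>R s" by simp
  then have "h + m s s = 2 *\<^sub>R s" by (simp add: F_def)
  ultimately show thesis by (rule that)
qed

section \<open>C*-algebras\<close>

lemmas scaleC_simps = scaleC_add_right scaleC_diff_right scaleC_mult_left scaleC_mult_right
  scaleC_scaleC scaleC_minus_left scaleC_minus_right

lemma star_zero [simp]: "star (0::'b::cstar_algebra) = 0"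
  using star_scaleC[of 0 "0::'b"] by simp

lemma star_minus: "star (- a) = - star (a::'b::cstar_algebra)"
  using star_scaleC[of "-1" a] by (simp add: scaleC_minus_left)

lemma star_diff: "star (a - b) = star a - star (b::'b::cstar_algebra)"
  using star_add[of a "- b"] by (simp add: star_minus)

lemma star_scaleR: "star (r *\<^sub>R a) = r *\<^sub>R star (a::'b::cstar_algebra)"
  using star_scaleC[of "complex_of_real r" a] by (simp add: scaleC_of_real)

lemma norm_star [simp]: "norm (star a) = norm (a::'b::cstar_algebra)"
proof -
  have le: "norm b \<le> norm (star b)" for b :: 'b
  proof (cases "b = 0")
    case False
    have "norm b * norm b \<le> norm (star b) * norm b"
      using cstar_identity[of b] norm_mult_ineq[of "star b" b] by (simp add: power2_eq_square)
    then show ?thesis using False by simp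
  qed simp
  show ?thesis using le[of a] le[of "star a"] by (simp add: star_star)
qed

lemma bounded_linear_star: "bounded_linear (star :: 'b::cstar_algebra \<Rightarrow> 'b)"
  by (rule bounded_linear_intro[of _ 1]) (simp_all add: star_add star_scaleR)

lemma star_mult_star: "star (star a * a) = star a * (a::'b::cstar_algebra)"
  by (simp add: star_mult star_star)

lemma norm_square_selfadjoint: "star h = h \<Longrightarrow> norm (h * h) = (norm (h::'b::cstar_algebra))\<^sup>2"
  using cstar_identity[of h] by simp

lemma norm_le_if_square_le:
  fixes h :: "'b::cstar_algebra"
  assumes "star h = h" "norm (h * h) \<le> c * norm h" "0 \<le> c"
  shows "norm h \<le> c"
proof (cases "h = 0")
  case False
  then show ?thesis
    using assms norm_square_selfadjoint[OF assms(1)] by (simp add: power2_eq_square)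
qed (use assms in simp)

lemma selfadjoint_decomposition:
  fixes a :: "'b::cstar_algebra"
  obtains b c where "star b = b" "star c = c" "a = b + \<i> *\<^sub>C c"
proof
  show "star ((1/2) *\<^sub>R (a + star a)) = (1/2) *\<^sub>R (a + star a)"
    by (simp add: star_scaleR star_add star_star add.commute)
  show "star ((- \<i> / 2) *\<^sub>C (a - star a)) = (- \<i> / 2) *\<^sub>C (a - star a)"
    by (simp add: star_scaleC star_diff star_star scaleC_diff_right scaleC_minus_left)
  show "a = (1/2) *\<^sub>R (a + star a) + \<i> *\<^sub>C ((- \<i> / 2) *\<^sub>C (a - star a))"
    by (simp add: scaleC_scaleC scaleC_of_real[symmetric] scaleC_diff_right scaleC_add_right
        flip: scaleC_add_left)
qed

text \<open>For self-adjoint \<open>h\<close> in the unit ball choose \<open>k\<close> commuting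
  with \<open>h\<close> and \<open>h * h + k * k = 2 k\<close>, that is
  \<open>h^2 + (1 - k)^2 = 1\<close>. Then \<open>h + \<i> (1 - k)\<close> and
  \<open>h - \<i> (1 - k)\<close> are formally unitary with mean \<open>h\<close>. The relation is
  algebraic, so it survives \<open>\<phi>\<close>, and the image of \<open>h\<close> becomes a mean
  of two isometric left multiplications.\<close>

lemma star_hom_norm_le:
  fixes \<phi> :: "'a::cstar_algebra \<Rightarrow> 'b::cstar_algebra"
  assumes add: "\<And>a b. \<phi> (a + b) = \<phi> a + \<phi> b"
    and scaleC: "\<And>c a. \<phi> (c *\<^sub>C a) = c *\<^sub>C \<phi> a"
    and mult: "\<And>a b. \<phi> (a * b) = \<phi> a * \<phi> b"
    and star: "\<And>a. \<phi> (star a) = star (\<phi> a)"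
  shows "norm (\<phi> a) \<le> norm a"
proof -
  have scaleR: "\<phi> (r *\<^sub>R a) = r *\<^sub>R \<phi> a" for r a
    using scaleC[of "complex_of_real r"] by (simp add: scaleC_of_real)
  have unit: "norm (\<phi> h) \<le> 1" if sa: "star h = h" and n: "norm h \<le> 1" for h
  proof -
    have hh: "norm (h * h) \<le> 1"
      using n norm_square_selfadjoint[OF sa] by (simp add: power_le_one)
    \<comment> \<open>Self-adjointness and commutation with \<open>h\<close> are closed conditions
      stable under the iteration, so they pass to its limit \<open>k\<close>.\<close>
    have S: "closed {k. star k = k \<and> k * h = h * k}"
      by (intro closed_Collect_conj closed_Collect_eq continuous_intros
          linear_continuous_on[OF bounded_linear_star])
    obtain k where k: "k \<in> {k. star k = k \<and> k * h = h * k}" "h * h + k * k = 2 *\<^sub>R k"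
    proof (rule square_root_series[OF bounded_bilinear_mult norm_mult_ineq hh S])
      fix k assume k: "k \<in> {k. star k = k \<and> k * h = h * k}"
      then have "k * k * h = h * (k * k)" by (metis (mono_tags, lifting) mem_Collect_eq mult.assoc)
      with k sa show "(1/2) *\<^sub>R (h * h + k * k) \<in> {k. star k = k \<and> k * h = h * k}"
        by (simp add: star_scaleR star_add star_mult distrib_left distrib_right mult.assoc)
    qed auto
    define b c where "b = \<phi> h" and "c = \<phi> k"
    have b: "star b = b" and c: "star c = c" and bc: "c * b = b * c"
      using sa k(1) by (auto simp: b_def c_def star[symmetric] mult[symmetric])
    have sq: "b * b + c * c = 2 *\<^sub>R c"
      using arg_cong[OF k(2), of \<phi>] by (simp add: b_def c_def add mult scaleR)
    \<comment> \<open>Left multiplication by \<open>b + s (1 - c)\<close>: the cross terms cancel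
      because \<open>b\<close> and \<open>c\<close> commute and \<open>cnj s = - s\<close>; the rest
      is the transported relation.\<close>
    have iso: "norm (b * x + s *\<^sub>C (x - c * x)) = norm x" if s: "s = \<i> \<or> s = - \<i>" for x s
    proof -
      define r where "r = x - c * x"
      have cs: "cnj s = - s" "s * s = - 1" using s by auto
      have sr: "star r = star x - star x * c" by (simp add: r_def star_diff star_mult c)
      have "star (b * x + s *\<^sub>C r) * (b * x + s *\<^sub>C r)
          = star x * (b * (b * x)) + s *\<^sub>C (star x * (b * r)) - s *\<^sub>C (star r * (b * x)) + star r * r"
        using cs by (simp add: star_add star_mult star_scaleC b scaleC_simps algebra_simps)
      also have "star x * (b * r) = star r * (b * x)"
      proof -
        have "c * (b * z) = b * (c * z)" for z by (simp add: bc flip: mult.assoc)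
        then show ?thesis by (simp add: sr) (simp add: r_def algebra_simps)
      qed
      also have "star x * (b * (b * x)) + s *\<^sub>C (star r * (b * x)) - s *\<^sub>C (star r * (b * x)) + star r * r
          = star x * (b * (b * x)) + star r * r" by simp
      also have "\<dots> = star x * x + star x * ((b * b + c * c - 2 *\<^sub>R c) * x)"
        by (simp add: sr) (simp add: r_def algebra_simps scaleR_2)
      finally have "star (b * x + s *\<^sub>C r) * (b * x + s *\<^sub>C r) = star x * x"
        by (simp add: sq)
      then have "(norm (b * x + s *\<^sub>C r))\<^sup>2 = (norm x)\<^sup>2"
        by (simp flip: cstar_identity)
      then show ?thesis by (simp add: r_def)
    qed
    have "norm (b * x) \<le> norm x" for x
    proof -
      have "2 *\<^sub>R (b * x) = (b * x + \<i> *\<^sub>C (x - c * x)) + (b * x + (-\<i>) *\<^sub>C (x - c * x))"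
        by (simp add: scaleC_minus_left scaleR_2)
      then have "norm (2 *\<^sub>R (b * x)) \<le> norm x + norm x"
        using norm_triangle_ineq iso[of \<i> x] iso[of "-\<i>" x] by metis
      then show ?thesis by simp
    qed
    from this[of b] show ?thesis
      using norm_le_if_square_le[OF b, of 1] by (simp add: b_def)
  qed
  have sa: "norm (\<phi> h) \<le> norm h" if "star h = h" for h
  proof (cases "h = 0")
    case True
    then show ?thesis using scaleR[of 0 h] by simp
  next
    case False
    with unit[of "inverse (norm h) *\<^sub>R h"] that show ?thesis
      by (simp add: star_scaleR scaleR field_simps)
  qed
  \<comment> \<open>The C*-identity reduces a general \<open>a\<close> to the self-adjoint
    \<open>star a * a\<close>.\<close>
  have "(norm (\<phi> a))\<^sup>2 \<le> (norm a)\<^sup>2"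
    using sa[OF star_mult_star, of a] by (simp add: mult star flip: cstar_identity)
  then show ?thesis by (simp add: abs_le_square_iff[symmetric])
qed

section \<open>Resolvents and bounded cutoffs of self-adjoint elements\<close>

text \<open>Both norms squared equal the norm of \<open>star y * (h^2 + s^2) * y\<close>, so the
  Cayley transform is isometric. Everything acts on an element \<open>y\<close> because a unit may
  be absent.\<close>

lemma norm_cayley:
  fixes h :: "'b::cstar_algebra"
  assumes h: "star h = h"
  shows "norm (h * y + (\<i> * complex_of_real s) *\<^sub>C y) = norm (h * y - (\<i> * complex_of_real s) *\<^sub>C y)"
proof -
  have *: "star (h * y + t *\<^sub>C y) * (h * y + t *\<^sub>C y) = star y * (h * (h * y)) - (t * t) *\<^sub>C (star y * y)"
    if "cnj t = - t" for t
    using that by (simp add: star_add star_mult star_scaleC h scaleC_simps algebra_simps)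
  let ?t = "\<i> * complex_of_real s"
  have "star (h * y + ?t *\<^sub>C y) * (h * y + ?t *\<^sub>C y) = star (h * y - ?t *\<^sub>C y) * (h * y - ?t *\<^sub>C y)"
    using *[of ?t] *[of "- ?t"] by (simp add: scaleC_minus_left)
  then have "(norm (h * y + ?t *\<^sub>C y))\<^sup>2 = (norm (h * y - ?t *\<^sub>C y))\<^sup>2"
    by (simp flip: cstar_identity)
  then show ?thesis by simp
qed

text \<open>\<open>2 \<i> s y\<close> is the difference of the two elements of
  \<open>norm_cayley\<close>, which have the same norm.\<close>

lemma norm_resolvent:
  fixes h :: "'b::cstar_algebra"
  assumes "star h = h" "0 \<le> s"
  shows "s * norm y \<le> norm (h * y + (\<i> * complex_of_real s) *\<^sub>C y)"
proof -
  let ?t = "\<i> * complex_of_real s"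
  have "(2 * ?t) *\<^sub>C y = (h * y + ?t *\<^sub>C y) - (h * y - ?t *\<^sub>C y)"
    by (simp only: mult_2 scaleC_add_left) simp
  then have "norm ((2 * ?t) *\<^sub>C y) \<le> norm (h * y + ?t *\<^sub>C y) + norm (h * y - ?t *\<^sub>C y)"
    by (simp only: norm_triangle_ineq4)
  then have "norm ((2 * ?t) *\<^sub>C y) \<le> 2 * norm (h * y + ?t *\<^sub>C y)"
    by (simp only: norm_cayley[OF assms(1), symmetric] mult_2)
  then show ?thesis using assms(2) by (simp add: norm_scaleC norm_mult)
qed

text \<open>Continuation in \<open>s\<close>: the estimate above makes the range of admissible steps independent of \<open>h\<close>.\<close>

lemma resolvent_exists:
  fixes h :: "'b::cstar_algebra"
  assumes h: "star h = h"
  shows "\<exists>y. h * y + \<i> *\<^sub>C y = z"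
proof -
  define P where "P s \<longleftrightarrow> (\<forall>z. \<exists>y. h * y + (\<i> * complex_of_real s) *\<^sub>C y = z)" for s
  \<comment> \<open>For \<open>s\<close> above the norm of \<open>h\<close> the equation is a fixed
    point problem with contraction factor \<open>norm h / s\<close>.\<close>
  have start: "P s" if "norm h < s" for s
    unfolding P_def
  proof
    fix z
    have s: "0 < s" using that norm_ge_zero[of h] by linarith
    define t where "t = \<i> * complex_of_real s"
    have t: "t \<noteq> 0" "cmod t = s" using s by (auto simp: t_def norm_mult)
    have "\<exists>!y. inverse t *\<^sub>C (z - h * y) = y"
    proof (rule banach_fix_type[of "norm h / s"])
      show "\<forall>x y. dist (inverse t *\<^sub>C (z - h * x)) (inverse t *\<^sub>C (z - h * y)) \<le> norm h / s * dist x y"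
      proof (intro allI)
        fix x y
        have "inverse t *\<^sub>C (z - h * x) - inverse t *\<^sub>C (z - h * y) = inverse t *\<^sub>C (h * (y - x))"
          by (simp add: scaleC_diff_right right_diff_distrib)
        then have "dist (inverse t *\<^sub>C (z - h * x)) (inverse t *\<^sub>C (z - h * y)) = norm (h * (y - x)) / s"
          by (simp add: dist_norm norm_scaleC norm_inverse t divide_inverse mult.commute)
        also have "\<dots> \<le> norm h * norm (y - x) / s"
          using s by (intro divide_right_mono norm_mult_ineq) auto
        finally show "dist (inverse t *\<^sub>C (z - h * x)) (inverse t *\<^sub>C (z - h * y)) \<le> norm h / s * dist x y"
          by (simp add: dist_norm norm_minus_commute)
      qed
    qed (use that s in auto)
    then obtain y where "inverse t *\<^sub>C (z - h * y) = y" by blast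
    then have "t *\<^sub>C y = t *\<^sub>C (inverse t *\<^sub>C (z - h * y))" by simp
    then have "t *\<^sub>C y = z - h * y" using t by (simp add: scaleC_scaleC)
    then show "\<exists>y. h * y + (\<i> * complex_of_real s) *\<^sub>C y = z"
      by (intro exI[of _ y]) (simp add: t_def)
  qed
  \<comment> \<open>The solution map \<open>R\<close> at \<open>s\<close> is Lipschitz with constant
    \<open>1 / s\<close>. Solving at \<open>s / 2\<close> amounts to
    \<open>y = R (z + (\<i> s / 2) y)\<close>, with contraction factor \<open>1 / 2\<close> at every
    stage.\<close>
  have step: "P (s / 2)" if P: "P s" and s: "0 < s" for s
    unfolding P_def
  proof
    fix z
    obtain R where R: "\<And>z. h * R z + (\<i> * complex_of_real s) *\<^sub>C R z = z"
      using P unfolding P_def by metis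
    have lip: "norm (R x - R y) \<le> norm (x - y) / s" for x y
    proof -
      have "h * (R x - R y) + (\<i> * complex_of_real s) *\<^sub>C (R x - R y) = x - y"
        using arg_cong2[OF R[of x] R[of y], of minus] by (simp add: algebra_simps scaleC_diff_right)
      from norm_resolvent[OF h, of s "R x - R y", unfolded this] s show ?thesis
        by (simp add: field_simps)
    qed
    let ?u = "\<i> * complex_of_real (s / 2)"
    have "\<exists>!y. R (z + ?u *\<^sub>C y) = y"
    proof (rule banach_fix_type[of "1/2"])
      show "\<forall>x y. dist (R (z + ?u *\<^sub>C x)) (R (z + ?u *\<^sub>C y)) \<le> 1/2 * dist x y"
      proof (intro allI)
        fix x y
        have "dist (R (z + ?u *\<^sub>C x)) (R (z + ?u *\<^sub>C y)) \<le> norm (?u *\<^sub>C (x - y)) / s"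
          using lip[of "z + ?u *\<^sub>C x" "z + ?u *\<^sub>C y"] by (simp add: dist_norm scaleC_diff_right)
        also have "\<dots> = 1/2 * dist x y" using s by (simp add: norm_scaleC norm_mult dist_norm)
        finally show "dist (R (z + ?u *\<^sub>C x)) (R (z + ?u *\<^sub>C y)) \<le> 1/2 * dist x y" .
      qed
    qed auto
    then obtain y where y: "R (z + ?u *\<^sub>C y) = y" by blast
    have "h * y + (\<i> * complex_of_real s) *\<^sub>C y = z + ?u *\<^sub>C y"
      using R[of "z + ?u *\<^sub>C y"] by (simp only: y)
    moreover have "(\<i> * complex_of_real s) *\<^sub>C y = ?u *\<^sub>C y + ?u *\<^sub>C y"
      by (simp flip: scaleC_add_left)
    ultimately have "h * y + ?u *\<^sub>C y = z" by (simp add: add.assoc[symmetric])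
    then show "\<exists>y. h * y + ?u *\<^sub>C y = z" by blast
  qed
  obtain n where "norm h < 2 ^ n" using real_arch_pow[of 2 "norm h"] by auto
  then have "P (2 ^ n)" by (rule start)
  then have "P 1"
  proof (induction n)
    case (Suc n)
    with step[of "2 ^ Suc n"] show ?case by simp
  qed simp
  then show ?thesis unfolding P_def by simp
qed

text \<open>\<open>A = h\<^sup>2 / (1 + h\<^sup>2)\<close>; \<open>2 A - 1\<close> is the real part of the square of a Cayley transform and
  \<open>h - A h = h / (1 + h\<^sup>2)\<close> is half of its imaginary part.\<close>

lemma selfadjoint_cutoff:
  fixes h :: "'b::cstar_algebra"
  assumes h: "star h = h"
  obtains A where "star A = A" "A + h * (h * A) = h * h" "\<And>x. norm (2 *\<^sub>R (A * x) - x) \<le> norm x"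
    "norm A \<le> 1" "norm (h - A * h) \<le> 1/2"
proof -
  \<comment> \<open>The factorisations \<open>(h - \<i>) (h + \<i>)\<close> and
    \<open>(h + \<i>) (h - \<i>)\<close> of \<open>1 + h^2\<close>, applied to
    \<open>y\<close>.\<close>
  have fact: "h * (h * y + \<i> *\<^sub>C y) - \<i> *\<^sub>C (h * y + \<i> *\<^sub>C y) = y + h * (h * y)"
             "h * (h * y - \<i> *\<^sub>C y) + \<i> *\<^sub>C (h * y - \<i> *\<^sub>C y) = y + h * (h * y)" for y
    by (simp_all add: algebra_simps scaleC_mult_right scaleC_add_right scaleC_diff_right scaleC_scaleC scaleC_minus_left)
  have cay: "norm (h * y + \<i> *\<^sub>C y) = norm (h * y - \<i> *\<^sub>C y)" for y
    using norm_cayley[OF h, of y 1] by simp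
  \<comment> \<open>The two factors are inverted in turn; the equation for \<open>h - \<i>\<close>
    is, up to sign, the resolvent equation of \<open>- h\<close>.\<close>
  have ex: "\<exists>y. y + h * (h * y) = z" for z
  proof -
    obtain v where v: "h * v + \<i> *\<^sub>C v = z" using resolvent_exists[OF h] by blast
    obtain y where "(- h) * y + \<i> *\<^sub>C y = - v" using resolvent_exists[of "- h"] h by (auto simp: star_minus)
    then have "h * y - \<i> *\<^sub>C y = v" by (simp add: algebra_simps)
    then show ?thesis using v fact(2)[of y] by auto
  qed
  have lower: "norm y \<le> norm (y + h * (h * y))" for y
  proof -
    have "norm y \<le> norm (h * y + \<i> *\<^sub>C y)" using norm_resolvent[OF h, of 1 y] by simp
    also have "\<dots> \<le> norm (h * (h * y + \<i> *\<^sub>C y) + \<i> *\<^sub>C (h * y + \<i> *\<^sub>C y))"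
      using norm_resolvent[OF h, of 1 "h * y + \<i> *\<^sub>C y"] by simp
    also have "\<dots> = norm (y + h * (h * y))" by (simp add: cay fact)
    finally show ?thesis .
  qed
  have unique: "y = z" if "y + h * (h * y) = z + h * (h * z)" for y z
    using lower[of "y - z"] that by (simp add: algebra_simps)
  have sq: "norm (h * (h * y + \<i> *\<^sub>C y) + \<i> *\<^sub>C (h * y + \<i> *\<^sub>C y)) = norm (y + h * (h * y))"
           "norm (h * (h * y - \<i> *\<^sub>C y) - \<i> *\<^sub>C (h * y - \<i> *\<^sub>C y)) = norm (y + h * (h * y))" for y
    using cay[of "h * y + \<i> *\<^sub>C y"] cay[of "h * y - \<i> *\<^sub>C y"] by (simp_all only: fact)
  \<comment> \<open>Uses \<open>2 (h^2 - 1) = (h + \<i>)^2 + (h - \<i>)^2\<close>. Each square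
    applied to \<open>y\<close> has the norm of \<open>(1 + h^2) y\<close>, since exchanging a
    factor \<open>h + \<i>\<close> for \<open>h - \<i>\<close> keeps norms.\<close>
  have re: "norm (h * (h * y) - y) \<le> norm (y + h * (h * y))" for y
  proof -
    have "2 *\<^sub>R (h * (h * y) - y) = (h * (h * y + \<i> *\<^sub>C y) + \<i> *\<^sub>C (h * y + \<i> *\<^sub>C y))
        + (h * (h * y - \<i> *\<^sub>C y) - \<i> *\<^sub>C (h * y - \<i> *\<^sub>C y))"
      by (simp add: algebra_simps scaleC_mult_right scaleC_add_right scaleC_diff_right scaleC_scaleC
          scaleC_minus_left scaleR_2)
    then have "norm (2 *\<^sub>R (h * (h * y) - y)) \<le> 2 * norm (y + h * (h * y))"
      using norm_triangle_ineq sq[of y] by (metis mult_2)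
    then show ?thesis by simp
  qed
  \<comment> \<open>Uses \<open>4 \<i> h = (h + \<i>)^2 - (h - \<i>)^2\<close>.\<close>
  have im: "norm (h * y) \<le> 1/2 * norm (y + h * (h * y))" for y
  proof -
    have "(4 * \<i>) *\<^sub>C (h * y) = (h * (h * y + \<i> *\<^sub>C y) + \<i> *\<^sub>C (h * y + \<i> *\<^sub>C y))
        - (h * (h * y - \<i> *\<^sub>C y) - \<i> *\<^sub>C (h * y - \<i> *\<^sub>C y))"
    proof -
      have "(4 * \<i>) *\<^sub>C (h * y) = \<i> *\<^sub>C (h * y) + \<i> *\<^sub>C (h * y) + (\<i> *\<^sub>C (h * y) + \<i> *\<^sub>C (h * y))"
        by (simp flip: scaleC_add_left)
      then show ?thesis
        by (simp add: algebra_simps scaleC_mult_right scaleC_add_right scaleC_diff_right scaleC_scaleC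
          scaleC_minus_left)
    qed
    then have "norm ((4 * \<i>) *\<^sub>C (h * y)) \<le> 2 * norm (y + h * (h * y))"
      using norm_triangle_ineq4 sq[of y] by (metis mult_2)
    then show ?thesis by (simp add: norm_scaleC norm_mult)
  qed
  obtain A where A: "A + h * (h * A) = h * h" using ex by blast
  \<comment> \<open>\<open>A\<close> is the unique solution of its equation, so commutation with
    \<open>h\<close>, and then self-adjointness, follow by checking that both candidates solve the
    same equation.\<close>
  have comm: "h * A = A * h"
  proof (rule unique)
    have "h * A + h * (h * (h * A)) = h * (h * h)" using arg_cong[OF A, of "\<lambda>x. h * x"] by (simp add: distrib_left)
    moreover have "A * h + h * (h * (A * h)) = h * h * h"
      using arg_cong[OF A, of "\<lambda>x. x * h"] by (simp add: distrib_right mult.assoc)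
    ultimately show "h * A + h * (h * (h * A)) = A * h + h * (h * (A * h))" by (simp add: mult.assoc)
  qed
  have sA: "star A = A"
  proof (rule unique)
    have c: "star A * h = h * star A" using arg_cong[OF comm, of star] by (simp add: star_mult h)
    have "star A + star A * h * h = h * h"
      using arg_cong[OF A, of star] by (simp add: star_mult star_add h)
    moreover have "h * (h * star A) = star A * h * h" by (metis c mult.assoc)
    ultimately show "star A + h * (h * star A) = A + h * (h * A)" by (simp add: A)
  qed
  have Ax: "A * (y + h * (h * y)) = h * (h * y)" for y
  proof -
    have "A * (y + h * (h * y)) = (A + h * (h * A)) * y" by (simp add: comm algebra_simps) (simp add: comm flip: mult.assoc)
    then show ?thesis by (simp add: A mult.assoc)
  qed
  have contr: "norm (2 *\<^sub>R (A * x) - x) \<le> norm x" for x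
  proof -
    obtain y where y: "x = y + h * (h * y)" using ex by metis
    have eq: "2 *\<^sub>R (A * x) - x = h * (h * y) - y" unfolding y Ax by (simp add: scaleR_2)
    show ?thesis using re[of y] unfolding eq by (simp add: y)
  qed
  \<comment> \<open>The contraction \<open>2 A - 1\<close> applied to \<open>A\<close> itself bounds
    \<open>A * A\<close>, and for self-adjoint \<open>A\<close> this bounds
    \<open>A\<close>.\<close>
  have "norm (A * A) \<le> 1 * norm A"
  proof -
    have "2 *\<^sub>R (A * A) = (2 *\<^sub>R (A * A) - A) + A" by simp
    then have "norm (2 *\<^sub>R (A * A)) \<le> norm A + norm A"
      using norm_triangle_ineq[of "2 *\<^sub>R (A * A) - A" A] contr[of A] by simp
    then show ?thesis by simp
  qed
  then have nA: "norm A \<le> 1" by (rule norm_le_if_square_le[OF sA]) simp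
  define q where "q = h - A * h"
  have sq: "star q = q" by (simp add: q_def star_diff star_mult h sA comm)
  have "norm (q * x) \<le> 1/2 * norm x" for x
  proof -
    obtain y where y: "x = y + h * (h * y)" using ex by metis
    have "q * x = h * (x - A * x)" by (simp add: q_def algebra_simps) (simp add: comm flip: mult.assoc)
    also have "x - A * x = y" unfolding y Ax by simp
    finally show ?thesis using im[of y] by (simp add: y)
  qed
  then have "norm q \<le> 1/2" by (intro norm_le_if_square_le[OF sq]) auto
  with sA A contr nA that show thesis by (simp add: q_def)
qed

text \<open>Applied to \<open>h / e\<close>, the cutoff leaves a remainder \<open>h - A h\<close> of
  norm at most \<open>e / 2\<close>. Self-adjoint elements are thus limits of products, and
  identities known on products extend to the whole algebra.\<close>

lemma selfadjoint_approx_product: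
  fixes h :: "'b::cstar_algebra"
  assumes h: "star h = h" and e: "0 < e"
  obtains A where "star A = A" "norm A \<le> 1" "norm (h - A * h) < e"
proof -
  define r where "r = 1 / e"
  have r: "0 < r" using e by (simp add: r_def)
  obtain A where A: "star A = A" "norm A \<le> 1" "norm (r *\<^sub>R h - A * (r *\<^sub>R h)) \<le> 1/2"
    using selfadjoint_cutoff[of "r *\<^sub>R h"] h by (auto simp: star_scaleR)
  have "r *\<^sub>R h - A * (r *\<^sub>R h) = r *\<^sub>R (h - A * h)" by (simp add: scaleR_diff_right)
  then have "r * norm (h - A * h) \<le> 1/2" using A(3) r by (metis norm_scaleR abs_of_pos)
  then have "norm (h - A * h) \<le> (1/2) * e" using r by (simp add: r_def field_simps)
  then have "norm (h - A * h) < e" using e by simp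
  with A that show thesis by blast
qed

section \<open>Representations\<close>

locale star_representation =
  fixes \<pi> :: "'b::cstar_algebra \<Rightarrow> ('h::complex_hilbert \<Rightarrow>\<^sub>L 'h)"
  assumes rep: "representation \<pi>"
begin

lemma apply_scaleC: "\<pi> A (c *\<^sub>C x) = c *\<^sub>C \<pi> A x"
  using rep by (simp add: representation_def complex_linear_def)

lemma add: "\<pi> (A + B) = \<pi> A + \<pi> B"
  using rep by (simp add: representation_def)

lemma scaleC: "\<pi> (c *\<^sub>C A) x = c *\<^sub>C \<pi> A x"
  using rep by (simp add: representation_def)

lemma mult: "\<pi> (A * B) = \<pi> A o\<^sub>L \<pi> B"
  using rep by (simp add: representation_def)

lemma mult_apply: "\<pi> (A * B) x = \<pi> A (\<pi> B x)"
  by (simp add: mult)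

lemma cinner_star: "cinner (\<pi> (star A) x) y = cinner x (\<pi> A y)"
  using rep by (simp add: representation_def)

lemma cinner_star': "cinner (\<pi> A x) y = cinner x (\<pi> (star A) y)"
  using cinner_star[of "star A"] by (simp add: star_star)

lemma nonzero: "\<exists>A. \<pi> A \<noteq> 0"
  using rep by (simp add: representation_def)

lemma scaleR: "\<pi> (r *\<^sub>R A) = r *\<^sub>R \<pi> A"
  by (rule blinfun_eqI) (simp add: scaleC_of_real[symmetric] scaleC blinfun.scaleR_left)

lemma zero [simp]: "\<pi> 0 = 0"
  using scaleR[of 0 0] by simp

lemma minus: "\<pi> (- A) = - \<pi> A"
  using scaleR[of "-1" A] by simp

lemma diff: "\<pi> (A - B) = \<pi> A - \<pi> B"
  using add[of A "- B"] by (simp add: minus)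

text \<open>For \<open>norm a = 1\<close> let \<open>1 - k\<close> be the formal square root of
  \<open>1 - star a * a\<close>. Then
  \<open>(norm (x - \<pi> k x))^2 = (norm x)^2 - (norm (\<pi> a x))^2\<close>, and the left side is
  nonnegative.\<close>

lemma norm_apply_le: "norm (\<pi> A x) \<le> norm A * norm x"
proof (cases "A = 0")
  case False
  define a where "a = inverse (norm A) *\<^sub>R A"
  have na: "norm (star a * a) \<le> 1" using False unfolding cstar_identity by (simp add: a_def)
  obtain k where k: "k \<in> {k. star k = k}" "star a * a + k * k = 2 *\<^sub>R k"
  proof (rule square_root_series[OF bounded_bilinear_mult norm_mult_ineq na])
    show "closed {k. star k = (k::'b)}"
      by (intro closed_Collect_eq continuous_intros linear_continuous_on[OF bounded_linear_star])
  qed (auto simp: star_scaleR star_add star_mult star_star)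
  have "(norm (x - \<pi> k x))\<^sup>2 = (norm x)\<^sup>2 - Re (cinner x (\<pi> (2 *\<^sub>R k) x)) + Re (cinner x (\<pi> (k * k) x))"
    using k(1) cinner_star'[of k x "\<pi> k x"]
    by (simp add: norm_diff_sq norm_sq_cinner[of "\<pi> k x"] scaleR mult_apply blinfun.scaleR_left cinner_simps)
  also have "\<dots> = (norm x)\<^sup>2 - Re (cinner x (\<pi> (star a * a) x))"
    unfolding k(2)[symmetric] by (simp add: add blinfun.add_left cinner_simps)
  also have "Re (cinner x (\<pi> (star a * a) x)) = (norm (\<pi> a x))\<^sup>2"
    by (simp add: norm_sq_cinner mult_apply cinner_star')
  finally have "(norm (\<pi> a x))\<^sup>2 \<le> (norm x)\<^sup>2" by (metis diff_ge_0_iff_ge zero_le_power2)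
  then have "norm (\<pi> a x) \<le> norm x" by (simp add: abs_le_square_iff[symmetric])
  then show ?thesis using False by (simp add: a_def scaleR blinfun.scaleR_left field_simps)
qed simp

lemma norm_le: "norm (\<pi> A) \<le> norm A"
  by (rule norm_blinfun_bound) (simp_all add: norm_apply_le)

lemma bounded_linear_rep: "bounded_linear \<pi>"
  by (rule bounded_linear_intro[of _ 1]) (simp_all add: add scaleR norm_le)

lemma vector_state_apply: "vector_state \<pi> \<Omega> B = cinner \<Omega> (\<pi> B \<Omega>)"
proof -
  have "bounded_linear (\<lambda>B. cinner \<Omega> (\<pi> B \<Omega>))"
  proof (rule bounded_linear_intro[of _ "(norm \<Omega>)\<^sup>2"])
    show "norm (cinner \<Omega> (\<pi> B \<Omega>)) \<le> norm B * (norm \<Omega>)\<^sup>2" for B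
      using norm_cinner[of \<Omega> "\<pi> B \<Omega>"] mult_left_mono[OF norm_apply_le[of B \<Omega>] norm_ge_zero[of \<Omega>]]
      by (simp add: power2_eq_square algebra_simps)
  qed (simp_all add: add scaleR cinner_simps blinfun.add_left blinfun.scaleR_left scaleR_conv_of_real)
  then show ?thesis by (simp add: vector_state_def bounded_linear_Blinfun_apply)
qed

end

section \<open>Irreducible representations\<close>

lemma dense_induct:
  assumes "closure S = UNIV" "closed {x. P x}" "\<And>x. x \<in> S \<Longrightarrow> P x"
  shows "P x"
proof -
  have "closure S \<subseteq> {x. P x}" using assms by (intro closure_minimal) auto
  then show ?thesis using assms(1) by auto
qed

lemma continuous_on_cinner [continuous_intros]:
  fixes f g :: "'a::topological_space \<Rightarrow> 'h::complex_hilbert"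
  shows "continuous_on S f \<Longrightarrow> continuous_on S g \<Longrightarrow> continuous_on S (\<lambda>x. cinner (f x) (g x))"
  by (rule bounded_bilinear.continuous_on[OF bounded_bilinear_cinner])

lemma continuous_on_scaleC [continuous_intros]:
  fixes f :: "'a::topological_space \<Rightarrow> 'h::complex_banach"
  shows "continuous_on S c \<Longrightarrow> continuous_on S f \<Longrightarrow> continuous_on S (\<lambda>x. c x *\<^sub>C f x)"
  by (rule bounded_bilinear.continuous_on[OF bounded_bilinear_scaleC])

lemma closed_complex_linear: "closed {T :: 'a::complex_banach \<Rightarrow>\<^sub>L 'b::complex_banach. complex_linear T}"
  unfolding complex_linear_def
  by (intro closed_Collect_all closed_Collect_eq continuous_intros)

lemma complex_linear_id: "complex_linear id_blinfun"
  by (simp add: complex_linear_def)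

lemma complex_linear_compose: "complex_linear S \<Longrightarrow> complex_linear T \<Longrightarrow> complex_linear (S o\<^sub>L T)"
  by (simp add: complex_linear_def)

lemma complex_linear_add: "complex_linear S \<Longrightarrow> complex_linear T \<Longrightarrow> complex_linear (S + T)"
  by (simp add: complex_linear_def blinfun.add_left scaleC_add_right)

lemma complex_linear_diff: "complex_linear S \<Longrightarrow> complex_linear T \<Longrightarrow> complex_linear (S - T)"
  by (simp add: complex_linear_def blinfun.diff_left scaleC_diff_right)

lemma complex_linear_scaleR: "complex_linear S \<Longrightarrow> complex_linear (r *\<^sub>R S)"
  by (simp add: complex_linear_def blinfun.scaleR_left scaleC_scaleR)

lemma isometry_cinner:
  fixes V :: "'h::complex_hilbert \<Rightarrow>\<^sub>L 'h"
  assumes "complex_linear V" "\<And>x. norm (V x) = norm x"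
  shows "cinner (V x) (V y) = cinner x y"
proof -
  have re: "Re (cinner (V x) (V y)) = Re (cinner x y)" for x y
    using norm_add_sq[of "V x" "V y"] norm_add_sq[of x y]
    by (simp add: assms(2) flip: blinfun.add_right)
  have "Im (cinner (V x) (V y)) = Im (cinner x y)"
    using re[of x "\<i> *\<^sub>C y"] assms(1) by (simp add: complex_linear_def cinner_simps)
  with re show ?thesis by (simp add: complex_eq_iff)
qed

lemma symmetric_semidefinite_form:
  fixes T :: "'h::complex_hilbert \<Rightarrow>\<^sub>L 'h"
  assumes "complex_linear T" "\<And>x y. cinner (T x) y = cinner x (T y)" "\<And>x. 0 \<le> Re (cinner x (T x))"
  shows "semidefinite_form (\<lambda>x y. cinner x (T y))"
proof
  show "cinner x (T y) = cnj (cinner y (T x))" for x y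
    using assms(2)[of x y] cinner_commute[of "T x" y] by simp
qed (use assms in \<open>auto simp: complex_linear_def cinner_simps blinfun.add_right\<close>)

locale irreducible_star_representation = star_representation +
  assumes irreducible: "closed_complex_subspace S \<Longrightarrow> (\<And>A x. x \<in> S \<Longrightarrow> \<pi> A x \<in> S) \<Longrightarrow> S = {0} \<or> S = UNIV"
begin

text \<open>The common kernel of all \<open>\<pi> B\<close> is closed and invariant, and it is not
  the whole space since some \<open>\<pi> A\<close> is nonzero. This is nondegeneracy of the
  representation.\<close>

lemma null_vector_eq_zero:
  assumes "\<And>B. \<pi> B x = 0"
  shows "x = 0"
proof -
  have "closed {y. \<forall>B. \<pi> B y = 0}"
    by (intro closed_Collect_all closed_Collect_eq continuous_intros)
  then have "closed_complex_subspace {y. \<forall>B. \<pi> B y = 0}"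
    by (auto simp: closed_complex_subspace_def blinfun.add_right apply_scaleC)
  then have "{y. \<forall>B. \<pi> B y = 0} = {0} \<or> {y. \<forall>B. \<pi> B y = 0} = UNIV"
    by (rule irreducible) auto
  moreover obtain A where "\<pi> A \<noteq> 0" using nonzero by blast
  then have "\<exists>y. \<pi> A y \<noteq> 0" using blinfun_eqI[of "\<pi> A" 0] by auto
  ultimately show ?thesis using assms by auto
qed

lemma apply_eqI:
  assumes "\<And>B. \<pi> B x = \<pi> B y"
  shows "x = y"
  using null_vector_eq_zero[of "x - y"] assms by (simp add: blinfun.diff_right)

text \<open>The closure of the orbit is invariant, and it is nonzero because no nonzero vector is
  annihilated by every \<open>\<pi> B\<close>. Without a unit, \<open>x\<close> need not itself lie
  in the orbit.\<close>

lemma cyclic: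
  assumes "x \<noteq> 0"
  shows "closure (range (\<lambda>B. \<pi> B x)) = UNIV"
proof -
  let ?R = "range (\<lambda>B. \<pi> B x)"
  have seq: "\<exists>f. (\<lambda>n. \<pi> (f n) x) \<longlonglongrightarrow> y" if y: "y \<in> closure ?R" for y
  proof -
    obtain z where z: "\<And>n. z n \<in> ?R" "z \<longlonglongrightarrow> y" using y unfolding closure_sequential by blast
    have "\<forall>n. \<exists>B. z n = \<pi> B x" using z(1) by (auto simp: image_iff)
    then obtain f where "\<forall>n. z n = \<pi> (f n) x" by (rule choice[THEN exE])
    then have "z = (\<lambda>n. \<pi> (f n) x)" by auto
    with z(2) show ?thesis by auto
  qed
  have memI: "y \<in> closure ?R" if "(\<lambda>n. \<pi> (f n) x) \<longlonglongrightarrow> y" for f y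
    unfolding closure_sequential using that by (intro exI[of _ "\<lambda>n. \<pi> (f n) x"]) auto
  have "closed_complex_subspace (closure ?R)"
    unfolding closed_complex_subspace_def
  proof (intro conjI ballI allI)
    show "0 \<in> closure ?R" using memI[of "\<lambda>_. 0" 0] by simp
    show "y + z \<in> closure ?R" if y: "y \<in> closure ?R" and z: "z \<in> closure ?R" for y z
    proof -
      obtain f g where f: "(\<lambda>n. \<pi> (f n) x) \<longlonglongrightarrow> y" and g: "(\<lambda>n. \<pi> (g n) x) \<longlonglongrightarrow> z"
        using seq y z by meson
      have "(\<lambda>n. \<pi> (f n + g n) x) \<longlonglongrightarrow> y + z"
        using tendsto_add[OF f g] by (simp add: add blinfun.add_left)
      then show ?thesis by (rule memI)
    qed
    show "c *\<^sub>C y \<in> closure ?R" if y: "y \<in> closure ?R" for c y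
    proof -
      obtain f where f: "(\<lambda>n. \<pi> (f n) x) \<longlonglongrightarrow> y" using seq y by meson
      have "(\<lambda>n. \<pi> (c *\<^sub>C f n) x) \<longlonglongrightarrow> c *\<^sub>C y"
        using bounded_bilinear.tendsto[OF bounded_bilinear_scaleC tendsto_const f] by (simp add: scaleC)
      then show ?thesis by (rule memI)
    qed
  qed auto
  moreover have "\<pi> A y \<in> closure ?R" if y: "y \<in> closure ?R" for A y
  proof -
    obtain f where f: "(\<lambda>n. \<pi> (f n) x) \<longlonglongrightarrow> y" using seq y by meson
    have "(\<lambda>n. \<pi> (A * f n) x) \<longlonglongrightarrow> \<pi> A y"
      using blinfun.tendsto[OF tendsto_const f] by (simp add: mult)
    then show ?thesis by (rule memI)
  qed
  ultimately have "closure ?R = {0} \<or> closure ?R = UNIV" by (rule irreducible)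
  moreover have "closure ?R \<noteq> {0}"
  proof
    assume "closure ?R = {0}"
    then have "\<pi> B x = 0" for B using closure_subset[of ?R] by auto
    then show False using null_vector_eq_zero assms by blast
  qed
  ultimately show ?thesis by blast
qed

lemma cyclic_approx:
  assumes "x \<noteq> 0" "0 < e"
  obtains B where "norm (\<pi> B x - y) < e"
proof -
  have "y \<in> closure (range (\<lambda>B. \<pi> B x))" using cyclic[OF assms(1)] by simp
  then show thesis using assms(2) that by (auto simp: closure_approachable dist_norm)
qed

text \<open>Functional calculus enters only through \<open>R = \<bar>T - t\<bar>\<close>: the range of \<open>R + (T - t)\<close> is
  contained in the invariant subspace \<open>ker (R - (T - t))\<close>.\<close>

lemma commutant_dichotomy:
  assumes lin: "complex_linear T" and sym: "\<And>x y. cinner (T x) y = cinner x (T y)"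
    and comm: "\<And>A x. T (\<pi> A x) = \<pi> A (T x)"
  shows "(\<forall>x. t * (norm x)\<^sup>2 \<le> Re (cinner x (T x))) \<or> (\<forall>x. Re (cinner x (T x)) \<le> t * (norm x)\<^sup>2)"
proof -
  \<comment> \<open>Scales \<open>T - t\<close> to norm at most \<open>1\<close>; the added
    \<open>1\<close> keeps the denominator positive when \<open>T\<close> equals
    \<open>t\<close>.\<close>
  define s where "s = 1 / (norm (T - t *\<^sub>R id_blinfun) + 1)"
  have s: "0 < s" by (simp add: s_def add_nonneg_pos)
  define A where "A = s *\<^sub>R (T - t *\<^sub>R id_blinfun)"
  have A_apply: "A x = s *\<^sub>R (T x - t *\<^sub>R x)" for x
    by (simp add: A_def blinfun.scaleR_left blinfun.diff_left)
  have nA: "norm A \<le> 1"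
    by (simp add: A_def s_def divide_le_eq add_nonneg_pos)
  have Alin: "complex_linear A"
    unfolding A_def using lin by (intro complex_linear_scaleR complex_linear_diff complex_linear_id)
  have Asym: "cinner (A x) y = cinner x (A y)" for x y
    by (simp add: A_apply cinner_simps sym)
  have Acomm: "A (\<pi> B x) = \<pi> B (A x)" for B x
    by (simp add: A_apply comm blinfun.diff_right blinfun.scaleR_right)
  define h where "h = id_blinfun - (A o\<^sub>L A)"
  have h_apply: "h x = x - A (A x)" for x by (simp add: h_def blinfun.diff_left)
  have hform: "Re (cinner x (h x)) = (norm x)\<^sup>2 - (norm (A x))\<^sup>2" for x
    by (simp add: h_apply cinner_simps norm_sq_cinner Asym)
  have Ax: "norm (A x) \<le> norm x" for x
    using norm_blinfun[of A x] nA mult_right_mono[OF nA norm_ge_zero[of x]] by simp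
  interpret h: semidefinite_form "\<lambda>x y. cinner x (h y)"
  proof (rule symmetric_semidefinite_form)
    show "complex_linear h"
      unfolding h_def using Alin by (intro complex_linear_diff complex_linear_compose complex_linear_id)
    show "cinner (h x) y = cinner x (h y)" for x y by (simp add: h_apply cinner_simps Asym)
    show "0 \<le> Re (cinner x (h x))" for x unfolding hform using Ax[of x] by (simp add: power_mono)
  qed
  \<comment> \<open>Here \<open>h = 1 - A^2\<close>. From \<open>0 \<le> h \<le> 1\<close> as forms,
    Cauchy-Schwarz for the form of \<open>h\<close> at \<open>h y\<close> and \<open>y\<close> gives
    the operator bound.\<close>
  have "norm (h y) \<le> norm y" for y
  proof (cases "h y = 0")
    case False
    have "((norm (h y))\<^sup>2)\<^sup>2 \<le> Re (cinner (h y) (h (h y))) * Re (cinner y (h y))"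
      using h.cauchy_schwarz[of "h y" y] by (simp add: cinner_self norm_power)
    also have "\<dots> \<le> (norm (h y))\<^sup>2 * (norm y)\<^sup>2"
      using h.nonneg by (intro mult_mono) (auto simp: hform)
    finally have "(norm (h y))\<^sup>2 \<le> (norm y)\<^sup>2" using False by (simp add: power2_eq_square)
    then show ?thesis by (simp add: abs_le_square_iff[symmetric])
  qed simp
  then have nh: "norm h \<le> 1" by (intro norm_blinfun_bound) auto
  let ?S = "{k :: 'b \<Rightarrow>\<^sub>L 'b. complex_linear k} \<inter> {k :: 'b \<Rightarrow>\<^sub>L 'b. (\<forall>x y. cinner (k x) y = cinner x (k y)) \<and> (\<forall>x. k (A x) = A (k x))
      \<and> (\<forall>B x. k (\<pi> B x) = \<pi> B (k x))}"
  obtain k where k: "k \<in> ?S" "norm k \<le> 1" "h + (k o\<^sub>L k) = 2 *\<^sub>R k"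
  proof (rule square_root_series[OF bounded_bilinear_blinfun_compose norm_blinfun_compose nh])
    show "closed ?S"
      by (intro closed_Int closed_complex_linear closed_Collect_all closed_Collect_conj closed_Collect_eq continuous_intros)
    show "0 \<in> ?S" by (simp add: complex_linear_def)
    fix k assume k: "k \<in> ?S"
    have "complex_linear ((1/2) *\<^sub>R (h + (k o\<^sub>L k)))"
      unfolding h_def using k Alin
      by (intro complex_linear_scaleR complex_linear_add complex_linear_diff complex_linear_compose complex_linear_id) auto
    then show "(1/2) *\<^sub>R (h + (k o\<^sub>L k)) \<in> ?S"
      using k by (simp add: blinfun.scaleR_left blinfun.add_left h_apply cinner_simps Asym Acomm
          blinfun.diff_right blinfun.add_right blinfun.scaleR_right)
  qed
  \<comment> \<open>\<open>R\<close> is a nonnegative root of \<open>A^2\<close> that commutes with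
    \<open>A\<close> and with the representation, that is, the absolute value of
    \<open>A\<close>.\<close>
  define R where "R = id_blinfun - k"
  have R_apply: "R x = x - k x" for x by (simp add: R_def blinfun.diff_left)
  have RR: "R (R x) = A (A x)" for x
    using arg_cong[OF k(3), of "\<lambda>f. f x"]
    by (simp add: R_apply h_apply blinfun.add_left blinfun.scaleR_left blinfun.diff_right scaleR_2 algebra_simps)
  have RA: "R (A x) = A (R x)" for x using k(1) by (simp add: R_apply blinfun.diff_right)
  have Rlin: "complex_linear R" using k(1) by (auto simp: R_def intro: complex_linear_diff complex_linear_id)
  have Rpos: "0 \<le> Re (cinner x (R x))" for x
  proof -
    have "Re (cinner x (k x)) \<le> norm x * norm (k x)"
      using norm_cinner[of x "k x"] complex_Re_le_cmod order_trans by blast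
    also have "\<dots> \<le> norm x * (1 * norm x)"
      using norm_blinfun[of k x] k(2) by (intro mult_left_mono order_trans[OF norm_blinfun] mult_right_mono) auto
    finally show ?thesis by (simp add: R_apply cinner_simps cinner_self power2_eq_square)
  qed
  have "closed {x. R x = A x}" by (intro closed_Collect_eq continuous_intros)
  then have "closed_complex_subspace {x. R x = A x}"
    using Rlin Alin by (auto simp: closed_complex_subspace_def complex_linear_def blinfun.add_right)
  then have "{x. R x = A x} = {0} \<or> {x. R x = A x} = UNIV"
    by (rule irreducible) (use k(1) in \<open>auto simp: R_apply Acomm blinfun.diff_right[symmetric]\<close>)
  then have "(\<forall>x. 0 \<le> Re (cinner x (A x))) \<or> (\<forall>x. Re (cinner x (A x)) \<le> 0)"
  proof
    assume *: "{x. R x = A x} = {0}"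
    have "R x + A x \<in> {x. R x = A x}" for x by (simp add: blinfun.add_right RR RA)
    then have "A x = - R x" for x unfolding * by (simp add: eq_neg_iff_add_eq_0 add.commute)
    then show ?thesis using Rpos by (simp add: cinner_simps)
  next
    assume "{x. R x = A x} = UNIV"
    then have "R x = A x" for x by auto
    then show ?thesis using Rpos by metis
  qed
  moreover have "Re (cinner x (A x)) = s * (Re (cinner x (T x)) - t * (norm x)\<^sup>2)" for x
    by (simp add: A_apply cinner_simps cinner_self)
  ultimately show ?thesis using s by (simp add: zero_le_mult_iff mult_le_0_iff)
qed

lemma exists_nonzero_vector: "\<exists>x::'b. x \<noteq> 0"
proof -
  obtain A where "\<pi> A \<noteq> 0" using nonzero by blast
  then have "\<exists>y. \<pi> A y \<noteq> 0" using blinfun_eqI[of "\<pi> A" 0] by auto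
  then show ?thesis by (metis blinfun.zero_right)
qed

text \<open>With \<open>t\<close> the supremum of the lower bounds of the form of \<open>T\<close>,
  every larger number fails to be a lower bound and is therefore, by the dichotomy, an upper bound.
  So the form of \<open>T - t\<close> vanishes.\<close>

lemma schur:
  assumes lin: "complex_linear T" and sym: "\<And>x y. cinner (T x) y = cinner x (T y)"
    and comm: "\<And>A x. T (\<pi> A x) = \<pi> A (T x)"
  obtains t where "\<And>x. T x = t *\<^sub>R x"
proof -
  obtain x0 :: 'b where x0: "x0 \<noteq> 0" using exists_nonzero_vector by blast
  define L where "L = {t. \<forall>x. t * (norm x)\<^sup>2 \<le> Re (cinner x (T x))}"
  have low: "\<bar>Re (cinner x (T x))\<bar> \<le> norm T * (norm x)\<^sup>2" for x
  proof -
    have "\<bar>Re (cinner x (T x))\<bar> \<le> norm x * norm (T x)"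
      using norm_cinner[of x "T x"] abs_Re_le_cmod order_trans by blast
    also have "\<dots> \<le> norm x * (norm T * norm x)" by (intro mult_left_mono norm_blinfun) auto
    finally show ?thesis by (simp add: power2_eq_square algebra_simps)
  qed
  have Lne: "- norm T \<in> L" unfolding L_def using low by (auto simp: abs_le_iff minus_le_iff)
  have bdd: "bdd_above L"
  proof (rule bdd_aboveI[of _ "norm T"])
    fix t assume "t \<in> L"
    then have "t * (norm x0)\<^sup>2 \<le> norm T * (norm x0)\<^sup>2"
      unfolding L_def using low[of x0] by (auto simp: abs_le_iff intro: order_trans)
    then show "t \<le> norm T" using x0 by simp
  qed
  define t where "t = Sup L"
  have form: "Re (cinner x (T x)) = t * (norm x)\<^sup>2" for x
  proof (rule antisym)
    have "Re (cinner x (T x)) \<le> t * (norm x)\<^sup>2 + e" if e: "0 < e" for e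
    proof -
      define d where "d = e / ((norm x)\<^sup>2 + 1)"
      have p: "0 < (norm x)\<^sup>2 + 1" by (simp add: add_nonneg_pos)
      have d: "0 < d" "d * (norm x)\<^sup>2 \<le> e"
        using e p mult_nonneg_nonneg[of e "(norm x)\<^sup>2"] by (auto simp: d_def divide_le_eq algebra_simps)
      have "t + d \<notin> L" using cSup_upper[OF _ bdd, of "t + d"] d(1) by (auto simp: t_def)
      then have "Re (cinner x (T x)) \<le> (t + d) * (norm x)\<^sup>2"
        using commutant_dichotomy[OF assms, of "t + d"] unfolding L_def by blast
      then show ?thesis using d by (simp add: algebra_simps)
    qed
    then show "Re (cinner x (T x)) \<le> t * (norm x)\<^sup>2" by (rule field_le_epsilon)
    show "t * (norm x)\<^sup>2 \<le> Re (cinner x (T x))"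
    proof (cases "x = 0")
      case False
      have "t \<le> Re (cinner x (T x)) / (norm x)\<^sup>2"
        unfolding t_def
      proof (rule cSup_least)
        show "L \<noteq> {}" using Lne by blast
      qed (use False in \<open>auto simp: L_def le_divide_eq\<close>)
      then show ?thesis using False by (simp add: le_divide_eq)
    qed simp
  qed
  define D where "D = T - t *\<^sub>R id_blinfun"
  have D_apply: "D x = T x - t *\<^sub>R x" for x by (simp add: D_def blinfun.diff_left blinfun.scaleR_left)
  have D0: "Re (cinner x (D x)) = 0" for x
    by (simp add: D_apply cinner_simps form cinner_self)
  interpret D: semidefinite_form "\<lambda>x y. cinner x (D y)"
  proof (rule symmetric_semidefinite_form)
    show "complex_linear D" unfolding D_def using lin
      by (intro complex_linear_diff complex_linear_scaleR complex_linear_id)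
  qed (simp_all add: D0, simp add: D_apply cinner_simps sym)
  \<comment> \<open>A semidefinite form with zero diagonal vanishes by Cauchy-Schwarz, here at the
    pair \<open>D x\<close>, \<open>x\<close>.\<close>
  have "D x = 0" for x
    using D.cauchy_schwarz[of "D x" x] by (simp add: D0)
  then show thesis using that[of t] by (simp add: D_apply)
qed

lemma linear_apply: "linear (\<lambda>B. \<pi> B x)"
  by (rule linearI) (simp_all add: add scaleR blinfun.add_left blinfun.scaleR_left)

section \<open>Invariant forms, proportional vectors and intertwining unitaries\<close>

text \<open>Radon-Nikodym argument: a form dominated by that of \<open>\<Psi>\<close> is given by a
  bounded operator \<open>T\<close> on the dense orbit of \<open>\<Psi>\<close>, invariance puts
  \<open>T\<close> into the commutant, and Schur's lemma makes it a scalar.\<close>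

lemma invariant_form_proportional:
  assumes "semidefinite_form q"
    and inv: "\<And>A B C. q (A * B) C = q B (star A * C)"
    and bound: "\<And>C. Re (q C C) \<le> M * (norm (\<pi> C \<Psi>))\<^sup>2"
    and \<Psi>: "\<Psi> \<noteq> 0"
  obtains t where "0 \<le> t" "\<And>B C. q B C = complex_of_real t * cinner (\<pi> B \<Psi>) (\<pi> C \<Psi>)"
proof -
  interpret q: semidefinite_form q by fact
  define f where "f B = \<pi> B \<Psi>" for B
  have dense: "closure (range f) = UNIV" using cyclic[OF \<Psi>] by (simp add: f_def[abs_def])
  have linf: "linear f" unfolding f_def[abs_def] by (rule linear_apply)
  have f_scaleC: "f (c *\<^sub>C B) = c *\<^sub>C f B" for c B by (simp add: f_def scaleC)
  \<comment> \<open>\<open>M\<close> comes without a sign; its absolute value keeps products of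
    bounds monotone.\<close>
  define N where "N = \<bar>M\<bar>"
  have "Re (q C C) \<le> N * (norm (f C))\<^sup>2" for C
    by (rule order_trans[OF bound]) (auto simp: N_def f_def intro: mult_right_mono)
  then have cs: "cmod (q B C) \<le> N * norm (f B) * norm (f C)" for B C
  proof -
    have "(cmod (q B C))\<^sup>2 \<le> Re (q B B) * Re (q C C)" by (rule q.cauchy_schwarz)
    also have "\<dots> \<le> (N * (norm (f B))\<^sup>2) * (N * (norm (f C))\<^sup>2)"
      using q.nonneg \<open>\<And>C. Re (q C C) \<le> N * (norm (f C))\<^sup>2\<close> by (intro mult_mono) (auto simp: N_def)
    also have "\<dots> = (N * norm (f B) * norm (f C))\<^sup>2" by (simp add: power2_eq_square algebra_simps)
    finally show ?thesis by (rule power2_le_imp_le) (simp add: N_def)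
  qed
  \<comment> \<open>For fixed \<open>C\<close> the functional \<open>B \<mapsto> q C B\<close>
    factors through the orbit and is bounded there, so a vector represents it.\<close>
  have ex: "\<exists>y. \<forall>B. q C B = cinner y (f B)" for C
  proof -
    have "linear (q C)"
    proof (rule linearI)
      show "q C (r *\<^sub>R B) = r *\<^sub>R q C B" for r B
        using q.scaleC_right[of C "complex_of_real r" B] by (simp add: scaleC_of_real scaleR_conv_of_real)
    qed (rule q.add_right)
    then obtain L :: "'b \<Rightarrow>\<^sub>L complex" where L: "\<And>B. L (f B) = q C B"
      using bounded_linear_extension[OF linf _ dense, of "q C" "N * norm (f C)"] cs by metis
    have "L (c *\<^sub>C x) = c * L x" for c x
    proof (rule dense_induct[OF dense, of _ x])
      show "closed {x. L (c *\<^sub>C x) = c * L x}" by (intro closed_Collect_eq continuous_intros)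
    qed (auto simp: L q.scaleC_right simp flip: f_scaleC)
    then obtain y where "\<And>x. L x = cinner y x"
      using riesz_representation[OF blinfun.bounded_linear_right, of L] by blast
    then show ?thesis using L by metis
  qed
  then obtain y where y: "\<And>C B. q C B = cinner (y C) (f B)" by metis
  have y_eqI: "u = v" if "\<And>B. cinner u (f B) = cinner v (f B)" for u v
  proof -
    have "cinner z (u - v) = 0" if "z \<in> range f" for z
      using that \<open>\<And>B. cinner u (f B) = cinner v (f B)\<close> cinner_commute[of z]
      by (auto simp: cinner_simps)
    then show ?thesis using cinner_zero_dense[OF dense, of "u - v"] by simp
  qed
  have yadd: "y (B + C) = y B + y C" for B C
    by (rule y_eqI) (simp add: cinner_simps q.add_left flip: y)
  have yscale: "y (c *\<^sub>C B) = c *\<^sub>C y B" for c B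
    by (rule y_eqI) (simp add: cinner_simps q.scaleC_left flip: y)
  have liny: "linear y"
    by (rule linearI) (simp_all add: yadd yscale flip: scaleC_of_real)
  have ny: "norm (y C) \<le> N * norm (f C)" for C
  proof -
    have "cmod (cinner (y C) x) \<le> N * norm (f C) * norm x" for x
    proof (rule dense_induct[OF dense, of _ x])
      show "closed {x. cmod (cinner (y C) x) \<le> N * norm (f C) * norm x}"
        by (intro closed_Collect_le continuous_intros)
    qed (use cs y in auto)
    from this[of "y C"] have "norm (y C) * norm (y C) \<le> N * norm (f C) * norm (y C)"
      by (simp add: cinner_self power2_eq_square norm_mult)
    then show ?thesis by (cases "y C = 0") (auto simp: N_def)
  qed
  \<comment> \<open>The assignment \<open>C \<mapsto> y C\<close> factors through the orbit by the
    same estimate; its extension satisfies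
    \<open>q C B = \<langle>T (f C), f B\<rangle>\<close>.\<close>
  obtain T :: "'b \<Rightarrow>\<^sub>L 'b" where T: "\<And>C. T (f C) = y C"
    using bounded_linear_extension[OF linf liny dense ny] by metis
  have lin: "complex_linear T"
    unfolding complex_linear_def
  proof (intro allI)
    fix c x show "T (c *\<^sub>C x) = c *\<^sub>C T x"
    proof (rule dense_induct[OF dense, of _ x])
      show "closed {x. T (c *\<^sub>C x) = c *\<^sub>C T x}" by (intro closed_Collect_eq continuous_intros)
    qed (auto simp: T yscale simp flip: f_scaleC)
  qed
  have sym: "cinner (T u) v = cinner u (T v)" for u v
  proof (rule dense_induct[OF dense, of _ u])
    show "closed {u. cinner (T u) v = cinner u (T v)}" by (intro closed_Collect_eq continuous_intros)
    fix u assume "u \<in> range f"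
    then obtain B where B: "u = f B" by blast
    show "cinner (T u) v = cinner u (T v)"
    proof (rule dense_induct[OF dense, of _ v])
      show "closed {v. cinner (T u) v = cinner u (T v)}" by (intro closed_Collect_eq continuous_intros)
      fix v assume "v \<in> range f"
      then obtain C where C: "v = f C" by blast
      show "cinner (T u) v = cinner u (T v)"
        unfolding B C T using q.hermitian[of B C] cinner_commute[of "f B" "y C"] by (simp flip: y)
    qed
  qed
  have comm: "T (\<pi> A x) = \<pi> A (T x)" for A x
  proof (rule dense_induct[OF dense, of _ x])
    show "closed {x. T (\<pi> A x) = \<pi> A (T x)}" by (intro closed_Collect_eq continuous_intros)
    fix x assume "x \<in> range f"
    then obtain C where C: "x = f C" by blast
    have fm: "\<pi> A (f B) = f (A * B)" for A B by (simp add: f_def mult)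
    show "T (\<pi> A x) = \<pi> A (T x)"
      unfolding C fm T by (rule y_eqI) (simp add: cinner_star' fm inv flip: y)
  qed
  obtain t where t: "\<And>x. T x = t *\<^sub>R x" using schur[OF lin sym comm] by blast
  have qt: "q B C = complex_of_real t * cinner (f B) (f C)" for B C
    by (simp add: y T[symmetric] t cinner_simps)
  obtain C where "f C \<noteq> 0" using \<Psi> null_vector_eq_zero by (auto simp: f_def)
  then have "0 \<le> t" using q.nonneg[of C] by (simp add: qt cinner_self zero_le_mult_iff)
  with qt that show thesis by (simp add: f_def)
qed

text \<open>Each \<open>x + z y\<close> is again dominated by \<open>y\<close>, so its form is a
  multiple \<open>t z\<close> of the form of \<open>y\<close>. Polarising over four values of
  \<open>z\<close> shows that \<open>\<pi> C x\<close> and \<open>c \<pi> C y\<close> have equal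
  inner products with the dense orbit of \<open>y\<close>.\<close>

lemma dominated_vector_proportional:
  assumes bound: "\<And>C. norm (\<pi> C x) \<le> M * norm (\<pi> C y)" and y: "y \<noteq> 0"
  obtains c where "x = c *\<^sub>C y"
proof -
  have "\<exists>t. \<forall>B C. cinner (\<pi> B (x + z *\<^sub>C y)) (\<pi> C (x + z *\<^sub>C y)) = t * cinner (\<pi> B y) (\<pi> C y)" for z
  proof -
    define u where "u = x + z *\<^sub>C y"
    have "semidefinite_form (\<lambda>B C. cinner (\<pi> B u) (\<pi> C u))"
      by (rule semidefinite_formI)
        (simp_all add: add scaleC blinfun.add_left cinner_simps cinner_self)
    moreover have "norm (\<pi> C u) \<le> (M + cmod z) * norm (\<pi> C y)" for C
    proof -
      have "norm (\<pi> C u) \<le> norm (\<pi> C x) + norm (z *\<^sub>C \<pi> C y)"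
        unfolding u_def by (simp add: blinfun.add_right apply_scaleC norm_triangle_ineq)
      then show ?thesis using bound[of C] by (simp add: norm_scaleC algebra_simps)
    qed
    then have "(norm (\<pi> C u))\<^sup>2 \<le> (M + cmod z)\<^sup>2 * (norm (\<pi> C y))\<^sup>2" for C
      by (metis norm_ge_zero power_mono power_mult_distrib)
    ultimately obtain t where "\<And>B C. cinner (\<pi> B u) (\<pi> C u) = complex_of_real t * cinner (\<pi> B y) (\<pi> C y)"
      using invariant_form_proportional[of "\<lambda>B C. cinner (\<pi> B u) (\<pi> C u)" "(M + cmod z)\<^sup>2" y] y
      by (metis norm_sq_cinner mult_apply cinner_star')
    then show ?thesis unfolding u_def by blast
  qed
  then obtain t where t: "\<And>z B C. cinner (\<pi> B (x + z *\<^sub>C y)) (\<pi> C (x + z *\<^sub>C y)) = t z * cinner (\<pi> B y) (\<pi> C y)"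
    by metis
  \<comment> \<open>The weights \<open>1\<close>, \<open>-1\<close>, \<open>\<i>\<close>,
    \<open>-\<i>\<close> at the same values of \<open>z\<close> keep only the term with factor
    \<open>cnj z\<close>, the mixed form \<open>\<langle>\<pi> B y, \<pi> C x\<rangle>\<close>, four
    times.\<close>
  define c where "c = (t 1 - t (-1) + \<i> * t \<i> - \<i> * t (-\<i>)) / 4"
  have "\<pi> C x = \<pi> C (c *\<^sub>C y)" for C
  proof -
    have "cinner (\<pi> B y) (\<pi> C x - c *\<^sub>C \<pi> C y) = 0" for B
    proof -
      have e: "cinner (\<pi> B (x + z *\<^sub>C y)) (\<pi> C (x + z *\<^sub>C y)) = cinner (\<pi> B x) (\<pi> C x) + z * cinner (\<pi> B x) (\<pi> C y)
          + cnj z * cinner (\<pi> B y) (\<pi> C x) + cnj z * z * cinner (\<pi> B y) (\<pi> C y)" for z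
        by (simp add: blinfun.add_right apply_scaleC cinner_simps algebra_simps)
      have "4 * cinner (\<pi> B y) (\<pi> C x) = 4 * c * cinner (\<pi> B y) (\<pi> C y)"
        using t[of B 1 C] t[of B "-1" C] t[of B \<i> C] t[of B "-\<i>" C] unfolding e c_def
        by (simp add: algebra_simps) (simp add: complex_eq_iff algebra_simps)
      then show ?thesis by (simp add: cinner_simps)
    qed
    then have "\<pi> C x - c *\<^sub>C \<pi> C y = 0" by (intro cinner_zero_dense[OF cyclic[OF y]]) auto
    then show ?thesis by (simp add: apply_scaleC)
  qed
  then have "x = c *\<^sub>C y" by (rule apply_eqI)
  then show thesis by (rule that)
qed

end

lemma unitary_of_isometry:
  fixes V :: "'h::complex_hilbert \<Rightarrow>\<^sub>L 'h"
  assumes "complex_linear V" "\<And>x. norm (V x) = norm x" "closure (range V) = UNIV"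
  shows "V \<in> unitaries"
proof -
  have "complete (V ` UNIV)"
    using assms(2) by (intro complete_isometric_image[of 1]) (auto simp: blinfun.bounded_linear_right)
  then have "closed (range V)" by (rule complete_imp_closed)
  then have "surj V" using assms(3) by simp
  with assms isometry_cinner[OF assms(1,2)] show ?thesis by (simp add: unitaries_def)
qed

text \<open>Uniqueness of cyclic representations: equality of the norms makes
  \<open>\<rho> B x \<mapsto> \<pi> B y\<close> a well-defined isometry between dense
  orbits.\<close>

lemma intertwining_unitary_exists:
  fixes \<rho> \<pi> :: "'b::cstar_algebra \<Rightarrow> ('h::complex_hilbert \<Rightarrow>\<^sub>L 'h)"
  assumes "irreducible_star_representation \<rho>" "irreducible_star_representation \<pi>"
    and norms: "\<And>B. norm (\<rho> B x) = norm (\<pi> B y)" and x: "x \<noteq> 0"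
  obtains V where "V \<in> unitaries" "\<And>B v. V (\<rho> B v) = \<pi> B (V v)" "V x = y"
proof -
  interpret r: irreducible_star_representation \<rho> by fact
  interpret p: irreducible_star_representation \<pi> by fact
  have dense: "closure (range (\<lambda>B. \<rho> B x)) = UNIV" by (rule r.cyclic[OF x])
  obtain V :: "'h \<Rightarrow>\<^sub>L 'h" where V: "\<And>B. V (\<rho> B x) = \<pi> B y"
    using bounded_linear_extension[OF r.linear_apply p.linear_apply dense, of y 1] norms by auto
  have y: "y \<noteq> 0"
  proof
    assume "y = 0"
    then have "\<rho> B x = 0" for B using norms[of B] by simp
    then show False using r.null_vector_eq_zero x by blast
  qed
  have lin: "complex_linear V"
    unfolding complex_linear_def
  proof (intro allI)
    fix c v show "V (c *\<^sub>C v) = c *\<^sub>C V v"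
    proof (rule dense_induct[OF dense, of _ v])
      show "closed {v. V (c *\<^sub>C v) = c *\<^sub>C V v}" by (intro closed_Collect_eq continuous_intros)
    qed (auto simp: V p.scaleC simp flip: r.scaleC)
  qed
  have iso: "norm (V v) = norm v" for v
  proof (rule dense_induct[OF dense, of _ v])
    show "closed {v. norm (V v) = norm v}" by (intro closed_Collect_eq continuous_intros)
  qed (auto simp: V norms)
  have inter: "V (\<rho> B v) = \<pi> B (V v)" for B v
  proof (rule dense_induct[OF dense, of _ v])
    show "closed {v. V (\<rho> B v) = \<pi> B (V v)}" by (intro closed_Collect_eq continuous_intros)
  qed (auto simp: V simp flip: r.mult_apply p.mult_apply)
  have "range (\<lambda>B. \<pi> B y) \<subseteq> range V" by (auto simp flip: V)
  then have "closure (range V) = UNIV" using closure_mono p.cyclic[OF y] by blast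
  then have "V \<in> unitaries" by (rule unitary_of_isometry[OF lin iso])
  \<comment> \<open>\<open>x\<close> need not lie in its own orbit, so the value is tested after
    applying every \<open>\<pi> B\<close>.\<close>
  moreover have "V x = y" by (rule p.apply_eqI) (simp add: V flip: inter)
  ultimately show thesis using inter that by blast
qed

lemma irreducible_star_representation_iff:
  "irreducible_star_representation \<pi> \<longleftrightarrow> irreducible_representation \<pi>"
  by (auto simp: irreducible_star_representation_def irreducible_star_representation_axioms_def
      star_representation_def irreducible_representation_def)

section \<open>Cutoffs in representations\<close>

lemma norm_diff_add_le: "norm (a - b + c) \<le> norm a + norm b + norm (c::'a::real_normed_vector)"
  using norm_triangle_ineq[of "a - b" c] norm_triangle_ineq4[of a b] by linarith

context star_representation
begin

lemma cinner_square: "cinner x (\<pi> (star C * C) x) = complex_of_real ((norm (\<pi> C x))\<^sup>2)"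
  using cinner_star'[of C x "\<pi> C x"] by (simp add: mult cinner_self)

text \<open>The residual \<open>v = z - \<pi> A z\<close> is \<open>(1 + h^2)^-1 z\<close>, so
  \<open>\<langle>z, v\<rangle> = (norm v)^2 + (norm (h v))^2\<close>. The hypothesis bounds the
  square of this sum by \<open>d \<langle>v, h v\<rangle>\<close>, which is at most
  \<open>d / 2\<close> times the same sum; dividing gives the claim.\<close>

lemma cutoff_residual_le:
  assumes h: "star h = h" and A: "A + h * (h * A) = h * h"
    and z: "\<And>v. (cmod (cinner z v))\<^sup>2 \<le> d * Re (cinner v (\<pi> h v))" and d: "0 \<le> d"
  shows "(norm (z - \<pi> A z))\<^sup>2 \<le> d / 2"
proof -
  define v where "v = z - \<pi> A z"
  have "\<pi> A z + \<pi> h (\<pi> h (\<pi> A z)) = \<pi> h (\<pi> h z)"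
    using arg_cong[OF A, of "\<lambda>a. \<pi> a z"] by (simp add: add mult blinfun.add_left)
  then have zv: "z = v + \<pi> h (\<pi> h v)"
    by (simp add: v_def blinfun.diff_right algebra_simps)
  define a b where "a = norm v" and "b = norm (\<pi> h v)"
  have "cinner (\<pi> h (\<pi> h v)) v = cinner (\<pi> h v) (\<pi> h v)" by (simp add: cinner_star' h)
  then have zz: "cinner z v = complex_of_real (a\<^sup>2 + b\<^sup>2)"
    by (subst zv) (simp add: cinner_simps cinner_self a_def b_def)
  have "(a\<^sup>2 + b\<^sup>2)\<^sup>2 \<le> d * Re (cinner v (\<pi> h v))"
    using z[of v] unfolding zz norm_of_real by simp
  also have "Re (cinner v (\<pi> h v)) \<le> a * b"
    using norm_cinner[of v "\<pi> h v"] complex_Re_le_cmod order_trans unfolding a_def b_def by blast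
  also have "a * b \<le> (a\<^sup>2 + b\<^sup>2) / 2"
    using zero_le_power2[of "a - b"] by (simp add: power2_diff)
  finally have "(a\<^sup>2 + b\<^sup>2) * (a\<^sup>2 + b\<^sup>2) \<le> (d / 2) * (a\<^sup>2 + b\<^sup>2)"
    using d by (simp add: power2_eq_square mult_left_mono)
  then have "a\<^sup>2 + b\<^sup>2 \<le> d / 2 \<or> a\<^sup>2 + b\<^sup>2 = 0"
    by (metis mult_le_cancel_right_pos add_nonneg_eq_0_iff zero_le_power2 add_nonneg_nonneg less_eq_real_def)
  then have "a\<^sup>2 \<le> d / 2" using d zero_le_power2[of a] zero_le_power2[of b] by linarith
  then show ?thesis by (simp add: a_def v_def)
qed

text \<open>The dual estimate. With \<open>v = (1 + h^2)^-1 y\<close> one has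
  \<open>A y = h^2 v\<close> and \<open>\<langle>y, h (h v)\<rangle> = (norm (h v))^2 + (norm (h^2
  v))^2\<close>; Cauchy-Schwarz for the form of \<open>h\<close> at \<open>y\<close> and
  \<open>h v\<close> bounds this number.\<close>

lemma cutoff_apply_le:
  assumes h: "star h = h" and A: "A + h * (h * A) = h * h"
    and pos: "\<And>v. 0 \<le> Re (cinner v (\<pi> h v))"
  shows "(norm (\<pi> A y))\<^sup>2 \<le> Re (cinner y (\<pi> h y)) / 2"
proof -
  define v where "v = y - \<pi> A y"
  have "\<pi> A y + \<pi> h (\<pi> h (\<pi> A y)) = \<pi> h (\<pi> h y)"
    using arg_cong[OF A, of "\<lambda>a. \<pi> a y"] by (simp add: add mult blinfun.add_left)
  then have Ay: "\<pi> A y = \<pi> h (\<pi> h v)"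
    by (simp add: v_def blinfun.diff_right algebra_simps)
  then have yv: "y = v + \<pi> h (\<pi> h v)" by (simp add: v_def)
  interpret f: semidefinite_form "\<lambda>x y. cinner x (\<pi> h y)"
    by (rule symmetric_semidefinite_form)
      (auto simp: complex_linear_def apply_scaleC cinner_star' h pos)
  define a b where "a = norm (\<pi> h v)" and "b = norm (\<pi> h (\<pi> h v))"
  have "cinner v (\<pi> h (\<pi> h v)) = cinner (\<pi> h v) (\<pi> h v)" by (simp add: cinner_star' h)
  then have yy: "cinner y (\<pi> h (\<pi> h v)) = complex_of_real (a\<^sup>2 + b\<^sup>2)"
    by (subst yv) (simp add: cinner_simps cinner_self a_def b_def)
  have "(a\<^sup>2 + b\<^sup>2)\<^sup>2 \<le> Re (cinner y (\<pi> h y)) * Re (cinner (\<pi> h v) (\<pi> h (\<pi> h v)))"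
    using f.cauchy_schwarz[of y "\<pi> h v"] unfolding yy norm_of_real by simp
  also have "\<dots> \<le> Re (cinner y (\<pi> h y)) * ((a\<^sup>2 + b\<^sup>2) / 2)"
  proof (rule mult_left_mono)
    have "Re (cinner (\<pi> h v) (\<pi> h (\<pi> h v))) \<le> a * b"
      using norm_cinner[of "\<pi> h v" "\<pi> h (\<pi> h v)"] complex_Re_le_cmod order_trans
      unfolding a_def b_def by blast
    also have "a * b \<le> (a\<^sup>2 + b\<^sup>2) / 2"
      using zero_le_power2[of "a - b"] by (simp add: power2_diff)
    finally show "Re (cinner (\<pi> h v) (\<pi> h (\<pi> h v))) \<le> (a\<^sup>2 + b\<^sup>2) / 2" .
  qed (rule pos)
  finally have "(a\<^sup>2 + b\<^sup>2) * (a\<^sup>2 + b\<^sup>2) \<le> (Re (cinner y (\<pi> h y)) / 2) * (a\<^sup>2 + b\<^sup>2)"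
    by (simp add: power2_eq_square)
  then have "a\<^sup>2 + b\<^sup>2 \<le> Re (cinner y (\<pi> h y)) / 2 \<or> a\<^sup>2 + b\<^sup>2 = 0"
    by (metis mult_le_cancel_right_pos add_nonneg_eq_0_iff zero_le_power2 add_nonneg_nonneg less_eq_real_def)
  then have "b\<^sup>2 \<le> Re (cinner y (\<pi> h y)) / 2"
    using pos[of y] zero_le_power2[of a] zero_le_power2[of b] by linarith
  then show ?thesis by (simp add: Ay b_def)
qed

lemma cutoff_approx:
  assumes "norm A \<le> 1" "norm (z - \<pi> A z) \<le> e" "norm (x - z) \<le> e"
  shows "norm (x - \<pi> A x) \<le> 3 * e"
proof -
  have "norm (\<pi> A (z - x)) \<le> norm (z - x)"
    using norm_apply_le[of A "z - x"] mult_right_mono[OF assms(1) norm_ge_zero[of "z - x"]] by simp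
  then have "norm (\<pi> A (z - x)) \<le> e" using assms(3) by (simp add: norm_minus_commute)
  moreover have "x - \<pi> A x = (x - z) + ((z - \<pi> A z) + \<pi> A (z - x))" by (simp add: blinfun.diff_right)
  then have "norm (x - \<pi> A x) \<le> norm (x - z) + (norm (z - \<pi> A z) + norm (\<pi> A (z - x)))"
    by (metis norm_triangle_le norm_triangle_ineq add_left_mono)
  ultimately show ?thesis using assms by linarith
qed

end

text \<open>A single \<open>A\<close> must work in both representations. It is the cutoff of a large
  multiple of \<open>B * star B + C * star C\<close>, where by cyclicity \<open>B\<close> nearly
  fixes \<open>x\<close> and \<open>C\<close> nearly fixes \<open>y\<close>.\<close>

lemma approximate_unit:
  fixes \<rho> \<pi> :: "'b::cstar_algebra \<Rightarrow> ('h::complex_hilbert \<Rightarrow>\<^sub>L 'h)"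
  assumes "irreducible_star_representation \<rho>" "irreducible_star_representation \<pi>"
    and x: "x \<noteq> 0" and y: "y \<noteq> 0" and e: "0 < e"
  obtains A where "norm A \<le> 1" "norm (x - \<rho> A x) < e" "norm (y - \<pi> A y) < e"
proof -
  interpret r: irreducible_star_representation \<rho> by fact
  interpret p: irreducible_star_representation \<pi> by fact
  obtain B where B: "norm (\<rho> B x - x) < e / 4" using r.cyclic_approx[OF x, of "e/4"] e by auto
  obtain C where C: "norm (\<pi> C y - y) < e / 4" using p.cyclic_approx[OF y, of "e/4"] e by auto
  define N where "N = 1 + (norm x)\<^sup>2 + (norm y)\<^sup>2"
  have N: "0 < N" "(norm x)\<^sup>2 \<le> N" "(norm y)\<^sup>2 \<le> N" by (auto simp: N_def add_pos_nonneg)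
  define d where "d = e\<^sup>2 / 8"
  have d: "0 < d" using e by (simp add: d_def)
  \<comment> \<open>\<open>star (star B) * star B\<close> is \<open>B * star B\<close> in the shape
    of \<open>cinner_square\<close>. The factor \<open>N / d\<close> makes the squared inner
    products of \<open>\<sigma> D u\<close> with \<open>v\<close> at most
    \<open>d \<langle>v, h v\<rangle>\<close> for both vectors, where
    \<open>d / 2 = (e / 4)^2\<close>.\<close>
  define h where "h = (N / d) *\<^sub>R (star (star B) * star B + star (star C) * star C)"
  have h: "star h = h" by (simp add: h_def star_scaleR star_add star_mult star_star)
  obtain A where A: "A + h * (h * A) = h * h" "norm A \<le> 1"
    using selfadjoint_cutoff[OF h] by blast
  have main: "norm (u - \<sigma> A u) < e"
    if \<sigma>: "star_representation \<sigma>" and D: "D = B \<or> D = C" "norm (\<sigma> D u - u) < e / 4" "(norm u)\<^sup>2 \<le> N"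
    for \<sigma> :: "'b \<Rightarrow> ('h \<Rightarrow>\<^sub>L 'h)" and D u
  proof -
    interpret s: star_representation \<sigma> by fact
    have "(norm (\<sigma> D u - \<sigma> A (\<sigma> D u)))\<^sup>2 \<le> d / 2"
    proof (rule s.cutoff_residual_le[OF h A(1)])
      fix v
      have "cinner (\<sigma> D u) v = cinner u (\<sigma> (star D) v)" by (rule s.cinner_star')
      then have "cmod (cinner (\<sigma> D u) v) \<le> norm u * norm (\<sigma> (star D) v)" using norm_cinner by simp
      then have "(cmod (cinner (\<sigma> D u) v))\<^sup>2 \<le> (norm u * norm (\<sigma> (star D) v))\<^sup>2"
        by (rule power_mono) simp
      also have "\<dots> \<le> N * ((norm (\<sigma> (star B) v))\<^sup>2 + (norm (\<sigma> (star C) v))\<^sup>2)"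
        unfolding power_mult_distrib using D(1,3) N by (intro mult_mono) auto
      also have "\<dots> = d * Re (cinner v (\<sigma> h v))"
        using d by (simp add: h_def s.scaleR s.add blinfun.add_left blinfun.scaleR_left cinner_simps
            s.cinner_square del: star_star)
      finally show "(cmod (cinner (\<sigma> D u) v))\<^sup>2 \<le> d * Re (cinner v (\<sigma> h v))" .
    qed (use d in simp)
    also have "d / 2 = (e / 4)\<^sup>2" by (simp add: d_def power2_eq_square)
    finally have "norm (\<sigma> D u - \<sigma> A (\<sigma> D u)) \<le> e / 4" by (rule power2_le_imp_le) (use e in simp)
    then have "norm (u - \<sigma> A u) \<le> 3 * (e / 4)"
      using s.cutoff_approx[OF A(2), of "\<sigma> D u" "e/4" u] D(2) by (simp add: norm_minus_commute)
    then show ?thesis using e by simp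
  qed
  show thesis
    using that[OF A(2)] main[OF r.star_representation_axioms, of B x] main[OF p.star_representation_axioms, of C y]
      B C N by simp
qed

text \<open>The convex set \<open>Z\<close> below consists of vectors \<open>z\<close> with \<open>|z><z| \<le> \<rho> P\<close> for some
  positive \<open>P\<close> that almost vanishes in the second state.  Either \<open>x\<close> is in its closure, and a
  cutoff of \<open>P\<close> separates the two states, or a separating hyperplane yields a vector \<open>u\<close> whose
  state is dominated by the second one.\<close>

lemma separating_cutoff:
  fixes \<rho> \<pi> :: "'b::cstar_algebra \<Rightarrow> ('h::complex_hilbert \<Rightarrow>\<^sub>L 'h)"
  assumes "irreducible_star_representation \<rho>" "irreducible_star_representation \<pi>"
    and disjoint: "\<And>u M. (\<And>C. norm (\<rho> C u) \<le> M * norm (\<pi> C y)) \<Longrightarrow> cinner u x = 0"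
    and e: "0 < e"
  obtains A where "star A = A" "norm A \<le> 1" "\<And>a. norm (2 *\<^sub>R (A * a) - a) \<le> norm a"
    "norm (x - \<rho> A x) < e" "norm (\<pi> A y) < e"
proof -
  interpret r: irreducible_star_representation \<rho> by fact
  interpret p: irreducible_star_representation \<pi> by fact
  define d where "d = e\<^sup>2 / 8"
  \<comment> \<open>After the rescaling \<open>P = d h\<close> below,
    \<open>\<langle>y, P y\<rangle> \<le> \<eta>\<close> becomes
    \<open>\<langle>y, h y\<rangle> \<le> e^2\<close>, and the domination of \<open>z\<close>
    acquires the factor \<open>d\<close> expected by \<open>cutoff_residual_le\<close>.\<close>
  define \<eta> where "\<eta> = d * e\<^sup>2"
  have d: "0 < d" and \<eta>: "0 < \<eta>" using e by (simp_all add: d_def \<eta>_def)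
  define Q where "Q z P \<longleftrightarrow> star P = P \<and> (\<forall>v. (cmod (cinner z v))\<^sup>2 \<le> Re (cinner v (\<rho> P v)))
    \<and> (\<forall>v. 0 \<le> Re (cinner v (\<pi> P v))) \<and> Re (cinner y (\<pi> P y)) \<le> \<eta>" for z P
  define Z where "Z = {z. \<exists>P. Q z P}"
  have "convex Z"
  proof (rule convexI)
    fix z w and s t :: real
    assume "z \<in> Z" "w \<in> Z" and st: "0 \<le> s" "0 \<le> t" "s + t = 1"
    then obtain P R where P: "Q z P" and R: "Q w R" by (auto simp: Z_def)
    have "Q (s *\<^sub>R z + t *\<^sub>R w) (s *\<^sub>R P + t *\<^sub>R R)"
      unfolding Q_def
    proof (intro conjI allI)
      show "star (s *\<^sub>R P + t *\<^sub>R R) = s *\<^sub>R P + t *\<^sub>R R" using P R by (simp add: Q_def star_add star_scaleR)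
      show "0 \<le> Re (cinner v (\<pi> (s *\<^sub>R P + t *\<^sub>R R) v))" for v
        using P R st by (simp add: Q_def p.add p.scaleR blinfun.add_left blinfun.scaleR_left cinner_simps)
      have "s * Re (cinner y (\<pi> P y)) + t * Re (cinner y (\<pi> R y)) \<le> s * \<eta> + t * \<eta>"
        using P R st by (intro add_mono mult_left_mono) (auto simp: Q_def)
      also have "\<dots> = \<eta>" using st by (simp flip: distrib_right)
      finally show "Re (cinner y (\<pi> (s *\<^sub>R P + t *\<^sub>R R) y)) \<le> \<eta>"
        by (simp add: p.add p.scaleR blinfun.add_left blinfun.scaleR_left cinner_simps)
      fix v
      define a b where "a = cmod (cinner z v)" and "b = cmod (cinner w v)"
      have "cmod (cinner (s *\<^sub>R z + t *\<^sub>R w) v) \<le> s * a + t * b"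
        using norm_triangle_ineq[of "complex_of_real s * cinner z v" "complex_of_real t * cinner w v"] st
        by (simp add: cinner_simps norm_mult a_def b_def)
      then have "(cmod (cinner (s *\<^sub>R z + t *\<^sub>R w) v))\<^sup>2 \<le> (s * a + t * b)\<^sup>2"
        by (rule power_mono) simp
      also have "\<dots> \<le> s * a\<^sup>2 + t * b\<^sup>2"
      proof -
        have "s * a\<^sup>2 + t * b\<^sup>2 - (s * a + t * b)\<^sup>2 = s * t * (a - b)\<^sup>2"
        proof -
          have t: "t = 1 - s" using st by simp
          show ?thesis unfolding t by (simp add: power2_eq_square algebra_simps)
        qed
        moreover have "0 \<le> s * t * (a - b)\<^sup>2" using st by simp
        ultimately show ?thesis by linarith
      qed
      also have "\<dots> \<le> s * Re (cinner v (\<rho> P v)) + t * Re (cinner v (\<rho> R v))"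
        using P R st by (intro add_mono mult_left_mono) (auto simp: Q_def a_def b_def)
      finally show "(cmod (cinner (s *\<^sub>R z + t *\<^sub>R w) v))\<^sup>2 \<le> Re (cinner v (\<rho> (s *\<^sub>R P + t *\<^sub>R R) v))"
        by (simp add: r.add r.scaleR blinfun.add_left blinfun.scaleR_left cinner_simps)
    qed
    then show "s *\<^sub>R z + t *\<^sub>R w \<in> Z" by (auto simp: Z_def)
  qed
  then have cvx: "convex (closure Z)" by (rule convex_closure)
  have "Q 0 0" using \<eta> by (simp add: Q_def)
  then have Z0: "0 \<in> Z" by (auto simp: Z_def)
  \<comment> \<open>These members are used against a separating functional:
    \<open>P = star C * C\<close> dominates the vector \<open>\<rho> (star C) v\<close>, and its
    value at the second vector is \<open>(norm (\<pi> C y))^2\<close>.\<close>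
  have memZ: "\<rho> (star C) v \<in> Z" if v: "norm v \<le> 1" and C: "(norm (\<pi> C y))\<^sup>2 \<le> \<eta>" for C v
  proof -
    have "(cmod (cinner (\<rho> (star C) v) u))\<^sup>2 \<le> (norm (\<rho> C u))\<^sup>2" for u
    proof -
      have "cmod (cinner (\<rho> (star C) v) u) \<le> norm v * norm (\<rho> C u)" using norm_cinner by (simp add: r.cinner_star)
      also have "\<dots> \<le> norm (\<rho> C u)" using v by (simp add: mult_left_le_one_le)
      finally show ?thesis by (rule power_mono) simp
    qed
    then have "Q (\<rho> (star C) v) (star C * C)"
      using C by (simp add: Q_def star_mult_star r.cinner_square p.cinner_square)
    then show ?thesis by (auto simp: Z_def)
  qed
  have "x \<in> closure Z"
  proof (rule ccontr)
    assume "x \<notin> closure Z"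
    then obtain u c where u: "\<And>t. t \<in> closure Z \<Longrightarrow> Re (cinner u t) \<le> c" "c < Re (cinner u x)"
      using separate_point_closed_convex[OF closed_closure cvx, of x] Z0 closure_subset by blast
    have Zc: "Re (cinner u t) \<le> c" if "t \<in> Z" for t using u(1) that closure_subset by blast
    have c: "0 \<le> c" using Zc[OF Z0] by simp
    \<comment> \<open>Testing the separating functional on \<open>\<rho> (star C) v\<close> with
      \<open>v\<close> along \<open>\<rho> C u\<close> produces
      \<open>norm (\<rho> C u)\<close>.\<close>
    have small: "norm (\<rho> C u) \<le> c" if C: "(norm (\<pi> C y))\<^sup>2 \<le> \<eta>" for C
    proof (cases "\<rho> C u = 0")
      case False
      define v where "v = inverse (norm (\<rho> C u)) *\<^sub>R \<rho> C u"
      have "\<rho> (star C) v \<in> Z" by (rule memZ) (use False C in \<open>auto simp: v_def\<close>)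
      then have "Re (cinner u (\<rho> (star C) v)) \<le> c" by (rule Zc)
      also have "cinner u (\<rho> (star C) v) = cinner (\<rho> C u) v" by (simp add: r.cinner_star')
      also have "Re \<dots> = norm (\<rho> C u)"
        using False by (simp add: v_def cinner_simps cinner_self power2_eq_square)
      finally show ?thesis .
    qed (use c in simp)
    \<comment> \<open>Homogeneity in \<open>C\<close> turns the implication into a domination
      inequality. If \<open>\<pi> C y = 0\<close>, all multiples of \<open>C\<close> are admissible,
      which forces \<open>\<rho> C u = 0\<close>.\<close>
    have "norm (\<rho> C u) \<le> c / sqrt \<eta> * norm (\<pi> C y)" for C
    proof (cases "\<pi> C y = 0")
      case False
      define k where "k = sqrt \<eta> / norm (\<pi> C y)"
      have k: "0 < k" using False \<eta> by (simp add: k_def)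
      have "norm (\<rho> (k *\<^sub>R C) u) \<le> c"
        by (rule small) (use False \<eta> in \<open>simp add: p.scaleR blinfun.scaleR_left k_def power_divide\<close>)
      then have "k * norm (\<rho> C u) \<le> c" using k by (simp add: r.scaleR blinfun.scaleR_left)
      then show ?thesis using False \<eta> by (simp add: k_def field_simps)
    next
      case True
      have "norm (\<rho> C u) = 0"
      proof (rule ccontr)
        assume n: "norm (\<rho> C u) \<noteq> 0"
        define k where "k = (c + 1) / norm (\<rho> C u)"
        have "norm (\<rho> (k *\<^sub>R C) u) \<le> c"
          by (rule small) (use True \<eta> in \<open>simp add: p.scaleR blinfun.scaleR_left\<close>)
        then show False using n c by (simp add: r.scaleR blinfun.scaleR_left k_def)
      qed
      then show ?thesis using True by simp
    qed
    then have "cinner u x = 0" by (rule disjoint)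
    then show False using u(2) c by simp
  qed
  then obtain z where z: "z \<in> Z" "norm (z - x) < e / 4"
    unfolding closure_approachable dist_norm using e by (metis divide_pos_pos zero_less_numeral)
  then obtain P where P: "Q z P" by (auto simp: Z_def)
  define h where "h = (1 / d) *\<^sub>R P"
  have h: "star h = h" using P by (simp add: h_def Q_def star_scaleR)
  have Ph: "P = d *\<^sub>R h" using d by (simp add: h_def)
  obtain A where A: "star A = A" "A + h * (h * A) = h * h" "\<And>a. norm (2 *\<^sub>R (A * a) - a) \<le> norm a" "norm A \<le> 1"
    using selfadjoint_cutoff[OF h] by blast
  have "(norm (z - \<rho> A z))\<^sup>2 \<le> d / 2"
    using P d by (intro r.cutoff_residual_le[OF h A(2)])
      (auto simp: Q_def Ph r.scaleR blinfun.scaleR_left cinner_simps)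
  also have "d / 2 = (e / 4)\<^sup>2" by (simp add: d_def power2_eq_square)
  finally have "norm (z - \<rho> A z) \<le> e / 4" by (rule power2_le_imp_le) (use e in simp)
  then have 1: "norm (x - \<rho> A x) \<le> 3 * (e / 4)"
    using r.cutoff_approx[OF A(4), of z "e/4" x] z(2) by (simp add: norm_minus_commute)
  have "(norm (\<pi> A y))\<^sup>2 \<le> Re (cinner y (\<pi> h y)) / 2"
  proof (rule p.cutoff_apply_le[OF h A(2)])
    fix v
    have "0 \<le> d * Re (cinner v (\<pi> h v))"
      using P by (simp add: Q_def Ph p.scaleR blinfun.scaleR_left cinner_simps)
    then show "0 \<le> Re (cinner v (\<pi> h v))" using d by (simp add: zero_le_mult_iff)
  qed
  also have "\<dots> < e\<^sup>2"
  proof -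
    have "d * Re (cinner y (\<pi> h y)) \<le> d * e\<^sup>2"
      using P by (simp add: Q_def Ph p.scaleR blinfun.scaleR_left cinner_simps \<eta>_def)
    then have "Re (cinner y (\<pi> h y)) \<le> e\<^sup>2" using d by simp
    moreover have "0 < e\<^sup>2" using e by simp
    ultimately show ?thesis by linarith
  qed
  finally have "norm (\<pi> A y) < e" using e by (simp add: power_less_imp_less_base)
  with 1 e A that show thesis by simp
qed

section \<open>Vector states of irreducible representations\<close>

lemma norm_vector_state_diff_le:
  fixes \<rho> \<pi> :: "'b::cstar_algebra \<Rightarrow> ('h::complex_hilbert \<Rightarrow>\<^sub>L 'h)"
  assumes "star_representation \<rho>" "star_representation \<pi>"
  shows "cmod (cinner x (\<rho> B x) - cinner y (\<pi> B y)) \<le> norm (vector_state \<rho> x - vector_state \<pi> y) * norm B"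
  using norm_blinfun[of "vector_state \<rho> x - vector_state \<pi> y" B]
  by (simp add: blinfun.diff_left star_representation.vector_state_apply[OF assms(1)]
      star_representation.vector_state_apply[OF assms(2)])

text \<open>If every vector \<open>u\<close> whose orbit norms are dominated by those of
  \<open>y\<close> is orthogonal to \<open>x\<close>, a cutoff \<open>A\<close> nearly fixes
  \<open>x\<close> and kills \<open>y\<close>. Then \<open>(2 A - 1) E\<close> is a contraction with
  values near \<open>1\<close> and \<open>-1\<close> in the two states, contradicting a distance
  below \<open>2\<close>. A dominated \<open>u\<close> overlapping with \<open>x\<close> yields the
  intertwiner.\<close>

lemma close_states_equivalent:
  fixes \<rho> \<pi> :: "'b::cstar_algebra \<Rightarrow> ('h::complex_hilbert \<Rightarrow>\<^sub>L 'h)"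
  assumes "irreducible_star_representation \<rho>" "irreducible_star_representation \<pi>"
    and x: "norm x = 1" and y: "norm y = 1"
    and close: "norm (vector_state \<rho> x - vector_state \<pi> y) < 2"
  obtains V where "V \<in> unitaries" "\<And>B v. V (\<rho> B v) = \<pi> B (V v)" "cinner y (V x) \<noteq> 0"
proof -
  interpret r: irreducible_star_representation \<rho> by fact
  interpret p: irreducible_star_representation \<pi> by fact
  have nz: "x \<noteq> 0" "y \<noteq> 0" using x y by auto
  have "\<exists>u M. (\<forall>C. norm (\<rho> C u) \<le> M * norm (\<pi> C y)) \<and> cinner u x \<noteq> 0"
  proof (rule ccontr)
    assume neg: "\<not> ?thesis"
    define g where "g = norm (vector_state \<rho> x - vector_state \<pi> y)"
    \<comment> \<open>Each of the two values deviates by at most \<open>3 e\<close>, so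
      \<open>2 \<le> g + 6 e\<close>; the denominator \<open>7\<close> leaves room for the
      contradiction.\<close>
    define e where "e = (2 - g) / 7"
    have e: "0 < e" using close by (simp add: e_def g_def)
    obtain A where A: "star A = A" "norm A \<le> 1" "\<And>a. norm (2 *\<^sub>R (A * a) - a) \<le> norm a"
      "norm (x - \<rho> A x) < e" "norm (\<pi> A y) < e"
      using separating_cutoff[OF assms(1,2) _ e, of y x] neg by blast
    obtain E where E: "norm E \<le> 1" "norm (x - \<rho> E x) < e" "norm (y - \<pi> E y) < e"
      using approximate_unit[OF assms(1,2) nz e] by blast
    define B where "B = 2 *\<^sub>R (A * E) - E"
    have B: "norm B \<le> 1" using A(3)[of E] E(1) by (simp add: B_def)
    have Ex: "norm (\<rho> E x) \<le> 1" "norm (\<pi> E y) \<le> 1"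
      using r.norm_apply_le[of E x] p.norm_apply_le[of E y] E(1) x y by auto
    have cb: "cmod (cinner u v) \<le> a" if "norm u \<le> a" "norm v \<le> 1" for a and u v :: 'h
    proof -
      have "cmod (cinner u v) \<le> norm u * norm v" by (rule norm_cinner)
      also have "\<dots> \<le> a * 1" using that by (intro mult_mono) (auto intro: order_trans[OF norm_ge_zero])
      finally show ?thesis by simp
    qed
    have "cinner x (\<rho> B x) - 1 = - (2 * cinner (x - \<rho> A x) (\<rho> E x) + cnj (cinner (x - \<rho> E x) x))"
    proof -
      have "cinner x (\<rho> B x) = 2 * cinner (\<rho> A x) (\<rho> E x) - cinner x (\<rho> E x)"
        by (simp add: B_def r.diff r.scaleR blinfun.diff_left blinfun.scaleR_left cinner_simps r.mult r.cinner_star' A(1))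
      moreover have "cinner x x = 1" by (simp add: cinner_self x)
      moreover have "cnj (cinner (\<rho> E x) x) = cinner x (\<rho> E x)" by (rule cinner_commute[symmetric])
      ultimately show ?thesis by (simp add: cinner_simps)
    qed
    then have "cmod (cinner x (\<rho> B x) - 1) \<le> 2 * cmod (cinner (x - \<rho> A x) (\<rho> E x)) + cmod (cinner (x - \<rho> E x) x)"
      using norm_triangle_ineq[of "2 * cinner (x - \<rho> A x) (\<rho> E x)" "cnj (cinner (x - \<rho> E x) x)"]
      by (simp only: norm_minus_cancel norm_mult complex_mod_cnj norm_numeral)
    also have "\<dots> \<le> 3 * e"
      using cb[of "x - \<rho> A x" e "\<rho> E x"] cb[of "x - \<rho> E x" e x] A E Ex x by simp
    finally have 1: "cmod (cinner x (\<rho> B x) - 1) \<le> 3 * e" .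
    have "cinner y (\<pi> B y) + 1 = 2 * cinner (\<pi> A y) (\<pi> E y) + cnj (cinner (y - \<pi> E y) y)"
    proof -
      have "cinner y (\<pi> B y) = 2 * cinner (\<pi> A y) (\<pi> E y) - cinner y (\<pi> E y)"
        by (simp add: B_def p.diff p.scaleR blinfun.diff_left blinfun.scaleR_left cinner_simps p.mult p.cinner_star' A(1))
      moreover have "cinner y y = 1" by (simp add: cinner_self y)
      moreover have "cnj (cinner (\<pi> E y) y) = cinner y (\<pi> E y)" by (rule cinner_commute[symmetric])
      ultimately show ?thesis by (simp add: cinner_simps)
    qed
    then have "cmod (cinner y (\<pi> B y) + 1) \<le> 2 * cmod (cinner (\<pi> A y) (\<pi> E y)) + cmod (cinner (y - \<pi> E y) y)"
      using norm_triangle_ineq[of "2 * cinner (\<pi> A y) (\<pi> E y)" "cnj (cinner (y - \<pi> E y) y)"]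
      by (simp only: norm_mult complex_mod_cnj norm_numeral)
    also have "\<dots> \<le> 3 * e"
      using cb[of "\<pi> A y" e "\<pi> E y"] cb[of "y - \<pi> E y" e y] A E Ex y by simp
    finally have 2: "cmod (cinner y (\<pi> B y) + 1) \<le> 3 * e" .
    have "cmod (cinner x (\<rho> B x) - cinner y (\<pi> B y)) \<le> g * norm B"
      unfolding g_def by (rule norm_vector_state_diff_le) unfold_locales
    also have "\<dots> \<le> g" using B by (simp add: g_def mult_left_le)
    finally have 3: "cmod (cinner x (\<rho> B x) - cinner y (\<pi> B y)) \<le> g" .
    have "(2::complex) = (cinner x (\<rho> B x) - cinner y (\<pi> B y)) - (cinner x (\<rho> B x) - 1) + (cinner y (\<pi> B y) + 1)"
      by simp
    then have "cmod 2 \<le> cmod (cinner x (\<rho> B x) - cinner y (\<pi> B y)) + cmod (cinner x (\<rho> B x) - 1) + cmod (cinner y (\<pi> B y) + 1)"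
      by (simp only: norm_diff_add_le)
    then have "2 \<le> g + 6 * e" using 1 2 3 by simp
    moreover have "7 * e = 2 - g" by (simp add: e_def)
    ultimately show False using e by linarith
  qed
  then obtain u M where u: "\<And>C. norm (\<rho> C u) \<le> M * norm (\<pi> C y)" "cinner u x \<noteq> 0" by blast
  have u0: "u \<noteq> 0" using u(2) by auto
  have form: "semidefinite_form (\<lambda>B C. cinner (\<rho> B u) (\<rho> C u))"
    by (rule semidefinite_formI) (simp_all add: r.add r.scaleC blinfun.add_left cinner_simps cinner_self)
  have inv: "cinner (\<rho> (A * B) u) (\<rho> C u) = cinner (\<rho> B u) (\<rho> (star A * C) u)" for A B C
    by (simp add: r.mult r.cinner_star')
  have bound: "Re (cinner (\<rho> C u) (\<rho> C u)) \<le> M\<^sup>2 * (norm (\<pi> C y))\<^sup>2" for C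
    using power_mono[OF u(1)[of C] norm_ge_zero, of 2] by (simp add: cinner_self power_mult_distrib)
  \<comment> \<open>The form of \<open>u\<close> is \<open>t\<close> times that of \<open>y\<close>,
    so \<open>u\<close> and \<open>sqrt t y\<close> have the same orbit norms, and the intertwiner
    carries \<open>\<langle>u, x\<rangle> \<noteq> 0\<close> over to \<open>y\<close>.\<close>
  obtain t where t: "0 \<le> t" "\<And>B C. cinner (\<rho> B u) (\<rho> C u) = complex_of_real t * cinner (\<pi> B y) (\<pi> C y)"
    by (rule p.invariant_form_proportional[OF form inv bound nz(2)]) blast
  have norms: "norm (\<rho> B u) = norm (\<pi> B (sqrt t *\<^sub>R y))" for B
  proof -
    have "complex_of_real ((norm (\<rho> B u))\<^sup>2) = complex_of_real ((norm (\<pi> B (sqrt t *\<^sub>R y)))\<^sup>2)"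
      using t(2)[of B B] t(1) by (simp add: cinner_self blinfun.scaleR_right power_mult_distrib)
    then have "(norm (\<rho> B u))\<^sup>2 = (norm (\<pi> B (sqrt t *\<^sub>R y)))\<^sup>2" by (simp only: of_real_eq_iff)
    then show ?thesis by simp
  qed
  obtain V where V: "V \<in> unitaries" "\<And>B v. V (\<rho> B v) = \<pi> B (V v)" "V u = sqrt t *\<^sub>R y"
    using intertwining_unitary_exists[OF assms(1,2) norms u0] by blast
  have "cinner (V u) (V x) = cinner u x" using V(1) by (simp add: unitaries_def)
  then have "cinner y (V x) \<noteq> 0" using u(2) by (auto simp: V(3) cinner_simps)
  with V that show thesis by blast
qed

context irreducible_star_representation
begin

text \<open>The bound \<open>1\<close> is approached along approximate units, which stand in for the
  unit.\<close>

lemma norm_vector_state: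
  assumes x: "norm x = 1"
  shows "norm (vector_state \<pi> x) = 1"
proof (rule antisym)
  show "norm (vector_state \<pi> x) \<le> 1"
  proof (rule norm_blinfun_bound)
    fix B
    have "cmod (cinner x (\<pi> B x)) \<le> norm x * norm (\<pi> B x)" by (rule norm_cinner)
    then show "norm (vector_state \<pi> x B) \<le> 1 * norm B"
      using norm_apply_le[of B x] x by (simp add: vector_state_apply)
  qed simp
  show "1 \<le> norm (vector_state \<pi> x)"
  proof (rule field_le_epsilon)
    fix e :: real assume e: "0 < e"
    have x0: "x \<noteq> 0" using x by auto
    obtain A where A: "norm A \<le> 1" "norm (x - \<pi> A x) < e"
      using approximate_unit[OF irreducible_star_representation_axioms irreducible_star_representation_axioms x0 x0 e]
      by blast
    have "cinner x x = cinner x (\<pi> A x) + cinner x (x - \<pi> A x)" by (simp add: cinner_simps)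
    then have "cmod (cinner x x) \<le> cmod (cinner x (\<pi> A x)) + cmod (cinner x (x - \<pi> A x))"
      by (simp only: norm_triangle_ineq)
    moreover have "cmod (cinner x (\<pi> A x)) \<le> norm (vector_state \<pi> x) * norm A"
      using norm_blinfun[of "vector_state \<pi> x" A] by (simp add: vector_state_apply)
    moreover have "norm (vector_state \<pi> x) * norm A \<le> norm (vector_state \<pi> x)"
      using A(1) by (simp add: mult_left_le)
    moreover have "cmod (cinner x (x - \<pi> A x)) \<le> e"
      using norm_cinner[of x "x - \<pi> A x"] A(2) x by simp
    ultimately show "1 \<le> norm (vector_state \<pi> x) + e" using x by (simp add: cinner_self)
  qed
qed

lemma vector_state_in_states:
  assumes x: "norm x = 1"
  shows "vector_state \<pi> x \<in> states"
  by (simp add: states_def vector_state_apply scaleC cinner_simps norm_vector_state[OF x]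
      cinner_square[unfolded of_real_power[symmetric]])

text \<open>With \<open>\<omega>\<close> the vector state, a component \<open>a\<close> of weight
  \<open>s\<close> in a convex decomposition satisfies \<open>a \<le> \<omega> / s\<close>, hence
  \<open>a (star B * C) = t \<omega> (star B * C)\<close>. Approximation by products extends this to
  the algebra, and the norms give \<open>t = 1\<close>.\<close>

lemma vector_state_pure:
  assumes x: "norm x = 1"
  shows "vector_state \<pi> x \<in> pure_states"
proof -
  have x0: "x \<noteq> 0" using x by auto
  let ?w = "vector_state \<pi> x"
  have component: "a = ?w" if a: "a \<in> states" and b: "b \<in> states" and s: "0 < s" "s < 1"
    and w: "?w = s *\<^sub>R a + (1 - s) *\<^sub>R b" for a b s
  proof -
    have as: "a (c *\<^sub>C B) = c * a B" for c B using a by (simp add: states_def)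
    have "semidefinite_form (\<lambda>B C. a (star B * C))"
      by (rule semidefinite_formI)
        (use a in \<open>auto simp: states_def star_add star_scaleC distrib_left distrib_right blinfun.add_right
          scaleC_mult_left scaleC_mult_right\<close>)
    moreover have "Re (a (star C * C)) \<le> 1 / s * (norm (\<pi> C x))\<^sup>2" for C
    proof -
      have "(norm (\<pi> C x))\<^sup>2 = s * Re (a (star C * C)) + (1 - s) * Re (b (star C * C))"
        using arg_cong[OF w, of "\<lambda>f. Re (f (star C * C))"]
        by (simp add: vector_state_apply cinner_square blinfun.add_left blinfun.scaleR_left)
      moreover have "0 \<le> (1 - s) * Re (b (star C * C))" using b s by (simp add: states_def)
      ultimately show ?thesis using s by (simp add: field_simps)
    qed
    ultimately obtain t where t: "0 \<le> t"
      "\<And>B C. a (star B * C) = complex_of_real t * cinner (\<pi> B x) (\<pi> C x)"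
      using invariant_form_proportional[of "\<lambda>B C. a (star B * C)" "1 / s" x] x0
      by (metis star_mult mult.assoc)
    have prod: "a (B * C) = complex_of_real t * ?w (B * C)" for B C
      using t(2)[of "star B" C] by (simp add: star_star vector_state_apply mult cinner_star)
    have sa: "a h = complex_of_real t * ?w h" if h: "star h = h" for h
    proof -
      have "cmod (a h - complex_of_real t * ?w h) \<le> 0 + e" if e: "0 < e" for e
      proof -
        \<comment> \<open>A common bound for both functionals; the added \<open>1\<close> makes it
          positive.\<close>
        define K where "K = norm a + t * norm ?w + 1"
        have K: "0 < K" using t(1) by (simp add: K_def add_nonneg_pos)
        obtain A where A: "norm (h - A * h) < e / K"
          using selfadjoint_approx_product[OF h, of "e / K"] e K by auto
        have "a h - complex_of_real t * ?w h = a (h - A * h) - complex_of_real t * ?w (h - A * h)"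
          by (simp add: blinfun.diff_right prod right_diff_distrib)
        also have "cmod \<dots> \<le> norm a * norm (h - A * h) + t * (norm ?w * norm (h - A * h))"
          using norm_blinfun[of a "h - A * h"] mult_left_mono[OF norm_blinfun[of ?w "h - A * h"] t(1)] t(1)
          by (intro order_trans[OF norm_triangle_ineq4] add_mono) (auto simp: norm_mult)
        also have "\<dots> \<le> K * norm (h - A * h)" by (simp add: K_def algebra_simps)
        also have "\<dots> \<le> e" using A K by (simp add: field_simps)
        finally show ?thesis by simp
      qed
      then have "cmod (a h - complex_of_real t * ?w h) \<le> 0" by (rule field_le_epsilon)
      then show ?thesis by simp
    qed
    have all: "a B = complex_of_real t * ?w B" for B
    proof -
      obtain b c where "star b = b" "star c = c" "B = b + \<i> *\<^sub>C c" by (rule selfadjoint_decomposition)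
      moreover have "?w (\<i> *\<^sub>C c) = \<i> * ?w c" by (simp add: vector_state_apply scaleC cinner_simps)
      ultimately show ?thesis by (simp add: blinfun.add_right as sa algebra_simps)
    qed
    have at: "a = t *\<^sub>R ?w"
      by (rule blinfun_eqI) (simp add: all blinfun.scaleR_left scaleR_conv_of_real)
    have "norm a = 1" using a by (simp add: states_def)
    then have "t = 1" using t(1) by (simp add: at norm_vector_state[OF x])
    then show ?thesis using at by simp
  qed
  have "\<not> (?w \<in> open_segment a b)" if ab: "a \<in> states" "b \<in> states" for a b
  proof
    assume "?w \<in> open_segment a b"
    then obtain u where u: "a \<noteq> b" "0 < u" "u < 1" "?w = (1 - u) *\<^sub>R a + u *\<^sub>R b"
      by (auto simp: in_segment)
    have "a = ?w" using component[OF ab, of "1 - u"] u by simp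
    moreover have "b = ?w" using component[OF ab(2,1), of u] u by (simp add: add.commute)
    ultimately show False using u(1) by simp
  qed
  then show ?thesis
    using vector_state_in_states[OF x] by (auto simp: pure_states_def extreme_point_of_def)
qed

lemma vector_state_eq_imp_proportional:
  assumes "vector_state \<pi> x = vector_state \<pi> y" "y \<noteq> 0"
  obtains c where "x = c *\<^sub>C y"
proof -
  have "norm (\<pi> C x) \<le> 1 * norm (\<pi> C y)" for C
  proof -
    have "complex_of_real ((norm (\<pi> C x))\<^sup>2) = complex_of_real ((norm (\<pi> C y))\<^sup>2)"
      using arg_cong[OF assms(1), of "\<lambda>w. w (star C * C)"] by (simp only: vector_state_apply cinner_square)
    then have "(norm (\<pi> C x))\<^sup>2 = (norm (\<pi> C y))\<^sup>2" by (simp only: of_real_eq_iff)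
    then show ?thesis by simp
  qed
  then show thesis using dominated_vector_proportional assms(2) that by blast
qed

section \<open>Orthogonal vectors, quantitative transitivity and distances of states\<close>

text \<open>Within one representation a vector dominated by \<open>y\<close> is a multiple of
  \<open>y\<close>, hence orthogonal to \<open>x\<close>; this is why
  \<open>separating_cutoff\<close> asks for orthogonality rather than for
  \<open>u = 0\<close>.\<close>

lemma orthogonal_cutoff:
  assumes x: "norm x = 1" and y: "norm y = 1" and xy: "cinner x y = 0" and e: "0 < e"
  obtains A where "star A = A" "norm A \<le> 1" "norm (x - \<pi> A x) < e" "norm (\<pi> A y) < e"
proof (rule separating_cutoff[OF irreducible_star_representation_axioms irreducible_star_representation_axioms _ e])
  show "cinner u x = 0" if dom: "\<And>C. norm (\<pi> C u) \<le> M * norm (\<pi> C y)" for u M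
  proof -
    have "y \<noteq> 0" using y by auto
    with dom obtain c where "u = c *\<^sub>C y" by (rule dominated_vector_proportional)
    then show ?thesis using xy cinner_commute[of y x] by (simp add: cinner_simps)
  qed
qed (use that in blast)

text \<open>Approximate Kadison transitivity with an explicit norm bound. The part of
  \<open>v\<close> along \<open>x\<close> is reached by an approximate unit. For the orthogonal
  part, with direction \<open>w\<close>, the near-reflection \<open>2 A - 1\<close> exchanges
  \<open>x\<close> and \<open>w\<close> when \<open>A\<close> nearly fixes
  \<open>(x + w) / sqrt 2\<close> and kills \<open>(x - w) / sqrt 2\<close>. The factor
  \<open>4\<close> is \<open>1\<close> for the first part plus \<open>3\<close>, a bound for
  \<open>2 A - E\<close>, for the second.\<close>

lemma bounded_transitivity:
  assumes x: "norm x = 1" and e: "0 < e"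
  obtains B where "norm B \<le> 4 * norm v" "norm (\<pi> B x - v) < e"
proof -
  have x0: "x \<noteq> 0" using x by auto
  define a where "a = cinner x v"
  define y where "y = v - a *\<^sub>C x"
  have v: "v = a *\<^sub>C x + y" by (simp add: y_def)
  have xx: "cinner x x = 1" by (simp add: cinner_self x)
  have xy: "cinner x y = 0" by (simp add: y_def a_def cinner_simps xx)
  have na: "cmod a \<le> norm v" using norm_cinner[of x v] x by (simp add: a_def)
  have "(norm v)\<^sup>2 = (cmod a)\<^sup>2 + (norm y)\<^sup>2"
    unfolding v by (simp add: norm_add_sq cinner_simps xy norm_scaleC x)
  then have "(norm y)\<^sup>2 \<le> (norm v)\<^sup>2" by simp
  then have ny: "norm y \<le> norm v" by (rule power2_le_imp_le) simp
  \<comment> \<open>The final error is at most \<open>5 * norm v * d\<close>: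
    \<open>4 * norm y * d\<close> from \<open>D\<close> and \<open>cmod a * d\<close> from
    \<open>E\<close>.\<close>
  define d where "d = e / (norm v * 5 + 1)"
  have d: "0 < d" using e by (simp add: d_def add_nonneg_pos)
  obtain E where E: "norm E \<le> 1" "norm (x - \<pi> E x) < d"
    using approximate_unit[OF irreducible_star_representation_axioms irreducible_star_representation_axioms x0 x0 d]
    by blast
  have "\<exists>D. norm D \<le> 3 * norm y \<and> norm (\<pi> D x - y) \<le> 4 * norm y * d"
  proof (cases "y = 0")
    case True
    then show ?thesis by (intro exI[of _ 0]) simp
  next
    case False
    define w where "w = inverse (norm y) *\<^sub>R y"
    have w: "norm w = 1" "cinner x w = 0" "cinner w x = 0" "y = norm y *\<^sub>R w"
      using False xy cinner_commute[of y x] by (auto simp: w_def cinner_simps)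
    define s where "s = inverse (sqrt 2)"
    have s: "s * s = 1/2" "0 < s" by (simp_all add: s_def flip: inverse_mult_distrib)
    define p m where "p = s *\<^sub>R (x + w)" and "m = s *\<^sub>R (x - w)"
    have ww: "cinner w w = 1" by (simp add: cinner_self w)
    have "cinner p p = complex_of_real (s * s) * 2" "cinner m m = complex_of_real (s * s) * 2"
      by (simp_all add: p_def m_def cinner_simps w xx ww)
    then have "(norm p)\<^sup>2 = 1\<^sup>2" "(norm m)\<^sup>2 = 1\<^sup>2" by (simp_all add: norm_sq_cinner s)
    then have pm: "norm p = 1" "norm m = 1" by (auto intro: power2_eq_imp_eq)
    have "cinner p m = 0" by (simp add: p_def m_def cinner_simps w xx ww)
    then obtain A where A: "norm A \<le> 1" "norm (p - \<pi> A p) < d" "norm (\<pi> A m) < d"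
      using orthogonal_cutoff[OF pm _ d] by blast
    have s2: "2 * s * s = 1" using s(1) by simp
    have s3: "s * (2 * s) = 1" using s(1) by simp
    have "(2 * s) *\<^sub>R p = (s * (2 * s)) *\<^sub>R (w + x)" by (simp add: p_def mult_ac add.commute)
    then have xpm2: "w + x = (2 * s) *\<^sub>R p" unfolding s3 by simp
    have "s *\<^sub>R (p + m) = (s * (2 * s)) *\<^sub>R x"
      by (simp add: p_def m_def scaleR_add_right scaleR_diff_right flip: scaleR_add_left mult_2)
    then have xpm: "x = s *\<^sub>R (p + m)" unfolding s3 by simp
    \<comment> \<open>Here \<open>2 * s\<close> is \<open>sqrt 2\<close>; this rational bound makes
      the error \<open>d + (3/2) * (2 * d) = 4 * d\<close>.\<close>
    have sle: "2 * s \<le> 3 / 2"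
    proof -
      have "(2 * s)\<^sup>2 \<le> (3/2)\<^sup>2" using s by (simp add: power2_eq_square)
      then show ?thesis by (rule power2_le_imp_le) simp
    qed
    define D where "D = norm y *\<^sub>R (2 *\<^sub>R A - E)"
    have "norm (2 *\<^sub>R A - E) \<le> 3"
      using norm_triangle_ineq4[of "2 *\<^sub>R A" E] A(1) E(1) by simp
    then have nD: "norm D \<le> 3 * norm y" by (simp add: D_def mult.commute mult_left_mono)
    have "\<pi> (2 *\<^sub>R A - E) x - w = (x - \<pi> E x) + (2 * s) *\<^sub>R (\<pi> A m - (p - \<pi> A p))"
    proof -
      have "2 *\<^sub>R \<pi> A x = (2 * s) *\<^sub>R (\<pi> A p + \<pi> A m)"
        by (subst xpm) (simp add: blinfun.scaleR_right blinfun.add_right)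
      moreover have "w = (2 * s) *\<^sub>R p - x" using xpm2 by (simp add: algebra_simps)
      ultimately show ?thesis
        by (simp add: diff scaleR blinfun.diff_left blinfun.scaleR_left algebra_simps)
    qed
    then have "norm (\<pi> (2 *\<^sub>R A - E) x - w) \<le> norm (x - \<pi> E x) + norm ((2 * s) *\<^sub>R (\<pi> A m - (p - \<pi> A p)))"
      by (simp only: norm_triangle_ineq)
    also have "norm ((2 * s) *\<^sub>R (\<pi> A m - (p - \<pi> A p))) = (2 * s) * norm (\<pi> A m - (p - \<pi> A p))"
      using s by simp
    also have "\<dots> \<le> (3/2) * (norm (\<pi> A m) + norm (p - \<pi> A p))"
      using sle s by (intro mult_mono norm_triangle_ineq4) auto
    finally have "norm (\<pi> (2 *\<^sub>R A - E) x - w) \<le> 4 * d"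
      unfolding distrib_left using A(2,3) E(2) by linarith
    moreover have "\<pi> D x - y = norm y *\<^sub>R (\<pi> (2 *\<^sub>R A - E) x - w)"
      unfolding scaleR_diff_right[of _ _ w] w(4)[symmetric]
      by (simp only: D_def scaleR blinfun.scaleR_left)
    ultimately have "norm (\<pi> D x - y) \<le> norm y * (4 * d)"
      by (simp add: mult_left_mono)
    then have "norm (\<pi> D x - y) \<le> 4 * norm y * d" by (simp add: mult_ac)
    with nD show ?thesis by blast
  qed
  then obtain D where D: "norm D \<le> 3 * norm y" "norm (\<pi> D x - y) \<le> 4 * norm y * d" by blast
  show thesis
  proof (rule that[of "a *\<^sub>C E + D"])
    have "norm (a *\<^sub>C E) \<le> cmod a" using E(1) by (simp add: norm_scaleC mult_left_le)
    then show "norm (a *\<^sub>C E + D) \<le> 4 * norm v"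
      using norm_triangle_ineq[of "a *\<^sub>C E" D] D(1) na ny by linarith
    have "\<pi> (a *\<^sub>C E + D) x - v = (\<pi> D x - y) - a *\<^sub>C (x - \<pi> E x)"
      by (simp add: v add blinfun.add_left scaleC scaleC_diff_right algebra_simps)
    then have "norm (\<pi> (a *\<^sub>C E + D) x - v) \<le> norm (\<pi> D x - y) + norm (a *\<^sub>C (x - \<pi> E x))"
      by (simp only: norm_triangle_ineq4)
    also have "\<dots> \<le> 4 * norm v * d + norm v * d"
      using D(2) ny na E(2) d
      by (intro add_mono order_trans[OF D(2)]) (auto simp: norm_scaleC intro!: mult_mono)
    also have "\<dots> = (norm v * 5) * d" by simp
    also have "\<dots> < (norm v * 5 + 1) * d" using d by (simp add: algebra_simps)
    also have "\<dots> = e" using norm_ge_zero[of v] by (simp add: d_def add_nonneg_eq_0_iff)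
    finally show "norm (\<pi> (a *\<^sub>C E + D) x - v) < e" .
  qed
qed

text \<open>The difference of the states is tested on a cutoff \<open>A\<close> that kills
  \<open>x\<close> and nearly fixes the direction \<open>w\<close> of the component of
  \<open>z\<close> orthogonal to \<open>x\<close>: the state of \<open>z\<close> gives about
  \<open>1 - a^2\<close>, that of \<open>x\<close> about \<open>0\<close>.\<close>

lemma overlap_bound:
  assumes x: "norm x = 1" and z: "norm z = 1" and a: "cinner x z = complex_of_real a"
  shows "1 - a\<^sup>2 \<le> norm (vector_state \<pi> z - vector_state \<pi> x)"
proof -
  define y where "y = z - a *\<^sub>R x"
  have zy: "z = a *\<^sub>R x + y" by (simp add: y_def)
  have xx: "cinner x x = 1" by (simp add: cinner_self x)
  have xy: "cinner x y = 0" by (simp add: y_def a cinner_simps xx)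
  have "(norm z)\<^sup>2 = a\<^sup>2 + (norm y)\<^sup>2"
    unfolding zy by (simp add: norm_add_sq cinner_simps xy x)
  then have ny: "(norm y)\<^sup>2 = 1 - a\<^sup>2" by (simp add: z)
  show ?thesis
  proof (cases "y = 0")
    case True
    then show ?thesis using ny by simp
  next
    case False
    define b where "b = norm y"
    have "b\<^sup>2 \<le> 1\<^sup>2" using ny by (simp add: b_def)
    then have b: "0 < b" "b \<le> 1" using False power2_le_imp_le[of b 1] by (auto simp: b_def)
    define w where "w = inverse b *\<^sub>R y"
    have w: "norm w = 1" "cinner w x = 0" "y = b *\<^sub>R w"
      using b xy cinner_commute[of y x] by (auto simp: w_def cinner_simps b_def)
    have a1: "\<bar>a\<bar> \<le> 1" using ny zero_le_power2[of "norm y"] by (simp add: abs_square_le_1)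
    show ?thesis
    proof (rule field_le_epsilon)
      fix e :: real assume e: "0 < e"
      obtain A where A: "norm A \<le> 1" "norm (w - \<pi> A w) < e / 3" "norm (\<pi> A x) < e / 3"
        using orthogonal_cutoff[OF w(1) x w(2), of "e / 3"] e by auto
      have zw: "cinner z w = complex_of_real b"
        using w cinner_commute[of x w] by (simp add: zy cinner_simps cinner_self)
      have "cinner z (\<pi> A z) = complex_of_real a * cinner z (\<pi> A x) + complex_of_real b * cinner z (\<pi> A w)"
        by (subst (2) zy) (simp add: w(3) blinfun.add_right blinfun.scaleR_right cinner_simps)
      moreover have "complex_of_real (b * b) = complex_of_real b * cinner z w" by (simp add: zw)
      ultimately have "complex_of_real (b * b) = (cinner z (\<pi> A z) - cinner x (\<pi> A x))
          + (complex_of_real b * cinner z (w - \<pi> A w) - complex_of_real a * cinner z (\<pi> A x) + cinner x (\<pi> A x))"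
        by (simp add: cinner_simps algebra_simps)
      then have "cmod (complex_of_real (b * b)) \<le> cmod (cinner z (\<pi> A z) - cinner x (\<pi> A x))
          + (cmod (complex_of_real b * cinner z (w - \<pi> A w)) + cmod (complex_of_real a * cinner z (\<pi> A x))
            + cmod (cinner x (\<pi> A x)))"
        by (simp only: order_trans[OF norm_triangle_ineq add_left_mono[OF norm_diff_add_le]])
      moreover have "cmod (cinner z (\<pi> A z) - cinner x (\<pi> A x)) \<le> norm (vector_state \<pi> z - vector_state \<pi> x) * norm A"
        by (rule norm_vector_state_diff_le) unfold_locales
      moreover have "norm (vector_state \<pi> z - vector_state \<pi> x) * norm A \<le> norm (vector_state \<pi> z - vector_state \<pi> x)"
        using A(1) by (simp add: mult_left_le)
      moreover have "cmod (complex_of_real b * cinner z (w - \<pi> A w)) \<le> 1 * (e / 3)"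
        unfolding norm_mult norm_of_real
        using b norm_cinner[of z "w - \<pi> A w"] A(2) z by (intro mult_mono) auto
      moreover have "cmod (complex_of_real a * cinner z (\<pi> A x)) \<le> 1 * (e / 3)"
        unfolding norm_mult norm_of_real
        using a1 norm_cinner[of z "\<pi> A x"] A(3) z by (intro mult_mono) auto
      moreover have "cmod (cinner x (\<pi> A x)) \<le> e / 3"
        using norm_cinner[of x "\<pi> A x"] A(3) x by simp
      moreover have "cmod (complex_of_real (b * b)) = 1 - a\<^sup>2"
      proof -
        have "cmod (complex_of_real (b * b)) = b\<^sup>2"
          unfolding norm_of_real by (simp add: power2_eq_square)
        then show ?thesis using ny by (simp add: b_def)
      qed
      ultimately show "1 - a\<^sup>2 \<le> norm (vector_state \<pi> z - vector_state \<pi> x) + e" by linarith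
    qed
  qed
qed

end

section \<open>Unitary operators and automorphisms\<close>

definition scalar_op :: "complex \<Rightarrow> ('a::complex_banach \<Rightarrow>\<^sub>L 'a)" where
  "scalar_op c = Blinfun (\<lambda>x. c *\<^sub>C x)"

lemma scalar_op_apply [simp]: "scalar_op c x = c *\<^sub>C x"
  unfolding scalar_op_def
  by (simp add: bounded_linear_Blinfun_apply bounded_bilinear.bounded_linear_right[OF bounded_bilinear_scaleC])

lemma bounded_linear_scalar_op: "bounded_linear scalar_op"
proof (rule bounded_linear_intro[of _ 1])
  show "norm (scalar_op c :: 'a \<Rightarrow>\<^sub>L 'a) \<le> norm c * 1" for c
    by (rule norm_blinfun_bound) (simp_all add: norm_scaleC)
qed (auto intro!: blinfun_eqI simp: blinfun.add_left blinfun.scaleR_left scaleC_add_left scaleR_scaleC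
    scaleR_conv_of_real)

lemma complex_linear_scalar_op: "complex_linear (scalar_op c)"
  by (simp add: complex_linear_def scaleC_scaleC mult.commute)

lemma unitary_cinner: "V \<in> unitaries \<Longrightarrow> cinner (V x) (V y) = cinner x y"
  by (simp add: unitaries_def)

lemma unitary_linear: "V \<in> unitaries \<Longrightarrow> V (c *\<^sub>C x) = c *\<^sub>C V x"
  by (simp add: unitaries_def complex_linear_def)

lemma unitary_norm: "V \<in> unitaries \<Longrightarrow> norm (V x) = norm x"
  by (metis norm_sq_cinner unitary_cinner norm_ge_zero power2_eq_imp_eq)

lemma unitary_inverse:
  fixes V :: "'h::complex_hilbert \<Rightarrow>\<^sub>L 'h"
  assumes V: "V \<in> unitaries"
  obtains W where "W \<in> unitaries" "W o\<^sub>L V = id_blinfun" "V o\<^sub>L W = id_blinfun"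
proof -
  define w where "w = inv (blinfun_apply V)"
  have surj: "surj V" using V by (simp add: unitaries_def)
  have inj: "inj V"
  proof (rule injI)
    fix x y assume "V x = V y"
    then have "V (x - y) = 0" by (simp add: blinfun.diff_right)
    then show "x = y" using unitary_norm[OF V, of "x - y"] by simp
  qed
  have Vw: "V (w x) = x" and wV: "w (V x) = x" for x
    using surj inj by (simp_all add: w_def surj_f_inv_f)
  have "bounded_linear w"
  proof (rule bounded_linear_intro[of _ 1])
    show "w (x + y) = w x + w y" for x y by (metis Vw wV blinfun.add_right)
    show "w (r *\<^sub>R x) = r *\<^sub>R w x" for r x by (metis Vw wV blinfun.scaleR_right)
    show "norm (w x) \<le> norm x * 1" for x using unitary_norm[OF V, of "w x"] by (simp add: Vw)
  qed
  then have W: "blinfun_apply (Blinfun w) = w" by (rule bounded_linear_Blinfun_apply)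
  show thesis
  proof (rule that[of "Blinfun w"])
    have "w (c *\<^sub>C x) = c *\<^sub>C w x" for c x by (metis Vw wV unitary_linear[OF V])
    moreover have "surj w" using wV by (metis surjI)
    moreover have "cinner (w x) (w y) = cinner x y" for x y
      using unitary_cinner[OF V, of "w x" "w y"] by (simp add: Vw)
    ultimately show "Blinfun w \<in> unitaries" by (simp add: unitaries_def complex_linear_def W)
  qed (rule blinfun_eqI, simp add: W Vw wV)+
qed

lemma unitary_compose: "V \<in> unitaries \<Longrightarrow> W \<in> unitaries \<Longrightarrow> V o\<^sub>L W \<in> unitaries"
  by (auto simp: unitaries_def complex_linear_compose comp_surj[unfolded comp_def])

lemma unitary_scalar_op:
  assumes "cmod c = 1"
  shows "scalar_op c \<in> unitaries"
proof -
  have cc: "cnj c * c = 1" using assms complex_norm_square[of c] by (simp add: mult.commute)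
  have "scalar_op c (cnj c *\<^sub>C y) = y" for y using cc by (simp add: scaleC_scaleC mult.commute)
  then have "surj (scalar_op c)" by (metis surjI)
  then show ?thesis
    using cc by (simp add: unitaries_def complex_linear_scalar_op cinner_simps mult.assoc[symmetric] mult.commute[of c])
qed

lemma automorphism_simps:
  assumes "\<alpha> \<in> automorphisms"
  shows "\<alpha> (c *\<^sub>C A) = c *\<^sub>C \<alpha> A" "\<alpha> (A * B) = \<alpha> A * \<alpha> B" "\<alpha> (star A) = star (\<alpha> A)"
  using assms by (auto simp: automorphisms_def complex_linear_def)

lemma automorphism_inverse:
  fixes \<alpha> :: "'b::cstar_algebra \<Rightarrow>\<^sub>L 'b"
  assumes \<alpha>: "\<alpha> \<in> automorphisms"
  obtains \<beta> where "\<beta> \<in> automorphisms" "\<forall>B. \<alpha> (\<beta> B) = B" "\<forall>B. \<beta> (\<alpha> B) = B"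
    "blinfun_apply \<beta> = inv (blinfun_apply \<alpha>)"
proof -
  define b where "b = inv (blinfun_apply \<alpha>)"
  have bij: "bij (blinfun_apply \<alpha>)" using \<alpha> by (simp add: automorphisms_def)
  then have ab: "\<alpha> (b x) = x" and ba: "b (\<alpha> x) = x" for x
    by (simp_all add: b_def bij_is_inj bij_is_surj surj_f_inv_f)
  have add: "b (x + y) = b x + b y" for x y by (metis ab ba blinfun.add_right)
  have scaleC: "b (c *\<^sub>C x) = c *\<^sub>C b x" for c x by (metis ab ba automorphism_simps(1)[OF \<alpha>])
  have mult: "b (x * y) = b x * b y" for x y by (metis ab ba automorphism_simps(2)[OF \<alpha>])
  have star: "b (star x) = star (b x)" for x by (metis ab ba automorphism_simps(3)[OF \<alpha>])
  have "bounded_linear b"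
  proof (rule bounded_linear_intro[of _ 1])
    show "b (r *\<^sub>R x) = r *\<^sub>R b x" for r x using scaleC[of "complex_of_real r"] by (simp add: scaleC_of_real)
    show "norm (b x) \<le> norm x * 1" for x using star_hom_norm_le[of b x] add scaleC mult star by simp
  qed (rule add)
  then have W: "blinfun_apply (Blinfun b) = b" by (rule bounded_linear_Blinfun_apply)
  show thesis
  proof (rule that[of "Blinfun b"])
    have "bij b" using bij by (simp add: b_def bij_imp_bij_inv)
    then show "Blinfun b \<in> automorphisms"
      by (simp add: automorphisms_def complex_linear_def W scaleC mult star)
  qed (simp_all add: W ab ba, simp add: b_def)
qed

lemma automorphism_norm:
  fixes \<alpha> :: "'b::cstar_algebra \<Rightarrow>\<^sub>L 'b"
  assumes \<alpha>: "\<alpha> \<in> automorphisms"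
  shows "norm (\<alpha> B) = norm B"
proof -
  have le: "norm (\<gamma> C) \<le> norm C" if "\<gamma> \<in> automorphisms" for \<gamma> :: "'b \<Rightarrow>\<^sub>L 'b" and C
    by (rule star_hom_norm_le[of "blinfun_apply \<gamma>"]) (simp_all add: automorphism_simps[OF that] blinfun.add_right)
  obtain \<beta> where \<beta>: "\<beta> \<in> automorphisms" "\<forall>B. \<alpha> (\<beta> B) = B" "\<forall>B. \<beta> (\<alpha> B) = B" "blinfun_apply \<beta> = inv (blinfun_apply \<alpha>)"
    by (rule automorphism_inverse[OF \<alpha>])
  show ?thesis using le[OF \<alpha>, of B] le[OF \<beta>(1), of "\<alpha> B"] by (simp add: \<beta>(3))
qed

lemma automorphism_compose:
  "\<alpha> \<in> automorphisms \<Longrightarrow> \<beta> \<in> automorphisms \<Longrightarrow> \<alpha> o\<^sub>L \<beta> \<in> automorphisms"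
proof -
  assume *: "\<alpha> \<in> automorphisms" "\<beta> \<in> automorphisms"
  have "blinfun_apply (\<alpha> o\<^sub>L \<beta>) = blinfun_apply \<alpha> \<circ> blinfun_apply \<beta>" by auto
  then have "bij (blinfun_apply (\<alpha> o\<^sub>L \<beta>))" using * by (simp add: automorphisms_def bij_comp)
  then show ?thesis using * by (simp add: automorphisms_def complex_linear_compose)
qed

lemma id_automorphism: "id_blinfun \<in> automorphisms"
  by (simp add: automorphisms_def complex_linear_id bij_id[unfolded id_def])

lemma irreducible_star_representation_automorphism:
  assumes "irreducible_star_representation \<pi>" "\<alpha> \<in> automorphisms"
  shows "irreducible_star_representation (\<lambda>B. \<pi> (\<alpha> B))"
proof -
  interpret irreducible_star_representation \<pi> by fact
  obtain \<beta> where \<beta>: "\<beta> \<in> automorphisms" "\<forall>B. \<alpha> (\<beta> B) = B" "\<forall>B. \<beta> (\<alpha> B) = B" "blinfun_apply \<beta> = inv (blinfun_apply \<alpha>)"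
    by (rule automorphism_inverse[OF assms(2)])
  obtain A where "\<pi> A \<noteq> 0" using nonzero by blast
  then have "\<pi> (\<alpha> (\<beta> A)) \<noteq> 0" by (simp add: \<beta>(2))
  then have nz: "\<exists>A. \<pi> (\<alpha> A) \<noteq> 0" by blast
  show ?thesis
  proof
    show "representation (\<lambda>B. \<pi> (\<alpha> B))"
      using nz by (simp add: representation_def complex_linear_def apply_scaleC automorphism_simps[OF assms(2)]
          add blinfun.add_right scaleC mult cinner_star)
    show "S = {0} \<or> S = UNIV"
      if S: "closed_complex_subspace S" "\<And>A x. x \<in> S \<Longrightarrow> \<pi> (\<alpha> A) x \<in> S" for S
    proof (rule irreducible[OF S(1)])
      show "\<pi> A x \<in> S" if "x \<in> S" for A x using S(2)[OF that, of "\<beta> A"] by (simp add: \<beta>(2))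
    qed
  qed
qed

text \<open>Pushing forward by \<open>\<alpha>\<close> becomes a twist of the representation by the
  inverse, so both states to be compared are vector states of representations on the same
  space.\<close>

lemma push_vector_state:
  assumes "star_representation \<pi>" "blinfun_apply \<beta> = inv (blinfun_apply \<alpha>)"
  shows "push_state \<alpha> (vector_state \<pi> x) = vector_state (\<lambda>B. \<pi> (\<beta> B)) x"
  by (simp add: push_state_def star_representation.vector_state_apply[OF assms(1)]
      assms(2)) (simp add: vector_state_def)

section \<open>Implementing unitaries and the choice of phase\<close>

text \<open>\<open>\<alpha>\<close> sits on the side of \<open>\<pi>'\<close>, so the relation
  composes: multiplying from the left by an implementer within \<open>\<pi>'\<close> moves
  \<open>\<alpha>\<close>.\<close>

definition implements ::
    "('b::cstar_algebra \<Rightarrow> ('h::complex_hilbert \<Rightarrow>\<^sub>L 'h)) \<Rightarrow> ('b \<Rightarrow> ('h \<Rightarrow>\<^sub>L 'h)) \<Rightarrow> ('h \<Rightarrow>\<^sub>L 'h) \<Rightarrow> ('b \<Rightarrow>\<^sub>L 'b) \<Rightarrow> bool"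
  where "implements \<pi> \<pi>' V \<alpha> \<longleftrightarrow> V \<in> unitaries \<and> (\<forall>B v. V (\<pi> B v) = \<pi>' (\<alpha> B) (V v))"

lemma implements_compose:
  "implements \<pi>' \<pi>' V \<alpha> \<Longrightarrow> implements \<pi> \<pi>' W \<beta> \<Longrightarrow> implements \<pi> \<pi>' (V o\<^sub>L W) (\<alpha> o\<^sub>L \<beta>)"
  by (simp add: implements_def unitary_compose)

text \<open>The unit number that turns a nonzero \<open>z\<close> onto the positive axis. At
  \<open>z = 0\<close> the value is \<open>0\<close>, and \<open>phase_mult\<close> holds there
  too.\<close>

definition phase :: "complex \<Rightarrow> complex" where
  "phase z = cnj z / complex_of_real (cmod z)"

lemma phase_mult: "phase z * z = complex_of_real (cmod z)"
  by (cases "z = 0") (simp_all add: phase_def complex_norm_square[symmetric] power2_eq_square mult.commute)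

lemma norm_phase: "z \<noteq> 0 \<Longrightarrow> cmod (phase z) = 1"
  by (simp add: phase_def norm_divide)

lemma phase_unique: "cmod c = 1 \<Longrightarrow> Im (c * z) = 0 \<Longrightarrow> 0 < Re (c * z) \<Longrightarrow> c = phase z"
proof -
  assume c: "cmod c = 1" "Im (c * z) = 0" "0 < Re (c * z)"
  then have z: "z \<noteq> 0" by auto
  have "w = complex_of_real (cmod w)" if "Im w = 0" "0 < Re w" for w
    using that by (simp add: complex_eq_iff cmod_def)
  from this[OF c(2,3)] have "c * z = phase z * z" using c(1) by (simp add: norm_mult phase_mult)
  then show "c = phase z" using z by simp
qed

lemma intertwiner_vector_state:
  assumes "star_representation \<rho>" "star_representation \<pi>" "V \<in> unitaries" "\<And>B v. V (\<rho> B v) = \<pi> B (V v)"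
  shows "vector_state \<pi> (V x) = vector_state \<rho> x"
  by (rule blinfun_eqI)
    (simp add: star_representation.vector_state_apply[OF assms(1)]
      star_representation.vector_state_apply[OF assms(2)] unitary_cinner[OF assms(3)] flip: assms(4))

text \<open>Inversion is Lipschitz because automorphisms are isometric: applying
  \<open>\<alpha>\<close> to \<open>\<beta> B - \<beta>' B\<close> gives
  \<open>(\<alpha>' - \<alpha>) (\<beta>' B)\<close>.\<close>

lemma norm_automorphism_inverse_diff:
  assumes "\<alpha> \<in> automorphisms" "\<alpha>' \<in> automorphisms" "\<And>B. \<alpha> (\<beta> B) = B" "\<And>B. \<alpha>' (\<beta>' B) = B" "\<And>B. \<beta>' (\<alpha>' B) = B"
  shows "norm (\<beta> B - \<beta>' B) \<le> norm (\<alpha> - \<alpha>') * norm (B :: 'b::cstar_algebra)"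
proof -
  have "norm (\<beta> B - \<beta>' B) = norm (\<alpha> (\<beta> B - \<beta>' B))" by (simp add: automorphism_norm[OF assms(1)])
  also have "\<alpha> (\<beta> B - \<beta>' B) = - ((\<alpha> - \<alpha>') (\<beta>' B))"
    by (simp add: blinfun.diff_right blinfun.diff_left assms)
  also have "norm \<dots> \<le> norm (\<alpha> - \<alpha>') * norm (\<beta>' B)" by (simp add: norm_blinfun)
  also have "norm (\<beta>' B) = norm B" using automorphism_norm[OF assms(2), of "\<beta>' B"] by (simp add: assms)
  finally show ?thesis .
qed

context irreducible_star_representation
begin

lemma exists_unit_vector: "\<exists>x::'b. norm x = 1"
proof -
  obtain x :: 'b where "x \<noteq> 0" using exists_nonzero_vector by blast
  then have "norm (inverse (norm x) *\<^sub>R x) = 1" by simp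
  then show ?thesis by blast
qed

text \<open>With the phase chosen so that \<open>\<langle>x, V x\<rangle>\<close> is nonnegative at
  a fixed unit vector \<open>x\<close>, \<open>overlap_bound\<close> puts \<open>V x\<close> near
  \<open>x\<close>. Any \<open>v\<close> is close to some \<open>\<pi> B x\<close> with
  \<open>norm B \<le> 4 * norm v\<close>, and
  \<open>V (\<pi> B x) = \<pi> (\<alpha> B) (V x)\<close> is then close to \<open>\<pi> B x\<close>,
  uniformly on bounded sets of \<open>v\<close>.\<close>

lemma near_identity_implemented:
  assumes e: "0 < e"
  obtains r where "0 < r" "\<And>\<alpha>. \<alpha> \<in> automorphisms \<Longrightarrow> norm (\<alpha> - id_blinfun) < r \<Longrightarrow>
    \<exists>V. implements \<pi> \<pi> V \<alpha> \<and> norm (V - id_blinfun) < e"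
proof -
  obtain x :: 'b where x: "norm x = 1" using exists_unit_vector by blast
  \<comment> \<open>The radius is \<open>k^2\<close> because the overlap controls the square of
    \<open>norm (V x - x)\<close>. This gives \<open>norm (V x - x) \<le> 2 * k\<close> and finally
    \<open>norm (V - id_blinfun) \<le> 12 * k\<close>, below \<open>e\<close>.\<close>
  define k where "k = min 1 (e / 20)"
  have k: "0 < k" "k \<le> 1" "20 * k \<le> e" using e by (auto simp: k_def)
  show thesis
  proof (rule that[of "k\<^sup>2"])
    show "0 < k\<^sup>2" using k by simp
    fix \<alpha> :: "'a \<Rightarrow>\<^sub>L 'a" assume \<alpha>: "\<alpha> \<in> automorphisms" and close: "norm (\<alpha> - id_blinfun) < k\<^sup>2"
    have k2: "k\<^sup>2 \<le> k" using k by (simp add: power2_eq_square mult_left_le)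
    obtain \<beta> where \<beta>: "\<beta> \<in> automorphisms" "\<forall>B. \<alpha> (\<beta> B) = B" "\<forall>B. \<beta> (\<alpha> B) = B" "blinfun_apply \<beta> = inv (blinfun_apply \<alpha>)"
    by (rule automorphism_inverse[OF \<alpha>])
    define \<rho> where "\<rho> B = \<pi> (\<beta> B)" for B
    have \<rho>: "irreducible_star_representation \<rho>"
      unfolding \<rho>_def[abs_def]
      by (rule irreducible_star_representation_automorphism[OF irreducible_star_representation_axioms \<beta>(1)])
    then interpret r: irreducible_star_representation \<rho> .
    have dist: "norm (vector_state \<rho> x - vector_state \<pi> x) \<le> k\<^sup>2"
    proof (rule norm_blinfun_bound)
      fix B
      have "norm (\<beta> B - id_blinfun B) \<le> norm (\<alpha> - id_blinfun) * norm B"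
        by (rule norm_automorphism_inverse_diff[OF \<alpha> id_automorphism]) (simp_all add: \<beta>(2,3))
      also have "\<dots> \<le> k\<^sup>2 * norm B" using close by (simp add: mult_right_mono)
      finally have n: "norm (\<beta> B - B) \<le> k\<^sup>2 * norm B" by simp
      have "(vector_state \<rho> x - vector_state \<pi> x) B = cinner x (\<pi> (\<beta> B - B) x)"
        by (simp add: blinfun.diff_left vector_state_apply r.vector_state_apply \<rho>_def diff cinner_simps)
      also have "cmod \<dots> \<le> norm (\<beta> B - B)"
        using norm_cinner[of x "\<pi> (\<beta> B - B) x"] norm_apply_le[of "\<beta> B - B" x] x by simp
      finally show "norm ((vector_state \<rho> x - vector_state \<pi> x) B) \<le> k\<^sup>2 * norm B" using n by simp
    qed simp
    also have "k\<^sup>2 < 2" using k k2 by simp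
    finally have "norm (vector_state \<rho> x - vector_state \<pi> x) < 2" .
    then obtain W where W: "W \<in> unitaries" "\<And>B v. W (\<rho> B v) = \<pi> B (W v)" "cinner x (W x) \<noteq> 0"
      using close_states_equivalent[OF \<rho> irreducible_star_representation_axioms x x] by blast
    define V where "V = scalar_op (phase (cinner x (W x))) o\<^sub>L W"
    have V: "V \<in> unitaries"
      unfolding V_def by (intro unitary_compose unitary_scalar_op norm_phase W)
    have V\<rho>: "V (\<rho> B v) = \<pi> B (V v)" for B v by (simp add: V_def W(2) apply_scaleC)
    have V\<pi>: "V (\<pi> B v) = \<pi> (\<alpha> B) (V v)" for B v using V\<rho>[of "\<alpha> B" v] by (simp add: \<rho>_def \<beta>(3))
    define a where "a = cmod (cinner x (W x))"
    have a: "cinner x (V x) = complex_of_real a" "0 \<le> a"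
      by (simp_all add: V_def cinner_simps phase_mult a_def)
    have nV: "norm (V v) = norm v" for v by (rule unitary_norm[OF V])
    have "vector_state \<pi> (V x) = vector_state \<rho> x"
      by (rule intertwiner_vector_state[OF r.star_representation_axioms star_representation_axioms V V\<rho>])
    then have "1 - a\<^sup>2 \<le> k\<^sup>2"
      using overlap_bound[OF x _ a(1)] dist nV[of x] x by simp
    moreover have "a \<le> 1" using norm_cinner[of x "V x"] a nV[of x] x by simp
    then have "a\<^sup>2 \<le> a" using a(2) by (simp add: power2_eq_square mult_left_le)
    moreover have "(norm (V x - x))\<^sup>2 = 2 - 2 * a"
      using a(1) cinner_commute[of "V x" x] by (simp add: norm_diff_sq nV x)
    ultimately have "(norm (V x - x))\<^sup>2 \<le> 2 * k\<^sup>2" by simp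
    also have "\<dots> \<le> (2 * k)\<^sup>2" by (simp add: power_mult_distrib)
    finally have Vx: "norm (V x - x) \<le> 2 * k" by (rule power2_le_imp_le) (use k in simp)
    have "norm ((V - id_blinfun) v) \<le> 12 * k * norm v" for v
    proof (rule field_le_epsilon)
      fix d :: real assume d: "0 < d"
      obtain B where B: "norm B \<le> 4 * norm v" "norm (\<pi> B x - v) < d / 2"
        using bounded_transitivity[OF x, of "d / 2" v] d by auto
      have "norm ((\<alpha> - id_blinfun) B) \<le> k * norm B"
        using norm_blinfun[of "\<alpha> - id_blinfun" B] close k2 mult_right_mono[of "norm (\<alpha> - id_blinfun)" k "norm B"]
        by simp
      then have 1: "norm (\<alpha> B - B) \<le> k * norm B" by (simp add: blinfun.diff_left)
      \<comment> \<open>Four terms: the change of \<open>B\<close> under \<open>\<alpha>\<close>,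
        the displacement of \<open>x\<close>, and the approximation error of \<open>v\<close> with
        and without \<open>V\<close>. The first two add up to \<open>3 * k * norm B\<close>, whence
        \<open>12 = 3 * 4\<close>.\<close>
      have "(V - id_blinfun) v = (\<pi> (\<alpha> B - B) (V x) + \<pi> B (V x - x)) - (V (\<pi> B x - v) - (\<pi> B x - v))"
        by (simp add: blinfun.diff_left blinfun.diff_right diff V\<pi>)
      then have "norm ((V - id_blinfun) v) \<le> (norm (\<pi> (\<alpha> B - B) (V x)) + norm (\<pi> B (V x - x)))
          + (norm (V (\<pi> B x - v)) + norm (\<pi> B x - v))"
        by (rule ssubst[of _ _ "\<lambda>a. norm a \<le> _"])
          (rule order_trans[OF norm_triangle_ineq4 add_mono[OF norm_triangle_ineq norm_triangle_ineq4]])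
      also have "norm (\<pi> (\<alpha> B - B) (V x)) \<le> k * norm B"
        using norm_apply_le[of "\<alpha> B - B" "V x"] 1 x by (simp add: nV)
      also have "norm (\<pi> B (V x - x)) \<le> norm B * (2 * k)"
        using norm_apply_le[of B "V x - x"] mult_left_mono[OF Vx norm_ge_zero[of B]] by simp
      also have "k * norm B + norm B * (2 * k) = 3 * k * norm B" by simp
      also have "3 * k * norm B \<le> 3 * k * (4 * norm v)" using B(1) k by (intro mult_left_mono) auto
      finally show "norm ((V - id_blinfun) v) \<le> 12 * k * norm v + d" using B(2) by (simp add: nV)
    qed
    then have "norm (V - id_blinfun) \<le> 12 * k" using k by (intro norm_blinfun_bound) auto
    then have "norm (V - id_blinfun) < e" using k by simp
    then show "\<exists>V. implements \<pi> \<pi> V \<alpha> \<and> norm (V - id_blinfun) < e"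
      using V V\<pi> by (auto simp: implements_def)
  qed
qed

end

section \<open>The section and the unitary in terms of an implementing unitary\<close>

locale irreducible_pair =
  p: irreducible_star_representation \<pi> + p': irreducible_star_representation \<pi>'
  for \<pi> \<pi>' :: "'b::cstar_algebra \<Rightarrow> ('h::complex_hilbert \<Rightarrow>\<^sub>L 'h)"
begin

lemma push_eq_vector_state:
  assumes "\<alpha> \<in> automorphisms" "implements \<pi> \<pi>' V \<alpha>"
  shows "push_state \<alpha> (vector_state \<pi> x) = vector_state \<pi>' (V x)"
proof -
  obtain \<beta> where \<beta>: "\<beta> \<in> automorphisms" "\<forall>B. \<alpha> (\<beta> B) = B" "\<forall>B. \<beta> (\<alpha> B) = B" "blinfun_apply \<beta> = inv (blinfun_apply \<alpha>)"
    by (rule automorphism_inverse[OF assms(1)])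
  interpret r: irreducible_star_representation "\<lambda>B. \<pi> (\<beta> B)"
    by (rule irreducible_star_representation_automorphism[OF p.irreducible_star_representation_axioms \<beta>(1)])
  have "vector_state \<pi>' (V x) = vector_state (\<lambda>B. \<pi> (\<beta> B)) x"
    using assms(2) \<beta>(2) by (intro intertwiner_vector_state[OF r.star_representation_axioms p'.star_representation_axioms])
      (auto simp: implements_def)
  then show ?thesis by (simp add: push_vector_state[OF p.star_representation_axioms \<beta>(4)])
qed

lemma triple_domain_implementer:
  assumes "(\<alpha>, \<Omega>, \<Psi>) \<in> triple_domain \<pi> \<pi>'"
  obtains V where "implements \<pi> \<pi>' V \<alpha>" "cinner \<Psi> (V \<Omega>) \<noteq> 0"
proof -
  have \<alpha>: "\<alpha> \<in> automorphisms" and n: "norm \<Omega> = 1" "norm \<Psi> = 1"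
    and ball: "push_state \<alpha> (vector_state \<pi> \<Omega>) \<in> ball2 (vector_state \<pi>' \<Psi>)"
    using assms by (auto simp: triple_domain_def unit_sphere_def)
  obtain \<beta> where \<beta>: "\<beta> \<in> automorphisms" "\<forall>B. \<alpha> (\<beta> B) = B" "\<forall>B. \<beta> (\<alpha> B) = B" "blinfun_apply \<beta> = inv (blinfun_apply \<alpha>)"
    by (rule automorphism_inverse[OF \<alpha>])
  have r: "irreducible_star_representation (\<lambda>B. \<pi> (\<beta> B))"
    by (rule irreducible_star_representation_automorphism[OF p.irreducible_star_representation_axioms \<beta>(1)])
  have "norm (vector_state (\<lambda>B. \<pi> (\<beta> B)) \<Omega> - vector_state \<pi>' \<Psi>) < 2"
    using ball by (simp add: ball2_def push_vector_state[OF p.star_representation_axioms \<beta>(4)])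
  then obtain V where V: "V \<in> unitaries" "\<And>B v. V (\<pi> (\<beta> B) v) = \<pi>' B (V v)" "cinner \<Psi> (V \<Omega>) \<noteq> 0"
    using close_states_equivalent[OF r p'.irreducible_star_representation_axioms n] by blast
  have "V (\<pi> B v) = \<pi>' (\<alpha> B) (V v)" for B v using V(2)[of "\<alpha> B" v] by (simp add: \<beta>(3))
  then have "implements \<pi> \<pi>' V \<alpha>" unfolding implements_def using V(1) by blast
  then show thesis using V(3) by (rule that)
qed

text \<open>Holds for every implementer \<open>V\<close>: another one maps \<open>\<Omega>\<close>
  to a multiple of \<open>V \<Omega>\<close>, since the two image vectors have the same state. This
  freedom later permits a smooth local choice of \<open>V\<close>.\<close>

lemma section_map_formula:
  assumes O: "(\<alpha>, \<Omega>, \<Psi>) \<in> triple_domain \<pi> \<pi>'" and V: "implements \<pi> \<pi>' V \<alpha>"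
  shows "cinner \<Psi> (V \<Omega>) \<noteq> 0"
    and "section_map \<pi> \<pi>' (\<alpha>, \<Omega>, \<Psi>) = phase (cinner \<Psi> (V \<Omega>)) *\<^sub>C V \<Omega>"
proof -
  have \<alpha>: "\<alpha> \<in> automorphisms" and n: "norm \<Omega> = 1"
    using O by (auto simp: triple_domain_def unit_sphere_def)
  define \<omega> where "\<omega> = push_state \<alpha> (vector_state \<pi> \<Omega>)"
  define z where "z = cinner \<Psi> (V \<Omega>)"
  have nV: "norm (V \<Omega>) = 1" using V n by (simp add: implements_def unitary_norm)
  then have V0: "V \<Omega> \<noteq> 0" by auto
  have \<omega>V: "\<omega> = vector_state \<pi>' (V \<Omega>)" unfolding \<omega>_def by (rule push_eq_vector_state[OF \<alpha> V])
  obtain W where W: "implements \<pi> \<pi>' W \<alpha>" "cinner \<Psi> (W \<Omega>) \<noteq> 0"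
    using triple_domain_implementer[OF O] by blast
  have "vector_state \<pi>' (W \<Omega>) = vector_state \<pi>' (V \<Omega>)"
    using push_eq_vector_state[OF \<alpha> W(1), of \<Omega>] \<omega>V by (simp add: \<omega>_def)
  then obtain c where "W \<Omega> = c *\<^sub>C V \<Omega>" using p'.vector_state_eq_imp_proportional V0 by blast
  then show z0: "cinner \<Psi> (V \<Omega>) \<noteq> 0" using W(2) by (auto simp: cinner_simps)
  have "state_section \<pi>' \<Psi> \<omega> = phase z *\<^sub>C V \<Omega>"
    unfolding state_section_def
  proof (rule the_equality)
    have "vector_state \<pi>' (phase z *\<^sub>C V \<Omega>) = \<omega>"
    proof (rule blinfun_eqI)
      have "cnj (phase z) * phase z = 1"
        using norm_phase[of z] z0 complex_norm_square[of "phase z"] by (simp add: z_def mult.commute)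
      then show "vector_state \<pi>' (phase z *\<^sub>C V \<Omega>) B = \<omega> B" for B
        by (simp add: \<omega>V p'.vector_state_apply p'.apply_scaleC cinner_simps mult.assoc[symmetric] mult.commute[of "phase z"])
    qed
    then show "norm (phase z *\<^sub>C V \<Omega>) = 1 \<and> vector_state \<pi>' (phase z *\<^sub>C V \<Omega>) = \<omega>
        \<and> Im (cinner \<Psi> (phase z *\<^sub>C V \<Omega>)) = 0 \<and> 0 < Re (cinner \<Psi> (phase z *\<^sub>C V \<Omega>))"
      using z0 norm_phase[of z] by (simp add: norm_scaleC nV cinner_simps phase_mult flip: z_def)
  next
    fix \<Theta>
    assume \<Theta>: "norm \<Theta> = 1 \<and> vector_state \<pi>' \<Theta> = \<omega> \<and> Im (cinner \<Psi> \<Theta>) = 0 \<and> 0 < Re (cinner \<Psi> \<Theta>)"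
    then obtain c where c: "\<Theta> = c *\<^sub>C V \<Omega>" using p'.vector_state_eq_imp_proportional[of \<Theta> "V \<Omega>"] V0 \<omega>V by auto
    have "cmod c = 1" using \<Theta> nV by (simp add: c norm_scaleC)
    then have "c = phase z" using \<Theta> phase_unique[of c z] by (simp add: c cinner_simps z_def)
    then show "\<Theta> = phase z *\<^sub>C V \<Omega>" by (simp add: c)
  qed
  then show "section_map \<pi> \<pi>' (\<alpha>, \<Omega>, \<Psi>) = phase (cinner \<Psi> (V \<Omega>)) *\<^sub>C V \<Omega>"
    by (simp add: section_map_def \<omega>_def z_def)
qed

text \<open>The defining relation fixes \<open>U\<close> on the dense orbit of
  \<open>\<Omega>\<close>, so uniqueness and the explicit form come together.\<close>

lemma intertwining_map_formula:
  assumes U: "intertwining_unitary_map \<pi> \<pi>' U"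
    and O: "(\<alpha>, \<Omega>, \<Psi>) \<in> triple_domain \<pi> \<pi>'" and V: "implements \<pi> \<pi>' V \<alpha>"
  shows "U (\<alpha>, \<Omega>, \<Psi>) = scalar_op (phase (cinner \<Psi> (V \<Omega>))) o\<^sub>L V"
proof (rule blinfun_eqI)
  fix v
  have "\<Omega> \<noteq> 0" using O by (auto simp: triple_domain_def unit_sphere_def)
  then have dense: "closure (range (\<lambda>B. \<pi> B \<Omega>)) = UNIV" by (rule p.cyclic)
  show "U (\<alpha>, \<Omega>, \<Psi>) v = (scalar_op (phase (cinner \<Psi> (V \<Omega>))) o\<^sub>L V) v"
  proof (rule dense_induct[OF dense, of _ v])
    show "closed {v. U (\<alpha>, \<Omega>, \<Psi>) v = (scalar_op (phase (cinner \<Psi> (V \<Omega>))) o\<^sub>L V) v}"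
      by (intro closed_Collect_eq continuous_intros)
    fix v assume "v \<in> range (\<lambda>B. \<pi> B \<Omega>)"
    then obtain B where v: "v = \<pi> B \<Omega>" by blast
    have "U (\<alpha>, \<Omega>, \<Psi>) v = \<pi>' (\<alpha> B) (section_map \<pi> \<pi>' (\<alpha>, \<Omega>, \<Psi>))"
      using U O by (auto simp: intertwining_unitary_map_def v)
    also have "\<dots> = (scalar_op (phase (cinner \<Psi> (V \<Omega>))) o\<^sub>L V) v"
      using V by (simp add: section_map_formula(2)[OF O V] v implements_def p'.apply_scaleC)
    finally show "U (\<alpha>, \<Omega>, \<Psi>) v = (scalar_op (phase (cinner \<Psi> (V \<Omega>))) o\<^sub>L V) v" .
  qed
qed

text \<open>Implementers are chosen point by point without any regularity; smoothness is shown for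
  the resulting formula, which does not see the choice.\<close>

lemma intertwining_map_exists: "\<exists>!U. intertwining_unitary_map \<pi> \<pi>' U"
proof -
  obtain W where W: "\<And>\<alpha> \<Omega> \<Psi>. (\<alpha>, \<Omega>, \<Psi>) \<in> triple_domain \<pi> \<pi>' \<Longrightarrow> implements \<pi> \<pi>' (W (\<alpha>, \<Omega>, \<Psi>)) \<alpha>"
  proof -
    have "\<forall>x. \<exists>V. x \<in> triple_domain \<pi> \<pi>' \<longrightarrow> implements \<pi> \<pi>' V (fst x)"
      using triple_domain_implementer by (metis prod.collapse)
    then obtain W where "\<forall>x. x \<in> triple_domain \<pi> \<pi>' \<longrightarrow> implements \<pi> \<pi>' (W x) (fst x)" by metis
    then show thesis using that by (metis fst_conv)
  qed
  define U where "U = (\<lambda>(\<alpha>, \<Omega>, \<Psi>)\<in>triple_domain \<pi> \<pi>'.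
    scalar_op (phase (cinner \<Psi> (W (\<alpha>, \<Omega>, \<Psi>) \<Omega>))) o\<^sub>L W (\<alpha>, \<Omega>, \<Psi>))"
  have "intertwining_unitary_map \<pi> \<pi>' U"
    unfolding intertwining_unitary_map_def
  proof (intro conjI PiE_I ballI)
    fix x assume x: "x \<in> triple_domain \<pi> \<pi>'"
    obtain \<alpha> \<Omega> \<Psi> where xe: "x = (\<alpha>, \<Omega>, \<Psi>)" by (metis prod.collapse)
    note O = x[unfolded xe]
    have Ux: "U x = scalar_op (phase (cinner \<Psi> (W x \<Omega>))) o\<^sub>L W x"
      using O by (simp add: U_def xe)
    have z: "cinner \<Psi> (W x \<Omega>) \<noteq> 0" using section_map_formula(1)[OF O W[OF O]] by (simp add: xe)
    show "U x \<in> unitaries"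
      unfolding Ux using W[OF O] z by (intro unitary_compose unitary_scalar_op norm_phase) (auto simp: implements_def xe)
    have "\<forall>B. U x (\<pi> B \<Omega>) = \<pi>' (\<alpha> B) (section_map \<pi> \<pi>' (\<alpha>, \<Omega>, \<Psi>))"
      using W[OF O] by (simp add: Ux[unfolded xe] section_map_formula(2)[OF O W[OF O]] implements_def p'.apply_scaleC xe)
    then show "case x of (\<alpha>, \<Omega>, \<Psi>) \<Rightarrow> \<forall>B. U (\<alpha>, \<Omega>, \<Psi>) (\<pi> B \<Omega>) = \<pi>' (\<alpha> B) (section_map \<pi> \<pi>' (\<alpha>, \<Omega>, \<Psi>))"
      by (simp add: xe)
  qed (simp add: U_def)
  moreover have "U1 = U2" if "intertwining_unitary_map \<pi> \<pi>' U1" "intertwining_unitary_map \<pi> \<pi>' U2" for U1 U2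
  proof (rule PiE_ext)
    show "U1 \<in> triple_domain \<pi> \<pi>' \<rightarrow>\<^sub>E unitaries" "U2 \<in> triple_domain \<pi> \<pi>' \<rightarrow>\<^sub>E unitaries"
      using that by (simp_all add: intertwining_unitary_map_def)
    fix x assume "x \<in> triple_domain \<pi> \<pi>'"
    moreover obtain \<alpha> \<Omega> \<Psi> where "x = (\<alpha>, \<Omega>, \<Psi>)" by (metis prod.collapse)
    ultimately show "U1 x = U2 x"
      using intertwining_map_formula[OF that(1) _ W] intertwining_map_formula[OF that(2) _ W] by simp
  qed
  ultimately show ?thesis by blast
qed

end

section \<open>Calculus of smooth maps\<close>

abbreviation wt :: "'a::real_normed_vector list \<Rightarrow> real" where
  "wt vs \<equiv> prod_list (map norm vs)"

lemma wt_nonneg [simp]: "0 \<le> wt vs"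
  by (induction vs) auto

lemma wt_map_nonneg [simp]: "0 \<le> prod_list (map (norm \<circ> f) vs)"
  by (induction vs) auto

text \<open>For \<open>x\<close> in \<open>W\<close> this is not a punctured neighbourhood, so an
  estimate that holds eventually also holds at \<open>y = x\<close>. In filter form finitely many
  estimates can be combined without handling radii.\<close>

definition near :: "'a::real_normed_vector \<Rightarrow> 'a set \<Rightarrow> 'a filter" where
  "near x W = inf (nhds x) (principal W)"

lemma eventually_near:
  "eventually P (near x W) \<longleftrightarrow> (\<exists>d>0. \<forall>y\<in>W. norm (y - x) < d \<longrightarrow> P y)"
  unfolding near_def eventually_inf_principal eventually_nhds_metric dist_norm by blast

text \<open>The derivatives without the function: constructions act on the witness \<open>D\<close>,
  and the function is its value at the empty list.\<close>

definition smooth_tower ::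
  "'a::real_normed_vector set \<Rightarrow> 'a set \<Rightarrow> ('a \<Rightarrow> 'a list \<Rightarrow> 'b::real_normed_vector) \<Rightarrow> bool" where
  "smooth_tower E W D \<longleftrightarrow>
        (\<forall>x\<in>W. \<forall>n. bounded_multilinear_on E n (D x))
      \<and> (\<forall>n. \<forall>x\<in>W. \<forall>e>0. \<forall>\<^sub>F y in near x W. \<forall>vs. length vs = n \<and> set vs \<subseteq> E \<longrightarrow>
              norm (D y vs - D x vs - D x ((y - x) # vs)) \<le> e * norm (y - x) * wt vs)"

lemma smooth_on_iff:
  "smooth_on E W f \<longleftrightarrow> openin (top_of_set E) W \<and> (\<exists>D. (\<forall>x\<in>W. D x [] = f x) \<and> smooth_tower E W D)"
  unfolding smooth_on_def smooth_tower_def eventually_near by blast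

lemma bounded_multilinear_onD:
  assumes "bounded_multilinear_on E n M" "length us + length vs + 1 = n" "set us \<subseteq> E" "set vs \<subseteq> E" "v \<in> E" "w \<in> E"
  shows "M (us @ (v + w) # vs) = M (us @ v # vs) + M (us @ w # vs)"
    and "M (us @ (c *\<^sub>R v) # vs) = c *\<^sub>R M (us @ v # vs)"
  using assms unfolding bounded_multilinear_on_def by blast+

lemma bounded_multilinear_on_bound:
  assumes "bounded_multilinear_on E n M"
  shows "\<exists>K\<ge>0. \<forall>vs. length vs = n \<and> set vs \<subseteq> E \<longrightarrow> norm (M vs) \<le> K * wt vs"
proof -
  obtain K where K: "\<And>vs. length vs = n \<and> set vs \<subseteq> E \<Longrightarrow> norm (M vs) \<le> K * wt vs"
    using assms unfolding bounded_multilinear_on_def by blast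
  have "norm (M vs) \<le> \<bar>K\<bar> * wt vs" if "length vs = n \<and> set vs \<subseteq> E" for vs
    using K[OF that] mult_right_mono[OF abs_ge_self[of K] wt_nonneg[of vs]] by linarith
  then show ?thesis by (intro exI[of _ "\<bar>K\<bar>"]) simp
qed

text \<open>Linearity in the first slot propagates to the later ones, since they are obtained from it by
  differentiation.\<close>

lemma smooth_towerI:
  fixes D :: "'a::real_normed_vector \<Rightarrow> 'a list \<Rightarrow> 'b::real_normed_vector"
  assumes E: "subspace E" and W: "openin (top_of_set E) W"
    and add: "\<And>x v w vs. x \<in> W \<Longrightarrow> v \<in> E \<Longrightarrow> w \<in> E \<Longrightarrow> set vs \<subseteq> E \<Longrightarrow> D x ((v + w) # vs) = D x (v # vs) + D x (w # vs)"
    and scale: "\<And>x c v vs. x \<in> W \<Longrightarrow> v \<in> E \<Longrightarrow> set vs \<subseteq> E \<Longrightarrow> D x ((c *\<^sub>R v) # vs) = c *\<^sub>R D x (v # vs)"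
    and bound: "\<And>x n. x \<in> W \<Longrightarrow> \<exists>K. \<forall>vs. length vs = n \<and> set vs \<subseteq> E \<longrightarrow> norm (D x vs) \<le> K * wt vs"
    and deriv: "\<And>n x e. x \<in> W \<Longrightarrow> 0 < e \<Longrightarrow> \<forall>\<^sub>F y in near x W. \<forall>vs. length vs = n \<and> set vs \<subseteq> E \<longrightarrow>
              norm (D y vs - D x vs - D x ((y - x) # vs)) \<le> e * norm (y - x) * wt vs"
  shows "smooth_tower E W D"
proof -
  have WE: "W \<subseteq> E" using W by (rule openin_imp_subset)
  \<comment> \<open>A linear relation among the values at three argument lists, valid throughout
    \<open>W\<close>, differentiates to the same relation with \<open>u\<close> prepended. Three
    terms suffice for additivity; homogeneity uses a zero coefficient.\<close>
  have diff: "a *\<^sub>R D x (u # p) + b *\<^sub>R D x (u # q) + c *\<^sub>R D x (u # r) = 0"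
    if zero: "\<And>y. y \<in> W \<Longrightarrow> a *\<^sub>R D y p + b *\<^sub>R D y q + c *\<^sub>R D y r = 0"
      and sub: "x \<in> W" "u \<in> E" "set p \<subseteq> E" "set q \<subseteq> E" "set r \<subseteq> E"
    for a b c p q r x u
  proof -
    define G where "G = a *\<^sub>R D x (u # p) + b *\<^sub>R D x (u # q) + c *\<^sub>R D x (u # r)"
    define C where "C = norm u * (\<bar>a\<bar> * wt p + \<bar>b\<bar> * wt q + \<bar>c\<bar> * wt r)"
    have "norm G \<le> e * C" if e: "0 < e" for e
    proof -
      have "\<forall>\<^sub>F y in near x W. \<forall>vs. vs = p \<or> vs = q \<or> vs = r \<longrightarrow>
          norm (D y vs - D x vs - D x ((y - x) # vs)) \<le> e * norm (y - x) * wt vs"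
        using deriv[OF sub(1) e, of "length p"] deriv[OF sub(1) e, of "length q"] deriv[OF sub(1) e, of "length r"]
        by eventually_elim (use sub in auto)
      then obtain d where d: "0 < d" "\<And>y vs. y \<in> W \<Longrightarrow> norm (y - x) < d \<Longrightarrow> vs = p \<or> vs = q \<or> vs = r \<Longrightarrow>
          norm (D y vs - D x vs - D x ((y - x) # vs)) \<le> e * norm (y - x) * wt vs"
        unfolding eventually_near by blast
      obtain k where k: "0 < k" "\<And>y. y \<in> E \<Longrightarrow> dist y x < k \<Longrightarrow> y \<in> W"
        using W sub(1) unfolding openin_euclidean_subtopology_iff by metis
      \<comment> \<open>Small enough that \<open>x + t u\<close> stays in \<open>W\<close> and
        within reach of the derivative estimates; dividing by \<open>t\<close> afterwards leaves the
        error \<open>e * C\<close> with \<open>e\<close> arbitrary.\<close>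
      define t where "t = min k d / (2 * (norm u + 1))"
      have t: "0 < t" using k d by (simp add: t_def add_nonneg_pos)
      have "t * norm u < min k d"
      proof -
        have "t * norm u \<le> t * (norm u + 1)" using t by simp
        also have "\<dots> = min k d / 2"
          using norm_ge_zero[of u] by (simp add: t_def field_simps add_nonneg_eq_0_iff)
        finally show ?thesis using k(1) d(1) by simp
      qed
      then have tu: "norm (t *\<^sub>R u) < k" "norm (t *\<^sub>R u) < d" using t by auto
      define y where "y = x + t *\<^sub>R u"
      have yE: "y \<in> E" unfolding y_def using E sub WE by (auto intro!: subspace_add subspace_scale)
      have yW: "y \<in> W" using k(2)[OF yE] tu(1) by (simp add: y_def dist_norm)
      have each: "norm (D y vs - D x vs - t *\<^sub>R D x (u # vs)) \<le> e * (t * norm u) * wt vs"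
        if "vs = p \<or> vs = q \<or> vs = r" for vs
        using d(2)[OF yW _ that] tu(2) scale[OF sub(1,2), of vs t] that sub t by (auto simp: y_def)
      have "t *\<^sub>R G = (a *\<^sub>R D y p + b *\<^sub>R D y q + c *\<^sub>R D y r) - (a *\<^sub>R D x p + b *\<^sub>R D x q + c *\<^sub>R D x r)
          - (a *\<^sub>R (D y p - D x p - t *\<^sub>R D x (u # p)) + b *\<^sub>R (D y q - D x q - t *\<^sub>R D x (u # q))
             + c *\<^sub>R (D y r - D x r - t *\<^sub>R D x (u # r)))"
        by (simp add: G_def scaleR_add_right scaleR_diff_right mult.commute)
      then have "norm (t *\<^sub>R G) = norm (0 - 0 - (a *\<^sub>R (D y p - D x p - t *\<^sub>R D x (u # p)) + b *\<^sub>R (D y q - D x q - t *\<^sub>R D x (u # q))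
             + c *\<^sub>R (D y r - D x r - t *\<^sub>R D x (u # r))))"
        by (simp only: zero[OF yW] zero[OF sub(1)])
      also have "\<dots> = norm (a *\<^sub>R (D y p - D x p - t *\<^sub>R D x (u # p)) + b *\<^sub>R (D y q - D x q - t *\<^sub>R D x (u # q))
             + c *\<^sub>R (D y r - D x r - t *\<^sub>R D x (u # r)))"
        by (simp only: diff_self diff_0 norm_minus_cancel)
      also have "\<dots> \<le> \<bar>a\<bar> * norm (D y p - D x p - t *\<^sub>R D x (u # p)) + \<bar>b\<bar> * norm (D y q - D x q - t *\<^sub>R D x (u # q))
             + \<bar>c\<bar> * norm (D y r - D x r - t *\<^sub>R D x (u # r))"
        by (rule order_trans[OF norm_triangle_ineq add_mono[OF order_trans[OF norm_triangle_ineq]]]) simp_all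
      also have "\<dots> \<le> \<bar>a\<bar> * (e * (t * norm u) * wt p) + \<bar>b\<bar> * (e * (t * norm u) * wt q) + \<bar>c\<bar> * (e * (t * norm u) * wt r)"
        by (intro add_mono mult_left_mono each) auto
      also have "\<dots> = t * (e * C)" by (simp add: C_def algebra_simps)
      finally show ?thesis using t by simp
    qed
    then have le: "norm G \<le> e" if "0 < e" for e
    proof -
      have C: "0 \<le> C" by (simp add: C_def)
      have "norm G \<le> e / (C + 1) * C" using \<open>\<And>e. 0 < e \<Longrightarrow> norm G \<le> e * C\<close>[of "e / (C + 1)"] that C by simp
      also have "\<dots> \<le> e" using that C by (simp add: field_simps)
      finally show ?thesis .
    qed
    have "norm G \<le> 0" by (rule field_le_epsilon) (use le in simp)
    then show ?thesis by (simp add: G_def)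
  qed
  have "bounded_multilinear_on E n (D x)" if x: "x \<in> W" for x n
    unfolding bounded_multilinear_on_def
  proof (intro conjI allI ballI impI)
    fix us vs :: "'a list" and v w :: 'a and c :: real
    assume vw: "v \<in> E" "w \<in> E" and "length us + length vs + 1 = n \<and> set us \<subseteq> E \<and> set vs \<subseteq> E"
    then have us: "set us \<subseteq> E" and vs: "set vs \<subseteq> E" by auto
    have "\<forall>y\<in>W. 1 *\<^sub>R D y (us @ (v + w) # vs) + (-1) *\<^sub>R D y (us @ v # vs) + (-1) *\<^sub>R D y (us @ w # vs) = 0"
      using us
    proof (induction us)
      case Nil
      then show ?case using add vw vs by simp
    next
      case (Cons u us)
      have "v + w \<in> E" using E vw by (rule subspace_add)
      then show ?case using Cons diff[of 1 "us @ (v + w) # vs" "-1" "us @ v # vs" "-1" "us @ w # vs"] vw vs by simp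
    qed
    with x have "D x (us @ (v + w) # vs) - D x (us @ v # vs) - D x (us @ w # vs) = 0" by auto
    then show "D x (us @ (v + w) # vs) = D x (us @ v # vs) + D x (us @ w # vs)" by (simp add: algebra_simps)
    have "\<forall>y\<in>W. 1 *\<^sub>R D y (us @ (c *\<^sub>R v) # vs) + (-c) *\<^sub>R D y (us @ v # vs) + 0 *\<^sub>R D y vs = 0"
      using us
    proof (induction us)
      case Nil
      then show ?case using scale vw vs by simp
    next
      case (Cons u us)
      have "c *\<^sub>R v \<in> E" using E vw(1) by (rule subspace_scale)
      then show ?case using Cons diff[of 1 "us @ (c *\<^sub>R v) # vs" "-c" "us @ v # vs" 0 "vs"] vw vs by simp
    qed
    with x show "D x (us @ (c *\<^sub>R v) # vs) = c *\<^sub>R D x (us @ v # vs)" by auto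
  qed (use bound[OF x] in blast)
  with deriv show ?thesis unfolding smooth_tower_def by blast
qed

lemma smooth_on_cong:
  assumes "smooth_on E W f" "\<And>x. x \<in> W \<Longrightarrow> f x = g x"
  shows "smooth_on E W g"
  using assms unfolding smooth_on_iff by auto

lemma smooth_on_openin: "smooth_on E W f \<Longrightarrow> openin (top_of_set E) W"
  by (simp add: smooth_on_iff)

lemma smooth_on_empty: "smooth_on E {} f"
  by (simp add: smooth_on_iff smooth_tower_def)

section \<open>Linear, constant, paired and bilinear maps\<close>

text \<open>Linearity and boundedness are asked for on \<open>E\<close> alone: the choice of
  \<open>K(\<delta>)\<close>, to which this is applied, is known to have them only on symmetric
  derivations.\<close>

lemma smooth_on_linear:
  assumes E: "subspace E" and W: "openin (top_of_set E) W"
    and add: "\<And>v w. v \<in> E \<Longrightarrow> w \<in> E \<Longrightarrow> f (v + w) = f v + f w"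
    and scale: "\<And>c v. v \<in> E \<Longrightarrow> f (c *\<^sub>R v) = c *\<^sub>R f v"
    and bound: "\<And>v. v \<in> E \<Longrightarrow> norm (f v) \<le> K * norm v"
  shows "smooth_on E W f"
proof -
  define D where "D x vs = (case vs of [] \<Rightarrow> f x | [h] \<Rightarrow> f h | _ \<Rightarrow> 0)" for x vs
  have WE: "W \<subseteq> E" using W by (rule openin_imp_subset)
  have "smooth_tower E W D"
  proof (rule smooth_towerI[OF E W])
    show "\<exists>K. \<forall>vs. length vs = n \<and> set vs \<subseteq> E \<longrightarrow> norm (D x vs) \<le> K * wt vs" for x n
      by (rule exI[of _ "if n = 0 then norm (f x) else \<bar>K\<bar>"])
        (auto simp: D_def split: list.splits intro: order_trans[OF bound mult_right_mono[OF abs_ge_self norm_ge_zero]])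
    show "\<forall>\<^sub>F y in near x W. \<forall>vs. length vs = n \<and> set vs \<subseteq> E \<longrightarrow>
        norm (D y vs - D x vs - D x ((y - x) # vs)) \<le> e * norm (y - x) * wt vs"
      if x: "x \<in> W" and e: "0 < e" for x n and e :: real
      unfolding eventually_near
    proof (intro exI[of _ 1] conjI ballI impI allI)
      fix y vs assume y: "y \<in> W"
      have "y - x \<in> E" "x \<in> E" using x y WE subspace_diff[OF E] by auto
      then have "f (y - x) = f y - f x" using add[of "y - x" x] by simp
      then have "D y vs - D x vs - D x ((y - x) # vs) = 0" by (auto simp: D_def split: list.splits)
      then show "norm (D y vs - D x vs - D x ((y - x) # vs)) \<le> e * norm (y - x) * wt vs" using e by simp
    qed simp
  qed (auto simp: D_def add scale split: list.splits)
  then show ?thesis unfolding smooth_on_iff using W by (intro conjI exI[of _ D]) (simp_all add: D_def)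
qed

lemma smooth_on_bounded_linear:
  assumes "bounded_linear f" "subspace E" "openin (top_of_set E) W"
  shows "smooth_on E W f"
proof -
  interpret bounded_linear f by fact
  obtain K where "\<And>x. norm (f x) \<le> norm x * K" using bounded by blast
  then show ?thesis using assms by (intro smooth_on_linear[where K = K]) (auto simp: add scale mult.commute)
qed

lemma smooth_on_const:
  assumes E: "subspace E" and W: "openin (top_of_set E) W"
  shows "smooth_on E W (\<lambda>_. c)"
proof -
  have "smooth_tower E W (\<lambda>x vs. if vs = [] then c else 0)"
  proof (rule smooth_towerI[OF E W])
    show "\<exists>K. \<forall>vs. length vs = n \<and> set vs \<subseteq> E \<longrightarrow> norm (if vs = [] then c else 0) \<le> K * wt vs" for n
      by (rule exI[of _ "norm c"]) auto
  qed (auto simp: eventually_near intro: exI[of _ 1])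
  then show ?thesis unfolding smooth_on_iff using W by (intro conjI exI[of _ "\<lambda>x vs. if vs = [] then c else 0"]) simp_all
qed

lemma smooth_on_Pair:
  assumes E: "subspace E" and "smooth_on E W f" "smooth_on E W g"
  shows "smooth_on E W (\<lambda>x. (f x, g x))"
proof -
  have W: "openin (top_of_set E) W" using assms(2) by (rule smooth_on_openin)
  obtain F where F: "\<And>x. x \<in> W \<Longrightarrow> F x [] = f x" "smooth_tower E W F" using assms(2) unfolding smooth_on_iff by blast
  obtain G where G: "\<And>x. x \<in> W \<Longrightarrow> G x [] = g x" "smooth_tower E W G" using assms(3) unfolding smooth_on_iff by blast
  define D where "D x vs = (F x vs, G x vs)" for x vs
  have nP: "norm (a, b) \<le> norm a + norm b" for a :: 'b and b :: 'c
    by (simp add: norm_Pair_le)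
  have "smooth_tower E W D"
    unfolding smooth_tower_def
  proof (intro conjI ballI allI impI)
    fix x n assume x: "x \<in> W"
    have bF: "bounded_multilinear_on E n (F x)" and bG: "bounded_multilinear_on E n (G x)"
      using F(2) G(2) x by (auto simp: smooth_tower_def)
    obtain K where K: "0 \<le> K" "\<And>vs. length vs = n \<Longrightarrow> set vs \<subseteq> E \<Longrightarrow> norm (F x vs) \<le> K * wt vs"
      using bounded_multilinear_on_bound[OF bF] by blast
    obtain L where L: "0 \<le> L" "\<And>vs. length vs = n \<Longrightarrow> set vs \<subseteq> E \<Longrightarrow> norm (G x vs) \<le> L * wt vs"
      using bounded_multilinear_on_bound[OF bG] by blast
    have "norm (D x vs) \<le> (K + L) * wt vs" if "length vs = n" "set vs \<subseteq> E" for vs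
      using nP[of "F x vs" "G x vs"] K(2)[OF that] L(2)[OF that] by (simp add: D_def algebra_simps)
    then show "bounded_multilinear_on E n (D x)"
      using bF bG unfolding bounded_multilinear_on_def D_def by (auto intro!: exI[of _ "K + L"])
  next
    fix n x and e :: real assume x: "x \<in> W" and e: "0 < e"
    have "\<forall>\<^sub>F y in near x W. \<forall>vs. length vs = n \<and> set vs \<subseteq> E \<longrightarrow>
        norm (F y vs - F x vs - F x ((y - x) # vs)) \<le> (e/2) * norm (y - x) * wt vs"
      "\<forall>\<^sub>F y in near x W. \<forall>vs. length vs = n \<and> set vs \<subseteq> E \<longrightarrow>
        norm (G y vs - G x vs - G x ((y - x) # vs)) \<le> (e/2) * norm (y - x) * wt vs"
      using F(2) G(2) x e unfolding smooth_tower_def by (meson half_gt_zero)+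
    then show "\<forall>\<^sub>F y in near x W. \<forall>vs. length vs = n \<and> set vs \<subseteq> E \<longrightarrow>
        norm (D y vs - D x vs - D x ((y - x) # vs)) \<le> e * norm (y - x) * wt vs"
    proof eventually_elim
      case (elim y)
      show ?case
      proof (intro allI impI)
        fix vs assume vs: "length vs = n \<and> set vs \<subseteq> E"
        have "norm (D y vs - D x vs - D x ((y - x) # vs)) \<le> norm (F y vs - F x vs - F x ((y - x) # vs))
            + norm (G y vs - G x vs - G x ((y - x) # vs))"
          unfolding D_def by (simp add: nP)
        also have "\<dots> \<le> (e/2) * norm (y - x) * wt vs + (e/2) * norm (y - x) * wt vs"
          using elim vs by (intro add_mono) blast+
        finally show "norm (D y vs - D x vs - D x ((y - x) # vs)) \<le> e * norm (y - x) * wt vs"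
          by (simp add: mult_ac)
      qed
    qed
  qed
  then show ?thesis unfolding smooth_on_iff using W F(1) G(1) by (intro conjI exI[of _ D]) (simp_all add: D_def)
qed

text \<open>The tower stops after order two; the only nonzero remainder is the product of the two
  components of the increment, at order zero.\<close>

lemma smooth_on_bilinear:
  assumes "bounded_bilinear B"
  shows "smooth_on UNIV UNIV (\<lambda>p. B (fst p) (snd p))"
proof -
  interpret bounded_bilinear B by fact
  define D where "D x vs = (case vs of [] \<Rightarrow> B (fst x) (snd x) | [h] \<Rightarrow> B (fst h) (snd x) + B (fst x) (snd h)
     | [h, k] \<Rightarrow> B (fst h) (snd k) + B (fst k) (snd h) | _ \<Rightarrow> 0)" for x vs
  obtain K where K: "0 \<le> K" "\<And>a b. norm (B a b) \<le> norm a * norm b * K" using nonneg_bounded by blast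
  have Bxy: "norm (B (fst a) (snd b)) \<le> K * (norm a * norm b)" for a b
  proof -
    have "norm (fst a) * norm (snd b) * K \<le> norm a * norm b * K"
      using K(1) norm_fst_le[of "fst a" "snd a"] norm_snd_le[of "snd b" "fst b"] by (intro mult_right_mono mult_mono) auto
    with K(2)[of "fst a" "snd b"] show ?thesis by (simp add: mult_ac)
  qed
  have "smooth_tower UNIV UNIV D"
  proof (rule smooth_towerI)
    show "\<exists>K. \<forall>vs. length vs = n \<and> set vs \<subseteq> UNIV \<longrightarrow> norm (D x vs) \<le> K * wt vs" for x n
    proof (rule exI[of _ "if n = 0 then norm (B (fst x) (snd x)) else if n = 1 then 2 * K * norm x else 2 * K"], intro allI impI)
      fix vs :: "('a \<times> 'b) list" assume "length vs = n \<and> set vs \<subseteq> UNIV"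
      moreover have m: "norm (B (fst h) (snd k) + B (fst k) (snd h)) \<le> 2 * K * (norm h * norm k)" for h k
        using norm_triangle_ineq[of "B (fst h) (snd k)" "B (fst k) (snd h)"] Bxy[of h k] Bxy[of k h]
        by (simp add: mult_ac)
      moreover have "norm (D x [h]) \<le> 2 * K * norm x * norm h" "norm (D x [h, k]) \<le> 2 * K * (norm h * norm k)" for h k
        using m[of h x] m[of h k] by (simp_all add: D_def mult_ac)
      moreover have "norm (D x (h # k # l # vs)) = 0" for h k l vs by (simp add: D_def)
      ultimately show "norm (D x vs) \<le> (if n = 0 then norm (B (fst x) (snd x)) else if n = 1 then 2 * K * norm x else 2 * K) * wt vs"
        using K(1) by (cases vs; cases "tl vs"; cases "tl (tl vs)") (auto simp: D_def)
    qed
    show "\<forall>\<^sub>F y in near x UNIV. \<forall>vs. length vs = n \<and> set vs \<subseteq> UNIV \<longrightarrow>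
        norm (D y vs - D x vs - D x ((y - x) # vs)) \<le> e * norm (y - x) * wt vs"
      if e: "0 < e" for x n and e :: real
      unfolding eventually_near
    proof (intro exI[of _ "e / (K + 1)"] conjI ballI impI allI)
      fix y and vs :: "('a \<times> 'b) list" assume y: "norm (y - x) < e / (K + 1)"
      show "norm (D y vs - D x vs - D x ((y - x) # vs)) \<le> e * norm (y - x) * wt vs"
      proof (cases "vs = []")
        case True
        have "D y vs - D x vs - D x ((y - x) # vs) = B (fst (y - x)) (snd (y - x))"
          using True by (simp add: D_def diff_left diff_right)
        then have "norm (D y vs - D x vs - D x ((y - x) # vs)) \<le> (K * norm (y - x)) * norm (y - x)"
          using Bxy[of "y - x" "y - x"] by (simp add: mult_ac)
        also have "\<dots> \<le> e * norm (y - x)"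
        proof (rule mult_right_mono)
          have "(K + 1) * norm (y - x) \<le> e" using y K(1) by (simp add: field_simps)
          then show "K * norm (y - x) \<le> e" using norm_ge_zero[of "y - x"] unfolding distrib_right by linarith
        qed simp
        finally show ?thesis using True by simp
      next
        case False
        then have "D y vs - D x vs - D x ((y - x) # vs) = 0"
          by (auto simp: D_def diff_left diff_right split: list.splits)
        then show ?thesis using e by simp
      qed
    qed (use e K in simp)
  qed (auto simp: D_def add_left add_right scaleR_left scaleR_right scaleR_add_right split: list.splits)
  then show ?thesis unfolding smooth_on_iff by (intro conjI exI[of _ D]) (simp_all add: D_def)
qed

subsection \<open>The chain rule\<close>

text \<open>Faa di Bruno's formula: \<open>parts vs\<close> lists the partitions of the positions of \<open>vs\<close> into blocks,
  and differentiating once more in the direction \<open>h\<close> adds \<open>h\<close> as a new block or to one of the old ones.\<close>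

fun inserts :: "'a \<Rightarrow> 'a list list \<Rightarrow> 'a list list list" where
  "inserts v [] = []"
| "inserts v (b # p) = ((v # b) # p) # map ((#) b) (inserts v p)"

fun parts :: "'a list \<Rightarrow> 'a list list list" where
  "parts [] = [[]]"
| "parts (v # vs) = concat (map (\<lambda>p. ([v] # p) # inserts v p) (parts vs))"

text \<open>The block sizes depend only on the number of vectors. Hence the neighbourhoods needed
  for all partitions come from a finite list fixed in advance, uniformly in the vectors.\<close>

definition part_shapes :: "nat \<Rightarrow> nat list list" where
  "part_shapes n = map (map length) (parts (replicate n ()))"

lemma inserts_map: "inserts (g v) (map (map g) p) = map (map (map g)) (inserts v p)"
  by (induction p) (simp_all add: comp_def)

lemma parts_map: "parts (map g vs) = map (map (map g)) (parts vs)"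
  by (induction vs) (simp_all add: map_concat comp_def inserts_map)

lemma shapes_parts: "map (map length) (parts vs) = part_shapes (length vs)"
proof -
  have "parts (replicate (length vs) ()) = map (map (map (\<lambda>_. ()))) (parts vs)"
    by (simp add: parts_map[symmetric] map_replicate_const)
  then show ?thesis by (simp add: part_shapes_def comp_def)
qed

lemma mset_inserts: "q \<in> set (inserts v p) \<Longrightarrow> mset (concat q) = add_mset v (mset (concat p))"
  by (induction p arbitrary: q) auto

lemma mset_parts: "p \<in> set (parts vs) \<Longrightarrow> mset (concat p) = mset vs"
  by (induction vs arbitrary: p) (auto simp: mset_inserts)

lemma wt_parts: "p \<in> set (parts vs) \<Longrightarrow> wt (concat p) = wt vs"
  using mset_parts[of p vs] by (metis mset_map prod_mset_prod_list)

lemma set_parts: "p \<in> set (parts vs) \<Longrightarrow> b \<in> set p \<Longrightarrow> set b \<subseteq> set vs"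
  using mset_parts[of p vs] by (metis mset_eq_setD set_concat UN_upper)

text \<open>The bound \<open>K\<close> is explicit because the estimates below must be uniform in
  the multilinear map: the inductions over blocks change the map after the neighbourhood has been
  chosen.\<close>

definition mlin :: "nat \<Rightarrow> real \<Rightarrow> ('a::real_normed_vector list \<Rightarrow> 'b::real_normed_vector) \<Rightarrow> bool" where
  "mlin n K M \<longleftrightarrow> 0 \<le> K \<and> bounded_multilinear_on UNIV n M \<and> (\<forall>vs. length vs = n \<longrightarrow> norm (M vs) \<le> K * wt vs)"

lemma mlin_bound: "mlin n K M \<Longrightarrow> length vs = n \<Longrightarrow> norm (M vs) \<le> K * wt vs"
  by (simp add: mlin_def)

text \<open>Freezing the first argument multiplies the bound by its norm; this drives the inductions
  over the blocks of a partition.\<close>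

lemma mlin_Cons:
  assumes "mlin (Suc n) K M"
  shows "mlin n (K * norm a) (\<lambda>l. M (a # l))"
proof -
  have M: "bounded_multilinear_on UNIV (Suc n) M" using assms by (simp add: mlin_def)
  have b: "norm (M (a # vs)) \<le> K * norm a * wt vs" if "length vs = n" for vs
    using mlin_bound[OF assms, of "a # vs"] that by (simp add: mult_ac)
  have "bounded_multilinear_on UNIV n (\<lambda>l. M (a # l))"
    unfolding bounded_multilinear_on_def
  proof (intro conjI allI ballI impI)
    fix us vs :: "'a list" and v w :: 'a and c :: real
    assume "length us + length vs + 1 = n \<and> set us \<subseteq> UNIV \<and> set vs \<subseteq> UNIV"
    then have l: "length (a # us) + length vs + 1 = Suc n" by simp
    show "M (a # us @ (v + w) # vs) = M (a # us @ v # vs) + M (a # us @ w # vs)"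
      using bounded_multilinear_onD(1)[OF M l, of v w] by simp
    show "M (a # us @ c *\<^sub>R v # vs) = c *\<^sub>R M (a # us @ v # vs)"
      using bounded_multilinear_onD(2)[OF M l, of v v c] by simp
  qed (use b in blast)
  then show ?thesis using b assms by (simp add: mlin_def)
qed

lemma mlin_first:
  assumes "mlin (Suc n) K M" "length l = n"
  shows "M ((a + b) # l) = M (a # l) + M (b # l)" "M ((c *\<^sub>R a) # l) = c *\<^sub>R M (a # l)"
    "M ((a - b) # l) = M (a # l) - M (b # l)"
proof -
  have M: "bounded_multilinear_on UNIV (Suc n) M" using assms by (simp add: mlin_def)
  have add: "M ((a + b) # l) = M (a # l) + M (b # l)" for a b
    using bounded_multilinear_onD(1)[OF M, of "[]" l a b] assms(2) by simp
  show "M ((a + b) # l) = M (a # l) + M (b # l)" by (rule add)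
  show "M ((c *\<^sub>R a) # l) = c *\<^sub>R M (a # l)"
    using bounded_multilinear_onD(2)[OF M, of "[]" l a a c] assms(2) by simp
  show "M ((a - b) # l) = M (a # l) - M (b # l)" using add[of "a - b" b] by (simp add: algebra_simps)
qed

lemma bounded_multilinear_on_mlin:
  assumes "bounded_multilinear_on UNIV n M"
  obtains K where "mlin n K M"
  using bounded_multilinear_on_bound[OF assms] assms unfolding mlin_def by auto

locale tower_at =
  fixes E W :: "'a::real_normed_vector set" and F :: "'a \<Rightarrow> 'a list \<Rightarrow> 'b::real_normed_vector" and x :: 'a
  assumes E: "subspace E" and WE: "W \<subseteq> E" and x: "x \<in> W" and tower: "smooth_tower E W F"
begin

text \<open>Prescribing the block sizes \<open>\<sigma>\<close> allows induction on
  \<open>\<sigma>\<close> with one neighbourhood for all lists of blocks of that shape.\<close>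

definition adm :: "nat list \<Rightarrow> 'a list list \<Rightarrow> bool" where
  "adm \<sigma> p \<longleftrightarrow> map length p = \<sigma> \<and> (\<forall>b\<in>set p. set b \<subseteq> E)"

lemma adm_Cons: "adm (m # \<sigma>) q \<longleftrightarrow> (\<exists>b p. q = b # p \<and> length b = m \<and> set b \<subseteq> E \<and> adm \<sigma> p)"
  by (cases q) (auto simp: adm_def)

lemma adm_Nil: "adm [] q \<longleftrightarrow> q = []"
  by (auto simp: adm_def)

lemma adm_length: "adm \<sigma> p \<Longrightarrow> length p = length \<sigma>"
  by (auto simp: adm_def)

lemma step_mem: "y \<in> W \<Longrightarrow> y - x \<in> E"
  using E WE x by (auto intro: subspace_diff)

lemma eventually_mem: "\<forall>\<^sub>F y in near x W. y \<in> W"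
  by (auto simp: eventually_near intro: exI[of _ 1])

lemma eventually_small: "0 < d \<Longrightarrow> \<forall>\<^sub>F y in near x W. norm (y - x) \<le> d"
  by (auto simp: eventually_near intro!: exI[of _ d])

lemma bound: "\<exists>K\<ge>0. \<forall>vs. length vs = n \<and> set vs \<subseteq> E \<longrightarrow> norm (F x vs) \<le> K * wt vs"
  using tower x by (intro bounded_multilinear_on_bound) (simp add: smooth_tower_def)

lemma deriv: "0 < e \<Longrightarrow> \<forall>\<^sub>F y in near x W. \<forall>vs. length vs = n \<and> set vs \<subseteq> E \<longrightarrow>
    norm (F y vs - F x vs - F x ((y - x) # vs)) \<le> e * norm (y - x) * wt vs"
  using tower x unfolding smooth_tower_def by blast

text \<open>The derivative estimate with error factor \<open>1\<close>, combined with the bounds on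
  the derivatives of orders \<open>n\<close> and \<open>n + 1\<close> at \<open>x\<close>.\<close>

lemma lipschitz1:
  "\<exists>C\<ge>0. \<forall>\<^sub>F y in near x W. \<forall>b. length b = n \<and> set b \<subseteq> E \<longrightarrow>
     norm (F y b) \<le> C * wt b \<and> norm (F y b - F x b) \<le> C * norm (y - x) * wt b \<and> norm (F x ((y - x) # b)) \<le> C * norm (y - x) * wt b"
proof -
  obtain K where K: "0 \<le> K" "\<And>vs. length vs = n \<Longrightarrow> set vs \<subseteq> E \<Longrightarrow> norm (F x vs) \<le> K * wt vs" using bound[of "n"] by blast
  obtain L where L: "0 \<le> L" "\<And>vs. length vs = Suc n \<Longrightarrow> set vs \<subseteq> E \<Longrightarrow> norm (F x vs) \<le> L * wt vs" using bound[of "Suc n"] by blast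
  define C where "C = K + L + 1"
  have "\<forall>\<^sub>F y in near x W. \<forall>b. length b = n \<and> set b \<subseteq> E \<longrightarrow>
     norm (F y b) \<le> C * wt b \<and> norm (F y b - F x b) \<le> C * norm (y - x) * wt b \<and> norm (F x ((y - x) # b)) \<le> C * norm (y - x) * wt b"
    using deriv[OF zero_less_one, of n] eventually_mem eventually_small[OF zero_less_one]
  proof (eventually_elim, intro allI impI)
    fix y b
    assume 1: "\<forall>vs. length vs = n \<and> set vs \<subseteq> E \<longrightarrow> norm (F y vs - F x vs - F x ((y - x) # vs)) \<le> 1 * norm (y - x) * wt vs"
      and y: "y \<in> W" "norm (y - x) \<le> 1" and b: "length b = n \<and> set b \<subseteq> E"
    have h: "norm (F x ((y - x) # b)) \<le> L * (norm (y - x) * wt b)"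
      using L(2)[of "(y - x) # b"] b step_mem[OF y(1)] by simp
    have "norm (F y b - F x b - F x ((y - x) # b)) \<le> norm (y - x) * wt b" using 1 b by simp
    then have d: "norm (F y b - F x b) \<le> (L + 1) * (norm (y - x) * wt b)"
      using norm_triangle_ineq2[of "F y b - F x b" "F x ((y - x) # b)"] h by (simp add: algebra_simps)
    have nn: "0 \<le> norm (y - x) * wt b" by simp
    have "norm (y - x) * wt b \<le> wt b" using y(2) mult_right_mono[OF y(2) wt_nonneg[of b]] by simp
    then have "(L + 1) * (norm (y - x) * wt b) \<le> (L + 1) * wt b" using L(1) by (intro mult_left_mono) auto
    moreover have "norm (F y b) \<le> norm (F y b - F x b) + norm (F x b)"
      using norm_triangle_ineq2[of "F y b" "F x b"] by simp
    ultimately have "norm (F y b) \<le> C * wt b" using d K(2)[of b] b by (simp add: C_def algebra_simps)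
    moreover have "(L + 1) * (norm (y - x) * wt b) \<le> C * (norm (y - x) * wt b)" "L * (norm (y - x) * wt b) \<le> C * (norm (y - x) * wt b)"
      using nn K(1) by (intro mult_right_mono; simp add: C_def)+
    ultimately show "norm (F y b) \<le> C * wt b \<and> norm (F y b - F x b) \<le> C * norm (y - x) * wt b
        \<and> norm (F x ((y - x) # b)) \<le> C * norm (y - x) * wt b"
      using d h by (simp add: mult.assoc)
  qed
  then show ?thesis using K(1) L(1) by (intro exI[of _ C]) (simp add: C_def)
qed

text \<open>Blocks are replaced one at a time. \<open>M\<close> is quantified inside the
  neighbourhood since the induction step applies the hypothesis to \<open>M\<close> with its first
  argument frozen.\<close>

lemma lipschitz:
  "\<exists>C\<ge>0. \<forall>\<^sub>F y in near x W. \<forall>p. adm \<sigma> p \<longrightarrow> wt (map (F y) p) \<le> C * wt (concat p) \<and>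
     (\<forall>M K. mlin (length p) K (M :: 'b list \<Rightarrow> 'c::real_normed_vector) \<longrightarrow>
        norm (M (map (F y) p) - M (map (F x) p)) \<le> C * K * norm (y - x) * wt (concat p))"
proof (induction \<sigma>)
  case Nil
  then show ?case by (intro exI[of _ 1]) (auto simp: adm_Nil mlin_def intro!: always_eventually)
next
  case (Cons m \<sigma>)
  then obtain C where C: "0 \<le> C" and evC: "\<forall>\<^sub>F y in near x W. \<forall>p. adm \<sigma> p \<longrightarrow> wt (map (F y) p) \<le> C * wt (concat p) \<and>
     (\<forall>M K. mlin (length p) K (M :: 'b list \<Rightarrow> 'c) \<longrightarrow>
        norm (M (map (F y) p) - M (map (F x) p)) \<le> C * K * norm (y - x) * wt (concat p))" by blast
  obtain B where B: "0 \<le> B" and evB: "\<forall>\<^sub>F y in near x W. \<forall>b. length b = m \<and> set b \<subseteq> E \<longrightarrow>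
     norm (F y b) \<le> B * wt b \<and> norm (F y b - F x b) \<le> B * norm (y - x) * wt b \<and> norm (F x ((y - x) # b)) \<le> B * norm (y - x) * wt b"
    using lipschitz1 by blast
  obtain A where A: "0 \<le> A" "\<And>vs. length vs = m \<Longrightarrow> set vs \<subseteq> E \<Longrightarrow> norm (F x vs) \<le> A * wt vs" using bound[of "m"] by blast
  define N where "N = (A + B) * C"
  have N: "0 \<le> N" using A B C by (simp add: N_def)
  have "\<forall>\<^sub>F y in near x W. \<forall>q. adm (m # \<sigma>) q \<longrightarrow> wt (map (F y) q) \<le> N * wt (concat q) \<and>
     (\<forall>M K. mlin (length q) K (M :: 'b list \<Rightarrow> 'c) \<longrightarrow>
        norm (M (map (F y) q) - M (map (F x) q)) \<le> N * K * norm (y - x) * wt (concat q))"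
    using evB evC
  proof (eventually_elim, intro allI impI)
    fix y q
    assume hB: "\<forall>b. length b = m \<and> set b \<subseteq> E \<longrightarrow>
      norm (F y b) \<le> B * wt b \<and> norm (F y b - F x b) \<le> B * norm (y - x) * wt b \<and> norm (F x ((y - x) # b)) \<le> B * norm (y - x) * wt b"
      and hC: "\<forall>p. adm \<sigma> p \<longrightarrow> wt (map (F y) p) \<le> C * wt (concat p) \<and>
       (\<forall>M K. mlin (length p) K (M :: 'b list \<Rightarrow> 'c) \<longrightarrow>
        norm (M (map (F y) p) - M (map (F x) p)) \<le> C * K * norm (y - x) * wt (concat p))"
      and "adm (m # \<sigma>) q"
    then obtain b p where q: "q = b # p" "length b = m" "set b \<subseteq> E" "adm \<sigma> p" by (auto simp: adm_Cons)
    have b: "norm (F y b) \<le> B * wt b" "norm (F y b - F x b) \<le> B * norm (y - x) * wt b" using hB q by auto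
    have p: "wt (map (F y) p) \<le> C * wt (concat p)" using hC q by blast
    have "wt (map (F y) q) \<le> (B * wt b) * (C * wt (concat p))"
      using b(1) p B by (simp add: q mult_mono)
    also have "\<dots> = (B * C) * wt (concat q)" by (simp add: q)
    also have "\<dots> \<le> N * wt (concat q)" using A C by (intro mult_right_mono) (auto simp: N_def algebra_simps)
    finally have 1: "wt (map (F y) q) \<le> N * wt (concat q)" .
    have 2: "norm (M (map (F y) q) - M (map (F x) q)) \<le> N * K * norm (y - x) * wt (concat q)"
      if M: "mlin (length q) K M" for M :: "'b list \<Rightarrow> 'c" and K
    proof -
      have M': "mlin (Suc (length p)) K M" using M by (simp add: q)
      have K: "0 \<le> K" using M by (simp add: mlin_def)
      have "norm (M (map (F y) q) - M (map (F x) q))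
          = norm (M ((F y b - F x b) # map (F y) p) + (M (F x b # map (F y) p) - M (F x b # map (F x) p)))"
        by (simp add: q mlin_first(3)[OF M'])
      also have "\<dots> \<le> norm (M ((F y b - F x b) # map (F y) p)) + norm (M (F x b # map (F y) p) - M (F x b # map (F x) p))"
        by (rule norm_triangle_ineq)
      also have "norm (M ((F y b - F x b) # map (F y) p)) \<le> K * (norm (F y b - F x b) * wt (map (F y) p))"
        using mlin_bound[OF M', of "(F y b - F x b) # map (F y) p"] by simp
      also have "\<dots> \<le> K * ((B * norm (y - x) * wt b) * (C * wt (concat p)))"
        using K b(2) p B by (intro mult_left_mono mult_mono) auto
      also have "norm (M (F x b # map (F y) p) - M (F x b # map (F x) p)) \<le> C * (K * norm (F x b)) * norm (y - x) * wt (concat p)"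
        using hC q(4) mlin_Cons[OF M'] by blast
      also have "\<dots> \<le> C * (K * (A * wt b)) * norm (y - x) * wt (concat p)"
        using A(2)[of b] q K C by (intro mult_right_mono mult_left_mono) auto
      finally show ?thesis by (simp add: q N_def algebra_simps)
    qed
    show "wt (map (F y) q) \<le> N * wt (concat q) \<and>
       (\<forall>M K. mlin (length q) K (M :: 'b list \<Rightarrow> 'c) \<longrightarrow>
        norm (M (map (F y) q) - M (map (F x) q)) \<le> N * K * norm (y - x) * wt (concat q))"
      using 1 2 by blast
  qed
  then show ?case using N by blast
qed

text \<open>Leibniz rule: \<open>inserts (y - x) p\<close> runs over the ways to differentiate
  exactly one factor \<open>F x b\<close> in the direction \<open>y - x\<close>.\<close>

lemma product_rule:
  assumes "0 < e"
  shows "\<forall>\<^sub>F y in near x W. \<forall>p. adm \<sigma> p \<longrightarrow> (\<forall>M K. mlin (length p) K (M :: 'b list \<Rightarrow> 'c::real_normed_vector) \<longrightarrow>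
     norm (M (map (F y) p) - M (map (F x) p) - (\<Sum>q\<leftarrow>inserts (y - x) p. M (map (F x) q))) \<le> e * K * norm (y - x) * wt (concat p))"
  using assms
proof (induction \<sigma> arbitrary: e)
  case Nil
  then show ?case by (auto simp: adm_Nil mlin_def intro!: always_eventually)
next
  case (Cons m \<sigma>)
  obtain C where C: "0 \<le> C" and evC: "\<forall>\<^sub>F y in near x W. \<forall>p. adm \<sigma> p \<longrightarrow> wt (map (F y) p) \<le> C * wt (concat p) \<and>
     (\<forall>M K. mlin (length p) K (M :: 'b list \<Rightarrow> 'c) \<longrightarrow>
        norm (M (map (F y) p) - M (map (F x) p)) \<le> C * K * norm (y - x) * wt (concat p))"
    using lipschitz by blast
  obtain B where B: "0 \<le> B" and evB: "\<forall>\<^sub>F y in near x W. \<forall>b. length b = m \<and> set b \<subseteq> E \<longrightarrow>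
     norm (F y b) \<le> B * wt b \<and> norm (F y b - F x b) \<le> B * norm (y - x) * wt b \<and> norm (F x ((y - x) # b)) \<le> B * norm (y - x) * wt b"
    using lipschitz1 by blast
  obtain A where A: "0 \<le> A" "\<And>vs. length vs = m \<Longrightarrow> set vs \<subseteq> E \<Longrightarrow> norm (F x vs) \<le> A * wt vs" using bound[of "m"] by blast
  \<comment> \<open>The three error terms below carry the weights \<open>A\<close>, \<open>C\<close>
    and \<open>B * C\<close>, from the bounds on \<open>F x b\<close>, on the remaining factors, and
    on the cross term.\<close>
  define d where "d = e / (A + C + B * C + 1)"
  have ABC: "0 < A + C + B * C + 1" using A B C by (simp add: add_nonneg_pos)
  have d: "0 < d" using Cons.prems ABC by (simp add: d_def)
  have de: "(A + C + B * C) * d \<le> e"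
  proof -
    have "(A + C + B * C + 1) * d = e" using ABC by (simp add: d_def)
    then show ?thesis using d unfolding distrib_right by linarith
  qed
  show ?case
    using evB evC Cons.IH[OF d] deriv[OF d, of m] eventually_small[OF d]
  proof (eventually_elim, intro allI impI)
    fix y q K and M :: "'b list \<Rightarrow> 'c"
    assume hB: "\<forall>b. length b = m \<and> set b \<subseteq> E \<longrightarrow>
      norm (F y b) \<le> B * wt b \<and> norm (F y b - F x b) \<le> B * norm (y - x) * wt b \<and> norm (F x ((y - x) # b)) \<le> B * norm (y - x) * wt b"
      and hC: "\<forall>p. adm \<sigma> p \<longrightarrow> wt (map (F y) p) \<le> C * wt (concat p) \<and>
       (\<forall>M K. mlin (length p) K (M :: 'b list \<Rightarrow> 'c) \<longrightarrow>
        norm (M (map (F y) p) - M (map (F x) p)) \<le> C * K * norm (y - x) * wt (concat p))"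
      and hI: "\<forall>p. adm \<sigma> p \<longrightarrow> (\<forall>M K. mlin (length p) K (M :: 'b list \<Rightarrow> 'c) \<longrightarrow>
       norm (M (map (F y) p) - M (map (F x) p) - (\<Sum>q\<leftarrow>inserts (y - x) p. M (map (F x) q))) \<le> d * K * norm (y - x) * wt (concat p))"
      and hD: "\<forall>vs. length vs = m \<and> set vs \<subseteq> E \<longrightarrow> norm (F y vs - F x vs - F x ((y - x) # vs)) \<le> d * norm (y - x) * wt vs"
      and yx: "norm (y - x) \<le> d" and adm: "adm (m # \<sigma>) q" and M: "mlin (length q) K M"
    from adm obtain b p where q: "q = b # p" "length b = m" "set b \<subseteq> E" "adm \<sigma> p" by (auto simp: adm_Cons)
    define h where "h = y - x"
    define w where "w = wt b * wt (concat p)"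
    have w: "0 \<le> w" by (simp add: w_def)
    have M': "mlin (Suc (length p)) K M" using M by (simp add: q)
    have K: "0 \<le> K" using M by (simp add: mlin_def)
    have p: "wt (map (F y) p) \<le> C * wt (concat p)" using hC q by blast
    \<comment> \<open>\<open>T1\<close> is the remainder of the first factor, \<open>T3\<close> that
      of the others with the first frozen, and \<open>T2\<close> the cross term, of second order in
      \<open>y - x\<close>.\<close>
    define T1 where "T1 = M ((F y b - F x b - F x (h # b)) # map (F y) p)"
    define T2 where "T2 = M (F x (h # b) # map (F y) p) - M (F x (h # b) # map (F x) p)"
    define T3 where "T3 = M (F x b # map (F y) p) - M (F x b # map (F x) p) - (\<Sum>q\<leftarrow>inserts h p. M (F x b # map (F x) q))"
    have split: "M (map (F y) q) - M (map (F x) q) - (\<Sum>q\<leftarrow>inserts (y - x) q. M (map (F x) q)) = T1 + T2 + T3"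
      by (simp add: q T1_def T2_def T3_def h_def mlin_first(3)[OF M'] comp_def)
    have "norm T1 \<le> K * (norm (F y b - F x b - F x (h # b)) * wt (map (F y) p))"
      using mlin_bound[OF M', of "(F y b - F x b - F x (h # b)) # map (F y) p"] by (simp add: T1_def)
    also have "\<dots> \<le> K * ((d * norm h * wt b) * (C * wt (concat p)))"
      using K p d C hD q by (intro mult_left_mono mult_mono) (auto simp: h_def)
    finally have 1: "norm T1 \<le> C * (d * (K * norm h * w))" by (simp add: w_def mult_ac)
    have "norm T2 \<le> C * (K * norm (F x (h # b))) * norm h * wt (concat p)"
      unfolding T2_def using hC q(4) mlin_Cons[OF M'] by (auto simp: h_def)
    also have "\<dots> \<le> C * (K * (B * norm h * wt b)) * d * wt (concat p)"
    proof -
      have "norm (F x (h # b)) \<le> B * norm h * wt b" using hB q by (auto simp: h_def)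
      then show ?thesis using K C B d yx by (intro mult_right_mono mult_mono mult_left_mono) (auto simp: h_def)
    qed
    finally have 2: "norm T2 \<le> (B * C) * (d * (K * norm h * w))" by (simp add: w_def mult_ac)
    have "norm T3 \<le> d * (K * norm (F x b)) * norm h * wt (concat p)"
      unfolding T3_def using hI q(4) mlin_Cons[OF M'] by (auto simp: h_def)
    also have "\<dots> \<le> d * (K * (A * wt b)) * norm h * wt (concat p)"
      using A(2)[of b] q K d by (intro mult_right_mono mult_left_mono) auto
    finally have 3: "norm T3 \<le> A * (d * (K * norm h * w))" by (simp add: w_def mult_ac)
    have "norm (T1 + T2 + T3) \<le> norm T1 + norm T2 + norm T3"
      by (rule order_trans[OF norm_triangle_ineq add_right_mono[OF norm_triangle_ineq]])
    also have "\<dots> \<le> ((A + C + B * C) * d) * (K * norm h * w)"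
      using 1 2 3 by (simp add: algebra_simps)
    also have "\<dots> \<le> e * (K * norm h * w)" using de K w by (intro mult_right_mono) auto
    finally show "norm (M (map (F y) q) - M (map (F x) q) - (\<Sum>q\<leftarrow>inserts (y - x) q. M (map (F x) q)))
        \<le> e * K * norm (y - x) * wt (concat q)"
      unfolding split by (simp add: q w_def h_def mult_ac)
  qed
qed

end

lemma sum_list_concat_map:
  "(\<Sum>y\<leftarrow>concat (map f xs). g y) = (\<Sum>x\<leftarrow>xs. \<Sum>y\<leftarrow>f x. (g y :: 'a::monoid_add))"
  by (induction xs) simp_all

lemma scaleR_sum_list: "c *\<^sub>R sum_list xs = (\<Sum>x\<leftarrow>xs. c *\<^sub>R (x :: 'a::real_vector))"
  by (induction xs) (simp_all add: scaleR_add_right)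

context tower_at
begin

lemma first_slot:
  assumes "v \<in> E" "w \<in> E" "set b \<subseteq> E"
  shows "F x ((v + w) # b) = F x (v # b) + F x (w # b)" "F x ((c *\<^sub>R v) # b) = c *\<^sub>R F x (v # b)"
proof -
  have "bounded_multilinear_on E (Suc (length b)) (F x)" using tower x by (simp add: smooth_tower_def)
  from bounded_multilinear_onD(1)[OF this, of "[]" b v w] bounded_multilinear_onD(2)[OF this, of "[]" b v v c] assms
  show "F x ((v + w) # b) = F x (v # b) + F x (w # b)" "F x ((c *\<^sub>R v) # b) = c *\<^sub>R F x (v # b)"
    by simp_all
qed

text \<open>Supplies linearity in the first slot for the chain rule; \<open>smooth_towerI\<close>
  then obtains the later slots.\<close>

lemma inserts_linear:
  fixes M :: "'b list \<Rightarrow> 'c::real_normed_vector"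
  assumes "mlin (length p) K M" "v \<in> E" "w \<in> E" "\<forall>b\<in>set p. set b \<subseteq> E"
  shows "(\<Sum>q\<leftarrow>inserts (v + w) p. M (map (F x) q)) = (\<Sum>q\<leftarrow>inserts v p. M (map (F x) q)) + (\<Sum>q\<leftarrow>inserts w p. M (map (F x) q))"
    and "(\<Sum>q\<leftarrow>inserts (c *\<^sub>R v) p. M (map (F x) q)) = c *\<^sub>R (\<Sum>q\<leftarrow>inserts v p. M (map (F x) q))"
  using assms
proof (induction p arbitrary: M K)
  case Nil
  { case 1 then show ?case by simp }
  { case 2 then show ?case by simp }
next
  case (Cons b p)
  { case 1
    then have M: "mlin (Suc (length p)) K M" by simp
    have "length (map (F x) p) = length p" by simp
    with 1 show ?case
      using Cons.IH(1)[OF mlin_Cons[OF M, of "F x b"]] mlin_first(1)[OF M]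
      by (simp add: comp_def first_slot algebra_simps) }
  { case 2
    then have M: "mlin (Suc (length p)) K M" by simp
    with 2 show ?case
      using Cons.IH(2)[OF mlin_Cons[OF M, of "F x b"]] mlin_first(2)[OF M]
      by (simp add: comp_def first_slot algebra_simps) }
qed

text \<open>The error \<open>e\<close> is halved between the first shape and the rest. The
  alternative \<open>ps = []\<close> is there because for an empty list nothing prevents
  \<open>w\<close> from being negative.\<close>

lemma eventually_sum_shapes:
  fixes T :: "'a \<Rightarrow> 'a list list \<Rightarrow> 'c::real_normed_vector"
  assumes "\<And>\<sigma> e. \<sigma> \<in> set S \<Longrightarrow> 0 < e \<Longrightarrow> \<forall>\<^sub>F y in near x W. \<forall>p. adm \<sigma> p \<longrightarrow> norm (T y p) \<le> e * norm (y - x) * wt (concat p)"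
    and "0 < e"
  shows "\<forall>\<^sub>F y in near x W. \<forall>ps w. map (map length) ps = S \<and> (\<forall>p\<in>set ps. adm (map length p) p \<and> wt (concat p) = w) \<longrightarrow>
    norm (\<Sum>p\<leftarrow>ps. T y p) \<le> e * norm (y - x) * w \<or> ps = []"
  using assms
proof (induction S arbitrary: e)
  case Nil
  then show ?case by simp
next
  case (Cons \<sigma> S)
  have "\<forall>\<^sub>F y in near x W. \<forall>p. adm \<sigma> p \<longrightarrow> norm (T y p) \<le> e / 2 * norm (y - x) * wt (concat p)"
    by (intro Cons.prems(1)) (use Cons.prems(2) in auto)
  moreover have "\<forall>\<^sub>F y in near x W. \<forall>ps w. map (map length) ps = S \<and> (\<forall>p\<in>set ps. adm (map length p) p \<and> wt (concat p) = w) \<longrightarrow>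
    norm (\<Sum>p\<leftarrow>ps. T y p) \<le> e / 2 * norm (y - x) * w \<or> ps = []"
    using Cons.prems by (intro Cons.IH) auto
  ultimately show ?case
  proof (eventually_elim, intro allI impI)
    fix y ps w
    assume 1: "\<forall>p. adm \<sigma> p \<longrightarrow> norm (T y p) \<le> e / 2 * norm (y - x) * wt (concat p)"
      and 2: "\<forall>ps w. map (map length) ps = S \<and> (\<forall>p\<in>set ps. adm (map length p) p \<and> wt (concat p) = w) \<longrightarrow>
        norm (\<Sum>p\<leftarrow>ps. T y p) \<le> e / 2 * norm (y - x) * w \<or> ps = []"
      and 3: "map (map length) ps = \<sigma> # S \<and> (\<forall>p\<in>set ps. adm (map length p) p \<and> wt (concat p) = w)"
    then obtain p ps' where ps: "ps = p # ps'" "map length p = \<sigma>" "map (map length) ps' = S" by auto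
    have p: "norm (T y p) \<le> e / 2 * norm (y - x) * w" using 1 3 ps by auto
    have w: "0 \<le> w" using 3 ps wt_nonneg[of "concat p"] by auto
    have "norm (\<Sum>p\<leftarrow>ps'. T y p) \<le> e / 2 * norm (y - x) * w"
    proof (cases "ps' = []")
      case True
      then show ?thesis using w Cons.prems(2) by simp
    next
      case False
      then show ?thesis using 2 3 ps by auto
    qed
    moreover have "norm (\<Sum>p\<leftarrow>ps. T y p) \<le> norm (T y p) + norm (\<Sum>p\<leftarrow>ps'. T y p)"
      by (simp add: ps norm_triangle_ineq)
    ultimately have "norm (\<Sum>p\<leftarrow>ps. T y p) \<le> e / 2 * norm (y - x) * w + e / 2 * norm (y - x) * w"
      using p by linarith
    then show "norm (\<Sum>p\<leftarrow>ps. T y p) \<le> e * norm (y - x) * w \<or> ps = []"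
      by (simp add: mult_ac)
  qed
qed

lemma bound_sum_shapes:
  fixes T :: "'a list list \<Rightarrow> 'c::real_normed_vector"
  assumes "\<And>\<sigma>. \<sigma> \<in> set S \<Longrightarrow> \<exists>K\<ge>0. \<forall>p. adm \<sigma> p \<longrightarrow> norm (T p) \<le> K * wt (concat p)"
  shows "\<exists>K\<ge>0. \<forall>ps w. map (map length) ps = S \<and> (\<forall>p\<in>set ps. adm (map length p) p \<and> wt (concat p) = w) \<and> 0 \<le> w \<longrightarrow>
    norm (\<Sum>p\<leftarrow>ps. T p) \<le> K * w"
  using assms
proof (induction S)
  case Nil
  then show ?case by (intro exI[of _ 0]) simp
next
  case (Cons \<sigma> S)
  obtain K where K: "0 \<le> K" "\<forall>p. adm \<sigma> p \<longrightarrow> norm (T p) \<le> K * wt (concat p)" using Cons.prems[of \<sigma>] by auto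
  obtain L where L: "0 \<le> L" "\<forall>ps w. map (map length) ps = S \<and> (\<forall>p\<in>set ps. adm (map length p) p \<and> wt (concat p) = w) \<and> 0 \<le> w \<longrightarrow>
    norm (\<Sum>p\<leftarrow>ps. T p) \<le> L * w" using Cons.IH Cons.prems by auto
  have "norm (\<Sum>p\<leftarrow>ps. T p) \<le> (K + L) * w"
    if ps: "map (map length) ps = \<sigma> # S" "\<forall>p\<in>set ps. adm (map length p) p \<and> wt (concat p) = w" "0 \<le> w" for ps w
  proof -
    obtain p ps' where q: "ps = p # ps'" "map length p = \<sigma>" "map (map length) ps' = S" using ps by auto
    have "norm (T p) \<le> K * w" using K ps q by auto
    moreover have "norm (\<Sum>p\<leftarrow>ps'. T p) \<le> L * w" using L ps q by auto
    ultimately show ?thesis by (simp add: q distrib_right order_trans[OF norm_triangle_ineq add_mono])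
  qed
  then show ?case using K(1) L(1) by (intro exI[of _ "K + L"]) auto
qed

end

text \<open>The inner map lives on a subspace and the outer one on an open set of the whole space,
  as happens in charts. The error of the sum splits into one error per partition, bounded separately
  for each list of block sizes.\<close>

lemma smooth_on_compose:
  fixes f :: "'a::real_normed_vector \<Rightarrow> 'b::real_normed_vector" and g :: "'b \<Rightarrow> 'c::real_normed_vector"
  assumes E: "subspace E" and f: "smooth_on E W f" and g: "smooth_on UNIV V g" and fW: "f ` W \<subseteq> V"
  shows "smooth_on E W (\<lambda>x. g (f x))"
proof -
  have W: "openin (top_of_set E) W" using f by (rule smooth_on_openin)
  have WE: "W \<subseteq> E" using W by (rule openin_imp_subset)
  obtain F where F: "\<And>x. x \<in> W \<Longrightarrow> F x [] = f x" "smooth_tower E W F" using f unfolding smooth_on_iff by blast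
  obtain G where G: "\<And>z. z \<in> V \<Longrightarrow> G z [] = g z" "smooth_tower UNIV V G" using g unfolding smooth_on_iff by blast
  define D where "D x vs = (\<Sum>p\<leftarrow>parts vs. G (f x) (map (F x) p))" for x vs
  have D_Cons: "D x (h # vs) = (\<Sum>p\<leftarrow>parts vs. G (f x) (F x [h] # map (F x) p) + (\<Sum>q\<leftarrow>inserts h p. G (f x) (map (F x) q)))" for x h vs
    by (simp add: D_def sum_list_concat_map)
  have "smooth_tower E W D"
  proof (rule smooth_towerI[OF E W])
    fix x assume x: "x \<in> W"
    interpret F: tower_at E W F x by unfold_locales (use E WE x F in auto)
    have fx: "f x \<in> V" using x fW by auto
    have Gm: "\<exists>K. mlin n K (G (f x))" for n
      using bounded_multilinear_on_mlin G(2) fx unfolding smooth_tower_def by metis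
    have adm: "F.adm (map length p) p" if "p \<in> set (parts vs)" "set vs \<subseteq> E" for p vs
      using set_parts[OF that(1)] that(2) unfolding F.adm_def by blast
    have blocks: "\<forall>b\<in>set p. set b \<subseteq> E" if "p \<in> set (parts vs)" "set vs \<subseteq> E" for p vs
      using set_parts[OF that(1)] that(2) by blast
    show "D x ((v + w) # vs) = D x (v # vs) + D x (w # vs)" if "v \<in> E" "w \<in> E" "set vs \<subseteq> E" for v w vs
      unfolding D_Cons sum_list_addf[symmetric]
    proof (rule arg_cong[of _ _ sum_list], rule map_cong[OF refl])
      fix p assume p: "p \<in> set (parts vs)"
      obtain K where K: "mlin (length p) K (G (f x))" using Gm by blast
      obtain L where L: "mlin (Suc (length p)) L (G (f x))" using Gm by blast
      show "G (f x) (F x [v + w] # map (F x) p) + (\<Sum>q\<leftarrow>inserts (v + w) p. G (f x) (map (F x) q))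
        = G (f x) (F x [v] # map (F x) p) + (\<Sum>q\<leftarrow>inserts v p. G (f x) (map (F x) q))
          + (G (f x) (F x [w] # map (F x) p) + (\<Sum>q\<leftarrow>inserts w p. G (f x) (map (F x) q)))"
        using F.inserts_linear(1)[OF K that(1,2) blocks[OF p that(3)]] mlin_first(1)[OF L, of "map (F x) p" "F x [v]" "F x [w]"]
          F.first_slot(1)[OF that(1,2), of "[]"] by simp
    qed
    show "D x ((c *\<^sub>R v) # vs) = c *\<^sub>R D x (v # vs)" if "v \<in> E" "set vs \<subseteq> E" for c v vs
      unfolding D_Cons
    proof -
      have "(\<Sum>p\<leftarrow>parts vs. G (f x) (F x [c *\<^sub>R v] # map (F x) p) + (\<Sum>q\<leftarrow>inserts (c *\<^sub>R v) p. G (f x) (map (F x) q)))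
          = (\<Sum>p\<leftarrow>parts vs. c *\<^sub>R (G (f x) (F x [v] # map (F x) p) + (\<Sum>q\<leftarrow>inserts v p. G (f x) (map (F x) q))))"
      proof (rule arg_cong[of _ _ sum_list], rule map_cong[OF refl])
        fix p assume p: "p \<in> set (parts vs)"
        obtain K where K: "mlin (length p) K (G (f x))" using Gm by blast
        obtain L where L: "mlin (Suc (length p)) L (G (f x))" using Gm by blast
        show "G (f x) (F x [c *\<^sub>R v] # map (F x) p) + (\<Sum>q\<leftarrow>inserts (c *\<^sub>R v) p. G (f x) (map (F x) q))
          = c *\<^sub>R (G (f x) (F x [v] # map (F x) p) + (\<Sum>q\<leftarrow>inserts v p. G (f x) (map (F x) q)))"
          using F.inserts_linear(2)[OF K that(1,1) blocks[OF p that(2)]] mlin_first(2)[OF L, of "map (F x) p" c "F x [v]"]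
            F.first_slot(2)[OF that(1,1), of "[]"] by (simp add: scaleR_add_right)
      qed
      also have "\<dots> = c *\<^sub>R (\<Sum>p\<leftarrow>parts vs. G (f x) (F x [v] # map (F x) p) + (\<Sum>q\<leftarrow>inserts v p. G (f x) (map (F x) q)))"
        by (simp only: scaleR_sum_list map_map comp_def)
      finally show "(\<Sum>p\<leftarrow>parts vs. G (f x) (F x [c *\<^sub>R v] # map (F x) p) + (\<Sum>q\<leftarrow>inserts (c *\<^sub>R v) p. G (f x) (map (F x) q)))
        = c *\<^sub>R (\<Sum>p\<leftarrow>parts vs. G (f x) (F x [v] # map (F x) p) + (\<Sum>q\<leftarrow>inserts v p. G (f x) (map (F x) q)))" .
    qed
    fix n
    have "\<exists>K\<ge>0. \<forall>ps w. map (map length) ps = part_shapes n \<and> (\<forall>p\<in>set ps. F.adm (map length p) p \<and> wt (concat p) = w) \<and> 0 \<le> w \<longrightarrow>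
        norm (\<Sum>p\<leftarrow>ps. G (f x) (map (F x) p)) \<le> K * w"
    proof (rule F.bound_sum_shapes)
      fix \<sigma>
      obtain C where C: "0 \<le> C" "\<forall>\<^sub>F y in near x W. \<forall>p. F.adm \<sigma> p \<longrightarrow> wt (map (F y) p) \<le> C * wt (concat p) \<and>
         (\<forall>M K. mlin (length p) K (M :: 'b list \<Rightarrow> 'c) \<longrightarrow>
            norm (M (map (F y) p) - M (map (F x) p)) \<le> C * K * norm (y - x) * wt (concat p))"
        using F.lipschitz by blast
      then have Cx: "wt (map (F x) p) \<le> C * wt (concat p)" if "F.adm \<sigma> p" for p
        using that x unfolding eventually_near by (metis diff_self norm_zero)
      obtain K where K: "mlin (length \<sigma>) K (G (f x))" using Gm by blast
      have "norm (G (f x) (map (F x) p)) \<le> (K * C) * wt (concat p)" if p: "F.adm \<sigma> p" for p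
      proof -
        have "norm (G (f x) (map (F x) p)) \<le> K * wt (map (F x) p)"
          by (rule mlin_bound[OF K]) (simp add: F.adm_length[OF p])
        also have "\<dots> \<le> K * (C * wt (concat p))"
          using K Cx[OF p] by (intro mult_left_mono) (auto simp: mlin_def)
        finally show ?thesis by (simp add: mult_ac)
      qed
      then show "\<exists>K\<ge>0. \<forall>p. F.adm \<sigma> p \<longrightarrow> norm (G (f x) (map (F x) p)) \<le> K * wt (concat p)"
        using K C(1) by (intro exI[of _ "K * C"]) (simp add: mlin_def)
    qed
    then obtain K where K: "\<And>ps w. map (map length) ps = part_shapes n \<Longrightarrow> (\<forall>p\<in>set ps. F.adm (map length p) p \<and> wt (concat p) = w) \<Longrightarrow> 0 \<le> w \<Longrightarrow>
        norm (\<Sum>p\<leftarrow>ps. G (f x) (map (F x) p)) \<le> K * w" by blast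
    show "\<exists>K. \<forall>vs. length vs = n \<and> set vs \<subseteq> E \<longrightarrow> norm (D x vs) \<le> K * wt vs"
      unfolding D_def
      using K[of "parts vs" "wt vs" for vs] adm by (intro exI[of _ K] allI impI) (auto simp: shapes_parts wt_parts)
    fix e :: real assume e: "0 < e"
    \<comment> \<open>The error of the term of \<open>p\<close>: its derivative along
      \<open>y - x\<close> consists of the term with the new block \<open>[y - x]\<close>, from the
      outer map, and of the insertions, from the inner one.\<close>
    define T where "T y p = G (f y) (map (F y) p) - G (f x) (map (F x) p)
        - (G (f x) (F x [y - x] # map (F x) p) + (\<Sum>q\<leftarrow>inserts (y - x) p. G (f x) (map (F x) q)))" for y p
    have T: "\<forall>\<^sub>F y in near x W. \<forall>p. F.adm \<sigma> p \<longrightarrow> norm (T y p) \<le> e * norm (y - x) * wt (concat p)" if e: "0 < e" for \<sigma> e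
    proof -
      obtain C where C: "0 \<le> C" "\<forall>\<^sub>F y in near x W. \<forall>p. F.adm \<sigma> p \<longrightarrow> wt (map (F y) p) \<le> C * wt (concat p) \<and>
         (\<forall>M K. mlin (length p) K (M :: 'b list \<Rightarrow> 'c) \<longrightarrow>
            norm (M (map (F y) p) - M (map (F x) p)) \<le> C * K * norm (y - x) * wt (concat p))"
        using F.lipschitz by blast
      obtain B where B: "0 \<le> B" "\<forall>\<^sub>F y in near x W. \<forall>b. length b = 0 \<and> set b \<subseteq> E \<longrightarrow>
         norm (F y b) \<le> B * wt b \<and> norm (F y b - F x b) \<le> B * norm (y - x) * wt b \<and> norm (F x ((y - x) # b)) \<le> B * norm (y - x) * wt b"
        using F.lipschitz1 by blast
      define k where "k = length \<sigma>"
      obtain K where K: "mlin k K (G (f x))" using Gm by blast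
      obtain L where L: "mlin (Suc k) L (G (f x))" using Gm by blast
      have K0: "0 \<le> K" and L0: "0 \<le> L" using K L by (simp_all add: mlin_def)
      \<comment> \<open>The sum of the constants of the four errors \<open>T1\<close> to
        \<open>T4\<close> below.\<close>
      define N where "N = B * C + L * C + C * L * B + K"
      have N: "0 \<le> N" using B C K0 L0 by (simp add: N_def)
      define d where "d = e / (N + 1)"
      have d: "0 < d" using e N by (simp add: d_def)
      have Nd: "N * d \<le> e"
      proof -
        have "(N + 1) * d = e" using N by (simp add: d_def)
        then show ?thesis using d unfolding distrib_right by linarith
      qed
      have fB: "\<forall>\<^sub>F y in near x W. norm (f y - f x) \<le> B * norm (y - x) \<and> norm (F x [y - x]) \<le> B * norm (y - x)"
        using B(2) F.eventually_mem by eventually_elim (use F(1) x in force)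
      have G1: "\<forall>\<^sub>F y in near x W. \<forall>ls. length ls = k \<longrightarrow>
          norm (G (f y) ls - G (f x) ls - G (f x) ((f y - f x) # ls)) \<le> d * norm (f y - f x) * wt ls"
      proof -
        have "\<forall>\<^sub>F z in near (f x) V. \<forall>ls. length ls = k \<and> set ls \<subseteq> UNIV \<longrightarrow>
            norm (G z ls - G (f x) ls - G (f x) ((z - f x) # ls)) \<le> d * norm (z - f x) * wt ls"
          using G(2) fx d unfolding smooth_tower_def by blast
        then obtain r where r: "0 < r" "\<And>z ls. z \<in> V \<Longrightarrow> norm (z - f x) < r \<Longrightarrow> length ls = k \<Longrightarrow>
            norm (G z ls - G (f x) ls - G (f x) ((z - f x) # ls)) \<le> d * norm (z - f x) * wt ls"
          unfolding eventually_near by auto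
        have "0 < r / (2 * (B + 1))" using r B by simp
        from fB F.eventually_mem F.eventually_small[OF this] show ?thesis
        proof eventually_elim
          case (elim y)
          have "B * norm (y - x) \<le> (B + 1) * (r / (2 * (B + 1)))" using elim B(1) by (intro mult_mono) auto
          also have "\<dots> = r / 2" using B(1) by (simp add: field_simps)
          also have "\<dots> < r" using r by simp
          finally have "norm (f y - f x) < r" using elim by linarith
          then show ?case using r(2) elim fW by auto
        qed
      qed
      have G2: "\<forall>\<^sub>F y in near x W. norm (f y - f x - F x [y - x]) \<le> d * norm (y - x)"
        using F.deriv[OF d, of 0] F.eventually_mem by eventually_elim (use F(1) x in force)
      show ?thesis
        using C(2) fB G1 G2 F.product_rule[OF d, of \<sigma>, where 'c='c] F.eventually_small[OF d]
      proof (eventually_elim, intro allI impI)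
        fix y p
        assume hC: "\<forall>p. F.adm \<sigma> p \<longrightarrow> wt (map (F y) p) \<le> C * wt (concat p) \<and>
         (\<forall>M K. mlin (length p) K (M :: 'b list \<Rightarrow> 'c) \<longrightarrow>
            norm (M (map (F y) p) - M (map (F x) p)) \<le> C * K * norm (y - x) * wt (concat p))"
          and hB: "norm (f y - f x) \<le> B * norm (y - x) \<and> norm (F x [y - x]) \<le> B * norm (y - x)"
          and h1: "\<forall>ls. length ls = k \<longrightarrow>
            norm (G (f y) ls - G (f x) ls - G (f x) ((f y - f x) # ls)) \<le> d * norm (f y - f x) * wt ls"
          and h2: "norm (f y - f x - F x [y - x]) \<le> d * norm (y - x)"
          and h4: "\<forall>p. F.adm \<sigma> p \<longrightarrow> (\<forall>M K. mlin (length p) K (M :: 'b list \<Rightarrow> 'c) \<longrightarrow>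
            norm (M (map (F y) p) - M (map (F x) p) - (\<Sum>q\<leftarrow>inserts (y - x) p. M (map (F x) q))) \<le> d * K * norm (y - x) * wt (concat p))"
          and yd: "norm (y - x) \<le> d" and p: "F.adm \<sigma> p"
        have lp: "length p = k" using F.adm_length[OF p] by (simp add: k_def)
        define h where "h = y - x"
        define w where "w = wt (concat p)"
        have w: "0 \<le> w" by (simp add: w_def)
        define Ly Lx where "Ly = map (F y) p" and "Lx = map (F x) p"
        have len: "length Ly = k" "length Lx = k" by (simp_all add: Ly_def Lx_def lp)
        have wL: "wt Ly \<le> C * w" using hC p by (simp add: Ly_def w_def del: map_map)
        have wL0: "0 \<le> wt Ly" by simp
        \<comment> \<open>\<open>T1\<close> is the error of differentiating the outer map,
          \<open>T2\<close> replaces the increment of \<open>f\<close> by its derivative,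
          \<open>T3\<close> moves the other factors back to \<open>x\<close>, and \<open>T4\<close>
          is the Leibniz error at the fixed base point.\<close>
        define T1 where "T1 = G (f y) Ly - G (f x) Ly - G (f x) ((f y - f x) # Ly)"
        define T2 where "T2 = G (f x) ((f y - f x - F x [h]) # Ly)"
        define T3 where "T3 = G (f x) (F x [h] # Ly) - G (f x) (F x [h] # Lx)"
        define T4 where "T4 = G (f x) Ly - G (f x) Lx - (\<Sum>q\<leftarrow>inserts h p. G (f x) (map (F x) q))"
        have "T y p = T1 + T2 + T3 + T4"
          using mlin_first(3)[OF L len(1), of "f y - f x" "F x [h]"]
          by (simp add: T_def T1_def T2_def T3_def T4_def h_def Ly_def Lx_def)
        moreover have "norm T1 \<le> B * C * (d * norm h * w)"
        proof -
          have "norm T1 \<le> d * norm (f y - f x) * wt Ly" unfolding T1_def using h1 len by blast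
          also have "\<dots> \<le> d * (B * norm h) * (C * w)"
            using d hB wL wL0 B by (intro mult_mono) (auto simp: h_def)
          finally show ?thesis by (simp add: mult_ac)
        qed
        moreover have "norm T2 \<le> L * C * (d * norm h * w)"
        proof -
          have "norm T2 \<le> L * (norm (f y - f x - F x [h]) * wt Ly)"
            unfolding T2_def using mlin_bound[OF L, of "(f y - f x - F x [h]) # Ly"] len by simp
          also have "\<dots> \<le> L * ((d * norm h) * (C * w))"
            using h2 wL wL0 L0 d by (intro mult_left_mono mult_mono) (auto simp: h_def)
          finally show ?thesis by (simp add: mult_ac)
        qed
        moreover have "norm T3 \<le> C * L * B * (d * norm h * w)"
        proof -
          have "mlin (length p) (L * norm (F x [h])) (\<lambda>l. G (f x) (F x [h] # l))" using mlin_Cons[OF L] by (simp add: lp)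
          then have "norm T3 \<le> C * (L * norm (F x [h])) * norm h * w"
            unfolding T3_def Ly_def Lx_def w_def h_def using hC p by blast
          also have "\<dots> \<le> C * (L * (B * norm h)) * d * w"
            using hB L0 C(1) B(1) yd w by (intro mult_right_mono mult_mono mult_left_mono) (auto simp: h_def)
          finally show ?thesis by (simp add: mult_ac)
        qed
        moreover have "norm T4 \<le> K * (d * norm h * w)"
        proof -
          have "norm T4 \<le> d * K * norm h * w"
            unfolding T4_def Ly_def Lx_def w_def h_def using h4 p K lp by blast
          then show ?thesis by (simp add: mult_ac)
        qed
        moreover have "norm (T1 + T2 + T3 + T4) \<le> norm T1 + norm T2 + norm T3 + norm T4"
          by (rule order_trans[OF norm_triangle_ineq add_right_mono[OF order_trans[OF norm_triangle_ineq add_right_mono[OF norm_triangle_ineq]]]])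
        ultimately have "norm (T y p) \<le> N * (d * norm h * w)" by (simp add: N_def distrib_right)
        also have "\<dots> = (N * d) * (norm h * w)" by (simp add: mult_ac)
        also have "\<dots> \<le> e * (norm h * w)" using Nd w by (intro mult_right_mono) auto
        finally show "norm (T y p) \<le> e * norm (y - x) * wt (concat p)" by (simp add: h_def w_def mult_ac)
      qed
    qed
    have "\<forall>\<^sub>F y in near x W. \<forall>ps w. map (map length) ps = part_shapes n \<and> (\<forall>p\<in>set ps. F.adm (map length p) p \<and> wt (concat p) = w) \<longrightarrow>
        norm (\<Sum>p\<leftarrow>ps. T y p) \<le> e * norm (y - x) * w \<or> ps = []"
      by (rule F.eventually_sum_shapes[OF _ e]) (rule T)
    then show "\<forall>\<^sub>F y in near x W. \<forall>vs. length vs = n \<and> set vs \<subseteq> E \<longrightarrow>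
        norm (D y vs - D x vs - D x ((y - x) # vs)) \<le> e * norm (y - x) * wt vs"
    proof (eventually_elim, intro allI impI)
      fix y vs
      assume 1: "\<forall>ps w. map (map length) ps = part_shapes n \<and> (\<forall>p\<in>set ps. F.adm (map length p) p \<and> wt (concat p) = w) \<longrightarrow>
          norm (\<Sum>p\<leftarrow>ps. T y p) \<le> e * norm (y - x) * w \<or> ps = []"
        and vs: "length vs = n \<and> set vs \<subseteq> E"
      have "D y vs - D x vs - D x ((y - x) # vs) = (\<Sum>p\<leftarrow>parts vs. T y p)"
        unfolding D_Cons unfolding D_def T_def by (simp add: sum_list_subtractf)
      moreover have "parts vs \<noteq> []" by (induction vs) auto
      moreover have "norm (\<Sum>p\<leftarrow>parts vs. T y p) \<le> e * norm (y - x) * wt vs \<or> parts vs = []"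
        using 1 vs adm wt_parts shapes_parts[of vs] by blast
      ultimately show "norm (D y vs - D x vs - D x ((y - x) # vs)) \<le> e * norm (y - x) * wt vs" by simp
    qed
  qed
  moreover have "D x [] = g (f x)" if "x \<in> W" for x
    using G(1) fW that by (auto simp: D_def)
  ultimately show ?thesis unfolding smooth_on_iff using W by blast
qed

lemma smooth_on_bilinear_compose:
  assumes "bounded_bilinear B" and E: "subspace E" and "smooth_on E W f" "smooth_on E W g"
  shows "smooth_on E W (\<lambda>x. B (f x) (g x))"
  using smooth_on_compose[OF E smooth_on_Pair[OF E assms(3,4)] smooth_on_bilinear[OF assms(1)]] by simp

lemma smooth_on_linear_compose:
  assumes "bounded_linear B" and E: "subspace E" and "smooth_on E W f"
  shows "smooth_on E W (\<lambda>x. B (f x))"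
  by (rule smooth_on_compose[OF E assms(3) smooth_on_bounded_linear[OF assms(1), of UNIV UNIV]]) auto

lemma smooth_on_add:
  assumes E: "subspace E" and "smooth_on E W f" "smooth_on E W g"
  shows "smooth_on E W (\<lambda>x. f x + g x)"
proof -
  have "bounded_linear (\<lambda>p. fst p + snd p)" by (intro bounded_linear_add bounded_linear_fst bounded_linear_snd)
  from smooth_on_linear_compose[OF this E smooth_on_Pair[OF assms]] show ?thesis by simp
qed

lemma smooth_on_diff:
  assumes E: "subspace E" and "smooth_on E W f" "smooth_on E W g"
  shows "smooth_on E W (\<lambda>x. f x - g x)"
proof -
  have "bounded_linear (\<lambda>p. fst p - snd p)" by (intro bounded_linear_sub bounded_linear_fst bounded_linear_snd)
  from smooth_on_linear_compose[OF this E smooth_on_Pair[OF assms]] show ?thesis by simp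
qed

lemma smooth_on_imp_continuous_on:
  assumes "smooth_on E W f" "subspace E"
  shows "continuous_on W f"
proof -
  obtain F where F: "\<And>x. x \<in> W \<Longrightarrow> F x [] = f x" "smooth_tower E W F" using assms(1) unfolding smooth_on_iff by blast
  have WE: "W \<subseteq> E" using smooth_on_openin[OF assms(1)] by (rule openin_imp_subset)
  show ?thesis
    unfolding continuous_on_iff
  proof (intro ballI allI impI)
    fix x and e :: real assume x: "x \<in> W" and e: "0 < e"
    interpret F: tower_at E W F x by unfold_locales (use assms WE x F in auto)
    obtain B where B: "0 \<le> B" "\<forall>\<^sub>F y in near x W. \<forall>b. length b = 0 \<and> set b \<subseteq> E \<longrightarrow>
         norm (F y b) \<le> B * wt b \<and> norm (F y b - F x b) \<le> B * norm (y - x) * wt b \<and> norm (F x ((y - x) # b)) \<le> B * norm (y - x) * wt b"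
      using F.lipschitz1 by blast
    then obtain d where d: "0 < d" "\<And>y. y \<in> W \<Longrightarrow> norm (y - x) < d \<Longrightarrow> norm (F y [] - F x []) \<le> B * norm (y - x)"
      unfolding eventually_near by auto
    show "\<exists>d>0. \<forall>x'\<in>W. dist x' x < d \<longrightarrow> dist (f x') (f x) < e"
    proof (intro exI[of _ "min d (e / (B + 1))"] conjI ballI impI)
      fix y assume y: "y \<in> W" "dist y x < min d (e / (B + 1))"
      then have "norm (f y - f x) \<le> B * norm (y - x)" using d(2)[of y] F(1) x by (simp add: dist_norm)
      also have "\<dots> \<le> (B + 1) * norm (y - x)" by (intro mult_right_mono) auto
      also have "\<dots> < (B + 1) * (e / (B + 1))" using y B(1) by (intro mult_strict_left_mono) (auto simp: dist_norm)
      also have "\<dots> = e" using B(1) by simp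
      finally show "dist (f y) (f x) < e" by (simp add: dist_norm)
    qed (use d e B in simp)
  qed
qed

text \<open>Used with exponents \<open>1/2\<close> and \<open>-1/2\<close>, for the inverse of the
  sphere chart and for the modulus in a phase. The coefficients of the derivatives are falling
  factorials.\<close>

lemma smooth_on_powr: "smooth_on UNIV {0<..} (\<lambda>r::real. r powr a)"
proof -
  define c where "c n = (\<Prod>j<n. a - real j)" for n
  define D where "D r vs = c (length vs) * r powr (a - real (length vs)) * prod_list vs" for r :: real and vs
  have n: "\<bar>prod_list vs\<bar> = wt vs" for vs :: "real list" by (induction vs) (simp_all add: abs_mult)
  have "smooth_tower UNIV {0<..} D"
  proof (rule smooth_towerI)
    show "openin (top_of_set UNIV) {0::real<..}" by (simp add: open_openin[symmetric])
    show "\<exists>K. \<forall>vs. length vs = n \<and> set vs \<subseteq> UNIV \<longrightarrow> norm (D r vs) \<le> K * wt vs" for r n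
      by (rule exI[of _ "\<bar>c n * r powr (a - real n)\<bar>"]) (auto simp: D_def abs_mult n)
    show "\<forall>\<^sub>F s in near r {0<..}. \<forall>vs. length vs = n \<and> set vs \<subseteq> UNIV \<longrightarrow>
        norm (D s vs - D r vs - D r ((s - r) # vs)) \<le> e * norm (s - r) * wt vs"
      if r: "r \<in> {0<..}" and e: "0 < e" for r n and e :: real
    proof -
      define f where "f s = c n * s powr (a - real n)" for s
      have "((\<lambda>s. c n * s powr (a - real n)) has_real_derivative c n * ((a - real n) * r powr (a - real n - 1))) (at r)"
        using r by (auto intro!: derivative_eq_intros)
      also have "c n * ((a - real n) * r powr (a - real n - 1)) = c (Suc n) * r powr (a - real (Suc n))"
        by (simp add: c_def algebra_simps)
      finally have "(f has_derivative (\<lambda>h. (c (Suc n) * r powr (a - real (Suc n))) * h)) (at r)"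
        unfolding f_def[abs_def] has_field_derivative_def .
      then obtain d where d: "0 < d" "\<And>s. norm (s - r) < d \<Longrightarrow>
          norm (f s - f r - c (Suc n) * r powr (a - real (Suc n)) * (s - r)) \<le> e * norm (s - r)"
        using e unfolding has_derivative_at_alt by blast
      show ?thesis
        unfolding eventually_near
      proof (intro exI[of _ d] conjI ballI impI allI)
        fix s and vs :: "real list" assume s: "norm (s - r) < d" and vs: "length vs = n \<and> set vs \<subseteq> UNIV"
        have "D s vs - D r vs - D r ((s - r) # vs) = (f s - f r - c (Suc n) * r powr (a - real (Suc n)) * (s - r)) * prod_list vs"
          using vs by (simp add: D_def f_def algebra_simps)
        then have "norm (D s vs - D r vs - D r ((s - r) # vs)) = norm (f s - f r - c (Suc n) * r powr (a - real (Suc n)) * (s - r)) * wt vs"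
          by (simp add: abs_mult n)
        also have "\<dots> \<le> e * norm (s - r) * wt vs" using d(2)[OF s] by (intro mult_right_mono) auto
        finally show "norm (D s vs - D r vs - D r ((s - r) # vs)) \<le> e * norm (s - r) * wt vs" .
      qed (rule d)
    qed
  qed (auto simp: D_def algebra_simps)
  then show ?thesis unfolding smooth_on_iff
    by (intro conjI exI[of _ D]) (simp_all add: D_def c_def open_openin[symmetric])
qed

section \<open>Power series of operators\<close>

text \<open>Each entry paired with the list without it: the directions that can hit one chosen
  factor \<open>X\<close> of a product when it is differentiated, and those left for the other
  factors.\<close>

fun picks :: "'a list \<Rightarrow> ('a \<times> 'a list) list" where
  "picks [] = []"
| "picks (v # vs) = (v, vs) # map (\<lambda>(u, us). (u, v # us)) (picks vs)"

lemma length_picks: "length (picks vs) = length vs"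
  by (induction vs) simp_all

lemma picks_mem: "p \<in> set (picks vs) \<Longrightarrow> Suc (length (snd p)) = length vs \<and> norm (fst p) * wt (snd p) = wt vs"
  by (induction vs arbitrary: p) (force simp: mult_ac)+

text \<open>\<open>pow_tower m X vs\<close> is the derivative of \<open>X \<mapsto> X\<^sup>m\<close> of order \<open>length vs\<close> at \<open>X\<close> in the
  directions \<open>vs\<close>.\<close>

fun pow_tower :: "nat \<Rightarrow> ('a::banach \<Rightarrow>\<^sub>L 'a) \<Rightarrow> ('a \<Rightarrow>\<^sub>L 'a) list \<Rightarrow> ('a \<Rightarrow>\<^sub>L 'a)" where
  "pow_tower 0 X vs = (if vs = [] then id_blinfun else 0)"
| "pow_tower (Suc m) X vs = (X o\<^sub>L pow_tower m X vs) + (\<Sum>p\<leftarrow>picks vs. fst p o\<^sub>L pow_tower m X (snd p))"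

lemma pow_tower_Cons:
  "pow_tower (Suc m) X (h # vs) = (X o\<^sub>L pow_tower m X (h # vs)) + (h o\<^sub>L pow_tower m X vs)
     + (\<Sum>p\<leftarrow>picks vs. fst p o\<^sub>L pow_tower m X (h # snd p))"
  by (simp add: comp_def case_prod_beta)

lemmas compose_simps =
  bounded_bilinear.add_left[OF bounded_bilinear_blinfun_compose]
  bounded_bilinear.add_right[OF bounded_bilinear_blinfun_compose]
  bounded_bilinear.diff_left[OF bounded_bilinear_blinfun_compose]
  bounded_bilinear.diff_right[OF bounded_bilinear_blinfun_compose]
  bounded_bilinear.minus_left[OF bounded_bilinear_blinfun_compose]
  bounded_bilinear.minus_right[OF bounded_bilinear_blinfun_compose]
  bounded_bilinear.scaleR_left[OF bounded_bilinear_blinfun_compose]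
  bounded_bilinear.scaleR_right[OF bounded_bilinear_blinfun_compose]
  bounded_bilinear.zero_left[OF bounded_bilinear_blinfun_compose]
  bounded_bilinear.zero_right[OF bounded_bilinear_blinfun_compose]

lemma compose_assoc: "(A o\<^sub>L B) o\<^sub>L C = A o\<^sub>L (B o\<^sub>L C)"
  by (rule blinfun_eqI) simp

lemma compose_id [simp]: "A o\<^sub>L id_blinfun = A" "id_blinfun o\<^sub>L A = A"
  by (auto intro: blinfun_eqI)

lemma pow_tower_linear:
  "pow_tower m X ((v + w) # vs) = pow_tower m X (v # vs) + pow_tower m X (w # vs)"
  "pow_tower m X ((c *\<^sub>R v) # vs) = c *\<^sub>R pow_tower m X (v # vs)"
proof (induction m arbitrary: vs)
  case (Suc m)
  { case 1 show ?case unfolding pow_tower_Cons Suc.IH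
      by (simp add: compose_simps sum_list_addf algebra_simps) }
  { case 2 show ?case unfolding pow_tower_Cons Suc.IH
      by (simp add: compose_simps scaleR_sum_list scaleR_add_right comp_def) }
qed simp_all

lemma norm_sum_list_le:
  assumes "\<And>p. p \<in> set ps \<Longrightarrow> norm (g p) \<le> c"
  shows "norm (\<Sum>p\<leftarrow>ps. g p) \<le> real (length ps) * c"
  using assms
proof (induction ps)
  case (Cons p ps)
  then have "norm (\<Sum>p\<leftarrow>p # ps. g p) \<le> c + real (length ps) * c"
    by (auto intro: order_trans[OF norm_triangle_ineq add_mono])
  then show ?case by (simp add: algebra_simps)
qed simp

lemma norm_sum_picks:
  fixes g :: "('a::banach \<Rightarrow>\<^sub>L 'a) list \<Rightarrow> 'a \<Rightarrow>\<^sub>L 'a"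
  assumes g: "\<And>us. Suc (length us) = length vs \<Longrightarrow> norm (g us) \<le> c * wt us" and c: "0 \<le> c"
  shows "norm (\<Sum>p\<leftarrow>picks vs. fst p o\<^sub>L g (snd p)) \<le> real (length vs) * (c * wt vs)"
proof -
  have "norm (fst p o\<^sub>L g (snd p)) \<le> c * wt vs" if p: "p \<in> set (picks vs)" for p
  proof -
    have "norm (fst p o\<^sub>L g (snd p)) \<le> norm (fst p) * (c * wt (snd p))"
      using g picks_mem[OF p] by (intro order_trans[OF norm_blinfun_compose] mult_left_mono) auto
    also have "\<dots> = c * (norm (fst p) * wt (snd p))" by (simp only: mult_ac)
    also have "\<dots> = c * wt vs" by (simp only: picks_mem[OF p])
    finally show ?thesis .
  qed
  then show ?thesis using norm_sum_list_le[of "picks vs" "\<lambda>p. fst p o\<^sub>L g (snd p)" "c * wt vs"] by (simp add: length_picks)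
qed

text \<open>The constant \<open>n! / s^n\<close> of Cauchy's estimate for derivatives of order
  \<open>n\<close>, where the radius grows from \<open>r\<close> to \<open>r + s\<close>.\<close>

definition tower_const :: "real \<Rightarrow> nat \<Rightarrow> real" where
  "tower_const s n = fact n / s ^ n"

lemma tower_const_Suc: "0 < s \<Longrightarrow> tower_const s (Suc n) * s = real (Suc n) * tower_const s n"
  by (simp add: tower_const_def field_simps)

lemma tower_const_nonneg: "0 < s \<Longrightarrow> 0 \<le> tower_const s n"
  by (simp add: tower_const_def)

lemma tower_const_pred: "0 < s \<Longrightarrow> real n * tower_const s (n - 1) = tower_const s n * s \<or> n = 0"
  using tower_const_Suc[of s "n - 1"] by (cases n) auto

text \<open>Induction on the power: differentiating the new factor contributes
  \<open>n * tower_const s (n - 1) = s * tower_const s n\<close> for positive \<open>n\<close>,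
  which turns the factor \<open>r\<close> into \<open>r + s\<close>.\<close>

lemma norm_pow_tower:
  assumes X: "norm X \<le> r" and s: "0 < s"
  shows "norm (pow_tower m X vs) \<le> tower_const s (length vs) * (r + s) ^ m * wt vs"
proof (induction m arbitrary: vs)
  case 0
  then show ?case using s by (simp add: tower_const_def norm_blinfun_id_le)
next
  case (Suc m)
  let ?n = "length vs"
  have r: "0 \<le> r" using X norm_ge_zero order_trans by blast
  define Q where "Q = (r + s) ^ m * wt vs"
  have Q: "0 \<le> Q" using r s by (simp add: Q_def)
  have 1: "norm (X o\<^sub>L pow_tower m X vs) \<le> r * (tower_const s ?n * Q)"
    using Suc[of vs] X r by (intro order_trans[OF norm_blinfun_compose] mult_mono) (auto simp: Q_def mult_ac)
  have "norm (\<Sum>p\<leftarrow>picks vs. fst p o\<^sub>L pow_tower m X (snd p)) \<le> real ?n * (tower_const s (?n - 1) * (r + s) ^ m * wt vs)"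
  proof (rule norm_sum_picks)
    show "norm (pow_tower m X us) \<le> tower_const s (?n - 1) * (r + s) ^ m * wt us" if "Suc (length us) = ?n" for us
      using Suc[of us] that by (metis diff_Suc_1)
  qed (use r s tower_const_nonneg in simp)
  also have "\<dots> = (real ?n * tower_const s (?n - 1)) * Q" by (simp add: Q_def mult_ac)
  also have "\<dots> \<le> (tower_const s ?n * s) * Q"
    using tower_const_pred[OF s, of ?n] Q s tower_const_nonneg[OF s, of ?n] by (intro mult_right_mono) auto
  finally have "norm (pow_tower (Suc m) X vs) \<le> r * (tower_const s ?n * Q) + (tower_const s ?n * s) * Q"
    using 1 by (auto intro: order_trans[OF norm_triangle_ineq add_mono])
  then show ?case by (simp add: Q_def algebra_simps)
qed

lemma pow_tower_lipschitz:
  assumes X: "norm X \<le> r" and Y: "norm Y \<le> r" and s: "0 < s"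
  shows "norm (pow_tower m Y vs - pow_tower m X vs) \<le> tower_const s (Suc (length vs)) * (r + s) ^ m * norm (Y - X) * wt vs"
proof (induction m arbitrary: vs)
  case 0
  then show ?case using s by (simp add: tower_const_nonneg)
next
  case (Suc m)
  let ?n = "length vs"
  have r: "0 \<le> r" using X norm_ge_zero order_trans by blast
  define Q where "Q = (r + s) ^ m * norm (Y - X) * wt vs"
  have Q: "0 \<le> Q" using r s by (simp add: Q_def)
  have eq: "pow_tower (Suc m) Y vs - pow_tower (Suc m) X vs = (X o\<^sub>L (pow_tower m Y vs - pow_tower m X vs))
     + ((Y - X) o\<^sub>L pow_tower m Y vs) + (\<Sum>p\<leftarrow>picks vs. fst p o\<^sub>L (pow_tower m Y (snd p) - pow_tower m X (snd p)))"
    by (simp add: compose_simps sum_list_subtractf algebra_simps)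
  have 1: "norm (X o\<^sub>L (pow_tower m Y vs - pow_tower m X vs)) \<le> r * (tower_const s (Suc ?n) * Q)"
    using Suc[of vs] X r by (intro order_trans[OF norm_blinfun_compose] mult_mono) (auto simp: Q_def mult_ac)
  have 2: "norm ((Y - X) o\<^sub>L pow_tower m Y vs) \<le> tower_const s ?n * Q"
  proof -
    have "norm ((Y - X) o\<^sub>L pow_tower m Y vs) \<le> norm (Y - X) * (tower_const s ?n * (r + s) ^ m * wt vs)"
      using norm_pow_tower[OF Y s, of m vs] by (intro order_trans[OF norm_blinfun_compose] mult_left_mono) auto
    then show ?thesis by (simp add: Q_def mult_ac)
  qed
  have "norm (\<Sum>p\<leftarrow>picks vs. fst p o\<^sub>L (pow_tower m Y (snd p) - pow_tower m X (snd p)))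
      \<le> real ?n * (tower_const s ?n * (r + s) ^ m * norm (Y - X) * wt vs)"
  proof (rule norm_sum_picks)
    show "norm (pow_tower m Y us - pow_tower m X us) \<le> tower_const s ?n * (r + s) ^ m * norm (Y - X) * wt us"
      if "Suc (length us) = ?n" for us
      using Suc[of us] that by simp
  qed (use r s tower_const_nonneg in simp)
  then have 3: "norm (\<Sum>p\<leftarrow>picks vs. fst p o\<^sub>L (pow_tower m Y (snd p) - pow_tower m X (snd p))) \<le> real ?n * (tower_const s ?n * Q)"
    by (simp add: Q_def mult_ac)
  have "norm (pow_tower (Suc m) Y vs - pow_tower (Suc m) X vs) \<le> r * (tower_const s (Suc ?n) * Q) + tower_const s ?n * Q + real ?n * (tower_const s ?n * Q)"
    unfolding eq using 1 2 3 by (intro order_trans[OF norm_triangle_ineq add_mono]) auto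
  also have "\<dots> = (r * tower_const s (Suc ?n) + real (Suc ?n) * tower_const s ?n) * Q" by (simp add: algebra_simps)
  also have "\<dots> = (r * tower_const s (Suc ?n) + tower_const s (Suc ?n) * s) * Q"
    by (simp only: tower_const_Suc[OF s])
  finally show ?case by (simp add: Q_def algebra_simps)
qed

text \<open>The power enters only through \<open>(r + s) ^ m\<close>, so the second-order remainders
  can be summed against the coefficients of a convergent series. Each order of difference costs one
  more index of \<open>tower_const\<close>.\<close>

lemma pow_tower_remainder:
  assumes X: "norm X \<le> r" and Y: "norm Y \<le> r" and s: "0 < s"
  shows "norm (pow_tower m Y vs - pow_tower m X vs - pow_tower m X ((Y - X) # vs))
    \<le> tower_const s (Suc (Suc (length vs))) * (r + s) ^ m * (norm (Y - X))\<^sup>2 * wt vs"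
proof (induction m arbitrary: vs)
  case 0
  then show ?case using s by (simp add: tower_const_nonneg)
next
  case (Suc m)
  let ?n = "length vs"
  let ?R = "\<lambda>vs. pow_tower m Y vs - pow_tower m X vs - pow_tower m X ((Y - X) # vs)"
  have r: "0 \<le> r" using X norm_ge_zero order_trans by blast
  define Q where "Q = (r + s) ^ m * (norm (Y - X))\<^sup>2 * wt vs"
  have Q: "0 \<le> Q" using r s by (simp add: Q_def)
  have eq: "pow_tower (Suc m) Y vs - pow_tower (Suc m) X vs - pow_tower (Suc m) X ((Y - X) # vs) = (X o\<^sub>L ?R vs)
     + ((Y - X) o\<^sub>L (pow_tower m Y vs - pow_tower m X vs)) + (\<Sum>p\<leftarrow>picks vs. fst p o\<^sub>L ?R (snd p))"
    unfolding pow_tower_Cons by (simp add: compose_simps sum_list_subtractf sum_list_addf algebra_simps)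
  have 1: "norm (X o\<^sub>L ?R vs) \<le> r * (tower_const s (Suc (Suc ?n)) * Q)"
    using Suc[of vs] X r by (intro order_trans[OF norm_blinfun_compose] mult_mono) (auto simp: Q_def mult_ac)
  have 2: "norm ((Y - X) o\<^sub>L (pow_tower m Y vs - pow_tower m X vs)) \<le> tower_const s (Suc ?n) * Q"
  proof -
    have "norm ((Y - X) o\<^sub>L (pow_tower m Y vs - pow_tower m X vs)) \<le> norm (Y - X) * (tower_const s (Suc ?n) * (r + s) ^ m * norm (Y - X) * wt vs)"
      using pow_tower_lipschitz[OF X Y s, of m vs] by (intro order_trans[OF norm_blinfun_compose] mult_left_mono) auto
    then show ?thesis by (simp add: Q_def mult_ac power2_eq_square)
  qed
  have "norm (\<Sum>p\<leftarrow>picks vs. fst p o\<^sub>L ?R (snd p))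
      \<le> real ?n * (tower_const s (Suc ?n) * (r + s) ^ m * (norm (Y - X))\<^sup>2 * wt vs)"
  proof (rule norm_sum_picks)
    show "norm (?R us) \<le> tower_const s (Suc ?n) * (r + s) ^ m * (norm (Y - X))\<^sup>2 * wt us"
      if "Suc (length us) = ?n" for us
      using Suc[of us] that by simp
  qed (use r s tower_const_nonneg in simp)
  then have 3: "norm (\<Sum>p\<leftarrow>picks vs. fst p o\<^sub>L ?R (snd p)) \<le> real ?n * (tower_const s (Suc ?n) * Q)"
    by (simp add: Q_def mult_ac)
  have "norm (pow_tower (Suc m) Y vs - pow_tower (Suc m) X vs - pow_tower (Suc m) X ((Y - X) # vs))
      \<le> r * (tower_const s (Suc (Suc ?n)) * Q) + tower_const s (Suc ?n) * Q + real ?n * (tower_const s (Suc ?n) * Q)"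
    unfolding eq using 1 2 3 by (intro order_trans[OF norm_triangle_ineq add_mono]) auto
  also have "\<dots> \<le> r * (tower_const s (Suc (Suc ?n)) * Q) + real (Suc (Suc ?n)) * tower_const s (Suc ?n) * Q"
    using Q tower_const_nonneg[OF s, of "Suc ?n"] by (simp add: algebra_simps)
  also have "\<dots> = r * (tower_const s (Suc (Suc ?n)) * Q) + tower_const s (Suc (Suc ?n)) * s * Q"
    by (simp only: tower_const_Suc[OF s])
  finally show ?case by (simp add: Q_def algebra_simps)
qed

section \<open>Operator-valued power series and their derivatives\<close>

definition op_series :: "(nat \<Rightarrow> real) \<Rightarrow> ('a::banach \<Rightarrow>\<^sub>L 'a) \<Rightarrow> ('a \<Rightarrow>\<^sub>L 'a)" where
  "op_series a X = (\<Sum>m. a m *\<^sub>R pow_tower m X [])"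

definition converges_within :: "(nat \<Rightarrow> real) \<Rightarrow> real \<Rightarrow> bool" where
  "converges_within a R \<longleftrightarrow> (\<forall>\<rho>. 0 \<le> \<rho> \<and> \<rho> < R \<longrightarrow> summable (\<lambda>m. \<bar>a m\<bar> * \<rho> ^ m))"

lemma summable_pow_tower:
  assumes a: "converges_within a R" and X: "norm X < R"
  shows "summable (\<lambda>m. a m *\<^sub>R pow_tower m X vs)"
proof -
  define s where "s = (R - norm X) / 2"
  have s: "0 < s" "norm X + s < R" using X by (simp_all add: s_def field_simps)
  let ?c = "tower_const s (length vs) * wt vs"
  have "summable (\<lambda>m. \<bar>a m\<bar> * (norm X + s) ^ m * ?c)"
    using a s by (intro summable_mult2) (simp add: converges_within_def)
  then show ?thesis
  proof (rule summable_comparison_test'[where N = 0])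
    fix m
    have "norm (a m *\<^sub>R pow_tower m X vs) \<le> \<bar>a m\<bar> * (tower_const s (length vs) * (norm X + s) ^ m * wt vs)"
      using norm_pow_tower[where X = X and m = m and vs = vs, OF order_refl s(1)] by (simp add: mult_left_mono)
    then show "norm (a m *\<^sub>R pow_tower m X vs) \<le> \<bar>a m\<bar> * (norm X + s) ^ m * ?c" by (simp add: mult_ac)
  qed
qed

definition series_tower :: "(nat \<Rightarrow> real) \<Rightarrow> ('a::banach \<Rightarrow>\<^sub>L 'a) \<Rightarrow> ('a \<Rightarrow>\<^sub>L 'a) list \<Rightarrow> ('a \<Rightarrow>\<^sub>L 'a)" where
  "series_tower a X vs = (\<Sum>m. a m *\<^sub>R pow_tower m X vs)"

lemma series_tower_Nil: "series_tower a X [] = op_series a X"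
  by (simp add: series_tower_def op_series_def)

lemma smooth_tower_series:
  assumes a: "converges_within a R"
  shows "smooth_tower UNIV {X. norm X < R} (series_tower a)"
proof (rule smooth_towerI)
  show "openin (top_of_set UNIV) {X::'a \<Rightarrow>\<^sub>L 'a. norm X < R}"
    by (simp add: open_Collect_less continuous_on_norm_id flip: open_openin)
  fix X :: "'a \<Rightarrow>\<^sub>L 'a" assume "X \<in> {X. norm X < R}"
  then have X: "norm X < R" by simp
  note sm = summable_pow_tower[OF a X]
  show "series_tower a X ((v + w) # vs) = series_tower a X (v # vs) + series_tower a X (w # vs)" for v w vs
    unfolding series_tower_def using suminf_add[OF sm sm] by (simp add: pow_tower_linear scaleR_add_right)
  show "series_tower a X ((c *\<^sub>R v) # vs) = c *\<^sub>R series_tower a X (v # vs)" for c v vs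
    unfolding series_tower_def using suminf_scaleR_right[OF sm, of c] by (simp add: pow_tower_linear mult.commute)
  \<comment> \<open>A third of the gap to \<open>R\<close>: nearby \<open>Y\<close> stay in the ball
    of radius \<open>r = norm X + s\<close>, and \<open>r + s\<close> is still below
    \<open>R\<close>.\<close>
  define s where "s = (R - norm X) / 3"
  define r where "r = norm X + s"
  have s: "0 < s" "norm X < r" "r + s < R" "0 \<le> r"
    using X by (simp_all add: s_def r_def field_simps add_nonneg_nonneg)
      (use norm_ge_zero[of X] in linarith)
  define S where "S = (\<Sum>m. \<bar>a m\<bar> * (r + s) ^ m)"
  have sumS: "summable (\<lambda>m. \<bar>a m\<bar> * (r + s) ^ m)" using a s by (simp add: converges_within_def)
  have S: "0 \<le> S" unfolding S_def using s by (intro suminf_nonneg sumS) simp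
  have le: "norm (\<Sum>m. a m *\<^sub>R f m) \<le> S * c" if f: "\<And>m. norm (f m) \<le> (r + s) ^ m * c" for f :: "nat \<Rightarrow> 'a \<Rightarrow>\<^sub>L 'a" and c
  proof -
    have b: "norm (a m *\<^sub>R f m) \<le> \<bar>a m\<bar> * (r + s) ^ m * c" for m
      using f[of m] by (simp add: mult_left_mono mult.assoc)
    have sc: "summable (\<lambda>m. \<bar>a m\<bar> * (r + s) ^ m * c)" by (rule summable_mult2[OF sumS])
    have sn: "summable (\<lambda>m. norm (a m *\<^sub>R f m))"
      by (rule summable_comparison_test'[OF sc, of 0]) (use b in simp)
    have "norm (\<Sum>m. a m *\<^sub>R f m) \<le> (\<Sum>m. norm (a m *\<^sub>R f m))" by (rule summable_norm[OF sn])
    also have "\<dots> \<le> (\<Sum>m. \<bar>a m\<bar> * (r + s) ^ m * c)" by (rule suminf_le[OF b sn sc])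
    also have "\<dots> = S * c" unfolding S_def by (rule suminf_mult2[OF sumS, symmetric])
    finally show ?thesis .
  qed
  show "\<exists>K. \<forall>vs. length vs = n \<and> set vs \<subseteq> UNIV \<longrightarrow> norm (series_tower a X vs) \<le> K * wt vs" for n
  proof (intro exI[of _ "S * tower_const s n"] allI impI)
    fix vs :: "('a \<Rightarrow>\<^sub>L 'a) list" assume vs: "length vs = n \<and> set vs \<subseteq> UNIV"
    have "norm (series_tower a X vs) \<le> S * (tower_const s n * wt vs)"
      unfolding series_tower_def
      by (rule le) (use norm_pow_tower[OF less_imp_le[OF s(2)] s(1), of _ vs] vs in \<open>simp add: mult_ac\<close>)
    then show "norm (series_tower a X vs) \<le> S * tower_const s n * wt vs" by (simp add: mult_ac)
  qed
  fix n and e :: real assume e: "0 < e"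
  define C where "C = S * tower_const s (Suc (Suc n))"
  have C: "0 \<le> C" using S tower_const_nonneg[OF s(1)] by (simp add: C_def)
  show "\<forall>\<^sub>F Y in near X {X. norm X < R}. \<forall>vs. length vs = n \<and> set vs \<subseteq> UNIV \<longrightarrow>
      norm (series_tower a Y vs - series_tower a X vs - series_tower a X ((Y - X) # vs)) \<le> e * norm (Y - X) * wt vs"
    unfolding eventually_near
  proof (intro exI[of _ "min s (e / (C + 1))"] conjI ballI impI allI)
    show "0 < min s (e / (C + 1))" using s e C by simp
    fix Y and vs :: "('a \<Rightarrow>\<^sub>L 'a) list"
    assume Y: "Y \<in> {X. norm X < R}" "norm (Y - X) < min s (e / (C + 1))" and vs: "length vs = n \<and> set vs \<subseteq> UNIV"
    have nY: "norm Y \<le> r" using Y(2) norm_triangle_ineq2[of Y X] by (simp add: r_def)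
    note sy = summable_pow_tower[OF a, of Y]
    have "series_tower a Y vs - series_tower a X vs - series_tower a X ((Y - X) # vs)
        = (\<Sum>m. a m *\<^sub>R (pow_tower m Y vs - pow_tower m X vs - pow_tower m X ((Y - X) # vs)))"
      unfolding series_tower_def scaleR_diff_right
      using Y by (subst suminf_diff[symmetric] | intro summable_diff sm sy | simp)+
    also have "norm \<dots> \<le> S * (tower_const s (Suc (Suc n)) * (norm (Y - X))\<^sup>2 * wt vs)"
      by (rule le) (use pow_tower_remainder[OF less_imp_le[OF s(2)] nY s(1), of _ vs] vs in \<open>simp add: mult_ac\<close>)
    also have "\<dots> = (C * norm (Y - X)) * (norm (Y - X) * wt vs)" by (simp add: C_def power2_eq_square mult_ac)
    also have "\<dots> \<le> e * (norm (Y - X) * wt vs)"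
    proof (rule mult_right_mono)
      have "(C + 1) * norm (Y - X) \<le> e" using Y(2) C by (simp add: field_simps)
      then show "C * norm (Y - X) \<le> e" using norm_ge_zero[of "Y - X"] unfolding distrib_right by linarith
    qed simp
    finally show "norm (series_tower a Y vs - series_tower a X vs - series_tower a X ((Y - X) # vs)) \<le> e * norm (Y - X) * wt vs"
      by (simp add: mult_ac)
  qed
qed (simp add: subspace_UNIV)

lemma smooth_on_op_series:
  assumes a: "converges_within a R"
  shows "smooth_on UNIV {X. norm X < R} (op_series a)"
  unfolding smooth_on_iff
  using smooth_tower_series[OF a]
  by (intro conjI exI[of _ "series_tower a"])
    (simp_all add: series_tower_Nil open_Collect_less continuous_on_norm_id flip: open_openin)

lemma op_series_has_derivative:
  assumes a: "converges_within a R" and X: "norm X < R"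
  shows "(op_series a has_derivative (\<lambda>H. series_tower a X [H])) (at X)"
proof -
  have t: "smooth_tower UNIV {X. norm X < R} (series_tower a)" by (rule smooth_tower_series[OF a])
  then have m: "bounded_multilinear_on UNIV 1 (series_tower a X)" using X unfolding smooth_tower_def by blast
  obtain K where K: "mlin 1 K (series_tower a X)" using bounded_multilinear_on_mlin[OF m] by blast
  have "bounded_linear (\<lambda>H. series_tower a X [H])"
  proof (rule bounded_linear_intro[of _ K])
    show "norm (series_tower a X [H]) \<le> norm H * K" for H using mlin_bound[OF K, of "[H]"] by (simp add: mult.commute)
  qed (use mlin_first[of 0 K "series_tower a X" "[]"] K in simp_all)
  moreover have "\<exists>d>0. \<forall>Y. norm (Y - X) < d \<longrightarrow> norm (op_series a Y - op_series a X - series_tower a X [Y - X]) \<le> e * norm (Y - X)"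
    if e: "0 < e" for e
  proof -
    have "\<forall>\<^sub>F Y in near X {X. norm X < R}. \<forall>vs. length vs = 0 \<and> set vs \<subseteq> UNIV \<longrightarrow>
      norm (series_tower a Y vs - series_tower a X vs - series_tower a X ((Y - X) # vs)) \<le> e * norm (Y - X) * wt vs"
      using t X e unfolding smooth_tower_def by blast
    then obtain d where d: "0 < d" "\<And>Y. norm Y < R \<Longrightarrow> norm (Y - X) < d \<Longrightarrow>
        norm (op_series a Y - op_series a X - series_tower a X [Y - X]) \<le> e * norm (Y - X)"
      unfolding eventually_near by (auto simp: series_tower_Nil)
    show ?thesis
    proof (intro exI[of _ "min d (R - norm X)"] conjI allI impI)
      fix Y assume Y: "norm (Y - X) < min d (R - norm X)"
      then have "norm Y < R" using norm_triangle_ineq2[of Y X] by simp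
      then show "norm (op_series a Y - op_series a X - series_tower a X [Y - X]) \<le> e * norm (Y - X)" using d(2) Y by simp
    qed (use d X in simp)
  qed
  ultimately show ?thesis unfolding has_derivative_at_alt by blast
qed

lemma pow_tower_intertwine:
  assumes "T o\<^sub>L X = Y o\<^sub>L T"
  shows "T o\<^sub>L pow_tower m X [] = pow_tower m Y [] o\<^sub>L T"
  by (induction m) (simp_all add: compose_simps, metis assms compose_assoc)

text \<open>With \<open>Y = X\<close> this is commutation. Taking for \<open>T\<close> a scalar
  operator or the star operation, it carries complex linearity and compatibility with
  \<open>star\<close> over to functions of \<open>X\<close>.\<close>

lemma op_series_intertwine:
  assumes "converges_within a R" "norm X < R" "norm Y < R" "T o\<^sub>L X = Y o\<^sub>L T"
  shows "T o\<^sub>L op_series a X = op_series a Y o\<^sub>L T"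
proof -
  have "T o\<^sub>L op_series a X = (\<Sum>m. T o\<^sub>L (a m *\<^sub>R pow_tower m X []))"
    unfolding op_series_def
    by (rule bounded_linear.suminf[OF bounded_bilinear.bounded_linear_right[OF bounded_bilinear_blinfun_compose] summable_pow_tower[OF assms(1,2)]])
  also have "\<dots> = (\<Sum>m. (a m *\<^sub>R pow_tower m Y []) o\<^sub>L T)"
    by (simp add: compose_simps pow_tower_intertwine[OF assms(4)])
  also have "\<dots> = op_series a Y o\<^sub>L T"
    unfolding op_series_def
    by (rule bounded_linear.suminf[OF bounded_bilinear.bounded_linear_left[OF bounded_bilinear_blinfun_compose] summable_pow_tower[OF assms(1,3)], symmetric])
  finally show ?thesis .
qed

lemma pow_tower_commuting_direction:
  assumes "V o\<^sub>L X = X o\<^sub>L V"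
  shows "pow_tower (Suc m) X [V] = real (Suc m) *\<^sub>R (pow_tower m X [] o\<^sub>L V)"
proof (induction m)
  case 0
  then show ?case by (simp add: compose_simps)
next
  case (Suc m)
  have "pow_tower (Suc (Suc m)) X [V] = (X o\<^sub>L pow_tower (Suc m) X [V]) + (V o\<^sub>L pow_tower (Suc m) X [])"
    by (subst pow_tower.simps(2)) simp
  also have "\<dots> = (real (Suc m) *\<^sub>R (pow_tower (Suc m) X [] o\<^sub>L V)) + (pow_tower (Suc m) X [] o\<^sub>L V)"
    unfolding Suc.IH pow_tower_intertwine[OF assms, of "Suc m"] by (simp add: compose_simps compose_assoc)
  finally show ?case by (simp only: of_nat_Suc scaleR_left_distrib scaleR_one add_ac)
qed

lemma series_tower_commuting_direction:
  assumes a: "converges_within a R" and X: "norm X < R" and b: "converges_within b R"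
    and b_def: "\<And>m. b m = real (Suc m) * a (Suc m)" and V: "V o\<^sub>L X = X o\<^sub>L V"
  shows "series_tower a X [V] = op_series b X o\<^sub>L V"
proof -
  have "series_tower a X [V] = (\<Sum>m. a (Suc m) *\<^sub>R pow_tower (Suc m) X [V])"
    unfolding series_tower_def using suminf_split_head[OF summable_pow_tower[OF a X, of "[V]"]] by simp
  also have "\<dots> = (\<Sum>m. (b m *\<^sub>R pow_tower m X []) o\<^sub>L V)"
    unfolding pow_tower_commuting_direction[OF V] by (simp add: b_def compose_simps mult.commute)
  also have "\<dots> = op_series b X o\<^sub>L V"
    unfolding op_series_def
    by (rule bounded_linear.suminf[OF bounded_bilinear.bounded_linear_left[OF bounded_bilinear_blinfun_compose] summable_pow_tower[OF b X], symmetric])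
  finally show ?thesis .
qed

text \<open>When the velocity commutes with the point, differentiating the series gives the formal
  derivative series times the velocity, as for scalars.\<close>

lemma op_series_vector_derivative:
  assumes a: "converges_within a R" and b: "converges_within b R" "\<And>m. b m = real (Suc m) * a (Suc m)"
    and \<gamma>: "(\<gamma> has_vector_derivative V) (at t within S)" "norm (\<gamma> t) < R" "V o\<^sub>L \<gamma> t = \<gamma> t o\<^sub>L V"
  shows "((\<lambda>t. op_series a (\<gamma> t)) has_vector_derivative (op_series b (\<gamma> t) o\<^sub>L V)) (at t within S)"
proof -
  have "((\<lambda>t. op_series a (\<gamma> t)) has_derivative (\<lambda>h. series_tower a (\<gamma> t) [h *\<^sub>R V])) (at t within S)"
    using \<gamma>(1) op_series_has_derivative[OF a \<gamma>(2)]
    unfolding has_vector_derivative_def by (rule has_derivative_compose)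
  moreover have "series_tower a (\<gamma> t) [h *\<^sub>R V] = h *\<^sub>R (op_series b (\<gamma> t) o\<^sub>L V)" for h
    using series_tower_commuting_direction[OF a \<gamma>(2) b, of "h *\<^sub>R V"] \<gamma>(3) by (simp add: compose_simps)
  ultimately show ?thesis by (simp add: has_vector_derivative_def)
qed

text \<open>The common scheme for the identities on exponentials below: both sides are joined by a
  curve over \<open>[0, 1]\<close> that turns out to be constant.\<close>

lemma zero_derivative_imp_eq:
  fixes f :: "real \<Rightarrow> 'b::real_normed_vector"
  assumes "\<And>t. 0 \<le> t \<Longrightarrow> t \<le> 1 \<Longrightarrow> (f has_vector_derivative 0) (at t within {0..1})"
  shows "f 1 = f 0"
proof -
  have "\<exists>c. \<forall>x\<in>{0..1}. f x = c"
    using assms by (intro has_derivative_zero_constant) (auto simp: has_vector_derivative_def)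
  then show ?thesis by auto
qed

subsection \<open>Exponential and logarithm\<close>

definition exp_coeff :: "nat \<Rightarrow> real" where "exp_coeff m = 1 / fact m"
definition geo_coeff :: "nat \<Rightarrow> real" where "geo_coeff m = (-1) ^ m"
definition log_coeff :: "nat \<Rightarrow> real" where "log_coeff m = (if m = 0 then 0 else (-1) ^ Suc m / real m)"

definition blinfun_log :: "('a::banach \<Rightarrow>\<^sub>L 'a) \<Rightarrow> ('a \<Rightarrow>\<^sub>L 'a)" where
  "blinfun_log V = op_series log_coeff (V - id_blinfun)"

lemma converges_exp: "converges_within exp_coeff R"
  unfolding converges_within_def exp_coeff_def
proof (intro allI impI)
  fix \<rho> :: real
  show "summable (\<lambda>m. \<bar>1 / fact m\<bar> * \<rho> ^ m)"
    using summable_exp[of \<rho>] by (simp add: inverse_eq_divide)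
qed

lemma converges_geo: "converges_within geo_coeff 1"
  by (simp add: converges_within_def geo_coeff_def summable_geometric)

lemma converges_log: "converges_within log_coeff 1"
  unfolding converges_within_def
proof (intro allI impI)
  fix \<rho> :: real assume \<rho>: "0 \<le> \<rho> \<and> \<rho> < 1"
  show "summable (\<lambda>m. \<bar>log_coeff m\<bar> * \<rho> ^ m)"
  proof (rule summable_comparison_test'[where N = 0 and g = "\<lambda>m. \<rho> ^ m"])
    show "summable (\<lambda>m. \<rho> ^ m)" using \<rho> by (simp add: summable_geometric)
    fix m
    have "\<bar>log_coeff m\<bar> \<le> 1" by (simp add: log_coeff_def abs_mult power_abs)
    then show "norm (\<bar>log_coeff m\<bar> * \<rho> ^ m) \<le> \<rho> ^ m" using \<rho> by (simp add: abs_mult mult_left_le_one_le)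
  qed
qed

lemma exp_coeff_deriv: "exp_coeff m = real (Suc m) * exp_coeff (Suc m)"
  by (simp add: exp_coeff_def del: of_nat_Suc)

lemma log_coeff_deriv: "geo_coeff m = real (Suc m) * log_coeff (Suc m)"
  by (simp add: geo_coeff_def log_coeff_def)

lemma blinfun_exp_series: "blinfun_exp X = op_series exp_coeff X"
proof -
  have "((\<lambda>Y. X o\<^sub>L Y) ^^ n) id_blinfun = pow_tower n X []" for n
    by (induction n) simp_all
  then show ?thesis by (simp add: blinfun_exp_def op_series_def exp_coeff_def)
qed

lemma blinfun_exp_zero [simp]: "blinfun_exp 0 = id_blinfun"
proof -
  have "(\<lambda>m. exp_coeff m *\<^sub>R pow_tower m 0 []) = (\<lambda>m. if m = 0 then id_blinfun else (0 :: 'a \<Rightarrow>\<^sub>L 'a))"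
  proof
    show "exp_coeff m *\<^sub>R pow_tower m 0 [] = (if m = 0 then id_blinfun else (0 :: 'a \<Rightarrow>\<^sub>L 'a))" for m
      by (cases m) (simp_all add: exp_coeff_def compose_simps)
  qed
  then show ?thesis using sums_unique[OF sums_single[of 0 "\<lambda>_. id_blinfun :: 'a \<Rightarrow>\<^sub>L 'a"]]
    unfolding blinfun_exp_series op_series_def by simp
qed

lemma blinfun_exp_intertwine: "T o\<^sub>L X = Y o\<^sub>L T \<Longrightarrow> T o\<^sub>L blinfun_exp X = blinfun_exp Y o\<^sub>L T"
  unfolding blinfun_exp_series
  by (rule op_series_intertwine[OF converges_exp, of _ "norm X + norm Y + 1"]) (simp_all add: add_nonneg_pos)

lemma blinfun_exp_vector_derivative:
  assumes "(\<gamma> has_vector_derivative V) (at t within S)" "V o\<^sub>L \<gamma> t = \<gamma> t o\<^sub>L V"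
  shows "((\<lambda>t. blinfun_exp (\<gamma> t)) has_vector_derivative (blinfun_exp (\<gamma> t) o\<^sub>L V)) (at t within S)"
  unfolding blinfun_exp_series
  by (rule op_series_vector_derivative[OF converges_exp converges_exp exp_coeff_deriv assms(1) _ assms(2), of "norm (\<gamma> t) + 1"]) simp

lemma blinfun_exp_line_derivative:
  "((\<lambda>t. blinfun_exp (t *\<^sub>R X)) has_vector_derivative (blinfun_exp (t *\<^sub>R X) o\<^sub>L X)) (at t within S)"
  by (rule blinfun_exp_vector_derivative) (auto intro!: derivative_eq_intros simp: compose_simps)

lemma blinfun_exp_commute: "X o\<^sub>L blinfun_exp (t *\<^sub>R X) = blinfun_exp (t *\<^sub>R X) o\<^sub>L X"
  by (rule blinfun_exp_intertwine) (simp add: compose_simps)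

lemma has_vector_derivative_compose:
  assumes "(f has_vector_derivative f') (at t within S)" "(g has_vector_derivative g') (at t within S)"
  shows "((\<lambda>t. f t o\<^sub>L g t) has_vector_derivative (f t o\<^sub>L g') + (f' o\<^sub>L g t)) (at t within S)"
  by (rule bounded_bilinear.has_vector_derivative[OF bounded_bilinear_blinfun_compose assms])

lemma blinfun_exp_minus: "blinfun_exp X o\<^sub>L blinfun_exp (- X) = id_blinfun"
proof -
  define f where "f t = blinfun_exp (t *\<^sub>R X) o\<^sub>L blinfun_exp (t *\<^sub>R (- X))" for t
  have "f 1 = f 0"
  proof (rule zero_derivative_imp_eq)
    fix t :: real
    have "(f has_vector_derivative (blinfun_exp (t *\<^sub>R X) o\<^sub>L (blinfun_exp (t *\<^sub>R (- X)) o\<^sub>L (- X)))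
        + ((blinfun_exp (t *\<^sub>R X) o\<^sub>L X) o\<^sub>L blinfun_exp (t *\<^sub>R (- X)))) (at t within {0..1})"
      unfolding f_def[abs_def] by (intro has_vector_derivative_compose blinfun_exp_line_derivative)
    also have "(blinfun_exp (t *\<^sub>R X) o\<^sub>L (blinfun_exp (t *\<^sub>R (- X)) o\<^sub>L (- X)))
        + ((blinfun_exp (t *\<^sub>R X) o\<^sub>L X) o\<^sub>L blinfun_exp (t *\<^sub>R (- X))) = 0"
      using blinfun_exp_commute[of "- X" t] by (simp add: compose_simps compose_assoc)
    finally show "(f has_vector_derivative 0) (at t within {0..1})" .
  qed
  then show ?thesis by (simp add: f_def)
qed

lemma norm_blinfun_exp_diff_id: "norm (blinfun_exp X - id_blinfun) \<le> exp (norm X) - 1"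
proof -
  have sm: "summable (\<lambda>m. exp_coeff m *\<^sub>R pow_tower m X [])"
    by (rule summable_pow_tower[OF converges_exp, of _ "norm X + 1"]) simp
  have eq: "blinfun_exp X - id_blinfun = (\<Sum>m. exp_coeff (Suc m) *\<^sub>R pow_tower (Suc m) X [])"
    unfolding blinfun_exp_series op_series_def using suminf_split_head[OF sm] by (simp add: exp_coeff_def)
  have p: "norm (pow_tower m X []) \<le> norm X ^ m" for m
  proof (induction m)
    case (Suc m)
    then show ?case
      using mult_left_mono[OF Suc norm_ge_zero[of X]] norm_blinfun_compose[of X "pow_tower m X []"] by simp
  qed (simp add: norm_blinfun_id_le)
  have b: "norm (exp_coeff (Suc m) *\<^sub>R pow_tower (Suc m) X []) \<le> exp_coeff (Suc m) * norm X ^ Suc m" for m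
    using p[of "Suc m"] unfolding norm_scaleR by (intro mult_mono) (auto simp: exp_coeff_def)
  have se: "(\<lambda>m. exp_coeff m * norm X ^ m) sums exp (norm X)"
    using exp_converges[of "norm X"] by (simp add: exp_coeff_def divide_inverse mult.commute)
  then have se': "(\<lambda>m. exp_coeff (Suc m) * norm X ^ Suc m) sums (exp (norm X) - 1)"
    using sums_Suc_iff[of "\<lambda>m. exp_coeff m * norm X ^ m"] by (simp add: exp_coeff_def)
  have sn: "summable (\<lambda>m. norm (exp_coeff (Suc m) *\<^sub>R pow_tower (Suc m) X []))"
    by (rule summable_comparison_test'[OF sums_summable[OF se'], of 0]) (use b in simp)
  have "norm (\<Sum>m. exp_coeff (Suc m) *\<^sub>R pow_tower (Suc m) X []) \<le> (\<Sum>m. norm (exp_coeff (Suc m) *\<^sub>R pow_tower (Suc m) X []))"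
    by (rule summable_norm[OF sn])
  also have "\<dots> \<le> (\<Sum>m. exp_coeff (Suc m) * norm X ^ Suc m)"
    by (rule suminf_le[OF b sn sums_summable[OF se']])
  also have "\<dots> = exp (norm X) - 1" using se' by (rule sums_unique[symmetric])
  finally show ?thesis by (simp add: eq)
qed

lemma norm_blinfun_exp_diff_id_less: "norm X < ln 2 \<Longrightarrow> norm (blinfun_exp X - id_blinfun) < 1"
proof -
  assume "norm X < ln 2"
  then have "exp (norm X) < exp (ln 2)" by (simp only: exp_less_cancel_iff)
  then show ?thesis using norm_blinfun_exp_diff_id[of X] by simp
qed

lemma geometric_series_inverse:
  assumes "norm Z < 1"
  shows "op_series geo_coeff Z o\<^sub>L (id_blinfun + Z) = id_blinfun"
proof -
  let ?f = "\<lambda>m. geo_coeff m *\<^sub>R pow_tower m Z []"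
  have sm: "summable ?f" by (rule summable_pow_tower[OF converges_geo assms])
  have "op_series geo_coeff Z o\<^sub>L Z = Z o\<^sub>L op_series geo_coeff Z"
    by (rule op_series_intertwine[OF converges_geo assms assms refl, symmetric])
  also have "\<dots> = (\<Sum>m. Z o\<^sub>L ?f m)"
    unfolding op_series_def
    by (rule bounded_linear.suminf[OF bounded_bilinear.bounded_linear_right[OF bounded_bilinear_blinfun_compose] sm])
  also have "\<dots> = (\<Sum>m. - ?f (Suc m))" by (simp add: geo_coeff_def compose_simps)
  also have "\<dots> = - (\<Sum>m. ?f (Suc m))" by (rule suminf_minus[OF iffD2[OF summable_Suc_iff sm]])
  also have "(\<Sum>m. ?f (Suc m)) = op_series geo_coeff Z - id_blinfun"
    unfolding op_series_def using suminf_split_head[OF sm] by (simp add: geo_coeff_def)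
  finally show ?thesis by (simp add: compose_simps)
qed

lemma blinfun_log_exp:
  assumes X: "norm X < ln 2"
  shows "blinfun_log (blinfun_exp X) = X"
proof -
  \<comment> \<open>The derivative of the logarithm at \<open>exp (t X)\<close> is the geometric
    series, that is, the inverse of \<open>exp (t X)\<close>; times the velocity
    \<open>exp (t X) X\<close> this is \<open>X\<close>.\<close>
  define f where "f t = op_series log_coeff (blinfun_exp (t *\<^sub>R X) - id_blinfun) - t *\<^sub>R X" for t
  have "f 1 = f 0"
  proof (rule zero_derivative_imp_eq)
    fix t :: real assume t: "0 \<le> t" "t \<le> 1"
    let ?E = "blinfun_exp (t *\<^sub>R X)"
    have "norm (t *\<^sub>R X) \<le> norm X" using t by (simp add: mult_left_le_one_le)
    then have Z: "norm (?E - id_blinfun) < 1" using X by (intro norm_blinfun_exp_diff_id_less) simp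
    have c: "(?E o\<^sub>L X) o\<^sub>L (?E - id_blinfun) = (?E - id_blinfun) o\<^sub>L (?E o\<^sub>L X)"
      by (simp add: compose_simps compose_assoc blinfun_exp_commute)
    have g: "((\<lambda>t. blinfun_exp (t *\<^sub>R X) - id_blinfun) has_vector_derivative (?E o\<^sub>L X)) (at t within {0..1})"
      using has_vector_derivative_diff[OF blinfun_exp_line_derivative has_vector_derivative_const] by simp
    have "(f has_vector_derivative (op_series geo_coeff (?E - id_blinfun) o\<^sub>L (?E o\<^sub>L X)) - X) (at t within {0..1})"
      unfolding f_def[abs_def]
      by (intro has_vector_derivative_diff op_series_vector_derivative[OF converges_log converges_geo log_coeff_deriv g Z c])
        (auto intro!: derivative_eq_intros)
    also have "op_series geo_coeff (?E - id_blinfun) o\<^sub>L (?E o\<^sub>L X) = X"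
      using geometric_series_inverse[OF Z] by (simp flip: compose_assoc)
    finally show "(f has_vector_derivative 0) (at t within {0..1})" by simp
  qed
  moreover have "op_series log_coeff 0 = (0 :: 'a \<Rightarrow>\<^sub>L 'a)"
  proof -
    have "log_coeff m *\<^sub>R pow_tower m 0 [] = (0 :: 'a \<Rightarrow>\<^sub>L 'a)" for m by (cases m) (simp_all add: log_coeff_def compose_simps)
    then show ?thesis by (simp only: op_series_def suminf_zero)
  qed
  ultimately show ?thesis by (simp add: f_def blinfun_log_def)
qed

lemma blinfun_log_id [simp]: "blinfun_log id_blinfun = 0"
  using blinfun_log_exp[of 0] by simp

lemma blinfun_exp_log:
  assumes V: "norm (V - id_blinfun) < 1"
  shows "blinfun_exp (blinfun_log V) = V"
proof -
  define Z where "Z = V - id_blinfun"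
  define \<gamma> where "\<gamma> t = op_series log_coeff (t *\<^sub>R Z)" for t :: real
  \<comment> \<open>\<open>exp (- log (1 + t Z)) (1 + t Z)\<close> starts at the identity and is
    constant; multiplying by \<open>exp (log V)\<close> at \<open>t = 1\<close> gives the
    claim.\<close>
  define f where "f t = blinfun_exp (- \<gamma> t) o\<^sub>L (id_blinfun + t *\<^sub>R Z)" for t
  have "f 1 = f 0"
  proof (rule zero_derivative_imp_eq)
    fix t :: real assume t: "0 \<le> t" "t \<le> 1"
    have "norm (t *\<^sub>R Z) \<le> norm Z" using t by (simp add: mult_left_le_one_le)
    then have tZ: "norm (t *\<^sub>R Z) < 1" using V by (simp add: Z_def)
    let ?G = "op_series geo_coeff (t *\<^sub>R Z)"
    have ZtZ: "Z o\<^sub>L (t *\<^sub>R Z) = (t *\<^sub>R Z) o\<^sub>L Z" by (simp add: compose_simps)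
    have line: "((\<lambda>t. t *\<^sub>R Z) has_vector_derivative Z) (at t within {0..1})" by (auto intro!: derivative_eq_intros)
    have \<gamma>: "(\<gamma> has_vector_derivative (?G o\<^sub>L Z)) (at t within {0..1})"
      unfolding \<gamma>_def[abs_def]
      by (rule op_series_vector_derivative[OF converges_log converges_geo log_coeff_deriv line tZ ZtZ])
    have Zs: "Z o\<^sub>L ?G = ?G o\<^sub>L Z" "Z o\<^sub>L \<gamma> t = \<gamma> t o\<^sub>L Z"
      unfolding \<gamma>_def using op_series_intertwine[OF converges_geo tZ tZ ZtZ] op_series_intertwine[OF converges_log tZ tZ ZtZ] by simp_all
    have Gg: "?G o\<^sub>L \<gamma> t = \<gamma> t o\<^sub>L ?G"
      unfolding \<gamma>_def
      by (rule op_series_intertwine[OF converges_log tZ tZ])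
        (rule op_series_intertwine[OF converges_geo tZ tZ refl, symmetric])
    have "(- (?G o\<^sub>L Z)) o\<^sub>L (- \<gamma> t) = (- \<gamma> t) o\<^sub>L (- (?G o\<^sub>L Z))"
      by (simp add: compose_simps compose_assoc Zs(2)) (simp add: Gg flip: compose_assoc)
    then have E: "((\<lambda>t. blinfun_exp (- \<gamma> t)) has_vector_derivative (blinfun_exp (- \<gamma> t) o\<^sub>L (- (?G o\<^sub>L Z)))) (at t within {0..1})"
      by (intro blinfun_exp_vector_derivative has_vector_derivative_minus \<gamma>)
    have "((\<lambda>t. id_blinfun + t *\<^sub>R Z) has_vector_derivative 0 + Z) (at t within {0..1})"
      by (intro has_vector_derivative_add has_vector_derivative_const line)
    then have "(f has_vector_derivative (blinfun_exp (- \<gamma> t) o\<^sub>L Z) + ((blinfun_exp (- \<gamma> t) o\<^sub>L (- (?G o\<^sub>L Z))) o\<^sub>L (id_blinfun + t *\<^sub>R Z)))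
        (at t within {0..1})"
      unfolding f_def[abs_def] using has_vector_derivative_compose[OF E] by simp
    also have "(blinfun_exp (- \<gamma> t) o\<^sub>L (- (?G o\<^sub>L Z))) o\<^sub>L (id_blinfun + t *\<^sub>R Z) = - (blinfun_exp (- \<gamma> t) o\<^sub>L Z)"
    proof -
      have "(?G o\<^sub>L Z) o\<^sub>L (id_blinfun + t *\<^sub>R Z) = Z o\<^sub>L (?G o\<^sub>L (id_blinfun + t *\<^sub>R Z))"
        by (simp add: compose_assoc[symmetric] Zs(1))
      also have "\<dots> = Z" by (simp add: geometric_series_inverse[OF tZ])
      finally show ?thesis by (simp add: compose_assoc bounded_bilinear.minus_left[OF bounded_bilinear_blinfun_compose]
        bounded_bilinear.minus_right[OF bounded_bilinear_blinfun_compose])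
    qed
    finally show "(f has_vector_derivative 0) (at t within {0..1})" by simp
  qed
  moreover have "\<gamma> 0 = 0" using blinfun_log_id by (simp add: \<gamma>_def blinfun_log_def)
  moreover have "\<gamma> 1 = blinfun_log V" by (simp add: \<gamma>_def blinfun_log_def Z_def)
  ultimately have "blinfun_exp (- blinfun_log V) o\<^sub>L V = id_blinfun" by (simp add: f_def Z_def)
  then have "blinfun_exp (blinfun_log V) o\<^sub>L (blinfun_exp (- blinfun_log V) o\<^sub>L V) = blinfun_exp (blinfun_log V)" by simp
  then show ?thesis by (simp add: blinfun_exp_minus flip: compose_assoc)
qed

lemma smooth_on_blinfun_exp: "smooth_on UNIV {X. norm X < R} blinfun_exp"
  using smooth_on_op_series[OF converges_exp] by (rule smooth_on_cong) (simp add: blinfun_exp_series)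

lemma smooth_on_blinfun_log: "smooth_on UNIV {V. norm (V - id_blinfun) < 1} blinfun_log"
proof -
  have o: "openin (top_of_set UNIV) {V :: 'a \<Rightarrow>\<^sub>L 'a. norm (V - id_blinfun) < 1}"
    by (simp add: open_Collect_less continuous_intros flip: open_openin)
  have "smooth_on UNIV {V :: 'a \<Rightarrow>\<^sub>L 'a. norm (V - id_blinfun) < 1} (\<lambda>V. V - id_blinfun)"
    by (intro smooth_on_diff smooth_on_const smooth_on_bounded_linear subspace_UNIV o bounded_linear_ident)
  from smooth_on_compose[OF subspace_UNIV this smooth_on_op_series[OF converges_log]]
  show ?thesis unfolding blinfun_log_def[abs_def] by auto
qed

section \<open>Exponentials of skew-adjoint operators and of derivations\<close>

text \<open>In the form of a commutation relation, complex linearity is inherited by power series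
  through \<open>op_series_intertwine\<close>.\<close>

lemma complex_linear_iff_commute: "complex_linear T \<longleftrightarrow> (\<forall>c. scalar_op c o\<^sub>L T = T o\<^sub>L scalar_op c)"
proof
  assume "complex_linear T"
  then show "\<forall>c. scalar_op c o\<^sub>L T = T o\<^sub>L scalar_op c"
    by (auto simp: complex_linear_def intro!: blinfun_eqI)
next
  assume *: "\<forall>c. scalar_op c o\<^sub>L T = T o\<^sub>L scalar_op c"
  have "T (c *\<^sub>C x) = c *\<^sub>C T x" for c x
    using arg_cong[OF *[rule_format, of c], of "\<lambda>f. blinfun_apply f x"] by simp
  then show "complex_linear T" by (simp add: complex_linear_def)
qed

lemma complex_linear_exp: "complex_linear X \<Longrightarrow> complex_linear (blinfun_exp X)"
  unfolding complex_linear_iff_commute using blinfun_exp_intertwine by blast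

lemma complex_linear_log:
  assumes "complex_linear V" "norm (V - id_blinfun) < 1"
  shows "complex_linear (blinfun_log V)"
  using assms(1) op_series_intertwine[OF converges_log assms(2) assms(2)]
  unfolding complex_linear_iff_commute blinfun_log_def by (simp add: compose_simps)

lemma op_series_adjoint:
  fixes X Y :: "'h::complex_hilbert \<Rightarrow>\<^sub>L 'h"
  assumes a: "converges_within a R" and X: "norm X < R" and Y: "norm Y < R"
    and adj: "\<And>x y. cinner (X x) y = cinner x (Y y)"
  shows "cinner (op_series a X x) y = cinner x (op_series a Y y)"
proof -
  have pow: "cinner (pow_tower m X [] x) y = cinner x (pow_tower m Y [] y)" for m x y
  proof (induction m arbitrary: x y)
    case (Suc m)
    have "Y o\<^sub>L pow_tower m Y [] = pow_tower m Y [] o\<^sub>L Y" by (rule pow_tower_intertwine) (rule refl)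
    then have "Y (pow_tower m Y [] y) = pow_tower m Y [] (Y y)" by (metis blinfun_apply_blinfun_compose)
    then show ?case by (simp add: adj Suc)
  qed simp
  have l: "bounded_linear (\<lambda>T. cinner (blinfun_apply T x) y)"
    using bounded_linear_compose[OF bounded_bilinear.bounded_linear_left[OF bounded_bilinear_cinner] blinfun.bounded_linear_left] .
  have r: "bounded_linear (\<lambda>T. cinner x (blinfun_apply T y))"
    using bounded_linear_compose[OF bounded_bilinear.bounded_linear_right[OF bounded_bilinear_cinner] blinfun.bounded_linear_left] .
  have "cinner (op_series a X x) y = (\<Sum>m. cinner ((a m *\<^sub>R pow_tower m X []) x) y)"
    unfolding op_series_def by (rule bounded_linear.suminf[OF l summable_pow_tower[OF a X]])
  also have "\<dots> = (\<Sum>m. cinner x ((a m *\<^sub>R pow_tower m Y []) y))"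
    by (simp add: blinfun.scaleR_left cinner_simps pow)
  also have "\<dots> = cinner x (op_series a Y y)"
    unfolding op_series_def by (rule bounded_linear.suminf[OF r summable_pow_tower[OF a Y], symmetric])
  finally show ?thesis .
qed

lemma skew_adjointsD:
  assumes "X \<in> skew_adjoints"
  shows "complex_linear X" "cinner (X x) y = cinner x ((- X) y)"
  using assms by (simp_all add: skew_adjoints_def blinfun.minus_left cinner_simps)

lemma exp_skew_adjoint_unitary:
  assumes X: "X \<in> skew_adjoints"
  shows "blinfun_exp X \<in> unitaries"
proof -
  have adj: "cinner (blinfun_exp X x) y = cinner x (blinfun_exp (- X) y)" for x y
    unfolding blinfun_exp_series
    by (rule op_series_adjoint[OF converges_exp, of _ "norm X + 1"]) (simp_all add: skew_adjointsD(2)[OF X])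
  have inv: "blinfun_exp (- X) (blinfun_exp X x) = x" "blinfun_exp X (blinfun_exp (- X) x) = x" for x
    using blinfun_exp_minus[of X] blinfun_exp_minus[of "- X"] by (simp_all flip: blinfun_apply_blinfun_compose)
  then have "surj (blinfun_exp X)" by (metis surjI)
  moreover have "cinner (blinfun_exp X x) (blinfun_exp X y) = cinner x y" for x y by (simp add: adj inv)
  ultimately show ?thesis using complex_linear_exp[OF skew_adjointsD(1)[OF X]] by (simp add: unitaries_def)
qed

text \<open>The adjoint of \<open>log V\<close> is the logarithm of the inverse
  \<open>W = exp (- log V)\<close>. The bound \<open>ln 2\<close> keeps \<open>W\<close> in the
  domain of the logarithm and gives \<open>log W = - log V\<close>.\<close>

lemma log_unitary_skew_adjoint:
  assumes V: "V \<in> unitaries" and V1: "norm (V - id_blinfun) < 1" and K: "norm (blinfun_log V) < ln 2"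
  shows "blinfun_log V \<in> skew_adjoints"
proof -
  let ?K = "blinfun_log V"
  obtain W where W: "W \<in> unitaries" "W o\<^sub>L V = id_blinfun" "V o\<^sub>L W = id_blinfun" by (rule unitary_inverse[OF V])
  have expK: "blinfun_exp ?K = V" by (rule blinfun_exp_log[OF V1])
  have "W = W o\<^sub>L (V o\<^sub>L blinfun_exp (- ?K))" using blinfun_exp_minus[of ?K] by (simp add: expK)
  also have "\<dots> = blinfun_exp (- ?K)" by (simp add: W(2) flip: compose_assoc)
  finally have We: "W = blinfun_exp (- ?K)" .
  have W1: "norm (W - id_blinfun) < 1" unfolding We by (rule norm_blinfun_exp_diff_id_less) (simp add: K)
  have logW: "blinfun_log W = - ?K" unfolding We by (rule blinfun_log_exp) (simp add: K)
  have adj: "cinner (V x) y = cinner x (W y)" for x y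
    using unitary_cinner[OF V, of x "W y"] W(3) by (simp flip: blinfun_apply_blinfun_compose)
  have "cinner (?K x) y = cinner x (blinfun_log W y)" for x y
    unfolding blinfun_log_def
    by (rule op_series_adjoint[OF converges_log V1 W1]) (simp add: blinfun.diff_left cinner_simps adj)
  then have "cinner (?K x) y = - cinner x (?K y)" for x y by (simp add: logW blinfun.minus_left cinner_simps)
  moreover have "complex_linear ?K" using V V1 by (intro complex_linear_log) (simp_all add: unitaries_def)
  ultimately show ?thesis by (simp add: skew_adjoints_def)
qed

lemma blinfun_exp_apply_derivative:
  "((\<lambda>t. blinfun_exp (t *\<^sub>R X) x) has_vector_derivative (blinfun_exp (t *\<^sub>R X) (X x))) (at t within S)"
  using bounded_linear.has_vector_derivative[OF blinfun.bounded_linear_left blinfun_exp_line_derivative[of X t S], of x] by simp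

lemma blinfun_exp_apply_commute: "blinfun_exp (t *\<^sub>R X) (X x) = X (blinfun_exp (t *\<^sub>R X) x)"
  using blinfun_exp_commute[of X t] by (metis blinfun_apply_blinfun_compose)

lemma blinfun_exp_inverse [simp]:
  "blinfun_exp (- X) (blinfun_exp X x) = x" "blinfun_exp X (blinfun_exp (- X) x) = x"
  using blinfun_exp_minus[of X] blinfun_exp_minus[of "- X"] by (simp_all flip: blinfun_apply_blinfun_compose)

lemma symmetric_derivationsD:
  assumes "\<delta> \<in> symmetric_derivations"
  shows "complex_linear \<delta>" "\<delta> (A * B) = \<delta> A * B + A * \<delta> B" "\<delta> (star A) = star (\<delta> A)"
  using assms by (auto simp: symmetric_derivations_def)

lemma subspace_symmetric_derivations: "subspace symmetric_derivations"
  by (rule subspaceI)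
    (auto simp: symmetric_derivations_def complex_linear_def blinfun.add_left blinfun.scaleR_left
      scaleC_add_right scaleC_scaleR distrib_left distrib_right star_add star_scaleR scaleR_add_right)

lemma subspace_skew_adjoints: "subspace skew_adjoints"
  by (rule subspaceI)
    (auto simp: skew_adjoints_def complex_linear_def blinfun.add_left blinfun.scaleR_left
      scaleC_add_right scaleC_scaleR cinner_simps)

text \<open>By the Leibniz rule the derivative of
  \<open>exp (t \<delta>) A * exp (t \<delta>) B\<close> is \<open>\<delta>\<close> applied to it,
  so transporting it back by \<open>exp (- t \<delta>)\<close> gives a constant curve. For
  \<open>star\<close>, which is conjugate linear, the real-linear operator \<open>S\<close> commutes
  with \<open>\<delta>\<close>.\<close>

lemma exp_derivation_automorphism:
  fixes \<delta> :: "'b::cstar_algebra \<Rightarrow>\<^sub>L 'b"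
  assumes \<delta>: "\<delta> \<in> symmetric_derivations"
  shows "blinfun_exp \<delta> \<in> automorphisms"
proof -
  let ?e = "\<lambda>t. blinfun_exp (t *\<^sub>R \<delta>)"
  have mult: "blinfun_exp \<delta> (A * B) = blinfun_exp \<delta> A * blinfun_exp \<delta> B" for A B
  proof -
    define f where "f t = blinfun_exp (t *\<^sub>R (- \<delta>)) (?e t A * ?e t B)" for t
    have "f 1 = f 0"
    proof (rule zero_derivative_imp_eq)
      fix t :: real
      have g: "((\<lambda>t. ?e t A * ?e t B) has_vector_derivative (?e t A * ?e t (\<delta> B) + ?e t (\<delta> A) * ?e t B)) (at t within {0..1})"
        by (rule bounded_bilinear.has_vector_derivative[OF bounded_bilinear_mult blinfun_exp_apply_derivative blinfun_exp_apply_derivative])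
      also have "?e t A * ?e t (\<delta> B) + ?e t (\<delta> A) * ?e t B = \<delta> (?e t A * ?e t B)"
        by (simp add: blinfun_exp_apply_commute symmetric_derivationsD(2)[OF \<delta>])
      finally have "(f has_vector_derivative
          blinfun_exp (t *\<^sub>R (- \<delta>)) (\<delta> (?e t A * ?e t B)) + (blinfun_exp (t *\<^sub>R (- \<delta>)) o\<^sub>L (- \<delta>)) (?e t A * ?e t B)) (at t within {0..1})"
        unfolding f_def[abs_def]
        using bounded_bilinear.has_vector_derivative[OF blinfun.bounded_bilinear_axioms blinfun_exp_line_derivative] by blast
      then show "(f has_vector_derivative 0) (at t within {0..1})"
        by (simp add: blinfun.minus_left blinfun.minus_right)
    qed
    then have "blinfun_exp (- \<delta>) (blinfun_exp \<delta> A * blinfun_exp \<delta> B) = A * B" by (simp add: f_def)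
    then show ?thesis using blinfun_exp_inverse(2)[of \<delta> "blinfun_exp \<delta> A * blinfun_exp \<delta> B"] by simp
  qed
  define S :: "'b \<Rightarrow>\<^sub>L 'b" where "S = Blinfun star"
  have S: "S a = star a" for a by (simp add: S_def bounded_linear_Blinfun_apply[OF bounded_linear_star])
  have "S o\<^sub>L \<delta> = \<delta> o\<^sub>L S" by (rule blinfun_eqI) (simp add: S symmetric_derivationsD(3)[OF \<delta>])
  then have "S o\<^sub>L blinfun_exp \<delta> = blinfun_exp \<delta> o\<^sub>L S" by (rule blinfun_exp_intertwine)
  then have star: "blinfun_exp \<delta> (star A) = star (blinfun_exp \<delta> A)" for A
    by (metis S blinfun_apply_blinfun_compose)
  have "bij (blinfun_exp \<delta>)" by (rule o_bij[of "blinfun_exp (- \<delta>)"]) (auto simp: fun_eq_iff)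
  then show ?thesis
    using complex_linear_exp[OF symmetric_derivationsD(1)[OF \<delta>]] mult star by (simp add: automorphisms_def)
qed

section \<open>Derivations are spatial in irreducible representations\<close>

lemma exp_le_one_plus_double: "0 \<le> x \<Longrightarrow> x \<le> 1/2 \<Longrightarrow> exp x - 1 \<le> 2 * (x::real)"
  using exp_bound_lemma[of x] by simp

context star_representation
begin

definition spatial :: "('b \<Rightarrow>\<^sub>L 'b) \<Rightarrow> ('h \<Rightarrow>\<^sub>L 'h) \<Rightarrow> bool" where
  "spatial \<delta> K \<longleftrightarrow> K \<in> skew_adjoints \<and> (\<forall>B. \<pi> (\<delta> B) = (K o\<^sub>L \<pi> B) - (\<pi> B o\<^sub>L K))"

lemma rep_exp_derivative:
  "((\<lambda>t. \<pi> (blinfun_exp (t *\<^sub>R \<delta>) B)) has_vector_derivative \<pi> (\<delta> (blinfun_exp (t *\<^sub>R \<delta>) B))) (at t within S)"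
  using bounded_linear.has_vector_derivative[OF bounded_linear_rep blinfun_exp_apply_derivative[of \<delta> B t S]]
  by (simp add: blinfun_exp_apply_commute)

text \<open>The curve \<open>exp (- t K) \<pi>(exp (t \<delta>) B) exp (t K)\<close> is constant:
  the three contributions to its derivative cancel by the commutator relation.\<close>

lemma spatial_exp_implements:
  assumes "spatial \<delta> K"
  shows "implements \<pi> \<pi> (blinfun_exp K) (blinfun_exp \<delta>)"
proof -
  have K: "K \<in> skew_adjoints" and rel: "\<And>B. \<pi> (\<delta> B) = (K o\<^sub>L \<pi> B) - (\<pi> B o\<^sub>L K)" using assms by (auto simp: spatial_def)
  have "blinfun_exp K o\<^sub>L \<pi> B = \<pi> (blinfun_exp \<delta> B) o\<^sub>L blinfun_exp K" for B
  proof -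
    define f where "f t = blinfun_exp (t *\<^sub>R (- K)) o\<^sub>L (\<pi> (blinfun_exp (t *\<^sub>R \<delta>) B) o\<^sub>L blinfun_exp (t *\<^sub>R K))" for t
    have "f 1 = f 0"
    proof (rule zero_derivative_imp_eq)
      fix t :: real
      let ?f = "blinfun_exp (t *\<^sub>R (- K))" and ?g = "\<pi> (blinfun_exp (t *\<^sub>R \<delta>) B)" and ?h = "blinfun_exp (t *\<^sub>R K)"
      have "(f has_vector_derivative (?f o\<^sub>L ((?g o\<^sub>L (?h o\<^sub>L K)) + (\<pi> (\<delta> (blinfun_exp (t *\<^sub>R \<delta>) B)) o\<^sub>L ?h)))
          + ((?f o\<^sub>L (- K)) o\<^sub>L (?g o\<^sub>L ?h))) (at t within {0..1})"
        unfolding f_def[abs_def]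
        by (intro has_vector_derivative_compose blinfun_exp_line_derivative rep_exp_derivative)
      also have "(?f o\<^sub>L ((?g o\<^sub>L (?h o\<^sub>L K)) + (\<pi> (\<delta> (blinfun_exp (t *\<^sub>R \<delta>) B)) o\<^sub>L ?h))) + ((?f o\<^sub>L (- K)) o\<^sub>L (?g o\<^sub>L ?h)) = 0"
        unfolding rel blinfun_exp_commute[of K, symmetric] by (simp add: compose_simps compose_assoc)
      finally show "(f has_vector_derivative 0) (at t within {0..1})" .
    qed
    then have "blinfun_exp (- K) o\<^sub>L (\<pi> (blinfun_exp \<delta> B) o\<^sub>L blinfun_exp K) = \<pi> B" by (simp add: f_def)
    then have "blinfun_exp K o\<^sub>L (blinfun_exp (- K) o\<^sub>L (\<pi> (blinfun_exp \<delta> B) o\<^sub>L blinfun_exp K)) = blinfun_exp K o\<^sub>L \<pi> B"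
      by simp
    then show ?thesis by (simp add: blinfun_exp_minus flip: compose_assoc)
  qed
  then show ?thesis
    using exp_skew_adjoint_unitary[OF K] unfolding implements_def by (metis blinfun_apply_blinfun_compose)
qed

text \<open>With \<open>Y B = [K, \<pi> B] - \<pi> (\<delta> B)\<close>, the curve \<open>t \<mapsto> exp (t K) \<pi> (exp (- t \<delta>) B) exp (- t K)\<close> is
  closed and its derivative stays close to \<open>Y B\<close>, so that \<open>Y = 0\<close> by the mean value inequality.\<close>

lemma implemented_exp_imp_spatial:
  assumes impl: "implements \<pi> \<pi> (blinfun_exp K) (blinfun_exp \<delta>)"
    and K: "K \<in> skew_adjoints" "norm K \<le> 1/20" and \<delta>: "norm \<delta> \<le> 1/20"
  shows "spatial \<delta> K"
proof -
  define Y where "Y = Blinfun (\<lambda>C. (K o\<^sub>L \<pi> C) - (\<pi> C o\<^sub>L K) - \<pi> (\<delta> C))"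
  have "bounded_linear (\<lambda>C. (K o\<^sub>L \<pi> C) - (\<pi> C o\<^sub>L K) - \<pi> (\<delta> C))"
    by (intro bounded_linear_sub bounded_linear_compose[OF bounded_linear_rep]
        bounded_linear_compose[OF bounded_bilinear.bounded_linear_right[OF bounded_bilinear_blinfun_compose] bounded_linear_rep]
        bounded_linear_compose[OF bounded_bilinear.bounded_linear_left[OF bounded_bilinear_blinfun_compose] bounded_linear_rep]
        blinfun.bounded_linear_right)
  then have Y: "Y C = (K o\<^sub>L \<pi> C) - (\<pi> C o\<^sub>L K) - \<pi> (\<delta> C)" for C
    by (simp add: Y_def bounded_linear_Blinfun_apply)
  \<comment> \<open>The bound \<open>1/20\<close> on \<open>K\<close> and \<open>\<delta>\<close>
    gives \<open>exp (1/20) - 1 \<le> 1/10\<close>.\<close>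
  have close: "norm (blinfun_exp (t *\<^sub>R X) - id_blinfun) \<le> 1/10" if "t \<in> {0..1}" "norm X \<le> 1/20" for t and X :: "'x::banach \<Rightarrow>\<^sub>L 'x"
  proof -
    have "norm (t *\<^sub>R X) \<le> norm X" using that by (simp add: mult_left_le_one_le)
    then have n: "norm (t *\<^sub>R X) \<le> 1/20" using that by linarith
    have "norm (blinfun_exp (t *\<^sub>R X) - id_blinfun) \<le> exp (norm (t *\<^sub>R X)) - 1" by (rule norm_blinfun_exp_diff_id)
    also have "\<dots> \<le> 2 * norm (t *\<^sub>R X)" using n by (intro exp_le_one_plus_double) auto
    finally show ?thesis using n by simp
  qed
  have "norm (Y B) \<le> (norm Y / 2) * norm B" for B
  proof -
    \<comment> \<open>Subtracting \<open>t Y B\<close> removes the derivative at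
      \<open>t = 0\<close>, so that the derivative \<open>D t\<close> is small on the whole
      interval.\<close>
    define f where "f t = (blinfun_exp (t *\<^sub>R K) o\<^sub>L (\<pi> (blinfun_exp (t *\<^sub>R (- \<delta>)) B) o\<^sub>L blinfun_exp (t *\<^sub>R (- K)))) - t *\<^sub>R Y B" for t
    define D where "D t = (blinfun_exp (t *\<^sub>R K) o\<^sub>L (Y (blinfun_exp (t *\<^sub>R (- \<delta>)) B) o\<^sub>L blinfun_exp (t *\<^sub>R (- K)))) - Y B" for t
    have "norm (f 1 - f 0) \<le> (norm Y / 2 * norm B) * norm (1 - 0 :: real)"
    proof (rule differentiable_bound[of "{0..1}" f "\<lambda>t h. h *\<^sub>R D t"])
      fix t :: real assume t: "t \<in> {0..1}"
      let ?a = "blinfun_exp (t *\<^sub>R K)" and ?c = "blinfun_exp (t *\<^sub>R (- \<delta>))" and ?b = "blinfun_exp (t *\<^sub>R (- K))"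
      have "((\<lambda>t. blinfun_exp (t *\<^sub>R K) o\<^sub>L (\<pi> (blinfun_exp (t *\<^sub>R (- \<delta>)) B) o\<^sub>L blinfun_exp (t *\<^sub>R (- K)))) has_vector_derivative
          (?a o\<^sub>L ((\<pi> (?c B) o\<^sub>L (?b o\<^sub>L (- K))) + (\<pi> ((- \<delta>) (?c B)) o\<^sub>L ?b))) + ((?a o\<^sub>L K) o\<^sub>L (\<pi> (?c B) o\<^sub>L ?b))) (at t within {0..1})"
        by (intro has_vector_derivative_compose blinfun_exp_line_derivative rep_exp_derivative)
      also have "(?a o\<^sub>L ((\<pi> (?c B) o\<^sub>L (?b o\<^sub>L (- K))) + (\<pi> ((- \<delta>) (?c B)) o\<^sub>L ?b))) + ((?a o\<^sub>L K) o\<^sub>L (\<pi> (?c B) o\<^sub>L ?b))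
          = ?a o\<^sub>L (Y (?c B) o\<^sub>L ?b)"
        unfolding Y blinfun_exp_commute[of "- K", symmetric]
        by (simp add: compose_simps compose_assoc blinfun.minus_left minus)
      finally have "(f has_vector_derivative D t) (at t within {0..1})"
        unfolding f_def[abs_def] D_def by (intro has_vector_derivative_diff) (auto intro!: derivative_eq_intros)
      then show "(f has_derivative (\<lambda>h. h *\<^sub>R D t)) (at t within {0..1})" by (simp add: has_vector_derivative_def)
      have a: "norm (?a - id_blinfun) \<le> 1/10" and b: "norm (?b - id_blinfun) \<le> 1/10" and c: "norm (?c - id_blinfun) \<le> 1/10"
        by (rule close[OF t]; use K(2) \<delta> in simp)+
      have b1: "norm ?b \<le> 11/10" and c1: "norm ?c \<le> 11/10"
        using norm_triangle_ineq[of "?b - id_blinfun" id_blinfun] norm_triangle_ineq[of "?c - id_blinfun" id_blinfun]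
          b c norm_blinfun_id_le[where 'a = 'b] norm_blinfun_id_le[where 'a = 'h] by simp_all
      define N where "N = norm Y * norm B"
      have N: "0 \<le> N" by (simp add: N_def)
      have cB: "norm (?c B) \<le> 11/10 * norm B" by (rule order_trans[OF norm_blinfun mult_right_mono[OF c1]]) simp
      have YcB: "norm (Y (?c B)) \<le> 11/10 * N"
        using mult_left_mono[OF cB norm_ge_zero[of Y]] norm_blinfun[of Y "?c B"] by (simp add: N_def mult_ac)
      have cB': "norm (?c B - B) \<le> 1/10 * norm B"
        using norm_blinfun[of "?c - id_blinfun" B] mult_right_mono[OF c norm_ge_zero[of B]] by (simp add: blinfun.diff_left)
      have YcB': "norm (Y (?c B - B)) \<le> 1/10 * N"
        using mult_left_mono[OF cB' norm_ge_zero[of Y]] norm_blinfun[of Y "?c B - B"] by (simp add: N_def mult_ac)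
      have YB: "norm (Y B) \<le> N" by (simp add: N_def norm_blinfun)
      have "D t = ((?a - id_blinfun) o\<^sub>L (Y (?c B) o\<^sub>L ?b)) + (Y (?c B - B) o\<^sub>L ?b) + (Y B o\<^sub>L (?b - id_blinfun))"
        by (simp add: D_def compose_simps blinfun.diff_right)
      also have "norm \<dots> \<le> norm ((?a - id_blinfun) o\<^sub>L (Y (?c B) o\<^sub>L ?b)) + norm (Y (?c B - B) o\<^sub>L ?b) + norm (Y B o\<^sub>L (?b - id_blinfun))"
        by (rule order_trans[OF norm_triangle_ineq add_right_mono[OF norm_triangle_ineq]])
      also have "norm ((?a - id_blinfun) o\<^sub>L (Y (?c B) o\<^sub>L ?b)) \<le> 1/10 * ((11/10 * N) * (11/10))"
        by (rule order_trans[OF norm_blinfun_compose mult_mono[OF a order_trans[OF norm_blinfun_compose mult_mono[OF YcB b1]]]]) (use N in auto)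
      also have "norm (Y (?c B - B) o\<^sub>L ?b) \<le> (1/10 * N) * (11/10)"
        by (rule order_trans[OF norm_blinfun_compose mult_mono[OF YcB' b1]]) (use N in auto)
      also have "norm (Y B o\<^sub>L (?b - id_blinfun)) \<le> N * (1/10)"
        by (rule order_trans[OF norm_blinfun_compose mult_mono[OF YB b]]) (use N in auto)
      \<comment> \<open>The three terms add up to \<open>0.121 + 0.11 + 0.1 = 0.331\<close> times
        \<open>N\<close>; a factor below \<open>1\<close> is what lets \<open>norm Y\<close> be
        absorbed at the end.\<close>
      finally have "norm (D t) \<le> N / 2" using N by simp
      then have "norm (h *\<^sub>R D t) \<le> (norm Y / 2 * norm B) * norm h" for h :: real
        using mult_left_mono[of "norm (D t)" "N / 2" "\<bar>h\<bar>"] by (simp add: N_def mult_ac)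
      then show "onorm (\<lambda>h. h *\<^sub>R D t) \<le> norm Y / 2 * norm B" by (intro onorm_le)
    qed auto
    moreover have "f 1 - f 0 = - Y B"
    proof -
      have "blinfun_exp K o\<^sub>L \<pi> (blinfun_exp (- \<delta>) B) = \<pi> B o\<^sub>L blinfun_exp K"
        using impl by (intro blinfun_eqI) (simp add: implements_def)
      then have "blinfun_exp K o\<^sub>L (\<pi> (blinfun_exp (- \<delta>) B) o\<^sub>L blinfun_exp (- K)) = \<pi> B"
        by (simp add: compose_assoc[symmetric]) (simp add: compose_assoc blinfun_exp_minus)
      then show ?thesis by (simp add: f_def)
    qed
    ultimately show ?thesis by simp
  qed
  then have "norm Y \<le> norm Y / 2" by (rule norm_blinfun_bound[rotated]) simp
  then have "Y = 0" by simp
  then have "\<pi> (\<delta> B) = (K o\<^sub>L \<pi> B) - (\<pi> B o\<^sub>L K)" for B using Y[of B] by simp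
  then show ?thesis using K(1) by (simp add: spatial_def)
qed

lemma spatial_add: "spatial \<delta> K \<Longrightarrow> spatial \<epsilon> L \<Longrightarrow> spatial (\<delta> + \<epsilon>) (K + L)"
  by (simp add: spatial_def subspace_add[OF subspace_skew_adjoints] blinfun.add_left add compose_simps algebra_simps)

lemma spatial_scaleR: "spatial \<delta> K \<Longrightarrow> spatial (r *\<^sub>R \<delta>) (r *\<^sub>R K)"
  by (simp add: spatial_def subspace_scale[OF subspace_skew_adjoints] blinfun.scaleR_left scaleR compose_simps
      scaleR_diff_right)

end

lemma log_near_identity:
  assumes "0 < e"
  obtains d where "0 < d" "\<And>V :: 'a::banach \<Rightarrow>\<^sub>L 'a. norm (V - id_blinfun) < d \<Longrightarrow> norm (V - id_blinfun) < 1 \<and> norm (blinfun_log V) < e"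
proof -
  have "continuous_on {V :: 'a \<Rightarrow>\<^sub>L 'a. norm (V - id_blinfun) < 1} blinfun_log"
    by (rule smooth_on_imp_continuous_on[OF smooth_on_blinfun_log subspace_UNIV])
  then obtain d where d: "0 < d" "\<And>V :: 'a \<Rightarrow>\<^sub>L 'a. norm (V - id_blinfun) < 1 \<Longrightarrow> dist V id_blinfun < d \<Longrightarrow> dist (blinfun_log V) (blinfun_log id_blinfun) < e"
    using assms unfolding continuous_on_iff by fastforce
  show thesis by (rule that[of "min d 1"]) (use d in \<open>auto simp: dist_norm\<close>)
qed

context irreducible_star_representation
begin

text \<open>\<open>exp \<delta>\<close> is an automorphism near the identity, hence implemented by
  some \<open>V\<close> near the identity; \<open>K = log V\<close> is skew-adjoint and meets the
  bound \<open>1/20\<close> of \<open>implemented_exp_imp_spatial\<close>.\<close>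

lemma spatial_small:
  obtains r where "0 < r" "\<And>\<delta>. \<delta> \<in> symmetric_derivations \<Longrightarrow> norm \<delta> < r \<Longrightarrow> \<exists>K. spatial \<delta> K \<and> norm K \<le> 1/20"
proof -
  obtain d where d: "0 < d" "\<And>V :: 'b \<Rightarrow>\<^sub>L 'b. norm (V - id_blinfun) < d \<Longrightarrow> norm (V - id_blinfun) < 1 \<and> norm (blinfun_log V) < 1/20"
    using log_near_identity[of "1/20"] by (metis zero_less_divide_1_iff zero_less_numeral)
  obtain s where s: "0 < s" "\<And>\<alpha>. \<alpha> \<in> automorphisms \<Longrightarrow> norm (\<alpha> - id_blinfun) < s \<Longrightarrow>
    \<exists>V. implements \<pi> \<pi> V \<alpha> \<and> norm (V - id_blinfun) < d"
    by (rule near_identity_implemented[OF d(1)]) blast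
  show thesis
  proof (rule that[of "min (1/20) (s / 2)"])
    show "0 < min (1/20) (s / 2)" using s by simp
    fix \<delta> :: "'a \<Rightarrow>\<^sub>L 'a" assume \<delta>: "\<delta> \<in> symmetric_derivations" and n: "norm \<delta> < min (1/20) (s / 2)"
    have "norm (blinfun_exp \<delta> - id_blinfun) \<le> exp (norm \<delta>) - 1" by (rule norm_blinfun_exp_diff_id)
    also have "\<dots> \<le> 2 * norm \<delta>" using n by (intro exp_le_one_plus_double) auto
    finally have "norm (blinfun_exp \<delta> - id_blinfun) < s" using n by simp
    then obtain V where V: "implements \<pi> \<pi> V (blinfun_exp \<delta>)" "norm (V - id_blinfun) < d"
      using s(2) exp_derivation_automorphism[OF \<delta>] by blast
    have V1: "norm (V - id_blinfun) < 1" and K: "norm (blinfun_log V) < 1/20" using d(2)[OF V(2)] by auto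
    have "(1::real) / 20 < ln 2" using ln2_ge_two_thirds by simp
    then have skew: "blinfun_log V \<in> skew_adjoints"
      using V(1) V1 K by (intro log_unitary_skew_adjoint) (auto simp: implements_def)
    have "spatial \<delta> (blinfun_log V)"
      using V(1) n K by (intro implemented_exp_imp_spatial skew) (simp_all add: blinfun_exp_log[OF V1])
    then show "\<exists>K. spatial \<delta> K \<and> norm K \<le> 1/20" using K by (intro exI[of _ "blinfun_log V"]) simp
  qed
qed

text \<open>The difference of two solutions commutes with the representation and becomes
  self-adjoint after multiplication by \<open>\<i>\<close>, so Schur's lemma makes it a scalar,
  which the normalisation at \<open>x\<close> sets to zero.\<close>

lemma spatial_unique:
  assumes "spatial \<delta> K" "spatial \<delta> L" "norm x = 1" "cinner x (K x) = 0" "cinner x (L x) = 0"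
  shows "K = L"
proof -
  define D where "D = K - L"
  have D: "D \<in> skew_adjoints"
    unfolding D_def using assms(1,2) by (intro subspace_diff subspace_skew_adjoints) (auto simp: spatial_def)
  have Dlin: "D (c *\<^sub>C v) = c *\<^sub>C D v" for c v using skew_adjointsD(1)[OF D] by (simp add: complex_linear_def)
  have comm: "D (\<pi> A v) = \<pi> A (D v)" for A v
  proof -
    have "(K o\<^sub>L \<pi> A) - (\<pi> A o\<^sub>L K) = (L o\<^sub>L \<pi> A) - (\<pi> A o\<^sub>L L)" using assms(1,2) by (simp add: spatial_def)
    then have "D o\<^sub>L \<pi> A = \<pi> A o\<^sub>L D" by (simp add: D_def compose_simps algebra_simps)
    then show ?thesis by (metis blinfun_apply_blinfun_compose)
  qed
  define T where "T = scalar_op \<i> o\<^sub>L D"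
  obtain t where t: "\<And>v. T v = t *\<^sub>R v"
  proof (rule schur[of T])
    show "complex_linear T" unfolding T_def using skew_adjointsD(1)[OF D] by (intro complex_linear_compose complex_linear_scalar_op)
    show "cinner (T u) v = cinner u (T v)" for u v
      by (simp add: T_def cinner_simps skew_adjointsD(2)[OF D] blinfun.minus_left)
    show "T (\<pi> A v) = \<pi> A (T v)" for A v by (simp add: T_def comm apply_scaleC)
  qed blast
  have "cinner x (T x) = 0" using assms(4,5) by (simp add: T_def D_def cinner_simps blinfun.diff_left)
  then have "t = 0" using assms(3) by (simp add: t cinner_simps cinner_self)
  then have "D v = 0" for v
  proof -
    have "D v = (- \<i>) *\<^sub>C T v" by (simp add: T_def scaleC_scaleC)
    then show ?thesis using \<open>t = 0\<close> by (simp add: t)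
  qed
  then have "D = 0" by (intro blinfun_eqI) simp
  then show ?thesis by (simp add: D_def)
qed

text \<open>For skew-adjoint \<open>K\<close> the number \<open>\<langle>x, K x\<rangle>\<close> is
  imaginary, so subtracting it keeps \<open>K\<close> skew-adjoint and does not change commutators;
  its modulus is at most \<open>norm K\<close>.\<close>

lemma spatial_normalize:
  assumes "spatial \<delta> K" "norm x = 1"
  obtains L where "spatial \<delta> L" "cinner x (L x) = 0" "norm L \<le> 2 * norm K"
proof -
  define c where "c = cinner x (K x)"
  have K: "K \<in> skew_adjoints" using assms(1) by (simp add: spatial_def)
  have "cnj c = - c"
    using skew_adjointsD(2)[OF K, of x x] cinner_commute[of "K x" x] by (simp add: c_def blinfun.minus_left cinner_simps)
  then have "scalar_op c \<in> skew_adjoints"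
    by (simp add: skew_adjoints_def complex_linear_scalar_op cinner_simps)
  then have L: "K - scalar_op c \<in> skew_adjoints" using K by (intro subspace_diff subspace_skew_adjoints)
  have "scalar_op c o\<^sub>L \<pi> B = \<pi> B o\<^sub>L scalar_op c" for B by (rule blinfun_eqI) (simp add: apply_scaleC)
  then have "spatial \<delta> (K - scalar_op c)"
    using assms(1) L by (simp add: spatial_def compose_simps)
  moreover have "cinner x ((K - scalar_op c) x) = 0"
    using assms(2) by (simp add: blinfun.diff_left cinner_simps cinner_self c_def)
  moreover have "norm (K - scalar_op c) \<le> 2 * norm K"
  proof -
    have "cmod c \<le> norm x * norm (K x)" unfolding c_def by (rule norm_cinner)
    also have "\<dots> \<le> norm K" using norm_blinfun[of K x] assms(2) by simp
    finally have "cmod c \<le> norm K" .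
    moreover have "norm (scalar_op c :: 'b \<Rightarrow>\<^sub>L 'b) \<le> cmod c" by (rule norm_blinfun_bound) (simp_all add: norm_scaleC)
    ultimately show ?thesis using norm_triangle_ineq4[of K "scalar_op c"] by linarith
  qed
  ultimately show thesis by (rule that)
qed

text \<open>Normalised solutions are unique and stable under sums and real multiples, so choosing
  them is automatically real-linear. The bound comes from solving for a rescaled derivation inside
  the radius \<open>r\<close>.\<close>

lemma spatial_selection:
  obtains K c where "0 \<le> c" "\<And>\<delta>. \<delta> \<in> symmetric_derivations \<Longrightarrow> spatial \<delta> (K \<delta>)"
    "\<And>\<delta>. \<delta> \<in> symmetric_derivations \<Longrightarrow> norm (K \<delta>) \<le> c * norm \<delta>"
    "\<And>\<delta> \<epsilon>. \<delta> \<in> symmetric_derivations \<Longrightarrow> \<epsilon> \<in> symmetric_derivations \<Longrightarrow> K (\<delta> + \<epsilon>) = K \<delta> + K \<epsilon>"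
    "\<And>r \<delta>. \<delta> \<in> symmetric_derivations \<Longrightarrow> K (r *\<^sub>R \<delta>) = r *\<^sub>R K \<delta>"
proof -
  obtain x :: 'b where x: "norm x = 1" using exists_unit_vector by blast
  obtain r where r: "0 < r" "\<And>\<delta>. \<delta> \<in> symmetric_derivations \<Longrightarrow> norm \<delta> < r \<Longrightarrow> \<exists>K. spatial \<delta> K \<and> norm K \<le> 1/20"
    by (rule spatial_small) blast
  define P where "P \<delta> K \<longleftrightarrow> spatial \<delta> K \<and> cinner x (K x) = 0" for \<delta> K
  note sub = subspace_symmetric_derivations
  have ex: "\<exists>K. P \<delta> K \<and> norm K \<le> (1 / r) * norm \<delta>" if \<delta>: "\<delta> \<in> symmetric_derivations" for \<delta>
  proof -
    \<comment> \<open>Brings a nonzero \<open>\<delta>\<close> to norm \<open>r / 2\<close>. The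
      normalised solution there has norm at most \<open>1/2\<close>, and scaling back by
      \<open>1 / s\<close> gives \<open>norm \<delta> / r\<close>.\<close>
    define s where "s = r / (2 * norm \<delta>)"
    show ?thesis
    proof (cases "\<delta> = 0")
      case True
      then have "P \<delta> 0" by (simp add: P_def spatial_def subspace_0[OF subspace_skew_adjoints] compose_simps)
      then show ?thesis by (intro exI[of _ 0]) (simp add: True)
    next
      case False
      then have s: "0 < s" "norm (s *\<^sub>R \<delta>) < r" using r by (simp_all add: s_def)
      have "s *\<^sub>R \<delta> \<in> symmetric_derivations" using \<delta> sub by (rule subspace_scale[rotated])
      then obtain K where K: "spatial (s *\<^sub>R \<delta>) K" "norm K \<le> 1/20" using r(2) s(2) by blast
      obtain L where L: "spatial (s *\<^sub>R \<delta>) L" "cinner x (L x) = 0" "norm L \<le> 2 * norm K"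
        by (rule spatial_normalize[OF K(1) x])
      have "spatial ((1 / s) *\<^sub>R s *\<^sub>R \<delta>) ((1 / s) *\<^sub>R L)" by (rule spatial_scaleR[OF L(1)])
      then have "P \<delta> ((1 / s) *\<^sub>R L)" using s L(2) by (simp add: P_def blinfun.scaleR_left cinner_simps)
      moreover have "norm ((1 / s) *\<^sub>R L) \<le> (1 / r) * norm \<delta>"
      proof -
        have "norm L \<le> 1/2" using L(3) K(2) by simp
        then have "(1 / s) * norm L \<le> (1 / s) * (1/2)" using s by (intro mult_left_mono) auto
        then have "norm ((1 / s) *\<^sub>R L) \<le> (1 / s) * (1/2)" using s by simp
        also have "\<dots> = (1 / r) * norm \<delta>" using r False by (simp add: s_def field_simps)
        finally show ?thesis .
      qed
      ultimately show ?thesis by blast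
    qed
  qed
  define K where "K \<delta> = (SOME K. P \<delta> K \<and> norm K \<le> (1 / r) * norm \<delta>)" for \<delta>
  have K: "P \<delta> (K \<delta>) \<and> norm (K \<delta>) \<le> (1 / r) * norm \<delta>" if "\<delta> \<in> symmetric_derivations" for \<delta>
    unfolding K_def using ex[OF that] by (rule someI_ex)
  have uniq: "L = K \<delta>" if "\<delta> \<in> symmetric_derivations" "P \<delta> L" for \<delta> L
    using K[OF that(1)] that(2) spatial_unique[OF _ _ x] unfolding P_def by blast
  show thesis
  proof (rule that[of "1 / r" K])
    fix \<delta> \<epsilon> :: "'a \<Rightarrow>\<^sub>L 'a" and s :: real assume \<delta>: "\<delta> \<in> symmetric_derivations"
    show "spatial \<delta> (K \<delta>)" "norm (K \<delta>) \<le> (1 / r) * norm \<delta>" using K[OF \<delta>] by (auto simp: P_def)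
    have "P (s *\<^sub>R \<delta>) (s *\<^sub>R K \<delta>)" using K[OF \<delta>] spatial_scaleR by (auto simp: P_def blinfun.scaleR_left cinner_simps)
    then show "K (s *\<^sub>R \<delta>) = s *\<^sub>R K \<delta>" using uniq[OF subspace_scale[OF sub \<delta>]] by simp
    assume \<epsilon>: "\<epsilon> \<in> symmetric_derivations"
    have "P (\<delta> + \<epsilon>) (K \<delta> + K \<epsilon>)" using K[OF \<delta>] K[OF \<epsilon>] spatial_add by (auto simp: P_def blinfun.add_left cinner_simps)
    then show "K (\<delta> + \<epsilon>) = K \<delta> + K \<epsilon>" using uniq[OF subspace_add[OF sub \<delta> \<epsilon>]] by simp
  qed (use r in simp)
qed

end

section \<open>Charts\<close>

text \<open>These properties ensure that relatively open subsets of \<open>M\<close> have open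
  images in \<open>E\<close>: the image of the chart domain is open and the inverse chart is
  continuous.\<close>

definition regular_chart :: "'m::topological_space set \<Rightarrow> ('m, 'e::real_normed_vector) chart \<Rightarrow> bool" where
  "regular_chart M c \<longleftrightarrow> (case c of (E, U, \<phi>) \<Rightarrow> subspace E \<and> U \<subseteq> M \<and> inj_on \<phi> U
     \<and> openin (top_of_set E) (\<phi> ` U) \<and> continuous_on (\<phi> ` U) (inv_into U \<phi>))"

lemma regular_chart_image_open:
  assumes c: "regular_chart M (E, U, \<phi>)" and Z: "openin (top_of_set M) Z"
  shows "openin (top_of_set E) (\<phi> ` (Z \<inter> U))"
proof -
  have inj: "inj_on \<phi> U" and UM: "U \<subseteq> M" using c by (auto simp: regular_chart_def)
  have "openin (top_of_set (\<phi> ` U)) (\<phi> ` U \<inter> inv_into U \<phi> -` Z)"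
    by (rule continuous_openin_preimage[OF _ _ Z]) (use c inj UM in \<open>auto simp: regular_chart_def inv_into_f_f\<close>)
  moreover have "\<phi> ` U \<inter> inv_into U \<phi> -` Z = \<phi> ` (Z \<inter> U)" using inj by (auto simp: inv_into_f_f)
  ultimately show ?thesis using c openin_trans by (auto simp: regular_chart_def)
qed

lemma regular_chart_product:
  assumes "regular_chart M (E, U, \<phi>)" "regular_chart N (F, V, \<psi>)"
  shows "regular_chart (M \<times> N) (E \<times> F, U \<times> V, map_prod \<phi> \<psi>)"
proof -
  have inj: "inj_on \<phi> U" "inj_on \<psi> V" using assms by (auto simp: regular_chart_def)
  have injp: "inj_on (map_prod \<phi> \<psi>) (U \<times> V)" using inj by (auto simp: inj_on_def)
  have im: "map_prod \<phi> \<psi> ` (U \<times> V) = \<phi> ` U \<times> \<psi> ` V" by (rule map_prod_surj_on) simp_all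
  have inv: "inv_into (U \<times> V) (map_prod \<phi> \<psi>) e = (inv_into U \<phi> (fst e), inv_into V \<psi> (snd e))"
    if e_mem: "e \<in> \<phi> ` U \<times> \<psi> ` V" for e
  proof -
    obtain u v where e: "u \<in> U" "v \<in> V" "e = map_prod \<phi> \<psi> (u, v)" using e_mem by auto
    show ?thesis
      unfolding e(3) using e(1,2) inj by (subst inv_into_f_f[OF injp]) (auto simp: inv_into_f_f)
  qed
  have "continuous_on (\<phi> ` U \<times> \<psi> ` V) (\<lambda>e. (inv_into U \<phi> (fst e), inv_into V \<psi> (snd e)))"
  proof (rule continuous_on_Pair)
    show "continuous_on (\<phi> ` U \<times> \<psi> ` V) (\<lambda>e. inv_into U \<phi> (fst e))"
      by (rule continuous_on_compose2[of "\<phi> ` U" _ _ fst]) (use assms in \<open>auto simp: regular_chart_def intro: continuous_intros\<close>)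
    show "continuous_on (\<phi> ` U \<times> \<psi> ` V) (\<lambda>e. inv_into V \<psi> (snd e))"
      by (rule continuous_on_compose2[of "\<psi> ` V" _ _ snd]) (use assms in \<open>auto simp: regular_chart_def intro: continuous_intros\<close>)
  qed
  then have "continuous_on (\<phi> ` U \<times> \<psi> ` V) (inv_into (U \<times> V) (map_prod \<phi> \<psi>))"
    by (rule continuous_on_eq) (simp add: inv)
  then show ?thesis
    using assms injp unfolding regular_chart_def
    by (auto simp: im subspace_Times openin_Times)
qed

lemma product_inv_into:
  assumes "inj_on \<phi> U" "inj_on \<psi> V" "u \<in> U" "v \<in> V"
  shows "inv_into (U \<times> V) (map_prod \<phi> \<psi>) (\<phi> u, \<psi> v) = (u, v)"
proof -
  have "inj_on (map_prod \<phi> \<psi>) (U \<times> V)" using assms by (auto simp: inj_on_def)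
  from inv_into_f_f[OF this, of "(u, v)"] assms(3,4) show ?thesis by simp
qed

text \<open>Exponential charts are defined as inverses, so the inverse of such a chart is the
  parametrisation \<open>h\<close> itself.\<close>

lemma inverse_chart:
  fixes h :: "'e \<Rightarrow> 'm"
  assumes inj: "inj_on h B"
  shows "inv_into B h ` h ` B = B" "inj_on (inv_into B h) (h ` B)"
    "b \<in> B \<Longrightarrow> inv_into (h ` B) (inv_into B h) b = h b"
proof -
  show 1: "inv_into B h ` h ` B = B" using inj by (simp add: inv_into_image_cancel)
  show 2: "inj_on (inv_into B h) (h ` B)" by (rule inj_on_inv_into) simp
  assume b: "b \<in> B"
  have "inv_into (h ` B) (inv_into B h) (inv_into B h (h b)) = h b" by (rule inv_into_f_f[OF 2]) (use b in simp)
  then show "inv_into (h ` B) (inv_into B h) b = h b" using b inj by (simp add: inv_into_f_f)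
qed

subsection \<open>Exponential charts\<close>

text \<open>\<open>g\<close> is cancelled by surjectivity, and the logarithm recovers
  \<open>X\<close> on the ball of radius \<open>ln 2\<close>.\<close>

lemma exp_chart_inj:
  fixes g :: "'a::banach \<Rightarrow>\<^sub>L 'a"
  assumes "surj g"
  shows "inj_on (\<lambda>X. blinfun_exp X o\<^sub>L g) {X \<in> L. norm X < ln 2}"
proof (rule inj_onI)
  fix X Y :: "'a \<Rightarrow>\<^sub>L 'a" assume X: "X \<in> {X \<in> L. norm X < ln 2}" and Y: "Y \<in> {X \<in> L. norm X < ln 2}"
    and eq: "blinfun_exp X o\<^sub>L g = blinfun_exp Y o\<^sub>L g"
  have "blinfun_exp X x = blinfun_exp Y x" for x
  proof -
    obtain y where "x = g y" using assms by (metis surjD)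
    then show ?thesis using arg_cong[OF eq, of "\<lambda>f. blinfun_apply f y"] by simp
  qed
  then have "blinfun_exp X = blinfun_exp Y" by (rule blinfun_eqI)
  then have "blinfun_log (blinfun_exp X) = blinfun_log (blinfun_exp Y)" by (rule arg_cong)
  moreover have "blinfun_log (blinfun_exp X) = X" using X by (intro blinfun_log_exp) simp
  moreover have "blinfun_log (blinfun_exp Y) = Y" using Y by (intro blinfun_log_exp) simp
  ultimately show "X = Y" by (simp only:)
qed

lemma exp_ball_open: "openin (top_of_set L) {X \<in> L. norm X < r}"
proof -
  have "{X \<in> L. norm X < r} = L \<inter> {X. norm X < r}" by auto
  then show ?thesis by (simp add: openin_open_Int open_Collect_less continuous_on_norm_id)
qed

lemma exp_chart_regular:
  fixes g :: "'a::banach \<Rightarrow>\<^sub>L 'a"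
  assumes L: "subspace L" and g: "g \<in> G" "surj g" and exp: "\<And>X. X \<in> L \<Longrightarrow> blinfun_exp X o\<^sub>L g \<in> G"
  shows "regular_chart G (L, (\<lambda>X. blinfun_exp X o\<^sub>L g) ` {X \<in> L. norm X < ln 2},
      inv_into {X \<in> L. norm X < ln 2} (\<lambda>X. blinfun_exp X o\<^sub>L g))"
proof -
  let ?B = "{X \<in> L. norm X < ln 2}"
  note inj = exp_chart_inj[OF g(2), of L]
  have "continuous_on ?B blinfun_exp"
    by (rule continuous_on_subset[OF smooth_on_imp_continuous_on[OF smooth_on_blinfun_exp[of "ln 2"] subspace_UNIV]]) auto
  then have "continuous_on ?B (\<lambda>X. blinfun_exp X o\<^sub>L g)"
    by (intro bounded_bilinear.continuous_on[OF bounded_bilinear_blinfun_compose] continuous_on_const)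
  then have "continuous_on ?B (inv_into ((\<lambda>X. blinfun_exp X o\<^sub>L g) ` ?B) (inv_into ?B (\<lambda>X. blinfun_exp X o\<^sub>L g)))"
    by (rule continuous_on_eq) (simp add: inverse_chart(3)[OF inj])
  then show ?thesis
    using inverse_chart(1,2)[OF inj] L exp exp_ball_open[of L "ln 2"] by (auto simp: regular_chart_def)
qed

lemma exp_atlas_carrier:
  assumes L: "0 \<in> L" and exp: "\<And>X g. X \<in> L \<Longrightarrow> g \<in> G \<Longrightarrow> blinfun_exp X o\<^sub>L g \<in> G"
  shows "atlas_carrier (exp_atlas L G) = G"
proof
  show "atlas_carrier (exp_atlas L G) \<subseteq> G" using exp by (auto simp: atlas_carrier_def exp_atlas_def)
  show "G \<subseteq> atlas_carrier (exp_atlas L G)"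
  proof
    fix g assume g: "g \<in> G"
    have "g = blinfun_exp 0 o\<^sub>L g" by simp
    then have "g \<in> (\<lambda>X. blinfun_exp X o\<^sub>L g) ` {X \<in> L. norm X < ln 2}" using L by (intro image_eqI[of _ _ 0]) auto
    then show "g \<in> atlas_carrier (exp_atlas L G)"
      unfolding atlas_carrier_def exp_atlas_def using g by blast
  qed
qed

lemma surj_automorphism: "\<alpha> \<in> automorphisms \<Longrightarrow> surj (blinfun_apply \<alpha>)"
  by (simp add: automorphisms_def bij_is_surj)

lemma surj_unitary: "V \<in> unitaries \<Longrightarrow> surj (blinfun_apply V)"
  by (simp add: unitaries_def)

lemma aut_atlas_carrier: "atlas_carrier aut_atlas = automorphisms"
  unfolding aut_atlas_def
  by (rule exp_atlas_carrier[OF subspace_0[OF subspace_symmetric_derivations]])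
    (intro automorphism_compose exp_derivation_automorphism)

lemma unitary_atlas_carrier: "atlas_carrier unitary_atlas = unitaries"
  unfolding unitary_atlas_def
  by (rule exp_atlas_carrier[OF subspace_0[OF subspace_skew_adjoints]])
    (intro unitary_compose exp_skew_adjoint_unitary)

subsection \<open>Charts of the sphere\<close>

text \<open>Near the unit vector \<open>\<Omega>\<close>, the map \<open>x \<mapsto> (x - p x \<Omega>) + (norm x\<^sup>2 - 1) \<Omega>\<close>, with \<open>p = Re \<langle>\<Omega>, _\<rangle>\<close>, flattens
  the sphere to the hyperplane \<open>p = 0\<close>.\<close>

lemma sphere_chart_exists:
  fixes \<Omega> :: "'h::complex_hilbert"
  assumes \<Omega>: "norm \<Omega> = 1"
  obtains E W \<theta> where "(E, W \<inter> unit_sphere, \<theta>) \<in> sphere_atlas" "\<Omega> \<in> W"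
proof -
  define p where "p x = Re (cinner \<Omega> x)" for x
  define N where "N x = Re (cinner x x)" for x :: 'h
  define \<theta> where "\<theta> x = x + (N x - 1 - p x) *\<^sub>R \<Omega>" for x
  \<comment> \<open>\<open>q\<close> is made so that \<open>q (\<theta> x) = (p x)^2\<close>. On the
    half space \<open>p > 0\<close> the square root recovers \<open>p x\<close>, and with it
    \<open>x\<close>.\<close>
  define q where "q y = 1 + p y - N y + p y * p y" for y
  define \<sigma> where "\<sigma> y = y + (q y powr (1/2) - p y) *\<^sub>R \<Omega>" for y
  define W where "W = {x. 0 < p x}"
  define W' where "W' = {y. 0 < q y}"
  define E where "E = {x. p x = 0}"
  have bp: "bounded_linear p"
    unfolding p_def[abs_def]
    using bounded_linear_compose[OF bounded_linear_Re bounded_bilinear.bounded_linear_right[OF bounded_bilinear_cinner]] .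
  have p_simps: "p (x + y) = p x + p y" "p (r *\<^sub>R x) = r * p x" "p \<Omega> = 1" for x y r
    using \<Omega> by (simp_all add: p_def cinner_simps cinner_self)
  have N_line: "N (x + r *\<^sub>R \<Omega>) = N x + 2 * r * p x + r\<^sup>2" for x r
    using norm_add_sq[of x "r *\<^sub>R \<Omega>"] cinner_commute[of x \<Omega>] \<Omega>
    by (simp add: N_def norm_sq_cinner[symmetric] p_def cinner_simps power_mult_distrib power2_eq_square algebra_simps)
  have p\<theta>: "p (\<theta> x) = N x - 1" for x by (simp add: \<theta>_def p_simps)
  have q\<theta>: "q (\<theta> x) = (p x)\<^sup>2" for x
  proof -
    have N\<theta>: "N (\<theta> x) = N x + 2 * (N x - 1 - p x) * p x + (N x - 1 - p x)\<^sup>2"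
      unfolding \<theta>_def by (rule N_line)
    show ?thesis unfolding q_def p\<theta> N\<theta> by (simp add: power2_eq_square algebra_simps)
  qed
  have \<sigma>\<theta>: "\<sigma> (\<theta> x) = x" if "x \<in> W" for x
  proof -
    have "q (\<theta> x) powr (1/2) = p x" using that by (simp add: q\<theta> W_def powr_half_sqrt)
    then have "\<sigma> (\<theta> x) = \<theta> x + (p x - (N x - 1)) *\<^sub>R \<Omega>" by (simp add: \<sigma>_def p\<theta>)
    then show ?thesis by (simp add: \<theta>_def algebra_simps)
  qed
  have p\<sigma>: "p (\<sigma> y) = q y powr (1/2)" for y by (simp add: \<sigma>_def p_simps)
  have \<theta>\<sigma>: "\<theta> (\<sigma> y) = y" if "y \<in> W'" for y
  proof -
    have sq: "(q y powr (1/2))\<^sup>2 = q y" using that by (simp add: W'_def powr_half_sqrt)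
    have "N (\<sigma> y) = N y + (q y powr (1/2))\<^sup>2 - p y * p y"
      unfolding \<sigma>_def N_line by (simp add: power2_eq_square algebra_simps)
    then have "N (\<sigma> y) - 1 = p y" unfolding sq by (simp add: q_def)
    then have "\<theta> (\<sigma> y) = \<sigma> y + (p y - q y powr (1/2)) *\<^sub>R \<Omega>" by (simp add: \<theta>_def p\<sigma>)
    then show ?thesis by (simp add: \<sigma>_def algebra_simps)
  qed
  have inj: "inj_on \<theta> W" using \<sigma>\<theta> by (rule inj_on_inverseI)
  have \<theta>W: "\<theta> ` W = W'"
  proof
    show "\<theta> ` W \<subseteq> W'" by (auto simp: W_def W'_def q\<theta>)
    have "\<sigma> y \<in> W" if "y \<in> W'" for y using that by (simp add: W_def W'_def p\<sigma>)
    then show "W' \<subseteq> \<theta> ` W" using \<theta>\<sigma> by (metis image_eqI subsetI)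
  qed
  have inv: "inv_into W \<theta> y = \<sigma> y" if "y \<in> W'" for y
    using that inj \<theta>W \<sigma>\<theta> by (metis imageE inv_into_f_f)
  have contp: "continuous_on UNIV p" by (rule linear_continuous_on[OF bp])
  have contq: "continuous_on UNIV q"
    unfolding q_def N_def by (intro continuous_intros contp)
  have oW: "openin (top_of_set UNIV) W" and oW': "openin (top_of_set UNIV) W'"
    unfolding W_def W'_def by (simp_all add: open_Collect_less contp contq continuous_on_const flip: open_openin)
  note U = subspace_UNIV
  have sid: "smooth_on UNIV V (\<lambda>x. x)" if "openin (top_of_set UNIV) V" for V :: "'h set"
    by (rule smooth_on_bounded_linear[OF bounded_linear_ident U that])
  have sp: "smooth_on UNIV V p" if "openin (top_of_set UNIV) V" for V
    by (rule smooth_on_bounded_linear[OF bp U that])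
  have sN: "smooth_on UNIV V N" if "openin (top_of_set UNIV) V" for V
    unfolding N_def[abs_def]
    by (intro smooth_on_linear_compose[OF bounded_linear_Re] smooth_on_bilinear_compose[OF bounded_bilinear_cinner] U sid that)
  have s\<theta>: "smooth_on UNIV W \<theta>"
    unfolding \<theta>_def[abs_def]
    by (intro smooth_on_add smooth_on_bilinear_compose[OF bounded_bilinear_scaleR] smooth_on_diff smooth_on_const sid sp sN U oW)
  have sq: "smooth_on UNIV W' q"
    unfolding q_def[abs_def]
    by (intro smooth_on_add smooth_on_diff smooth_on_bilinear_compose[OF bounded_bilinear_mult] smooth_on_const sp sN U oW')
  have "smooth_on UNIV W' (\<lambda>y. q y powr (1/2))"
    by (rule smooth_on_compose[OF U sq smooth_on_powr]) (auto simp: W'_def)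
  then have "smooth_on UNIV W' \<sigma>"
    unfolding \<sigma>_def[abs_def]
    by (intro smooth_on_add smooth_on_bilinear_compose[OF bounded_bilinear_scaleR] smooth_on_diff smooth_on_const sid sp U oW')
  then have s\<sigma>: "smooth_on UNIV (\<theta> ` W) (inv_into W \<theta>)"
    unfolding \<theta>W by (rule smooth_on_cong) (simp add: inv)
  have "closed E" unfolding E_def by (intro closed_Collect_eq contp continuous_on_const)
  moreover have "subspace E"
    unfolding E_def by (rule subspaceI) (auto simp: p_simps linear_0[OF bounded_linear.linear[OF bp]])
  moreover have "\<theta> ` (W \<inter> unit_sphere) = \<theta> ` W \<inter> E"
  proof -
    have "x \<in> unit_sphere \<longleftrightarrow> p (\<theta> x) = 0" for x
      unfolding p\<theta> by (simp add: unit_sphere_def N_def norm_sq_cinner[symmetric] power2_eq_1_iff)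
        (use norm_ge_zero[of x] in linarith)
    then show ?thesis by (auto simp: E_def)
  qed
  ultimately have "(E, W \<inter> unit_sphere, \<theta>) \<in> sphere_atlas"
    unfolding sphere_atlas_def submanifold_atlas_def using inj s\<theta> s\<sigma> by blast
  moreover have "\<Omega> \<in> W" by (simp add: W_def p_simps)
  ultimately show thesis by (rule that)
qed

lemma sphere_atlas_carrier: "atlas_carrier sphere_atlas = unit_sphere"
proof
  show "atlas_carrier sphere_atlas \<subseteq> unit_sphere"
    by (auto simp: atlas_carrier_def sphere_atlas_def submanifold_atlas_def)
  show "unit_sphere \<subseteq> atlas_carrier sphere_atlas"
  proof
    fix x assume x: "x \<in> unit_sphere"
    then obtain E W \<theta> where "(E, W \<inter> unit_sphere, \<theta>) \<in> sphere_atlas" "x \<in> W"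
      using sphere_chart_exists[of x] by (auto simp: unit_sphere_def)
    then show "x \<in> atlas_carrier sphere_atlas" using x unfolding atlas_carrier_def by blast
  qed
qed

lemma sphere_atlasE:
  assumes "(E, U, \<phi>) \<in> sphere_atlas"
  obtains W where "U = W \<inter> unit_sphere" "subspace E" "inj_on \<phi> W" "smooth_on UNIV W \<phi>"
    "smooth_on UNIV (\<phi> ` W) (inv_into W \<phi>)" "\<phi> ` U = \<phi> ` W \<inter> E" "open W"
  using assms smooth_on_openin[of UNIV _ \<phi>]
  unfolding sphere_atlas_def submanifold_atlas_def by (auto simp flip: open_openin)

lemma inv_into_subset_eq:
  assumes "inj_on f A" "B \<subseteq> A" "y \<in> f ` B"
  shows "inv_into B f y = inv_into A f y"
proof -
  obtain b where b: "b \<in> B" "y = f b" using assms(3) by blast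
  then show ?thesis using assms inj_on_subset[OF assms(1,2)] by (auto simp: inv_into_f_f)
qed

lemma sphere_chart_regular:
  assumes "(E, U, \<phi>) \<in> sphere_atlas"
  shows "regular_chart unit_sphere (E, U, \<phi>)"
proof -
  obtain W where W: "U = W \<inter> unit_sphere" "subspace E" "inj_on \<phi> W" "smooth_on UNIV W \<phi>"
    "smooth_on UNIV (\<phi> ` W) (inv_into W \<phi>)" "\<phi> ` U = \<phi> ` W \<inter> E" "open W"
    by (rule sphere_atlasE[OF assms])
  have "open (\<phi> ` W)" using smooth_on_openin[OF W(5)] by (simp flip: open_openin)
  then have "openin (top_of_set E) (\<phi> ` U)" unfolding W(6) by (simp add: openin_open_Int Int_commute)
  moreover have "continuous_on (\<phi> ` U) (inv_into W \<phi>)"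
    by (rule continuous_on_subset[OF smooth_on_imp_continuous_on[OF W(5) subspace_UNIV]]) (simp add: W(6))
  then have "continuous_on (\<phi> ` U) (inv_into U \<phi>)"
    by (rule continuous_on_eq) (rule inv_into_subset_eq[OF W(3), symmetric], auto simp: W(1))
  ultimately show ?thesis
    using W(1,2,3) by (auto simp: regular_chart_def intro: inj_on_subset)
qed

lemma product_atlas_carrier: "atlas_carrier (product_atlas \<A> \<B>) = atlas_carrier \<A> \<times> atlas_carrier \<B>"
proof (intro equalityI subsetI)
  fix x assume "x \<in> atlas_carrier (product_atlas \<A> \<B>)"
  then show "x \<in> atlas_carrier \<A> \<times> atlas_carrier \<B>"
    by (auto simp: atlas_carrier_def product_atlas_def)
next
  fix x assume "x \<in> atlas_carrier \<A> \<times> atlas_carrier \<B>"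
  then obtain E U \<phi> F V \<psi> where *: "(E, U, \<phi>) \<in> \<A>" "(F, V, \<psi>) \<in> \<B>" "x \<in> U \<times> V"
    by (auto simp: atlas_carrier_def)
  then have "(E \<times> F, U \<times> V, map_prod \<phi> \<psi>) \<in> product_atlas \<A> \<B>" unfolding product_atlas_def by blast
  with *(3) show "x \<in> atlas_carrier (product_atlas \<A> \<B>)" unfolding atlas_carrier_def by blast
qed

text \<open>The domain is cut out of the unitaries by open conditions on
  \<open>V o\<^sub>L h\<close> and its logarithm; skew-adjointness of the logarithm is automatic for
  unitaries. Openness is used to pull target charts back along a continuous map.\<close>

lemma unitary_chart_open:
  fixes g :: "'h::complex_hilbert \<Rightarrow>\<^sub>L 'h"
  assumes g: "g \<in> unitaries"
  shows "openin (top_of_set unitaries) ((\<lambda>X. blinfun_exp X o\<^sub>L g) ` {X \<in> skew_adjoints. norm X < ln 2})"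
proof -
  obtain h where h: "h \<in> unitaries" "h o\<^sub>L g = id_blinfun" "g o\<^sub>L h = id_blinfun" by (rule unitary_inverse[OF g])
  define S where "S = {V :: 'h \<Rightarrow>\<^sub>L 'h. norm (V - id_blinfun) < 1} \<inter> blinfun_log -` {K. norm K < ln 2}"
  have "open {V :: 'h \<Rightarrow>\<^sub>L 'h. norm (V - id_blinfun) < 1}"
    using smooth_on_openin[OF smooth_on_blinfun_log] by (simp flip: open_openin)
  then have S: "open S"
    unfolding S_def
    by (intro continuous_open_preimage smooth_on_imp_continuous_on[OF smooth_on_blinfun_log subspace_UNIV])
      (simp_all add: open_Collect_less continuous_on_norm_id)
  have "(\<lambda>X. blinfun_exp X o\<^sub>L g) ` {X \<in> skew_adjoints. norm X < ln 2} = unitaries \<inter> {V. V o\<^sub>L h \<in> S}"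
  proof (intro equalityI subsetI)
    fix V assume "V \<in> (\<lambda>X. blinfun_exp X o\<^sub>L g) ` {X \<in> skew_adjoints. norm X < ln 2}"
    then obtain X where X: "X \<in> skew_adjoints" "norm X < ln 2" "V = blinfun_exp X o\<^sub>L g" by auto
    have "V o\<^sub>L h = blinfun_exp X" by (simp add: X(3) compose_assoc h)
    then show "V \<in> unitaries \<inter> {V. V o\<^sub>L h \<in> S}"
      using X g norm_blinfun_exp_diff_id_less[OF X(2)]
      by (auto simp: S_def blinfun_log_exp intro: unitary_compose exp_skew_adjoint_unitary)
  next
    fix V assume V: "V \<in> unitaries \<inter> {V. V o\<^sub>L h \<in> S}"
    then have 1: "norm ((V o\<^sub>L h) - id_blinfun) < 1" and 2: "norm (blinfun_log (V o\<^sub>L h)) < ln 2" by (auto simp: S_def)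
    have "blinfun_log (V o\<^sub>L h) \<in> skew_adjoints"
      using V h by (intro log_unitary_skew_adjoint 1 2 unitary_compose) auto
    moreover have "V = blinfun_exp (blinfun_log (V o\<^sub>L h)) o\<^sub>L g" by (simp add: blinfun_exp_log[OF 1] compose_assoc h)
    ultimately show "V \<in> (\<lambda>X. blinfun_exp X o\<^sub>L g) ` {X \<in> skew_adjoints. norm X < ln 2}" using 2 by blast
  qed
  moreover have "open ((\<lambda>V. V o\<^sub>L h) -` S)"
    by (intro open_vimage S linear_continuous_on bounded_bilinear.bounded_linear_left[OF bounded_bilinear_blinfun_compose])
  then have "open {V. V o\<^sub>L h \<in> S}" by (simp add: vimage_def)
  ultimately show ?thesis by (simp add: openin_open_Int)
qed

section \<open>Smoothness of the section and of the unitary\<close>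

text \<open>Continuity of \<open>f\<close>, openness of the target charts and regularity of the
  source charts make the domain of every local expression open; only smoothness remains, with this
  openness at hand.\<close>

lemma smooth_mapI:
  assumes regular: "\<And>c. c \<in> \<A> \<Longrightarrow> regular_chart (atlas_carrier \<A>) c"
    and W: "openin (top_of_set (atlas_carrier \<A>)) W"
    and f: "f ` W \<subseteq> atlas_carrier \<B>" "continuous_on W f"
    and charts: "\<And>F V \<psi>. (F, V, \<psi>) \<in> \<B> \<Longrightarrow> openin (top_of_set (atlas_carrier \<B>)) V"
    and smooth: "\<And>E U \<phi> F V \<psi>. (E, U, \<phi>) \<in> \<A> \<Longrightarrow> (F, V, \<psi>) \<in> \<B> \<Longrightarrow>
      openin (top_of_set E) (\<phi> ` (W \<inter> U \<inter> f -` V)) \<Longrightarrow>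
      smooth_on E (\<phi> ` (W \<inter> U \<inter> f -` V)) (\<lambda>e. \<psi> (f (inv_into U \<phi> e)))"
  shows "smooth_map \<A> \<B> W f"
proof -
  have "smooth_on E (\<phi> ` (W \<inter> U \<inter> f -` V)) (\<lambda>e. \<psi> (f (inv_into U \<phi> e)))"
    if A: "(E, U, \<phi>) \<in> \<A>" and B: "(F, V, \<psi>) \<in> \<B>" for E U \<phi> F V \<psi>
  proof (rule smooth[OF A B])
    have "openin (top_of_set W) (W \<inter> f -` V)"
      by (rule continuous_openin_preimage[OF f(2) _ charts[OF B]]) (use f(1) in auto)
    then have "openin (top_of_set (atlas_carrier \<A>)) (W \<inter> f -` V)" using W by (rule openin_trans)
    from regular_chart_image_open[OF regular[OF A] this]
    show "openin (top_of_set E) (\<phi> ` (W \<inter> U \<inter> f -` V))" by (simp add: Int_ac)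
  qed
  then show ?thesis unfolding smooth_map_def using W f by auto
qed

text \<open>The inverse modulus is the power \<open>-1/2\<close> of the quadratic
  \<open>z \<bullet> z\<close>, which is positive off zero.\<close>

lemma smooth_on_phase: "smooth_on UNIV {z. z \<noteq> 0} phase"
proof -
  note U = subspace_UNIV
  have o: "openin (top_of_set UNIV) {z::complex. z \<noteq> 0}"
    by (simp add: open_Collect_neq continuous_intros flip: open_openin)
  have "smooth_on UNIV {z::complex. z \<noteq> 0} (\<lambda>z. z \<bullet> z)"
    by (intro smooth_on_bilinear_compose[OF bounded_bilinear_inner] smooth_on_bounded_linear[OF bounded_linear_ident] U o)
  then have "smooth_on UNIV {z::complex. z \<noteq> 0} (\<lambda>z. (z \<bullet> z) powr (- 1/2))"
    by (rule smooth_on_compose[OF U _ smooth_on_powr]) auto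
  then have "smooth_on UNIV {z. z \<noteq> 0} (\<lambda>z. (z \<bullet> z) powr (- 1/2) *\<^sub>R cnj z)"
    by (intro smooth_on_bilinear_compose[OF bounded_bilinear_scaleR] smooth_on_bounded_linear[OF bounded_linear_cnj] U o)
  then show ?thesis
  proof (rule smooth_on_cong)
    fix z :: complex
    have "(z \<bullet> z) powr (- 1/2) = inverse (sqrt (z \<bullet> z))"
      using powr_minus[of "z \<bullet> z" "1/2"] powr_half_sqrt[OF inner_ge_zero[of z]] by (simp del: inner_complex_def)
    also have "sqrt (z \<bullet> z) = cmod z" by (rule norm_eq_sqrt_inner[symmetric])
    finally show "(z \<bullet> z) powr (- 1/2) *\<^sub>R cnj z = phase z"
      by (simp only: phase_def scaleR_conv_of_real divide_inverse of_real_inverse mult.commute)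
  qed
qed

context irreducible_pair
begin

abbreviation "triple_manifold \<equiv> (automorphisms :: ('b \<Rightarrow>\<^sub>L 'b) set) \<times> (unit_sphere :: 'h set) \<times> (unit_sphere :: 'h set)"

section \<open>The domain, continuity and local expressions\<close>

text \<open>Pushed vector states are always pure, so membership reduces to the norm condition, and
  the difference of the two states is Lipschitz in the triple.\<close>

lemma triple_domain_open: "openin (top_of_set triple_manifold) (triple_domain \<pi> \<pi>')"
proof -
  define s where "s = (\<lambda>(\<alpha>, \<Omega>, \<Psi>). push_state \<alpha> (vector_state \<pi> \<Omega>) - vector_state \<pi>' \<Psi>)"
  have vs: "norm (vector_state \<rho> x - vector_state \<rho> y) \<le> 2 * norm (x - y)"
    if r: "star_representation \<rho>" and xy: "norm x = 1" "norm y = 1" for \<rho> :: "'b \<Rightarrow> ('h \<Rightarrow>\<^sub>L 'h)" and x y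
  proof (rule norm_blinfun_bound)
    interpret r: star_representation \<rho> by fact
    fix B
    have "(vector_state \<rho> x - vector_state \<rho> y) B = cinner (x - y) (\<rho> B x) + cinner y (\<rho> B (x - y))"
      by (simp add: blinfun.diff_left blinfun.diff_right r.vector_state_apply cinner_simps)
    then have "cmod ((vector_state \<rho> x - vector_state \<rho> y) B) \<le> norm (x - y) * norm (\<rho> B x) + norm y * norm (\<rho> B (x - y))"
      by (auto intro: order_trans[OF norm_triangle_ineq add_mono] norm_cinner)
    also have "\<dots> \<le> norm (x - y) * norm B + norm B * norm (x - y)"
      using r.norm_apply_le[of B x] r.norm_apply_le[of B "x - y"] xy by (intro add_mono mult_left_mono) auto
    finally show "norm ((vector_state \<rho> x - vector_state \<rho> y) B) \<le> 2 * norm (x - y) * norm B" by (simp add: mult_ac)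
  qed simp
  \<comment> \<open>\<open>5 = 1 + 2 + 2\<close>: one for \<open>\<alpha>\<close> and two for each
    of the unit vectors.\<close>
  have "dist (s x) (s y) \<le> 5 * dist x y" if x_mem: "x \<in> triple_manifold" and y_mem: "y \<in> triple_manifold" for x y
  proof -
    obtain \<alpha> \<Omega> \<Psi> where x: "x = (\<alpha>, \<Omega>, \<Psi>)" "\<alpha> \<in> automorphisms" "norm \<Omega> = 1" "norm \<Psi> = 1"
      using x_mem by (auto simp: unit_sphere_def)
    obtain \<alpha>' \<Omega>' \<Psi>' where y: "y = (\<alpha>', \<Omega>', \<Psi>')" "\<alpha>' \<in> automorphisms" "norm \<Omega>' = 1" "norm \<Psi>' = 1"
      using y_mem by (auto simp: unit_sphere_def)
    obtain \<beta> where \<beta>: "\<beta> \<in> automorphisms" "\<forall>B. \<alpha> (\<beta> B) = B" "\<forall>B. \<beta> (\<alpha> B) = B" "blinfun_apply \<beta> = inv (blinfun_apply \<alpha>)"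
      by (rule automorphism_inverse[OF x(2)])
    obtain \<beta>' where \<beta>': "\<beta>' \<in> automorphisms" "\<forall>B. \<alpha>' (\<beta>' B) = B" "\<forall>B. \<beta>' (\<alpha>' B) = B" "blinfun_apply \<beta>' = inv (blinfun_apply \<alpha>')"
      by (rule automorphism_inverse[OF y(2)])
    interpret r: irreducible_star_representation "\<lambda>B. \<pi> (\<beta> B)"
      by (rule irreducible_star_representation_automorphism[OF p.irreducible_star_representation_axioms \<beta>(1)])
    interpret r': irreducible_star_representation "\<lambda>B. \<pi> (\<beta>' B)"
      by (rule irreducible_star_representation_automorphism[OF p.irreducible_star_representation_axioms \<beta>'(1)])
    have "norm (vector_state (\<lambda>B. \<pi> (\<beta> B)) \<Omega> - vector_state (\<lambda>B. \<pi> (\<beta>' B)) \<Omega>) \<le> norm (\<alpha> - \<alpha>')"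
    proof (rule norm_blinfun_bound)
      fix B
      have "(vector_state (\<lambda>B. \<pi> (\<beta> B)) \<Omega> - vector_state (\<lambda>B. \<pi> (\<beta>' B)) \<Omega>) B = cinner \<Omega> (\<pi> (\<beta> B - \<beta>' B) \<Omega>)"
        by (simp add: blinfun.diff_left r.vector_state_apply r'.vector_state_apply p.diff cinner_simps)
      also have "cmod \<dots> \<le> norm \<Omega> * norm (\<pi> (\<beta> B - \<beta>' B) \<Omega>)" by (rule norm_cinner)
      also have "\<dots> \<le> norm (\<beta> B - \<beta>' B)" using p.norm_apply_le[of "\<beta> B - \<beta>' B" \<Omega>] x(3) by simp
      also have "\<dots> \<le> norm (\<alpha> - \<alpha>') * norm B"
        by (rule norm_automorphism_inverse_diff[OF x(2) y(2)]) (simp_all add: \<beta>(2) \<beta>'(2,3))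
      finally show "norm ((vector_state (\<lambda>B. \<pi> (\<beta> B)) \<Omega> - vector_state (\<lambda>B. \<pi> (\<beta>' B)) \<Omega>) B) \<le> norm (\<alpha> - \<alpha>') * norm B" .
    qed simp
    moreover have "norm (vector_state (\<lambda>B. \<pi> (\<beta>' B)) \<Omega> - vector_state (\<lambda>B. \<pi> (\<beta>' B)) \<Omega>') \<le> 2 * norm (\<Omega> - \<Omega>')"
      by (rule vs[OF r'.star_representation_axioms x(3) y(3)])
    moreover have "norm (vector_state \<pi>' \<Psi> - vector_state \<pi>' \<Psi>') \<le> 2 * norm (\<Psi> - \<Psi>')"
      by (rule vs[OF p'.star_representation_axioms x(4) y(4)])
    moreover have "s x - s y = ((vector_state (\<lambda>B. \<pi> (\<beta> B)) \<Omega> - vector_state (\<lambda>B. \<pi> (\<beta>' B)) \<Omega>)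
        + (vector_state (\<lambda>B. \<pi> (\<beta>' B)) \<Omega> - vector_state (\<lambda>B. \<pi> (\<beta>' B)) \<Omega>')) - (vector_state \<pi>' \<Psi> - vector_state \<pi>' \<Psi>')"
      by (simp add: s_def x(1) y(1) push_vector_state[OF p.star_representation_axioms \<beta>(4)]
          push_vector_state[OF p.star_representation_axioms \<beta>'(4)])
    then have "norm (s x - s y) \<le> (norm (vector_state (\<lambda>B. \<pi> (\<beta> B)) \<Omega> - vector_state (\<lambda>B. \<pi> (\<beta>' B)) \<Omega>)
        + norm (vector_state (\<lambda>B. \<pi> (\<beta>' B)) \<Omega> - vector_state (\<lambda>B. \<pi> (\<beta>' B)) \<Omega>')) + norm (vector_state \<pi>' \<Psi> - vector_state \<pi>' \<Psi>')"
      by (simp only: order_trans[OF norm_triangle_ineq4 add_right_mono[OF norm_triangle_ineq]])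
    ultimately have "norm (s x - s y) \<le> norm (\<alpha> - \<alpha>') + 2 * norm (\<Omega> - \<Omega>') + 2 * norm (\<Psi> - \<Psi>')" by linarith
    moreover have "norm (\<alpha> - \<alpha>') \<le> dist x y" "norm (\<Omega> - \<Omega>') \<le> dist x y" "norm (\<Psi> - \<Psi>') \<le> dist x y"
      using norm_fst_le[of "\<alpha> - \<alpha>'" "(\<Omega>, \<Psi>) - (\<Omega>', \<Psi>')"] norm_snd_le[of "(\<Omega>, \<Psi>) - (\<Omega>', \<Psi>')" "\<alpha> - \<alpha>'"]
        norm_fst_le[of "\<Omega> - \<Omega>'" "\<Psi> - \<Psi>'"] norm_snd_le[of "\<Psi> - \<Psi>'" "\<Omega> - \<Omega>'"]
      by (auto simp: x(1) y(1) dist_norm)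
    ultimately show ?thesis by (simp add: dist_norm)
  qed
  then have "5-lipschitz_on triple_manifold s" by (intro lipschitz_onI) auto
  then have cont: "continuous_on triple_manifold s" by (rule lipschitz_on_continuous_on)
  have "triple_domain \<pi> \<pi>' = triple_manifold \<inter> s -` {w. norm w < 2}"
  proof -
    have "push_state \<alpha> (vector_state \<pi> \<Omega>) \<in> pure_states" if \<alpha>: "\<alpha> \<in> automorphisms" and \<Omega>: "norm \<Omega> = 1" for \<alpha> \<Omega>
    proof -
      obtain \<beta> where \<beta>: "\<beta> \<in> automorphisms" "\<forall>B. \<alpha> (\<beta> B) = B" "\<forall>B. \<beta> (\<alpha> B) = B" "blinfun_apply \<beta> = inv (blinfun_apply \<alpha>)"
        by (rule automorphism_inverse[OF \<alpha>])
      interpret r: irreducible_star_representation "\<lambda>B. \<pi> (\<beta> B)"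
        by (rule irreducible_star_representation_automorphism[OF p.irreducible_star_representation_axioms \<beta>(1)])
      show ?thesis
        unfolding push_vector_state[OF p.star_representation_axioms \<beta>(4)] by (rule r.vector_state_pure[OF \<Omega>])
    qed
    then show ?thesis by (auto simp: triple_domain_def ball2_def s_def unit_sphere_def)
  qed
  moreover have "openin (top_of_set triple_manifold) (triple_manifold \<inter> s -` {w. norm w < 2})"
    by (intro continuous_openin_preimage_gen cont open_Collect_less continuous_intros)
  ultimately show ?thesis by simp
qed

text \<open>\<open>V\<close> ranges over all bounded operators, so that calculus in the full
  operator space applies; the condition is the one under which the phase is smooth.\<close>

definition transversal :: "(('h \<Rightarrow>\<^sub>L 'h) \<times> 'h \<times> 'h) set" where
  "transversal = {(V, \<Omega>, \<Psi>). cinner \<Psi> (blinfun_apply V \<Omega>) \<noteq> 0}"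

lemma mem_transversal [simp]: "(V, \<Omega>, \<Psi>) \<in> transversal \<longleftrightarrow> cinner \<Psi> (V \<Omega>) \<noteq> 0"
  by (simp add: transversal_def)

text \<open>Near \<open>\<alpha>\<close> write
  \<open>\<alpha>' = (\<alpha>' \<alpha>^-1) \<alpha>\<close>. The first factor is close to the
  identity and has an implementer \<open>W\<close> close to the identity, so \<open>W V\<close> is
  an implementer of \<open>\<alpha>'\<close> close to \<open>V\<close>. Continuity on the manifold
  itself is a separate requirement of \<open>smooth_map\<close>.\<close>

lemma continuous_on_via_implementer:
  fixes F :: "('h \<Rightarrow>\<^sub>L 'h) \<times> 'h \<times> 'h \<Rightarrow> 'z::metric_space"
  assumes F: "continuous_on transversal F"
    and f: "\<And>\<alpha> \<Omega> \<Psi> V. (\<alpha>, \<Omega>, \<Psi>) \<in> triple_domain \<pi> \<pi>' \<Longrightarrow> implements \<pi> \<pi>' V \<alpha> \<Longrightarrow> f (\<alpha>, \<Omega>, \<Psi>) = F (V, \<Omega>, \<Psi>)"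
  shows "continuous_on (triple_domain \<pi> \<pi>') f"
  unfolding continuous_on_iff
proof (intro ballI allI impI)
  fix x and e :: real assume x: "x \<in> triple_domain \<pi> \<pi>'" and e: "0 < e"
  obtain \<alpha> \<Omega> \<Psi> where xe: "x = (\<alpha>, \<Omega>, \<Psi>)" by (metis prod.collapse)
  note O = x[unfolded xe]
  obtain V where V: "implements \<pi> \<pi>' V \<alpha>" "cinner \<Psi> (V \<Omega>) \<noteq> 0" by (rule triple_domain_implementer[OF O])
  have \<alpha>: "\<alpha> \<in> automorphisms" using O by (simp add: triple_domain_def)
  have mem: "(V, \<Omega>, \<Psi>) \<in> transversal" using V(2) by simp
  obtain d where d: "0 < d" "\<And>y. y \<in> transversal \<Longrightarrow> dist y (V, \<Omega>, \<Psi>) < d \<Longrightarrow> dist (F y) (F (V, \<Omega>, \<Psi>)) < e"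
    using F[unfolded continuous_on_iff, THEN bspec, OF mem, THEN spec, THEN mp, OF e] by blast
  obtain r where r: "0 < r" "\<And>\<gamma>. \<gamma> \<in> automorphisms \<Longrightarrow> norm (\<gamma> - id_blinfun) < r \<Longrightarrow>
      \<exists>W. implements \<pi>' \<pi>' W \<gamma> \<and> norm (W - id_blinfun) < d / 2"
    by (rule p'.near_identity_implemented[of "d / 2"]) (use d in auto)
  obtain \<beta> where \<beta>: "\<beta> \<in> automorphisms" "\<forall>B. \<alpha> (\<beta> B) = B" "\<forall>B. \<beta> (\<alpha> B) = B" "blinfun_apply \<beta> = inv (blinfun_apply \<alpha>)"
    by (rule automorphism_inverse[OF \<alpha>])
  show "\<exists>d>0. \<forall>x'\<in>triple_domain \<pi> \<pi>'. dist x' x < d \<longrightarrow> dist (f x') (f x) < e"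
  proof (intro exI[of _ "min r (d / 2)"] conjI ballI impI)
    show "0 < min r (d / 2)" using r d by simp
    fix y assume y: "y \<in> triple_domain \<pi> \<pi>'" and dy: "dist y x < min r (d / 2)"
    obtain \<alpha>' \<Omega>' \<Psi>' where ye: "y = (\<alpha>', \<Omega>', \<Psi>')" by (metis prod.collapse)
    note O' = y[unfolded ye]
    have \<alpha>': "\<alpha>' \<in> automorphisms" using O' by (simp add: triple_domain_def)
    have d1: "norm (\<alpha>' - \<alpha>) \<le> dist y x" and d2: "dist (\<Omega>', \<Psi>') (\<Omega>, \<Psi>) \<le> dist y x"
      using norm_fst_le[of "\<alpha>' - \<alpha>" "(\<Omega>', \<Psi>') - (\<Omega>, \<Psi>)"] norm_snd_le[of "(\<Omega>', \<Psi>') - (\<Omega>, \<Psi>)" "\<alpha>' - \<alpha>"]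
      by (auto simp: xe ye dist_norm)
    have "norm ((\<alpha>' o\<^sub>L \<beta>) - id_blinfun) \<le> norm (\<alpha>' - \<alpha>)"
    proof (rule norm_blinfun_bound)
      fix B
      have "((\<alpha>' o\<^sub>L \<beta>) - id_blinfun) B = (\<alpha>' - \<alpha>) (\<beta> B)" by (simp add: blinfun.diff_left \<beta>(2))
      then show "norm (((\<alpha>' o\<^sub>L \<beta>) - id_blinfun) B) \<le> norm (\<alpha>' - \<alpha>) * norm B"
        using norm_blinfun[of "\<alpha>' - \<alpha>" "\<beta> B"] automorphism_norm[OF \<beta>(1), of B] by simp
    qed simp
    then have "norm ((\<alpha>' o\<^sub>L \<beta>) - id_blinfun) < r" using d1 dy by simp
    then obtain W where W: "implements \<pi>' \<pi>' W (\<alpha>' o\<^sub>L \<beta>)" "norm (W - id_blinfun) < d / 2"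
      using r(2) automorphism_compose[OF \<alpha>' \<beta>(1)] by blast
    have "(\<alpha>' o\<^sub>L \<beta>) o\<^sub>L \<alpha> = \<alpha>'" by (rule blinfun_eqI) (simp add: \<beta>(3))
    then have WV: "implements \<pi> \<pi>' (W o\<^sub>L V) \<alpha>'" using implements_compose[OF W(1) V(1)] by simp
    have nz: "cinner \<Psi>' ((W o\<^sub>L V) \<Omega>') \<noteq> 0" by (rule section_map_formula(1)[OF O' WV])
    have "norm ((W o\<^sub>L V) - V) \<le> norm (W - id_blinfun)"
    proof (rule norm_blinfun_bound)
      fix v
      have "((W o\<^sub>L V) - V) v = (W - id_blinfun) (V v)" by (simp add: blinfun.diff_left)
      then show "norm (((W o\<^sub>L V) - V) v) \<le> norm (W - id_blinfun) * norm v"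
        using norm_blinfun[of "W - id_blinfun" "V v"] V(1) by (simp add: implements_def unitary_norm)
    qed simp
    then have "dist (W o\<^sub>L V, \<Omega>', \<Psi>') (V, \<Omega>, \<Psi>) < d / 2 + d / 2"
      using norm_Pair_le[of "(W o\<^sub>L V) - V" "(\<Omega>', \<Psi>') - (\<Omega>, \<Psi>)"] W(2) d2 dy
      by (simp add: dist_norm)
    then show "dist (f y) (f x) < e"
      using d(2)[of "(W o\<^sub>L V, \<Omega>', \<Psi>')"] nz f[OF O' WV] f[OF O V(1)] by (simp add: xe ye)
  qed
qed

lemma product_chart:
  assumes "c \<in> product_atlas aut_atlas (product_atlas sphere_atlas sphere_atlas)"
  shows "regular_chart triple_manifold c"
proof -
  obtain L U \<phi> E1 U1 \<phi>1 E2 U2 \<phi>2 where c: "c = (L \<times> (E1 \<times> E2), U \<times> (U1 \<times> U2), map_prod \<phi> (map_prod \<phi>1 \<phi>2))"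
    "(L, U, \<phi>) \<in> aut_atlas" "(E1, U1, \<phi>1) \<in> sphere_atlas" "(E2, U2, \<phi>2) \<in> sphere_atlas"
    using assms unfolding product_atlas_def by blast
  obtain g where g: "g \<in> automorphisms" "L = symmetric_derivations"
    "U = (\<lambda>X. blinfun_exp X o\<^sub>L g) ` {X \<in> L. norm X < ln 2}"
    "\<phi> = inv_into {X \<in> L. norm X < ln 2} (\<lambda>X. blinfun_exp X o\<^sub>L g)"
    using c(2) unfolding aut_atlas_def exp_atlas_def by blast
  have "regular_chart automorphisms (L, U, \<phi>)"
    unfolding g(2-4)
    by (intro exp_chart_regular subspace_symmetric_derivations g(1) surj_automorphism automorphism_compose exp_derivation_automorphism)
  then show ?thesis unfolding c(1) by (intro regular_chart_product sphere_chart_regular c(3,4))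
qed

text \<open>Stated for any \<open>F\<close>, so that the section and the unitary are treated by one
  argument. The sphere variables enter through inverse charts extended to open sets of the Hilbert
  space.\<close>

lemma smooth_in_charts:
  fixes f :: "('b \<Rightarrow>\<^sub>L 'b) \<times> 'h \<times> 'h \<Rightarrow> 'z::real_normed_vector"
  assumes c: "(E, U, \<phi>) \<in> product_atlas aut_atlas (product_atlas sphere_atlas sphere_atlas)"
    and Z: "Z \<subseteq> triple_domain \<pi> \<pi>' \<inter> U" "openin (top_of_set E) (\<phi> ` Z)"
    and F: "smooth_on UNIV transversal F"
    and f: "\<And>\<alpha> \<Omega> \<Psi> V. (\<alpha>, \<Omega>, \<Psi>) \<in> triple_domain \<pi> \<pi>' \<Longrightarrow> implements \<pi> \<pi>' V \<alpha> \<Longrightarrow> f (\<alpha>, \<Omega>, \<Psi>) = F (V, \<Omega>, \<Psi>)"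
  shows "smooth_on E (\<phi> ` Z) (\<lambda>e. f (inv_into U \<phi> e))"
proof (cases "Z = {}")
  case True
  then show ?thesis by (simp add: smooth_on_empty)
next
  case False
  define L where "L = (symmetric_derivations :: ('b \<Rightarrow>\<^sub>L 'b) set)"
  have L: "subspace L" unfolding L_def by (rule subspace_symmetric_derivations)
  obtain L' U0 \<phi>0 E1 U1 \<phi>1 E2 U2 \<phi>2 where c': "E = L' \<times> (E1 \<times> E2)" "U = U0 \<times> (U1 \<times> U2)" "\<phi> = map_prod \<phi>0 (map_prod \<phi>1 \<phi>2)"
    "(L', U0, \<phi>0) \<in> aut_atlas" "(E1, U1, \<phi>1) \<in> sphere_atlas" "(E2, U2, \<phi>2) \<in> sphere_atlas"
    using c unfolding product_atlas_def by blast
  define B where "B = {X \<in> L. norm X < ln 2}"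
  obtain g where g: "g \<in> automorphisms" "L' = L" "U0 = (\<lambda>X. blinfun_exp X o\<^sub>L g) ` B" "\<phi>0 = inv_into B (\<lambda>X. blinfun_exp X o\<^sub>L g)"
    using c'(4) unfolding aut_atlas_def exp_atlas_def B_def L_def by blast
  define h where "h X = blinfun_exp X o\<^sub>L g" for X
  have injh: "inj_on h B" unfolding h_def[abs_def] B_def by (rule exp_chart_inj[OF surj_automorphism[OF g(1)]])
  have U0: "U0 = h ` B" and \<phi>0: "\<phi>0 = inv_into B h" using g by (simp_all add: h_def[abs_def])
  obtain W1 where W1: "U1 = W1 \<inter> unit_sphere" "subspace E1" "inj_on \<phi>1 W1" "smooth_on UNIV W1 \<phi>1"
    "smooth_on UNIV (\<phi>1 ` W1) (inv_into W1 \<phi>1)" "\<phi>1 ` U1 = \<phi>1 ` W1 \<inter> E1" "open W1" by (rule sphere_atlasE[OF c'(5)])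
  obtain W2 where W2: "U2 = W2 \<inter> unit_sphere" "subspace E2" "inj_on \<phi>2 W2" "smooth_on UNIV W2 \<phi>2"
    "smooth_on UNIV (\<phi>2 ` W2) (inv_into W2 \<phi>2)" "\<phi>2 ` U2 = \<phi>2 ` W2 \<inter> E2" "open W2" by (rule sphere_atlasE[OF c'(6)])
  have E: "subspace E" unfolding c'(1) g(2) by (intro subspace_Times L W1(2) W2(2))
  have inj: "inj_on \<phi>0 U0" "inj_on \<phi>1 U1" "inj_on \<phi>2 U2"
    using inverse_chart(2)[OF injh] W1(1,3) W2(1,3) by (auto simp: U0 \<phi>0 intro: inj_on_subset)
  have point: "\<exists>X \<Omega> \<Psi>. e = (X, \<phi>1 \<Omega>, \<phi>2 \<Psi>) \<and> X \<in> B \<and> \<Omega> \<in> W1 \<and> \<Psi> \<in> W2 \<and> (h X, \<Omega>, \<Psi>) \<in> triple_domain \<pi> \<pi>'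
      \<and> inv_into U \<phi> e = (h X, \<Omega>, \<Psi>)" if e_mem: "e \<in> \<phi> ` Z" for e
  proof -
    obtain \<alpha> \<Omega> \<Psi> where z: "(\<alpha>, \<Omega>, \<Psi>) \<in> Z" "e = \<phi> (\<alpha>, \<Omega>, \<Psi>)" using e_mem by (metis imageE prod.collapse)
    then have mem: "\<alpha> \<in> U0" "\<Omega> \<in> U1" "\<Psi> \<in> U2" and O: "(\<alpha>, \<Omega>, \<Psi>) \<in> triple_domain \<pi> \<pi>'" using Z(1) by (auto simp: c'(2))
    obtain X where X: "X \<in> B" "\<alpha> = h X" using mem(1) by (auto simp: U0)
    have "\<phi>0 \<alpha> = X" using X injh by (simp add: \<phi>0 inv_into_f_f)
    moreover have "inj_on (map_prod \<phi>1 \<phi>2) (U1 \<times> U2)" using inj by (auto simp: inj_on_def)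
    then have "inv_into U \<phi> e = (\<alpha>, \<Omega>, \<Psi>)"
      using product_inv_into[OF inj(1) _ mem(1), of "map_prod \<phi>1 \<phi>2" "U1 \<times> U2" "(\<Omega>, \<Psi>)"] mem by (simp add: z(2) c'(2,3))
    ultimately show ?thesis using X O mem W1(1) W2(1) by (auto simp: z(2) c'(3))
  qed
  obtain k K where K: "0 \<le> k" "\<And>\<delta>. \<delta> \<in> L \<Longrightarrow> p'.spatial \<delta> (K \<delta>)" "\<And>\<delta>. \<delta> \<in> L \<Longrightarrow> norm (K \<delta>) \<le> k * norm \<delta>"
    "\<And>\<delta> \<epsilon>. \<delta> \<in> L \<Longrightarrow> \<epsilon> \<in> L \<Longrightarrow> K (\<delta> + \<epsilon>) = K \<delta> + K \<epsilon>" "\<And>r \<delta>. \<delta> \<in> L \<Longrightarrow> K (r *\<^sub>R \<delta>) = r *\<^sub>R K \<delta>"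
    unfolding L_def by (rule p'.spatial_selection) blast
  \<comment> \<open>The centre \<open>g\<close> need not occur in the domain. An implementer exists
    for some \<open>h X\<close> that does occur, and \<open>exp (- K X)\<close> carries it back to
    \<open>g\<close>.\<close>
  obtain V where V: "implements \<pi> \<pi>' V g"
  proof -
    obtain e where "e \<in> \<phi> ` Z" using False by blast
    then obtain X \<Omega> \<Psi> where X: "X \<in> B" "(h X, \<Omega>, \<Psi>) \<in> triple_domain \<pi> \<pi>'" using point by blast
    obtain T where T: "implements \<pi> \<pi>' T (h X)" using triple_domain_implementer[OF X(2)] by blast
    have "p'.spatial ((-1) *\<^sub>R X) ((-1) *\<^sub>R K X)" using K(2)[of X] X(1) by (intro p'.spatial_scaleR) (simp add: B_def)
    then have "implements \<pi>' \<pi>' (blinfun_exp ((-1) *\<^sub>R K X)) (blinfun_exp ((-1) *\<^sub>R X))" by (rule p'.spatial_exp_implements)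
    from implements_compose[OF this T]
    have "implements \<pi> \<pi>' (blinfun_exp ((-1) *\<^sub>R K X) o\<^sub>L T) (blinfun_exp (- X) o\<^sub>L (blinfun_exp X o\<^sub>L g))" by (simp add: h_def)
    moreover have "blinfun_exp (- X) o\<^sub>L (blinfun_exp X o\<^sub>L g) = g" by (rule blinfun_eqI) simp
    ultimately show thesis using that by simp
  qed
  have impl: "implements \<pi> \<pi>' (blinfun_exp (K X) o\<^sub>L V) (h X)" if "X \<in> B" for X
    unfolding h_def using that by (intro implements_compose[OF p'.spatial_exp_implements V] K(2)) (simp add: B_def)
  define \<xi> where "\<xi> e = (blinfun_exp (K (fst e)) o\<^sub>L V, inv_into W1 \<phi>1 (fst (snd e)), inv_into W2 \<phi>2 (snd (snd e)))" for e
  have \<xi>: "\<xi> e = (blinfun_exp (K X) o\<^sub>L V, \<Omega>, \<Psi>)" if "e = (X, \<phi>1 \<Omega>, \<phi>2 \<Psi>)" "\<Omega> \<in> W1" "\<Psi> \<in> W2" for e X \<Omega> \<Psi>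
    using that W1(3) W2(3) by (simp add: \<xi>_def inv_into_f_f)
  have "smooth_on E (\<phi> ` Z) (\<lambda>e. K (fst e))"
  proof (rule smooth_on_linear[OF E Z(2), of _ k])
    show "norm (K (fst e)) \<le> k * norm e" if "e \<in> E" for e
    proof -
      have "norm (K (fst e)) \<le> k * norm (fst e)" using that by (intro K(3)) (auto simp: c'(1) g(2))
      also have "\<dots> \<le> k * norm e" using K(1) norm_fst_le[of "fst e" "snd e"] by (intro mult_left_mono) auto
      finally show ?thesis .
    qed
  qed (auto simp: c'(1) g(2) K(4,5))
  then have "smooth_on E (\<phi> ` Z) (\<lambda>e. blinfun_exp (K (fst e)))"
  \<comment> \<open>\<open>k * ln 2\<close> bounds \<open>K\<close> on the chart ball; the extra
    \<open>1\<close> gives the strict inequality.\<close>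
  proof (rule smooth_on_compose[OF E _ smooth_on_blinfun_exp[of "k * ln 2 + 1"]])
    show "(\<lambda>e. K (fst e)) ` \<phi> ` Z \<subseteq> {X. norm X < k * ln 2 + 1}"
    proof (rule image_subsetI)
      fix e assume "e \<in> \<phi> ` Z"
      then obtain X where X: "fst e = X" "X \<in> B" using point by fastforce
      have "norm (K X) \<le> k * norm X" using X(2) by (intro K(3)) (simp add: B_def)
      also have "\<dots> \<le> k * ln 2" using X(2) K(1) by (intro mult_left_mono) (auto simp: B_def)
      finally show "K (fst e) \<in> {X. norm X < k * ln 2 + 1}" by (simp add: X(1))
    qed
  qed
  then have s1: "smooth_on E (\<phi> ` Z) (\<lambda>e. blinfun_exp (K (fst e)) o\<^sub>L V)"
    by (rule smooth_on_linear_compose[OF bounded_bilinear.bounded_linear_left[OF bounded_bilinear_blinfun_compose] E])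
  have s2: "smooth_on E (\<phi> ` Z) (\<lambda>e. inv_into W1 \<phi>1 (fst (snd e)))"
  proof (rule smooth_on_compose[OF E _ W1(5)])
    show "smooth_on E (\<phi> ` Z) (\<lambda>e. fst (snd e))"
      by (intro smooth_on_bounded_linear[OF _ E Z(2)] bounded_linear_compose[OF bounded_linear_fst bounded_linear_snd])
    show "(\<lambda>e. fst (snd e)) ` \<phi> ` Z \<subseteq> \<phi>1 ` W1" using point by fastforce
  qed
  have s3: "smooth_on E (\<phi> ` Z) (\<lambda>e. inv_into W2 \<phi>2 (snd (snd e)))"
  proof (rule smooth_on_compose[OF E _ W2(5)])
    show "smooth_on E (\<phi> ` Z) (\<lambda>e. snd (snd e))"
      by (intro smooth_on_bounded_linear[OF _ E Z(2)] bounded_linear_compose[OF bounded_linear_snd bounded_linear_snd])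
    show "(\<lambda>e. snd (snd e)) ` \<phi> ` Z \<subseteq> \<phi>2 ` W2" using point by fastforce
  qed
  have "smooth_on E (\<phi> ` Z) \<xi>"
    unfolding \<xi>_def[abs_def] by (intro smooth_on_Pair E s1 s2 s3)
  then have "smooth_on E (\<phi> ` Z) (\<lambda>e. F (\<xi> e))"
  proof (rule smooth_on_compose[OF E _ F])
    show "\<xi> ` \<phi> ` Z \<subseteq> transversal"
    proof (rule image_subsetI)
      fix e assume "e \<in> \<phi> ` Z"
      then obtain X \<Omega> \<Psi> where X: "e = (X, \<phi>1 \<Omega>, \<phi>2 \<Psi>)" "X \<in> B" "\<Omega> \<in> W1" "\<Psi> \<in> W2" "(h X, \<Omega>, \<Psi>) \<in> triple_domain \<pi> \<pi>'"
        using point by blast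
      show "\<xi> e \<in> transversal"
        using section_map_formula(1)[OF X(5) impl[OF X(2)]] by (simp add: \<xi>[OF X(1,3,4)])
    qed
  qed
  then show ?thesis
  proof (rule smooth_on_cong)
    fix e assume "e \<in> \<phi> ` Z"
    then obtain X \<Omega> \<Psi> where X: "e = (X, \<phi>1 \<Omega>, \<phi>2 \<Psi>)" "X \<in> B" "\<Omega> \<in> W1" "\<Psi> \<in> W2" "(h X, \<Omega>, \<Psi>) \<in> triple_domain \<pi> \<pi>'"
      "inv_into U \<phi> e = (h X, \<Omega>, \<Psi>)" using point by blast
    show "F (\<xi> e) = f (inv_into U \<phi> e)" unfolding X(6) f[OF X(5) impl[OF X(2)]] \<xi>[OF X(1,3,4)] ..
  qed
qed

definition section_formula :: "('h \<Rightarrow>\<^sub>L 'h) \<times> 'h \<times> 'h \<Rightarrow> 'h" where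
  "section_formula = (\<lambda>(V, \<Omega>, \<Psi>). phase (cinner \<Psi> (blinfun_apply V \<Omega>)) *\<^sub>C V \<Omega>)"

definition unitary_formula :: "('h \<Rightarrow>\<^sub>L 'h) \<times> 'h \<times> 'h \<Rightarrow> ('h \<Rightarrow>\<^sub>L 'h)" where
  "unitary_formula = (\<lambda>(V, \<Omega>, \<Psi>). scalar_op (phase (cinner \<Psi> (blinfun_apply V \<Omega>))) o\<^sub>L V)"

lemma smooth_formulas:
  "smooth_on UNIV transversal section_formula"
  "smooth_on UNIV transversal unitary_formula"
proof -
  note U = subspace_UNIV
  define D where "D = {x :: ('h \<Rightarrow>\<^sub>L 'h) \<times> 'h \<times> 'h. cinner (snd (snd x)) (blinfun_apply (fst x) (fst (snd x))) \<noteq> 0}"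
  have D: "transversal = D" by (auto simp: D_def transversal_def)
  have o: "openin (top_of_set UNIV) D"
    unfolding D_def subtopology_UNIV
    by (intro open_openin[THEN iffD1] open_Collect_neq continuous_intros bounded_bilinear.continuous_on[OF bounded_bilinear_cinner]
        bounded_bilinear.continuous_on[OF bounded_bilinear_blinfun_apply])
  have V: "smooth_on UNIV D fst" by (intro smooth_on_bounded_linear U o bounded_linear_fst)
  have \<Omega>: "smooth_on UNIV D (\<lambda>x. fst (snd x))"
    by (intro smooth_on_bounded_linear[OF _ U o] bounded_linear_compose[OF bounded_linear_fst bounded_linear_snd])
  have \<Psi>: "smooth_on UNIV D (\<lambda>x. snd (snd x))"
    by (intro smooth_on_bounded_linear[OF _ U o] bounded_linear_compose[OF bounded_linear_snd bounded_linear_snd])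
  have w: "smooth_on UNIV D (\<lambda>x. blinfun_apply (fst x) (fst (snd x)))"
    by (rule smooth_on_bilinear_compose[OF bounded_bilinear_blinfun_apply U V \<Omega>])
  have "smooth_on UNIV D (\<lambda>x. cinner (snd (snd x)) (blinfun_apply (fst x) (fst (snd x))))"
    by (rule smooth_on_bilinear_compose[OF bounded_bilinear_cinner U \<Psi> w])
  then have ph: "smooth_on UNIV D (\<lambda>x. phase (cinner (snd (snd x)) (blinfun_apply (fst x) (fst (snd x)))))"
    by (rule smooth_on_compose[OF U _ smooth_on_phase]) (auto simp: D_def)
  show "smooth_on UNIV transversal section_formula"
    unfolding D section_formula_def case_prod_beta
    by (rule smooth_on_bilinear_compose[OF bounded_bilinear_scaleC U ph w])
  show "smooth_on UNIV transversal unitary_formula"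
    unfolding D unitary_formula_def case_prod_beta
    by (rule smooth_on_bilinear_compose[OF bounded_bilinear_blinfun_compose U smooth_on_linear_compose[OF bounded_linear_scalar_op U ph] V])
qed

lemma triple_atlas_carrier: "atlas_carrier (product_atlas aut_atlas (product_atlas sphere_atlas sphere_atlas)) = triple_manifold"
  by (simp add: product_atlas_carrier aut_atlas_carrier sphere_atlas_carrier)

lemma section_map_smooth:
  "smooth_map (product_atlas aut_atlas (product_atlas sphere_atlas sphere_atlas)) sphere_atlas
     (triple_domain \<pi> \<pi>') (section_map \<pi> \<pi>')"
proof (rule smooth_mapI)
  have f: "section_map \<pi> \<pi>' (\<alpha>, \<Omega>, \<Psi>) = section_formula (V, \<Omega>, \<Psi>)"
    if "(\<alpha>, \<Omega>, \<Psi>) \<in> triple_domain \<pi> \<pi>'" "implements \<pi> \<pi>' V \<alpha>" for \<alpha> \<Omega> \<Psi> V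
    using section_map_formula(2)[OF that] by (simp add: section_formula_def)
  show "openin (top_of_set (atlas_carrier (product_atlas aut_atlas (product_atlas sphere_atlas sphere_atlas)))) (triple_domain \<pi> \<pi>')"
    unfolding triple_atlas_carrier by (rule triple_domain_open)
  show "regular_chart (atlas_carrier (product_atlas aut_atlas (product_atlas sphere_atlas sphere_atlas))) c"
    if "c \<in> product_atlas aut_atlas (product_atlas sphere_atlas sphere_atlas)" for c :: "(('b \<Rightarrow>\<^sub>L 'b) \<times> 'h \<times> 'h, ('b \<Rightarrow>\<^sub>L 'b) \<times> 'h \<times> 'h) chart"
    unfolding triple_atlas_carrier by (rule product_chart[OF that])
  show "continuous_on (triple_domain \<pi> \<pi>') (section_map \<pi> \<pi>')"
    by (rule continuous_on_via_implementer[OF smooth_on_imp_continuous_on[OF smooth_formulas(1) subspace_UNIV] f])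
  show "section_map \<pi> \<pi>' ` triple_domain \<pi> \<pi>' \<subseteq> atlas_carrier sphere_atlas"
  proof (rule image_subsetI)
    fix x assume x: "x \<in> triple_domain \<pi> \<pi>'"
    obtain \<alpha> \<Omega> \<Psi> where xe: "x = (\<alpha>, \<Omega>, \<Psi>)" by (metis prod.collapse)
    note O = x[unfolded xe]
    obtain V where V: "implements \<pi> \<pi>' V \<alpha>" "cinner \<Psi> (V \<Omega>) \<noteq> 0" by (rule triple_domain_implementer[OF O])
    have "norm (V \<Omega>) = 1" using V(1) O by (simp add: implements_def unitary_norm triple_domain_def unit_sphere_def)
    then show "section_map \<pi> \<pi>' x \<in> atlas_carrier sphere_atlas"
      using V(2) by (simp add: xe section_map_formula(2)[OF O V(1)] sphere_atlas_carrier unit_sphere_def norm_scaleC norm_phase)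
  qed
  show "openin (top_of_set (atlas_carrier sphere_atlas)) V" if "(F, V, \<psi>) \<in> sphere_atlas" for F V and \<psi> :: "'h \<Rightarrow> 'h"
    unfolding sphere_atlas_carrier by (rule sphere_atlasE[OF that]) (auto simp: openin_open)
  fix E U \<phi> F V \<psi>
  assume c: "(E, U, \<phi>) \<in> product_atlas aut_atlas (product_atlas sphere_atlas sphere_atlas)" and B: "(F, V, \<psi>) \<in> sphere_atlas"
    and o: "openin (top_of_set E) (\<phi> ` (triple_domain \<pi> \<pi>' \<inter> U \<inter> section_map \<pi> \<pi>' -` V))"
  let ?Z = "triple_domain \<pi> \<pi>' \<inter> U \<inter> section_map \<pi> \<pi>' -` V"
  have E: "subspace E" and inj: "inj_on \<phi> U" using product_chart[OF c] by (auto simp: regular_chart_def)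
  obtain W where W: "V = W \<inter> unit_sphere" "subspace F" "inj_on \<psi> W" "smooth_on UNIV W \<psi>"
    "smooth_on UNIV (\<psi> ` W) (inv_into W \<psi>)" "\<psi> ` V = \<psi> ` W \<inter> F" "open W" by (rule sphere_atlasE[OF B])
  have "smooth_on E (\<phi> ` ?Z) (\<lambda>e. section_map \<pi> \<pi>' (inv_into U \<phi> e))"
    by (rule smooth_in_charts[OF c _ o smooth_formulas(1) f]) auto
  \<comment> \<open>A sphere chart is the restriction of a map smooth on an open set of the Hilbert
    space, so it composes with the Hilbert space valued expression.\<close>
  then show "smooth_on E (\<phi> ` ?Z) (\<lambda>e. \<psi> (section_map \<pi> \<pi>' (inv_into U \<phi> e)))"
    by (rule smooth_on_compose[OF E _ W(4)]) (auto simp: inv_into_f_f[OF inj] W(1))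
qed

lemma intertwining_map_smooth:
  assumes U: "intertwining_unitary_map \<pi> \<pi>' T"
  shows "smooth_map (product_atlas aut_atlas (product_atlas sphere_atlas sphere_atlas)) unitary_atlas
     (triple_domain \<pi> \<pi>') T"
proof (rule smooth_mapI)
  have f: "T (\<alpha>, \<Omega>, \<Psi>) = unitary_formula (V, \<Omega>, \<Psi>)"
    if "(\<alpha>, \<Omega>, \<Psi>) \<in> triple_domain \<pi> \<pi>'" "implements \<pi> \<pi>' V \<alpha>" for \<alpha> \<Omega> \<Psi> V
    using intertwining_map_formula[OF U that] by (simp add: unitary_formula_def)
  show "openin (top_of_set (atlas_carrier (product_atlas aut_atlas (product_atlas sphere_atlas sphere_atlas)))) (triple_domain \<pi> \<pi>')"
    unfolding triple_atlas_carrier by (rule triple_domain_open)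
  show "regular_chart (atlas_carrier (product_atlas aut_atlas (product_atlas sphere_atlas sphere_atlas))) c"
    if "c \<in> product_atlas aut_atlas (product_atlas sphere_atlas sphere_atlas)" for c :: "(('b \<Rightarrow>\<^sub>L 'b) \<times> 'h \<times> 'h, ('b \<Rightarrow>\<^sub>L 'b) \<times> 'h \<times> 'h) chart"
    unfolding triple_atlas_carrier by (rule product_chart[OF that])
  show "continuous_on (triple_domain \<pi> \<pi>') T"
    by (rule continuous_on_via_implementer[OF smooth_on_imp_continuous_on[OF smooth_formulas(2) subspace_UNIV] f])
  show "T ` triple_domain \<pi> \<pi>' \<subseteq> atlas_carrier unitary_atlas"
    using U unfolding unitary_atlas_carrier intertwining_unitary_map_def by (auto dest: PiE_mem)
  show "openin (top_of_set (atlas_carrier unitary_atlas)) V" if "(F, V, \<psi>) \<in> unitary_atlas"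
    for F V and \<psi> :: "('h \<Rightarrow>\<^sub>L 'h) \<Rightarrow> ('h \<Rightarrow>\<^sub>L 'h)"
  proof -
    obtain g where "g \<in> unitaries" "V = (\<lambda>X. blinfun_exp X o\<^sub>L g) ` {X \<in> skew_adjoints. norm X < ln 2}"
      using \<open>(F, V, \<psi>) \<in> unitary_atlas\<close> unfolding unitary_atlas_def exp_atlas_def by blast
    then show ?thesis unfolding unitary_atlas_carrier using unitary_chart_open by blast
  qed
  fix E U \<phi> F V \<psi>
  assume c: "(E, U, \<phi>) \<in> product_atlas aut_atlas (product_atlas sphere_atlas sphere_atlas)" and B: "(F, V, \<psi>) \<in> unitary_atlas"
    and o: "openin (top_of_set E) (\<phi> ` (triple_domain \<pi> \<pi>' \<inter> U \<inter> T -` V))"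
  let ?Z = "triple_domain \<pi> \<pi>' \<inter> U \<inter> T -` V"
  have E: "subspace E" and inj: "inj_on \<phi> U" using product_chart[OF c] by (auto simp: regular_chart_def)
  define S where "S = {X \<in> skew_adjoints :: ('h \<Rightarrow>\<^sub>L 'h) set. norm X < ln 2}"
  obtain g where g: "g \<in> unitaries" "V = (\<lambda>X. blinfun_exp X o\<^sub>L g) ` S" "\<psi> = inv_into S (\<lambda>X. blinfun_exp X o\<^sub>L g)"
    using B unfolding unitary_atlas_def exp_atlas_def S_def by blast
  obtain h where h: "h \<in> unitaries" "h o\<^sub>L g = id_blinfun" "g o\<^sub>L h = id_blinfun" by (rule unitary_inverse[OF g(1)])
  have injg: "inj_on (\<lambda>X. blinfun_exp X o\<^sub>L g) S" unfolding S_def by (rule exp_chart_inj[OF surj_unitary[OF g(1)]])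
  \<comment> \<open>On the target domain the chart is \<open>u \<mapsto> log (u h)\<close> with
    \<open>h\<close> the inverse of \<open>g\<close>; this expression is defined and smooth on an
    open set of operators.\<close>
  have chart: "norm ((u o\<^sub>L h) - id_blinfun) < 1 \<and> blinfun_log (u o\<^sub>L h) = \<psi> u" if u: "u \<in> V" for u
  proof -
    obtain X where X: "X \<in> S" "u = blinfun_exp X o\<^sub>L g" using u by (auto simp: g(2))
    have "u o\<^sub>L h = blinfun_exp X" by (simp add: X(2) compose_assoc h)
    moreover have "\<psi> u = X" unfolding g(3) X(2) by (rule inv_into_f_f[OF injg X(1)])
    ultimately show ?thesis using X(1) norm_blinfun_exp_diff_id_less[of X] blinfun_log_exp[of X] by (simp add: S_def)
  qed
  have "smooth_on E (\<phi> ` ?Z) (\<lambda>e. T (inv_into U \<phi> e))"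
    by (rule smooth_in_charts[OF c _ o smooth_formulas(2) f]) auto
  then have "smooth_on E (\<phi> ` ?Z) (\<lambda>e. T (inv_into U \<phi> e) o\<^sub>L h)"
    by (rule smooth_on_linear_compose[OF bounded_bilinear.bounded_linear_left[OF bounded_bilinear_blinfun_compose] E])
  then have "smooth_on E (\<phi> ` ?Z) (\<lambda>e. blinfun_log (T (inv_into U \<phi> e) o\<^sub>L h))"
    by (rule smooth_on_compose[OF E _ smooth_on_blinfun_log]) (use chart in \<open>auto simp: inv_into_f_f[OF inj]\<close>)
  then show "smooth_on E (\<phi> ` ?Z) (\<lambda>e. \<psi> (T (inv_into U \<phi> e)))"
    by (rule smooth_on_cong) (use chart in \<open>auto simp: inv_into_f_f[OF inj]\<close>)
qed

end

theorem proposition4p14: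
  fixes \<pi> \<pi>' :: "'b::cstar_algebra \<Rightarrow> ('h::complex_hilbert \<Rightarrow>\<^sub>L 'h)"
  assumes "irreducible_representation \<pi>"
    and "irreducible_representation \<pi>'"
    and "triple_domain \<pi> \<pi>' \<noteq> {}"
  shows "smooth_map (product_atlas aut_atlas (product_atlas sphere_atlas sphere_atlas)) sphere_atlas
           (triple_domain \<pi> \<pi>') (section_map \<pi> \<pi>')
       \<and> (\<exists>!U. intertwining_unitary_map \<pi> \<pi>' U)
       \<and> (\<forall>U. intertwining_unitary_map \<pi> \<pi>' U \<longrightarrow>
            smooth_map (product_atlas aut_atlas (product_atlas sphere_atlas sphere_atlas)) unitary_atlas
              (triple_domain \<pi> \<pi>') U)"
proof -
  interpret irreducible_pair \<pi> \<pi>'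
    using assms(1,2) by (simp add: irreducible_pair_def irreducible_star_representation_iff)
  show ?thesis using section_map_smooth intertwining_map_exists intertwining_map_smooth by blast
qed

end
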